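(* Let $p,q,m,n$ be positive odd integers with $\gcd(p,q)=1$, $q\mid p+m-1$ and $p\mid q+n-1$, and suppose that $r_1=(p+m-1)/q$ and $r_2=(q+n-1)/p$ are odd. Assume $r_1>r_2$ and $m>n$. Consider the system $$\frac{dx}{dt}=-y^{r_1},\qquad \frac{dy}{dt}=x^{r_2}+\sum_{j=1}^{[r_2/q]}b_jx^{r_2-jq}y^{jp}, \tag{A}$$ with real coefficients $b_j$. Let $\mu=[r_2/q]$ if $[r_2/q]$ is odd and $\mu=[r_2/q]-1$ if $[r_2/q]$ is even. Then: (i) A neighborhood of infinity is filled with periodic orbits of (A) if and only if $b_1=b_3=\cdots=b_\mu=0$. (ii) If $b_1=b_3=\cdots=b_{2i-3}=0$ and $b_{2i-1}\neq0$, where $2i-1\leq\mu$, then the stability of infinity is given by the sign of $b_{2i-1}$. Moreover, the maximum number of periodic orbits that bifurcate from infinity inside the family (A) for small perturbations is $i-1$. (iii) The cyclicity of infinity is $(\mu-1)/2=\left[([r_2/q]-1)/2\right]$.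
   Context: $[\cdot]$ denotes the integer part. Infinity is regarded as a single point added to the plane: with $r_1=2l_1-1$, $r_2=2l_2-1$, let $\mathrm{Cs}\,\phi,\mathrm{Sn}\,\phi$ be the solution $(z,\omega)$ of $\dot z=-\omega^{2l_1-1}$, $\dot\omega=z^{2l_2-1}$, $z(0)=l_1^{-1/(2l_2)}$, $\omega(0)=0$; write the system in the coordinates $x=\rho^{l_1}\mathrm{Cs}\,\phi$, $y=\rho^{l_2}\mathrm{Sn}\,\phi$, replace $\rho$ by $1/\rho$, and reparametrize time to obtain a smooth system; infinity corresponds to $\rho=0$. A neighborhood of infinity is filled with periodic orbits (infinity is a center) if there is a compact subset of $\mathbb{R}^2$ outside which all trajectories are closed. The family (A) is parametrized by the real coefficients $b_j$ ($1\le j\le[r_2/q]$), with $p,q,m,n$ fixed. The cyclicity is the total number of limit cycles (isolated periodic orbits) which can emerge from a configuration of trajectories (here, infinity) under a perturbation. *)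

theory Defs
  imports "HOL-Analysis.Analysis" "HOL-Library.Extended_Nat"
begin

type_synonym vfield = "real \<times> real \<Rightarrow> real \<times> real"

definition solution_on :: "vfield \<Rightarrow> real set \<Rightarrow> (real \<Rightarrow> real \<times> real) \<Rightarrow> bool" where
  "solution_on X J \<gamma> \<longleftrightarrow> (\<forall>t\<in>J. (\<gamma> has_vector_derivative X (\<gamma> t)) (at t within J))"

definition periodic_orbit :: "vfield \<Rightarrow> (real \<times> real) set \<Rightarrow> bool" where
  "periodic_orbit X \<Gamma> \<longleftrightarrow>
     (\<exists>\<gamma> T. 0 < T \<and> solution_on X UNIV \<gamma> \<and> (\<forall>t. \<gamma> (t + T) = \<gamma> t) \<and>
            (\<exists>s t. \<gamma> s \<noteq> \<gamma> t) \<and> \<Gamma> = range \<gamma>)"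

definition limit_cycle :: "vfield \<Rightarrow> (real \<times> real) set \<Rightarrow> bool" where
  "limit_cycle X \<Gamma> \<longleftrightarrow> periodic_orbit X \<Gamma> \<and>
     (\<exists>U. open U \<and> \<Gamma> \<subseteq> U \<and> (\<forall>\<Gamma>'. periodic_orbit X \<Gamma>' \<and> \<Gamma>' \<subseteq> U \<longrightarrow> \<Gamma>' = \<Gamma>))"

text \<open>
  Infinity is a single point added to the plane, and its basic neighbourhoods are the sets
  of points of norm greater than \<open>M\<close>. This is the same notion of nearness as in the
  coordinates \<open>x = \<rho> powr (-l1) * Cs \<phi>\<close>, \<open>y = \<rho> powr (-l2) * Sn \<phi>\<close>, where infinity is
  \<open>\<rho> = 0\<close> and \<open>r1 = 2*l1 - 1\<close>, \<open>r2 = 2*l2 - 1\<close>: the identity \<open>l1 * (Cs \<phi>)^(2*l2) + l2 * (Sn \<phi>)^(2*l1) = 1\<close> gives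
  \<open>\<rho> powr (-2*l1*l2) = l1 * x^(2*l2) + l2 * y^(2*l1)\<close>, so \<open>\<rho>\<close> tends to \<open>0\<close> exactly when the
  norm of \<open>(x, y)\<close> tends to infinity.
\<close>

definition infinity_center :: "vfield \<Rightarrow> bool" where
  "infinity_center X \<longleftrightarrow>
     (\<exists>K. compact K \<and> (\<forall>z. z \<notin> K \<longrightarrow> (\<exists>\<Gamma>. periodic_orbit X \<Gamma> \<and> z \<in> \<Gamma>)))"

text \<open>
  Trajectories may reach infinity in finite time (the reparametrization of time that makes
  the system smooth at infinity removes this), so forward solutions live on \<open>[0, T)\<close> with \<open>T\<close>
  a positive extended real.
\<close>

definition forward_interval :: "ereal \<Rightarrow> real set" where
  "forward_interval T = {t. 0 \<le> t \<and> ereal t < T}"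

definition forward_solution :: "vfield \<Rightarrow> ereal \<Rightarrow> (real \<Rightarrow> real \<times> real) \<Rightarrow> bool" where
  "forward_solution X T \<gamma> \<longleftrightarrow> 0 < T \<and> solution_on X (forward_interval T) \<gamma>"

definition maximal_forward_solution :: "vfield \<Rightarrow> ereal \<Rightarrow> (real \<Rightarrow> real \<times> real) \<Rightarrow> bool" where
  "maximal_forward_solution X T \<gamma> \<longleftrightarrow> forward_solution X T \<gamma> \<and>
     (\<forall>T' \<gamma>'. forward_solution X T' \<gamma>' \<and> T \<le> T' \<and> (\<forall>t\<in>forward_interval T. \<gamma>' t = \<gamma> t)
        \<longrightarrow> T' = T)"

text \<open>
  Asymptotic stability of the point at infinity: Lyapunov stability together with
  convergence to infinity of all nearby maximal forward trajectories.
\<close>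

definition infinity_attracting :: "vfield \<Rightarrow> bool" where
  "infinity_attracting X \<longleftrightarrow>
     (\<forall>M. \<exists>M'. \<forall>T \<gamma>. forward_solution X T \<gamma> \<and> norm (\<gamma> 0) > M'
        \<longrightarrow> (\<forall>t\<in>forward_interval T. norm (\<gamma> t) > M)) \<and>
     (\<exists>M'. \<forall>T \<gamma>. maximal_forward_solution X T \<gamma> \<and> norm (\<gamma> 0) > M'
        \<longrightarrow> (\<forall>M. \<exists>s\<in>forward_interval T. \<forall>t\<in>forward_interval T. s \<le> t \<longrightarrow> norm (\<gamma> t) > M))"

definition infinity_repelling :: "vfield \<Rightarrow> bool" where
  "infinity_repelling X \<longleftrightarrow> infinity_attracting (\<lambda>z. - X z)"

definition ecount :: "'a set \<Rightarrow> enat" where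
  "ecount A = (if finite A then enat (card A) else \<infinity>)"

text \<open>
  The maximum number of orbits of a given kind that bifurcate from infinity at the parameter
  \<open>b\<close> of a family \<open>X\<close> with real parameters indexed by \<open>J\<close>: the number of such orbits lying in a
  neighbourhood of infinity, maximized over the parameters close to \<open>b\<close>, as both
  neighbourhoods shrink.
\<close>

definition bifurcation_number ::
  "(vfield \<Rightarrow> (real \<times> real) set \<Rightarrow> bool) \<Rightarrow> nat set \<Rightarrow> ((nat \<Rightarrow> real) \<Rightarrow> vfield)
     \<Rightarrow> (nat \<Rightarrow> real) \<Rightarrow> enat" where
  "bifurcation_number orb J X b =
     (INF \<delta>\<in>{0<..}. INF M::real. SUP b'\<in>{b'. \<forall>j\<in>J. \<bar>b' j - b j\<bar> < (\<delta>::real)}.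
        ecount {\<Gamma>. orb (X b') \<Gamma> \<and> \<Gamma> \<subseteq> {z. norm z > M}})"

definition infinity_cyclicity ::
  "nat set \<Rightarrow> ((nat \<Rightarrow> real) \<Rightarrow> vfield) \<Rightarrow> (nat \<Rightarrow> real) \<Rightarrow> enat" where
  "infinity_cyclicity = bifurcation_number limit_cycle"

text \<open>Only the values \<open>b j\<close> with \<open>1 \<le> j \<le> r2 div q\<close> matter, and then \<open>j * q \<le> r2\<close>.\<close>

definition family_A :: "nat \<Rightarrow> nat \<Rightarrow> nat \<Rightarrow> nat \<Rightarrow> (nat \<Rightarrow> real) \<Rightarrow> vfield" where
  "family_A p q r1 r2 b = (\<lambda>(x, y).
     (- (y ^ r1), x ^ r2 + (\<Sum>j = 1..r2 div q. b j * x ^ (r2 - j * q) * y ^ (j * p))))"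

end

theory Submission
  imports Defs "HOL-Complex_Analysis.Complex_Analysis"
begin

text \<open>
  Put \<open>\<tau> = rad ^ (- s)\<close> with \<open>rad\<close> the quasi-homogeneous radius of weights \<open>l1\<close>, \<open>l2\<close>
  and \<open>s = l1 * q - l2 * p\<close>, which is positive because \<open>m > n\<close>, so that infinity becomes \<open>\<tau> = 0\<close>.
  The system is odd, so a trajectory near infinity closes up iff it does so after half a turn, that
  is, iff a scalar displacement \<open>disp b\<close>, holomorphic in the initial value of \<open>\<tau>\<close>, vanishes. The
  reflection in the \<open>y\<close>-axis kills the terms with even \<open>j\<close>: \<open>disp b\<close> is odd and equals
  \<open>(\<Sum>j odd. C j * b j * \<tau> ^ j)\<close> with \<open>C j > 0\<close>, up to an error which is \<open>O(\<tau>)\<close> relative to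
  \<open>(\<Sum>j odd. \<bar>b j\<bar> * \<tau> ^ j)\<close>. Hence the first nonzero odd coefficient decides the stability, and
  Rolle's theorem with Cauchy's estimates bounds the number of zeros uniformly in \<open>b\<close>.
\<close>

section \<open>Ordinary differential equations\<close>

text \<open>The angle cannot serve as the time of a trajectory: its speed carries the factor
  \<open>y ^ r1\<close>, which vanishes on the x-axis, where \<open>eta\<close> also has infinite
  slope. So the scalar equation is solved on its own, and Gronwall's inequality in time shows that
  \<open>tau - sig (xi)\<close> stays zero along trajectories. Solutions may also leave every
  bounded set in finite time, so closed orbits are built in a cut-off field that agrees with (A) on
  the curve in question.

  All constants depend on a bound \<open>K\<close> for the coefficients only, since the orbits of
  all nearby systems must be counted in one common neighbourhood of infinity. Near a center all odd
  coefficients are small at once and a plain error of size \<open>O(\<tau>)\<close> would swamp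
  them; the error is relative to them because the even coefficients alone give no displacement. The
  sign of \<open>C j\<close> is that of the integral of \<open>w j\<close>, which for odd
  \<open>j\<close> is even and nonnegative. Motion in the upper half-plane runs from
  \<open>u = 1\<close> to \<open>u = -1\<close>, so a positive displacement means that
  \<open>\<tau>\<close> decreases and infinity attracts.\<close>

lemma gronwall_zero_right:
  fixes u :: "real \<Rightarrow> 'a::real_inner"
  assumes "\<And>t. t \<in> {a..b} \<Longrightarrow> (u has_vector_derivative u' t) (at t within {a..b})"
    and "\<And>t. t \<in> {a..b} \<Longrightarrow> norm (u' t) \<le> L * norm (u t)"
    and "u a = 0" and "t \<in> {a..b}"
  shows "u t = 0"
proof -
  \<comment> \<open>Damping by \<open>exp (- 2 * L * t)\<close> makes the squared norm
    nonincreasing, and it starts at 0.\<close>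
  define g where "g \<equiv> \<lambda>t. (u t \<bullet> u t) * exp (- 2 * L * t)"
  have der: "(g has_derivative (\<lambda>h. h * ((2 * (u x \<bullet> u' x) - 2 * L * (u x \<bullet> u x)) * exp (- 2 * L * x))))
      (at x within {a..t})" if "a \<le> x" "x \<le> t" for x
  proof -
    have "(u has_vector_derivative u' x) (at x within {a..t})"
      using assms(1)[of x] that assms(4) by (auto intro: has_vector_derivative_within_subset)
    note d = this[unfolded has_vector_derivative_def]
    show ?thesis
      unfolding g_def
      by (rule derivative_eq_intros d refl | simp add: algebra_simps inner_commute)+
  qed
  obtain x where x: "x \<in> {a..t}"
    "g t - g a = (t - a) * ((2 * (u x \<bullet> u' x) - 2 * L * (u x \<bullet> u x)) * exp (- 2 * L * x))"
    using mvt_very_simple[of a t g, OF _ der] assms(4) by auto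
  have "u x \<bullet> u' x \<le> norm (u x) * norm (u' x)"
    by (rule norm_cauchy_schwarz)
  also have "\<dots> \<le> norm (u x) * (L * norm (u x))"
    using assms(2)[of x] x assms(4) by (intro mult_left_mono) auto
  also have "\<dots> = L * (u x \<bullet> u x)"
    by (simp add: dot_square_norm power2_eq_square)
  finally have "2 * (u x \<bullet> u' x) - 2 * L * (u x \<bullet> u x) \<le> 0" by simp
  then have "g t - g a \<le> 0"
    unfolding x(2) using assms(4) by (intro mult_nonneg_nonpos mult_nonpos_nonneg) auto
  then have "u t \<bullet> u t \<le> 0"
    using assms(3) by (simp add: g_def mult_le_0_iff)
  then show ?thesis by (metis inner_eq_zero_iff inner_ge_zero order_antisym)
qed

text \<open>A zero at any time spreads in both directions; the past is reached by reflecting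
  time.\<close>

lemma gronwall_zero:
  fixes u :: "real \<Rightarrow> 'a::real_inner"
  assumes der: "\<And>t. t \<in> {a..b} \<Longrightarrow> (u has_vector_derivative u' t) (at t within {a..b})"
    and bd: "\<And>t. t \<in> {a..b} \<Longrightarrow> norm (u' t) \<le> L * norm (u t)"
    and "u c = 0" and c: "c \<in> {a..b}" and t: "t \<in> {a..b}"
  shows "u t = 0"
proof (cases "c \<le> t")
  case True
  show ?thesis
  proof (rule gronwall_zero_right[of c b u u' L t])
    show "(u has_vector_derivative u' x) (at x within {c..b})" if "x \<in> {c..b}" for x
      using der[of x] that c by (auto intro: has_vector_derivative_within_subset)
  qed (use assms True in auto)
next
  case False
  have "(\<lambda>x. u (- x)) (- t) = 0"
  proof (rule gronwall_zero_right[of "- c" "- a" _ "\<lambda>x. - u' (- x)" L "- t"])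
    show "((\<lambda>x. u (- x)) has_vector_derivative - u' (- x)) (at x within {- c..- a})"
      if x: "x \<in> {- c..- a}" for x
    proof -
      have 1: "(u has_vector_derivative u' (- x)) (at (- x) within uminus ` {- c..- a})"
        using der[of "- x"] x c by (auto intro: has_vector_derivative_within_subset)
      have 2: "(uminus has_vector_derivative - 1) (at x within {- c..- a})"
        by (auto intro!: derivative_eq_intros)
      show ?thesis using vector_diff_chain_within[OF 2, of u "u' (- x)"] 1 by (simp add: o_def)
    qed
  qed (use assms False in auto)
  then show ?thesis by simp
qed

text \<open>Picard iteration on the whole line at once. Successive differences are measured against
  \<open>exp (2 * M * \<bar>t\<bar>)\<close>, for which one integration gains a factor 1/2 however
  long the interval is, so local solutions need not be glued.\<close>

lemma lipschitz_global_solution: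
  fixes Y :: "'a::euclidean_space \<Rightarrow> 'a"
  assumes "L-lipschitz_on UNIV Y"
  obtains \<gamma> where "\<gamma> 0 = z" and "\<And>t. (\<gamma> has_vector_derivative Y (\<gamma> t)) (at t)"
proof -
  \<comment> \<open>\<open>L\<close> may be 0; the added 1 allows division by
    \<open>M\<close>.\<close>
  define M where "M = L + 1"
  have M: "M > 0" and lip: "norm (Y x - Y y) \<le> M * norm (x - y)" for x y
  proof -
    show "M > 0" using lipschitz_on_nonneg[OF assms] by (simp add: M_def)
    have "norm (Y x - Y y) \<le> L * norm (x - y)"
      using lipschitz_onD[OF assms, of x y] by (simp add: dist_norm)
    also have "\<dots> \<le> M * norm (x - y)" by (intro mult_right_mono) (auto simp: M_def)
    finally show "norm (Y x - Y y) \<le> M * norm (x - y)" .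
  qed
  have contY: "continuous_on UNIV Y" by (rule lipschitz_on_continuous_on[OF assms])
  define P where "P = rec_nat (\<lambda>t::real. z) (\<lambda>n g t. z + (LBINT u=0..t. Y (g u)))"
  have P0: "P 0 = (\<lambda>t. z)" and PS: "P (Suc n) = (\<lambda>t. z + (LBINT u=0..t. Y (P n u)))" for n
    by (simp_all add: P_def)
  have step: "((\<lambda>t. z + (LBINT u=0..t. Y (g u))) has_vector_derivative Y (g t)) (at t)"
    if "continuous_on UNIV g" for g t
  proof -
    have "continuous_on {- (\<bar>t\<bar> + 1)..\<bar>t\<bar> + 1} (\<lambda>u. Y (g u))"
      by (intro continuous_on_compose2[OF contY] continuous_on_subset[OF that]) auto
    from interval_integral_FTC2[of "- (\<bar>t\<bar> + 1)" 0 "\<bar>t\<bar> + 1", OF _ _ this, of t]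
    have "((\<lambda>t. LBINT u=0..t. Y (g u)) has_vector_derivative Y (g t))
        (at t within {- (\<bar>t\<bar> + 1)..\<bar>t\<bar> + 1})" by (auto simp: zero_ereal_def)
    then have "((\<lambda>t. LBINT u=0..t. Y (g u)) has_vector_derivative Y (g t)) (at t)"
      by (subst (asm) at_within_interior) auto
    then show ?thesis by (auto intro!: derivative_eq_intros)
  qed
  have cont: "continuous_on UNIV (P n)" for n
  proof (induction n)
    case (Suc n)
    show ?case unfolding PS
      using step[OF Suc] by (intro continuous_at_imp_continuous_on ballI)
        (blast intro: has_vector_derivative_continuous)
  qed (simp add: P0)
  have dP: "(P (Suc n) has_vector_derivative Y (P n t)) (at t)" for n t
    unfolding PS by (rule step[OF cont])
  have init: "P n 0 = z" for n
    by (cases n) (simp_all add: P0 PS interval_lebesgue_integral_def zero_ereal_def einterval_def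
        set_lebesgue_integral_def)
  define C where "C = norm (Y z) / M"
  have C: "C \<ge> 0" using M by (simp add: C_def)
  have est: "norm (P (Suc n) t - P n t) \<le> C * (1/2)^n * exp (2 * M * \<bar>t\<bar>)" for n t
  proof (induction n arbitrary: t)
    case 0
    have d: "(P 1 has_vector_derivative Y z) (at x)" for x
      using dP[of 0 x] by (simp add: P0)
    have "((\<lambda>t. z + t *\<^sub>R Y z) has_vector_derivative Y z) (at x)" for x
      by (auto intro!: derivative_eq_intros)
    then have d2: "((\<lambda>x. P 1 x - (z + x *\<^sub>R Y z)) has_vector_derivative 0) (at x)" for x
      using has_vector_derivative_diff[OF d[of x]] by fastforce
    obtain c where c: "\<And>x. x \<in> UNIV \<Longrightarrow> P 1 x - (z + x *\<^sub>R Y z) = c"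
      by (rule has_vector_derivative_zero_constant[of UNIV "\<lambda>x. P 1 x - (z + x *\<^sub>R Y z)"]) (use d2 in auto)
    have "c = 0" using c[of 0] init[of 1] by simp
    then have "P 1 t = z + t *\<^sub>R Y z" using c[of t] by simp
    then have "norm (P 1 t - P 0 t) = \<bar>t\<bar> * norm (Y z)" by (simp add: P0)
    also have "\<dots> = C * (M * \<bar>t\<bar>)" using M by (simp add: C_def)
    also have "\<dots> \<le> C * exp (2 * M * \<bar>t\<bar>)"
    proof (intro mult_left_mono C)
      have "M * \<bar>t\<bar> \<le> 1 + 2 * M * \<bar>t\<bar>" using M by simp
      also have "\<dots> \<le> exp (2 * M * \<bar>t\<bar>)" by (rule exp_ge_add_one_self)
      finally show "M * \<bar>t\<bar> \<le> exp (2 * M * \<bar>t\<bar>)" .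
    qed
    finally show ?case by simp
  next
    case (Suc n)
    define w where "w = (\<lambda>t. P (Suc (Suc n)) t - P (Suc n) t)"
    have dw: "(w has_vector_derivative Y (P (Suc n) t) - Y (P n t)) (at t)" for t
      unfolding w_def by (intro has_vector_derivative_diff dP)
    have bw: "norm (Y (P (Suc n) t) - Y (P n t)) \<le> M * (C * (1/2)^n * exp (2 * M * \<bar>t\<bar>))" for t
      using lip[of "P (Suc n) t" "P n t"] mult_left_mono[OF Suc[of t], of M] M by linarith
    have w0: "w 0 = 0" by (simp add: w_def init)
    let ?E = "\<lambda>t. C * (1/2)^Suc n * exp (2 * M * t)"
    \<comment> \<open>Stated for an arbitrary curve and positive times, so that it serves
      \<open>w\<close> for \<open>t > 0\<close> and its time reflection for
      \<open>t < 0\<close>.\<close>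
    have pos: "norm (v t - v 0) \<le> ?E t - ?E 0"
      if t: "t > 0" and dv: "\<And>x. (v has_vector_derivative v' x) (at x)"
        and bv: "\<And>x. x \<ge> 0 \<Longrightarrow> norm (v' x) \<le> M * (C * (1/2)^n * exp (2 * M * x))" for t :: real and v v' :: "real \<Rightarrow> 'a"
    proof (rule differentiable_bound_general[OF t])
      show "continuous_on {0..t} v"
        using dv by (intro continuous_at_imp_continuous_on ballI)
          (blast intro: has_vector_derivative_continuous)
      show "continuous_on {0..t} ?E" by (intro continuous_intros)
      show "(?E has_vector_derivative M * (C * (1/2)^n * exp (2 * M * x))) (at x)" for x
        unfolding has_real_derivative_iff_has_vector_derivative[symmetric]
        by (auto intro!: derivative_eq_intros)
    qed (use dv bv in auto)
    have "norm (w t) \<le> ?E \<bar>t\<bar>"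
    proof (cases "t = 0")
      case False
      have E0: "?E 0 \<ge> 0" using C by simp
      show ?thesis
      proof (cases "t > 0")
        case True
        have "norm (w t - w 0) \<le> ?E t - ?E 0"
          by (rule pos[OF True dw]) (metis bw abs_of_nonneg)
        then show ?thesis using True E0 w0 by simp
      next
        case F: False
        have d2: "((\<lambda>x. w (- x)) has_vector_derivative - (Y (P (Suc n) (- x)) - Y (P n (- x)))) (at x)" for x
        proof -
          have "(uminus has_vector_derivative - 1) (at x)"
            by (auto intro!: derivative_eq_intros)
          from vector_diff_chain_at[OF this dw] show ?thesis by (simp add: o_def)
        qed
        have "norm (w (- (- t)) - w (- 0)) \<le> ?E (- t) - ?E 0"
        proof (rule pos[OF _ d2])
          show "norm (- (Y (P (Suc n) (- x)) - Y (P n (- x)))) \<le> M * (C * (1/2)^n * exp (2 * M * x))"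
            if "x \<ge> 0" for x
            using bw[of "- x"] that by (simp add: norm_minus_commute)
        qed (use F False in auto)
        then show ?thesis using F E0 w0 by simp
      qed
    qed (simp add: w0 C)
    then show ?case by (simp add: w_def)
  qed
  define \<gamma> where "\<gamma> = (\<lambda>t. lim (\<lambda>n. P n t))"
  have est2: "norm (P (n + k) t - P n t) \<le> 2 * C * (1/2)^n * exp (2 * M * \<bar>t\<bar>)" for n k t
  proof -
    have "norm (P (n + k) t - P n t) \<le> 2 * C * ((1/2)^n - (1/2)^(n + k)) * exp (2 * M * \<bar>t\<bar>)"
    proof (induction k)
      case (Suc k)
      have "norm (P (n + Suc k) t - P n t)
        \<le> norm (P (Suc (n + k)) t - P (n + k) t) + norm (P (n + k) t - P n t)"
        using norm_triangle_ineq[of "P (Suc (n + k)) t - P (n + k) t" "P (n + k) t - P n t"] by simp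
      also have "\<dots> \<le> C * (1/2)^(n+k) * exp (2 * M * \<bar>t\<bar>) +
          2 * C * ((1/2)^n - (1/2)^(n + k)) * exp (2 * M * \<bar>t\<bar>)"
        by (intro add_mono est Suc)
      also have "\<dots> = 2 * C * ((1/2)^n - (1/2)^(n + Suc k)) * exp (2 * M * \<bar>t\<bar>)"
        by (simp add: algebra_simps)
      finally show ?case .
    qed simp
    also have "\<dots> \<le> 2 * C * (1/2)^n * exp (2 * M * \<bar>t\<bar>)"
      using C by (intro mult_right_mono mult_left_mono) auto
    finally show ?thesis .
  qed
  have conv: "(\<lambda>n. P n t) \<longlonglongrightarrow> \<gamma> t" for t
  proof -
    have "Cauchy (\<lambda>n. P n t)"
    proof (rule metric_CauchyI)
      fix e :: real assume "e > 0"
      have "(\<lambda>n. 2 * (2 * C * (1/2)^n * exp (2 * M * \<bar>t\<bar>))) \<longlonglongrightarrow> 2 * (2 * C * 0 * exp (2 * M * \<bar>t\<bar>))"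
        by (intro tendsto_intros LIMSEQ_power_zero) simp
      then have "eventually (\<lambda>n. 2 * (2 * C * (1/2)^n * exp (2 * M * \<bar>t\<bar>)) < e) sequentially"
        using \<open>e > 0\<close> by (intro order_tendstoD) auto
      then obtain N where N: "2 * (2 * C * (1/2)^N * exp (2 * M * \<bar>t\<bar>)) < e"
        using eventually_sequentially by auto
      have "dist (P m t) (P n t) < e" if "m \<ge> N" "n \<ge> N" for m n
      proof -
        have "norm (P m t - P N t) \<le> 2 * C * (1/2)^N * exp (2 * M * \<bar>t\<bar>)"
          "norm (P n t - P N t) \<le> 2 * C * (1/2)^N * exp (2 * M * \<bar>t\<bar>)"
          using est2[of N "m - N" t] est2[of N "n - N" t] that by simp_all
        then show ?thesis
          using N dist_triangle2[of "P m t" "P n t" "P N t"] unfolding dist_norm by linarith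
      qed
      then show "\<exists>M. \<forall>m\<ge>M. \<forall>n\<ge>M. dist (P m t) (P n t) < e" by blast
    qed
    then show ?thesis unfolding \<gamma>_def by (simp add: Cauchy_convergent_iff convergent_LIMSEQ_iff)
  qed
  have est3: "norm (\<gamma> t - P n t) \<le> 2 * C * (1/2)^n * exp (2 * M * \<bar>t\<bar>)" for n t
  proof (rule LIMSEQ_le_const2)
    show "(\<lambda>k. norm (P (k + n) t - P n t)) \<longlonglongrightarrow> norm (\<gamma> t - P n t)"
      by (intro tendsto_intros LIMSEQ_ignore_initial_segment conv)
    show "\<exists>N. \<forall>k\<ge>N. norm (P (k + n) t - P n t) \<le> 2 * C * (1/2)^n * exp (2 * M * \<bar>t\<bar>)"
      using est2[of n _ t] by (metis add.commute)
  qed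
  have unif: "uniform_limit {- r..r} P \<gamma> sequentially" for r
  proof (rule uniform_limitI)
    fix e :: real assume "e > 0"
    have "(\<lambda>n. 2 * C * (1/2)^n * exp (2 * M * r)) \<longlonglongrightarrow> 2 * C * 0 * exp (2 * M * r)"
      by (intro tendsto_intros LIMSEQ_power_zero) simp
    then have "eventually (\<lambda>n. 2 * C * (1/2)^n * exp (2 * M * r) < e) sequentially"
      using \<open>e > 0\<close> by (intro order_tendstoD) auto
    then show "\<forall>\<^sub>F n in sequentially. \<forall>x\<in>{- r..r}. dist (P n x) (\<gamma> x) < e"
    proof eventually_elim
      case (elim n)
      show ?case
      proof
        fix x assume "x \<in> {- r..r}"
        then have "exp (2 * M * \<bar>x\<bar>) \<le> exp (2 * M * r)" using M by auto
        then have "2 * C * (1/2)^n * exp (2 * M * \<bar>x\<bar>) \<le> 2 * C * (1/2)^n * exp (2 * M * r)"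
          using C by (intro mult_left_mono) auto
        then show "dist (P n x) (\<gamma> x) < e"
          using est3[of x n] elim by (simp add: dist_norm norm_minus_commute)
      qed
    qed
  qed
  have contr: "continuous_on {- r..r} \<gamma>" for r
  proof (rule uniform_limit_theorem[OF _ unif[of r]])
    show "\<forall>\<^sub>F n in sequentially. continuous_on {- r..r} (P n)"
      by (intro always_eventually allI continuous_on_subset[OF cont]) simp
  qed simp
  have contg: "continuous_on UNIV \<gamma>"
  proof (intro continuous_at_imp_continuous_on ballI)
    fix x :: real
    have "x \<in> interior {- (\<bar>x\<bar> + 1)..\<bar>x\<bar> + 1}" by auto
    then show "isCont \<gamma> x" using contr continuous_on_interior by blast
  qed
  \<comment> \<open>The integral equation is checked for the limit: the derivatives of
    \<open>Q\<close> and of the iterates differ by an amount that tends to 0 uniformly between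
    \<open>- \<bar>t\<bar>\<close> and \<open>\<bar>t\<bar>\<close>, so the iterates converge to
    \<open>Q\<close> as well.\<close>
  define Q where "Q = (\<lambda>t::real. z + (LBINT u=0..t. Y (\<gamma> u)))"
  have dQ: "(Q has_vector_derivative Y (\<gamma> t)) (at t)" for t
    unfolding Q_def by (rule step[OF contg])
  have "Q t = \<gamma> t" for t :: real
  proof -
    have Q0: "Q 0 = z"
      by (simp add: Q_def interval_lebesgue_integral_def zero_ereal_def einterval_def
        set_lebesgue_integral_def)
    have "norm (Q t - P (Suc n) t) \<le> (M * (2 * C * (1/2)^n * exp (2 * M * \<bar>t\<bar>))) * norm (t - 0)" for n
    proof -
      have "norm ((\<lambda>x. Q x - P (Suc n) x) t - (\<lambda>x. Q x - P (Suc n) x) 0)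
          \<le> (M * (2 * C * (1/2)^n * exp (2 * M * \<bar>t\<bar>))) * norm (t - 0)"
      proof (rule differentiable_bound[of "{- \<bar>t\<bar>..\<bar>t\<bar>}" _ "\<lambda>x h. h *\<^sub>R (Y (\<gamma> x) - Y (P n x))"])
        show "((\<lambda>x. Q x - P (Suc n) x) has_derivative (\<lambda>h. h *\<^sub>R (Y (\<gamma> x) - Y (P n x))))
            (at x within {- \<bar>t\<bar>..\<bar>t\<bar>})" for x
          using has_vector_derivative_diff[OF dQ[of x] dP[of n x]]
          by (simp add: has_vector_derivative_def has_derivative_at_withinI)
        show "onorm (\<lambda>h. h *\<^sub>R (Y (\<gamma> x) - Y (P n x))) \<le> M * (2 * C * (1/2)^n * exp (2 * M * \<bar>t\<bar>))"
          if x: "x \<in> {- \<bar>t\<bar>..\<bar>t\<bar>}" for x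
        proof (rule onorm_le)
          fix h :: real
          have "norm (Y (\<gamma> x) - Y (P n x)) \<le> M * (2 * C * (1/2)^n * exp (2 * M * \<bar>x\<bar>))"
            using lip[of "\<gamma> x" "P n x"] mult_left_mono[OF est3[of x n], of M] M by linarith
          also have "\<dots> \<le> M * (2 * C * (1/2)^n * exp (2 * M * \<bar>t\<bar>))"
            using M C x by (intro mult_left_mono) auto
          finally show "norm (h *\<^sub>R (Y (\<gamma> x) - Y (P n x)))
              \<le> M * (2 * C * (1/2)^n * exp (2 * M * \<bar>t\<bar>)) * norm h"
            by (simp add: mult.commute mult_left_mono)
        qed
      qed auto
      then show ?thesis by (simp add: Q0 init)
    qed
    moreover have "(\<lambda>n. (M * (2 * C * (1/2)^n * exp (2 * M * \<bar>t\<bar>))) * norm (t - 0)) \<longlonglongrightarrow>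
        (M * (2 * C * 0 * exp (2 * M * \<bar>t\<bar>))) * norm (t - 0)"
      by (intro tendsto_intros LIMSEQ_power_zero) simp
    moreover have "(\<lambda>n. norm (Q t - P (Suc n) t)) \<longlonglongrightarrow> norm (Q t - \<gamma> t)"
      by (intro tendsto_intros LIMSEQ_Suc conv)
    ultimately have "norm (Q t - \<gamma> t) \<le> 0"
      by (intro LIMSEQ_le[where Y="\<lambda>n. (M * (2 * C * (1/2)^n * exp (2 * M * \<bar>t\<bar>))) * norm (t - 0)"]) auto
    then show ?thesis by simp
  qed
  then have "Q = \<gamma>" by blast
  moreover have "\<gamma> 0 = z" using conv[of 0] by (simp add: init LIMSEQ_const_iff)
  ultimately show ?thesis using dQ that by metis
qed

text \<open>Being Lipschitz on bounded sets suits polynomial fields: unlike global Lipschitz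
  continuity it is preserved by products.\<close>

definition lip_bounded :: "('a::real_normed_vector \<Rightarrow> 'b::real_normed_vector) \<Rightarrow> bool" where
  "lip_bounded f \<longleftrightarrow> (\<forall>r. \<exists>L. L-lipschitz_on (cball 0 r) f)"

lemma lip_bounded_const: "lip_bounded (\<lambda>z. c)"
  unfolding lip_bounded_def by (metis lipschitz_on_constant)

lemma lip_bounded_fst: "lip_bounded (fst :: 'a::real_normed_vector \<times> 'b::real_normed_vector \<Rightarrow> 'a)"
  unfolding lip_bounded_def
  by (intro allI exI[of _ 1] lipschitz_onI) (simp_all only: dist_fst_le mult_1 zero_le_one)

lemma lip_bounded_snd: "lip_bounded (snd :: 'a::real_normed_vector \<times> 'b::real_normed_vector \<Rightarrow> 'b)"
  unfolding lip_bounded_def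
  by (intro allI exI[of _ 1] lipschitz_onI) (simp_all only: dist_snd_le mult_1 zero_le_one)

lemma lip_bounded_add: "lip_bounded f \<Longrightarrow> lip_bounded g \<Longrightarrow> lip_bounded (\<lambda>z. f z + g z)"
  unfolding lip_bounded_def by (metis lipschitz_on_add)

lemma lip_bounded_minus: "lip_bounded f \<Longrightarrow> lip_bounded (\<lambda>z. - f z)"
  unfolding lip_bounded_def by (metis lipschitz_on_minus)

lemma lip_bounded_Pair: "lip_bounded f \<Longrightarrow> lip_bounded g \<Longrightarrow> lip_bounded (\<lambda>z. (f z, g z))"
  unfolding lip_bounded_def by (metis lipschitz_on_Pair)

lemma lip_bounded_bound:
  assumes "lip_bounded f"
  obtains B where "B \<ge> 0" and "\<And>z. norm z \<le> r \<Longrightarrow> norm (f z) \<le> B"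
proof -
  obtain L where L: "L-lipschitz_on (cball 0 \<bar>r\<bar>) f" using assms lip_bounded_def by blast
  show thesis
  proof (rule that[of "norm (f 0) + L * \<bar>r\<bar>"])
    have L0: "L \<ge> 0" by (rule lipschitz_on_nonneg[OF L])
    then show "norm (f 0) + L * \<bar>r\<bar> \<ge> 0" by simp
    fix z :: 'a assume z: "norm z \<le> r"
    then have "dist (f z) (f 0) \<le> L * dist z 0"
      by (intro lipschitz_onD[OF L]) auto
    also have "\<dots> \<le> L * \<bar>r\<bar>" using z L0 by (intro mult_left_mono) auto
    finally show "norm (f z) \<le> norm (f 0) + L * \<bar>r\<bar>"
      using norm_triangle_ineq2[of "f z" "f 0"] unfolding dist_norm by linarith
  qed
qed

lemma lip_bounded_scaleR:
  fixes f :: "'a::real_normed_vector \<Rightarrow> real" and g :: "'a \<Rightarrow> 'b::real_normed_vector"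
  assumes f: "lip_bounded f" and g: "lip_bounded g"
  shows "lip_bounded (\<lambda>z. f z *\<^sub>R g z)"
  unfolding lip_bounded_def
proof
  fix r :: real
  obtain A where A: "A \<ge> 0" "\<And>z. norm z \<le> r \<Longrightarrow> norm (f z) \<le> A" using lip_bounded_bound[OF f] by blast
  obtain B where B: "B \<ge> 0" "\<And>z. norm z \<le> r \<Longrightarrow> norm (g z) \<le> B" using lip_bounded_bound[OF g] by blast
  obtain L where L: "L-lipschitz_on (cball 0 r) f" using f lip_bounded_def by blast
  obtain M where M: "M-lipschitz_on (cball 0 r) g" using g lip_bounded_def by blast
  have L0: "L \<ge> 0" "M \<ge> 0" using lipschitz_on_nonneg L M by auto
  have "(A * M + B * L)-lipschitz_on (cball 0 r) (\<lambda>z. f z *\<^sub>R g z)"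
  proof (rule lipschitz_onI)
    fix x y :: 'a assume xy: "x \<in> cball 0 r" "y \<in> cball 0 r"
    have "f x *\<^sub>R g x - f y *\<^sub>R g y = f x *\<^sub>R (g x - g y) + (f x - f y) *\<^sub>R g y"
      by (simp add: algebra_simps)
    then have "norm (f x *\<^sub>R g x - f y *\<^sub>R g y) \<le> \<bar>f x\<bar> * norm (g x - g y) + \<bar>f x - f y\<bar> * norm (g y)"
      by (metis norm_scaleR norm_triangle_ineq)
    also have "\<dots> \<le> A * (M * dist x y) + (L * dist x y) * B"
    proof (intro add_mono mult_mono)
      show "\<bar>f x\<bar> \<le> A" "norm (g y) \<le> B" using A(2)[of x] B(2)[of y] xy by auto
      show "norm (g x - g y) \<le> M * dist x y" "\<bar>f x - f y\<bar> \<le> L * dist x y"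
        using lipschitz_onD[OF M xy] lipschitz_onD[OF L xy] by (simp_all add: dist_norm)
    qed (use A B L0 in auto)
    finally show "dist (f x *\<^sub>R g x) (f y *\<^sub>R g y) \<le> (A * M + B * L) * dist x y"
      by (simp add: dist_norm algebra_simps)
  qed (use A B L0 in auto)
  then show "\<exists>L. L-lipschitz_on (cball 0 r) (\<lambda>z. f z *\<^sub>R g z)" by blast
qed

lemma lip_bounded_mult:
  "lip_bounded f \<Longrightarrow> lip_bounded g \<Longrightarrow> lip_bounded (\<lambda>z. f z * g z :: real)"
  using lip_bounded_scaleR[of f g] by simp

lemma lip_bounded_power: "lip_bounded f \<Longrightarrow> lip_bounded (\<lambda>z. f z ^ n :: real)"
  by (induction n) (auto intro: lip_bounded_const lip_bounded_mult)

lemma lip_bounded_sum: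
  "(\<And>j. j \<in> J \<Longrightarrow> lip_bounded (f j)) \<Longrightarrow> lip_bounded (\<lambda>z. \<Sum>j\<in>J. f j z)"
  by (induction J rule: infinite_finite_induct) (auto intro: lip_bounded_const lip_bounded_add)

lemma lip_bounded_continuous:
  fixes f :: "'a::real_normed_vector \<Rightarrow> 'b::real_normed_vector"
  shows "lip_bounded f \<Longrightarrow> continuous_on UNIV f"
proof (intro continuous_at_imp_continuous_on ballI)
  fix x :: 'a assume "lip_bounded f"
  then obtain L where "L-lipschitz_on (cball 0 (norm x + 1)) f" using lip_bounded_def by blast
  then have "continuous_on (cball 0 (norm x + 1)) f" by (rule lipschitz_on_continuous_on)
  moreover have "x \<in> interior (cball 0 (norm x + 1))"
    by (rule subsetD[OF interior_maximal[of "ball 0 (norm x + 1)"]]) auto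
  ultimately show "isCont f x" using continuous_on_interior by blast
qed

section \<open>Solution curves: restriction, shift, reversal and uniqueness\<close>

lemma solution_on_subset: "solution_on X J \<gamma> \<Longrightarrow> I \<subseteq> J \<Longrightarrow> solution_on X I \<gamma>"
  unfolding solution_on_def by (meson has_vector_derivative_within_subset subsetD)

lemma solution_on_continuous: "solution_on X J \<gamma> \<Longrightarrow> continuous_on J \<gamma>"
  unfolding solution_on_def continuous_on_eq_continuous_within
  by (blast intro: has_vector_derivative_continuous)

lemma solution_on_shift:
  assumes "solution_on X ((+) c ` J) \<gamma>"
  shows "solution_on X J (\<lambda>t. \<gamma> (c + t))"
  unfolding solution_on_def
proof
  fix t assume "t \<in> J"
  then have "(\<gamma> has_vector_derivative X (\<gamma> (c + t))) (at (c + t) within (+) c ` J)"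
    using assms by (auto simp: solution_on_def)
  moreover have "((+) c has_vector_derivative 1) (at t within J)"
    by (auto intro!: derivative_eq_intros)
  ultimately show "((\<lambda>t. \<gamma> (c + t)) has_vector_derivative X (\<gamma> (c + t))) (at t within J)"
    using vector_diff_chain_within[of "(+) c" 1 t J \<gamma>] by (simp add: o_def)
qed

lemma solution_on_reverse:
  assumes "solution_on X (uminus ` J) \<gamma>"
  shows "solution_on (\<lambda>z. - X z) J (\<lambda>t. \<gamma> (- t))"
  unfolding solution_on_def
proof
  fix t assume "t \<in> J"
  then have "(\<gamma> has_vector_derivative X (\<gamma> (- t))) (at (- t) within uminus ` J)"
    using assms by (auto simp: solution_on_def)
  moreover have "(uminus has_vector_derivative - 1) (at t within J)"
    by (auto intro!: derivative_eq_intros)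
  ultimately show "((\<lambda>t. \<gamma> (- t)) has_vector_derivative - X (\<gamma> (- t))) (at t within J)"
    using vector_diff_chain_within[of uminus "- 1" t J \<gamma>] by (simp add: o_def)
qed

text \<open>On the compact interval both curves stay in one ball, where the field has a Lipschitz
  constant, and Gronwall's inequality applies to their difference.\<close>

lemma solution_unique:
  assumes X: "lip_bounded X" and g: "solution_on X {a..b} \<gamma>" and h: "solution_on X {a..b} \<eta>"
    and "\<gamma> c = \<eta> c" and "c \<in> {a..b}" and "t \<in> {a..b}"
  shows "\<gamma> t = \<eta> t"
proof -
  have "bounded (\<gamma> ` {a..b} \<union> \<eta> ` {a..b})"
    by (intro bounded_Un[THEN iffD2] conjI compact_imp_bounded compact_continuous_image
        solution_on_continuous[OF g] solution_on_continuous[OF h] compact_Icc)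
  then obtain r where r: "\<forall>z \<in> \<gamma> ` {a..b} \<union> \<eta> ` {a..b}. norm z \<le> r"
    unfolding bounded_iff ..
  obtain L where L: "L-lipschitz_on (cball 0 r) X" using X lip_bounded_def by blast
  have "\<gamma> t - \<eta> t = 0"
  proof (rule gronwall_zero[where c=c and L=L])
    show "((\<lambda>t. \<gamma> t - \<eta> t) has_vector_derivative X (\<gamma> t) - X (\<eta> t)) (at t within {a..b})"
      if "t \<in> {a..b}" for t
      using g h that by (auto simp: solution_on_def intro!: has_vector_derivative_diff)
    show "norm (X (\<gamma> t) - X (\<eta> t)) \<le> L * norm (\<gamma> t - \<eta> t)" if "t \<in> {a..b}" for t
      using lipschitz_onD[OF L, of "\<gamma> t" "\<eta> t"] r that by (auto simp: dist_norm)
  qed (use assms in auto)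
  then show ?thesis by simp
qed

lemma solution_unique_UNIV:
  assumes "lip_bounded X" "solution_on X UNIV \<gamma>" "solution_on X UNIV \<eta>" "\<gamma> c = \<eta> c"
  shows "\<gamma> = \<eta>"
proof
  fix t
  show "\<gamma> t = \<eta> t"
    by (rule solution_unique[OF assms(1), of "min c t" "max c t" _ _ c])
      (use assms in \<open>auto intro: solution_on_subset\<close>)
qed

text \<open>A factor equal to 1 on the ball of radius \<open>K\<close> and to 0 outside the ball of
  radius \<open>K + 1\<close>. It turns a field that is Lipschitz on bounded sets into a globally
  Lipschitz one, whose solutions live for all times, and leaves it unchanged on the smaller
  ball.\<close>

definition cutoff :: "real \<Rightarrow> real \<times> real \<Rightarrow> real" where
  "cutoff K z = max 0 (min 1 (K + 1 - norm z))"

lemma cutoff_eq_1: "norm z \<le> K \<Longrightarrow> cutoff K z = 1"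
  and cutoff_nonneg: "0 \<le> cutoff K z" and cutoff_le_1: "cutoff K z \<le> 1"
  and cutoff_eq_0: "norm z \<ge> K + 1 \<Longrightarrow> cutoff K z = 0"
  by (auto simp: cutoff_def)

lemma cutoff_lipschitz: "\<bar>cutoff K z - cutoff K w\<bar> \<le> norm (z - w)"
  unfolding cutoff_def using norm_triangle_ineq2[of z w] norm_triangle_ineq3[of z w] by linarith

lemma cutoff_field_lipschitz:
  assumes "lip_bounded X"
  obtains L where "L-lipschitz_on UNIV (\<lambda>z. cutoff K z *\<^sub>R X z)"
proof -
  obtain B where B: "B \<ge> 0" "\<And>z. norm z \<le> K + 1 \<Longrightarrow> norm (X z) \<le> B"
    using lip_bounded_bound[OF assms] by blast
  obtain L where L: "L-lipschitz_on (cball 0 (K + 1)) X" using assms lip_bounded_def by blast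
  have L0: "L \<ge> 0" using lipschitz_on_nonneg L by auto
  \<comment> \<open>It suffices to have one of the two points in the ball of radius
    \<open>K + 1\<close>, since otherwise both values vanish.\<close>
  have one: "dist (cutoff K x *\<^sub>R X x) (cutoff K y *\<^sub>R X y) \<le> (L + B) * dist x y"
    if y: "norm y \<le> K + 1" for x y
  proof (cases "norm x \<le> K + 1")
    case True
    have "cutoff K x *\<^sub>R X x - cutoff K y *\<^sub>R X y
        = cutoff K x *\<^sub>R (X x - X y) + (cutoff K x - cutoff K y) *\<^sub>R X y"
      by (simp add: algebra_simps)
    then have "norm (cutoff K x *\<^sub>R X x - cutoff K y *\<^sub>R X y)
        \<le> \<bar>cutoff K x\<bar> * norm (X x - X y) + \<bar>cutoff K x - cutoff K y\<bar> * norm (X y)"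
      by (metis norm_scaleR norm_triangle_ineq)
    also have "\<dots> \<le> 1 * (L * dist x y) + dist x y * B"
      using lipschitz_onD[OF L, of x y] True y B cutoff_lipschitz[of K x y] cutoff_nonneg[of K x]
        cutoff_le_1[of K x]
      by (intro add_mono mult_mono) (auto simp: dist_norm)
    finally show ?thesis by (simp add: dist_norm algebra_simps)
  next
    case False
    then have "dist (cutoff K x *\<^sub>R X x) (cutoff K y *\<^sub>R X y) = \<bar>cutoff K x - cutoff K y\<bar> * norm (X y)"
      by (simp add: cutoff_eq_0)
    also have "\<dots> \<le> dist x y * B"
      using cutoff_lipschitz[of K x y] B y by (intro mult_mono) (auto simp: dist_norm)
    also have "\<dots> \<le> (L + B) * dist x y" using L0 by (simp add: algebra_simps)
    finally show ?thesis .
  qed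
  show thesis
  proof (rule that[of "L + B"], rule lipschitz_onI)
    fix x y
    show "dist (cutoff K x *\<^sub>R X x) (cutoff K y *\<^sub>R X y) \<le> (L + B) * dist x y"
      using one[of y x] one[of x y] B L0
      by (cases "norm y \<le> K + 1"; cases "norm x \<le> K + 1") (auto simp: dist_commute cutoff_eq_0)
  qed (use B L0 in auto)
qed

lemma cutoff_global_solution:
  assumes "lip_bounded X"
  obtains \<gamma> where "\<gamma> 0 = z" and "solution_on (\<lambda>z. cutoff K z *\<^sub>R X z) UNIV \<gamma>"
proof -
  obtain L where "L-lipschitz_on UNIV (\<lambda>z. cutoff K z *\<^sub>R X z)"
    using cutoff_field_lipschitz[OF assms] by blast
  then show thesis
    using lipschitz_global_solution[of L "\<lambda>z. cutoff K z *\<^sub>R X z" z] that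
    unfolding solution_on_def by (metis (no_types, lifting))
qed

lemma cutoff_lip_bounded:
  assumes "lip_bounded X" shows "lip_bounded (\<lambda>z. cutoff K z *\<^sub>R X z)"
  using cutoff_field_lipschitz[OF assms, of K] unfolding lip_bounded_def
  by (metis lipschitz_on_subset subset_UNIV)

text \<open>In the direction \<open>v = X z\<close> the curve would eventually advance by more than
  \<open>(v \<bullet> v) / 2\<close> per unit of time, while convergence makes its increments over
  unit times tend to 0. This will exclude trajectories that never complete a half turn.\<close>

lemma limit_is_equilibrium:
  fixes X :: vfield
  assumes sol: "solution_on X {t0..} \<gamma>" and X: "continuous_on UNIV X" and lim: "(\<gamma> \<longlongrightarrow> z) at_top"
  shows "X z = 0"
proof (rule ccontr)
  assume nz: "X z \<noteq> 0"
  define v where "v = X z"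
  have vv: "v \<bullet> v > 0" using nz by (simp add: v_def)
  have "((\<lambda>t. X (\<gamma> t) \<bullet> v) \<longlongrightarrow> X z \<bullet> v) at_top"
    by (intro tendsto_intros continuous_on_tendsto_compose[OF X lim]) auto
  then have 1: "eventually (\<lambda>t. X (\<gamma> t) \<bullet> v > (v \<bullet> v) / 2) at_top"
    using vv by (intro order_tendstoD(1)) (auto simp: v_def)
  have 2: "filterlim (\<lambda>t::real. t + 1) at_top at_top"
    unfolding filterlim_at_top eventually_at_top_linorder
  proof
    show "\<exists>N. \<forall>n\<ge>N. Z \<le> n + 1" for Z :: real by (rule exI[of _ "Z - 1"]) auto
  qed
  have "((\<lambda>t. \<gamma> (t + 1) \<bullet> v - \<gamma> t \<bullet> v) \<longlongrightarrow> z \<bullet> v - z \<bullet> v) at_top"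
    by (intro tendsto_intros lim filterlim_compose[OF lim 2])
  then have 3: "eventually (\<lambda>t. \<gamma> (t + 1) \<bullet> v - \<gamma> t \<bullet> v < (v \<bullet> v) / 2) at_top"
    using vv by (intro order_tendstoD(2)) auto
  obtain T where T: "\<And>t. t \<ge> T \<Longrightarrow> X (\<gamma> t) \<bullet> v > (v \<bullet> v) / 2"
    "\<And>t. t \<ge> T \<Longrightarrow> \<gamma> (t + 1) \<bullet> v - \<gamma> t \<bullet> v < (v \<bullet> v) / 2"
    using eventually_conj[OF 1 3] unfolding eventually_at_top_linorder by blast
  define t where "t = max T t0"
  obtain s where s: "s \<in> {t..t+1}" "\<gamma> (t + 1) \<bullet> v - \<gamma> t \<bullet> v = (t + 1 - t) * (X (\<gamma> s) \<bullet> v)"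
  proof -
    have "((\<lambda>x. \<gamma> x \<bullet> v) has_derivative (\<lambda>h. h * (X (\<gamma> x) \<bullet> v))) (at x within {t..t+1})"
      if "t \<le> x" "x \<le> t + 1" for x
    proof -
      have "(\<gamma> has_vector_derivative X (\<gamma> x)) (at x within {t..t+1})"
        using solution_on_subset[OF sol, of "{t..t+1}"] that by (auto simp: solution_on_def t_def)
      then show ?thesis
        unfolding has_vector_derivative_def by (auto intro!: derivative_eq_intros)
    qed
    from mvt_very_simple[of t "t + 1", OF _ this] show thesis using that by auto
  qed
  show False using s T(1)[of s] T(2)[of t] by (auto simp: t_def)
qed

text \<open>The supremum of the times up to which \<open>Q\<close> holds throughout is reached by
  \<open>left\<close> and pushed further by \<open>right\<close>. It serves for invariants that
  change their form whenever a trajectory crosses the x-axis.\<close>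

lemma interval_induction:
  fixes a b :: real
  assumes "a \<le> b" and base: "Q a"
    and right: "\<And>t. t \<in> {a..<b} \<Longrightarrow> Q t \<Longrightarrow> \<exists>e>0. \<forall>s\<in>{t..t+e}. s \<le> b \<longrightarrow> Q s"
    and left: "\<And>t. t \<in> {a<..b} \<Longrightarrow> (\<And>s. s \<in> {a..<t} \<Longrightarrow> Q s) \<Longrightarrow> Q t"
    and t: "t \<in> {a..b}"
  shows "Q t"
proof -
  define S where "S = {t\<in>{a..b}. \<forall>s\<in>{a..t}. Q s}"
  have aS: "a \<in> S" using assms by (auto simp: S_def)
  have bdd: "bdd_above S" by (auto simp: S_def)
  define c where "c = Sup S"
  have c: "a \<le> c" "c \<le> b"
    unfolding c_def using cSup_upper[OF aS bdd] aS
    by (auto intro!: cSup_least) (simp add: S_def)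
  have below: "Q s" if "s \<in> {a..<c}" for s
  proof -
    have "s < Sup S" using that by (simp add: c_def)
    then obtain x where "x \<in> S" "s < x" using aS less_cSupD[of S s] by blast
    then show ?thesis using that by (auto simp: S_def)
  qed
  have Qc: "Q c"
  proof (cases "a = c")
    case False
    then show ?thesis using left[of c] below c by auto
  qed (use base in simp)
  have "c = b"
  proof (rule ccontr)
    assume "c \<noteq> b"
    then obtain e where e: "e > 0" "\<forall>s\<in>{c..c+e}. s \<le> b \<longrightarrow> Q s" using right[of c] Qc c by auto
    have "min (c + e) b \<in> S"
      unfolding S_def
    proof (intro CollectI conjI ballI)
      show "min (c + e) b \<in> {a..b}" using c e by auto
      show "Q s" if "s \<in> {a..min (c + e) b}" for s
        using that below[of s] e by (cases "s < c") auto
    qed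
    then have "min (c + e) b \<le> c" unfolding c_def by (rule cSup_upper[OF _ bdd])
    then show False using e c \<open>c \<noteq> b\<close> by auto
  qed
  then show ?thesis using below Qc t by (cases "t < c") auto
qed

text \<open>The infimum of the closed set where \<open>f\<close> is nonpositive belongs to it, and
  the intermediate value theorem excludes a negative value there.\<close>

lemma first_nonpos:
  fixes f :: "real \<Rightarrow> real"
  assumes "continuous_on {c..b} f" and "c \<le> b" and "f c > 0" and "f b \<le> 0"
  obtains t where "t \<in> {c<..b}" and "f t = 0" and "\<And>s. s \<in> {c..<t} \<Longrightarrow> f s > 0"
proof -
  define S where "S = {t\<in>{c..b}. f t \<le> 0}"
  have "closed S" unfolding S_def
    using continuous_on_closed_Collect_le[OF assms(1) continuous_on_const[of _ 0] closed_atLeastAtMost] by simp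
  moreover have "bdd_below S" by (auto simp: S_def)
  moreover have "b \<in> S" using assms by (auto simp: S_def)
  ultimately have IS: "Inf S \<in> S" and low: "\<And>s. s \<in> S \<Longrightarrow> Inf S \<le> s"
    using closed_contains_Inf[of S] cInf_lower[of _ S] by blast+
  define t where "t = Inf S"
  have t: "t \<in> {c<..b}" "f t \<le> 0"
    using IS assms(3) by (auto simp: S_def t_def less_le)
  have pos: "f s > 0" if "s \<in> {c..<t}" for s
    using low[of s] that t(1) by (cases "f s > 0") (auto simp: S_def t_def)
  have "f t = 0"
  proof (rule ccontr)
    assume "f t \<noteq> 0"
    then have neg: "f t < 0" using t by simp
    moreover have "continuous_on {c..t} f" by (rule continuous_on_subset[OF assms(1)]) (use t in auto)
    ultimately obtain x where "x \<in> {c..t}" "f x = 0"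
      using IVT2'[of f t 0 c] assms(3) t by auto
    then show False using pos[of x] neg by (cases "x = t") auto
  qed
  then show thesis by (rule that[OF t(1) _ pos])
qed

lemma solution_on_at: "solution_on X UNIV \<gamma> \<Longrightarrow> (\<gamma> has_vector_derivative X (\<gamma> t)) (at t)"
  by (simp add: solution_on_def)

text \<open>By uniqueness the two solutions agree up to a shift of time.\<close>

lemma periodic_orbits_disjoint:
  assumes X: "lip_bounded X" and G: "periodic_orbit X \<Gamma>" and G': "periodic_orbit X \<Gamma>'"
    and z: "z \<in> \<Gamma>" "z \<in> \<Gamma>'"
  shows "\<Gamma> = \<Gamma>'"
proof -
  obtain \<gamma> where g: "solution_on X UNIV \<gamma>" "\<Gamma> = range \<gamma>" using G by (auto simp: periodic_orbit_def)
  obtain \<eta> where h: "solution_on X UNIV \<eta>" "\<Gamma>' = range \<eta>" using G' by (auto simp: periodic_orbit_def)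
  obtain s t where st: "\<gamma> s = z" "\<eta> t = z" using z g h by auto
  have "(\<lambda>x. \<gamma> (s + x)) = (\<lambda>x. \<eta> (t + x))"
  proof (rule solution_unique_UNIV[OF X, of _ _ 0])
    show "solution_on X UNIV (\<lambda>x. \<gamma> (s + x))" "solution_on X UNIV (\<lambda>x. \<eta> (t + x))"
      by (rule solution_on_shift, rule solution_on_subset[OF g(1)], simp)
        (rule solution_on_shift, rule solution_on_subset[OF h(1)], simp)
  qed (use st in simp)
  then have e: "\<gamma> (s + x) = \<eta> (t + x)" for x by meson
  have "\<gamma> x = \<eta> (t + (x - s))" "\<eta> x = \<gamma> (s + (x - t))" for x
    using e[of "x - s"] e[of "x - t"] by simp_all
  then show ?thesis unfolding g(2) h(2) by (metis (no_types, lifting) image_cong rangeE range_eqI subsetI subset_antisym)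
qed

lemma periodic_orbit_compact: "periodic_orbit X \<Gamma> \<Longrightarrow> compact \<Gamma>"
proof -
  assume "periodic_orbit X \<Gamma>"
  then obtain \<gamma> T where g: "0 < T" "solution_on X UNIV \<gamma>" "\<And>t. \<gamma> (t + T) = \<gamma> t" "\<Gamma> = range \<gamma>"
    by (auto simp: periodic_orbit_def)
  have per: "\<gamma> (t + of_int n * T) = \<gamma> t" for t n
  proof (induction n rule: int_induct[where k=0])
    case (step1 i)
    then show ?case using g(3)[of "t + of_int i * T"] by (simp add: algebra_simps)
  next
    case (step2 i)
    then show ?case using g(3)[of "t + of_int (i - 1) * T"] by (simp add: algebra_simps)
  qed simp
  have "\<Gamma> = \<gamma> ` {0..T}"
  proof
    show "\<Gamma> \<subseteq> \<gamma> ` {0..T}"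
    proof
      fix z assume "z \<in> \<Gamma>"
      then obtain t where t: "z = \<gamma> t" using g by auto
      let ?n = "\<lfloor>t / T\<rfloor>"
      have n: "of_int ?n \<le> t / T" "t / T \<le> of_int ?n + 1" by linarith+
      have "t / T * T = t" using g(1) by simp
      then have "of_int ?n * T \<le> t" "t \<le> of_int ?n * T + T"
        using mult_right_mono[OF n(1), of T] mult_right_mono[OF n(2), of T] g(1) by (simp_all add: distrib_right)
      then have "t + of_int (- ?n) * T \<in> {0..T}" by auto
      then show "z \<in> \<gamma> ` {0..T}" using per[of t "- ?n"] t by (metis image_eqI)
    qed
  qed (use g in auto)
  then show ?thesis
    by (metis compact_Icc compact_continuous_image continuous_on_subset g(2) solution_on_continuous subset_UNIV)
qed

text \<open>At a finite end time the solution of a cut-off field goes on and extends the given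
  solution beyond its maximal interval.\<close>

lemma maximal_bounded_global:
  assumes X: "lip_bounded X" and max: "maximal_forward_solution X T \<gamma>"
    and bd: "\<And>t. t \<in> forward_interval T \<Longrightarrow> norm (\<gamma> t) \<le> M"
  shows "T = \<infinity>"
proof (rule ccontr)
  assume "T \<noteq> \<infinity>"
  have T0: "0 < T" and sol: "solution_on X (forward_interval T) \<gamma>"
    using max by (auto simp: maximal_forward_solution_def forward_solution_def)
  then obtain r where r: "T = ereal r" "r > 0" using \<open>T \<noteq> \<infinity>\<close> by (cases T) auto
  have fi: "forward_interval (ereal s) = {0..<s}" for s by (auto simp: forward_interval_def)
  \<comment> \<open>Cutting off at \<open>M + 1\<close> leaves room: at the end time the norm is at
    most \<open>M\<close>, so the continuation stays below \<open>M + 1\<close> for a while.\<close>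
  let ?Y = "\<lambda>z. cutoff (M + 1) z *\<^sub>R X z"
  obtain \<eta> where h: "\<eta> 0 = \<gamma> 0" "solution_on ?Y UNIV \<eta>" by (rule cutoff_global_solution[OF X])
  have ag: "\<eta> t = \<gamma> t" if t: "t \<in> {0..<r}" for t
  proof (rule solution_unique[OF cutoff_lip_bounded[OF X], of "M + 1" 0 t _ _ 0 t])
    show "solution_on ?Y {0..t} \<eta>" by (rule solution_on_subset[OF h(2)]) simp
    have "solution_on X {0..t} \<gamma>" by (rule solution_on_subset[OF sol]) (use t r fi in auto)
    then show "solution_on ?Y {0..t} \<gamma>"
      using bd t r fi unfolding solution_on_def by (auto simp: cutoff_eq_1 add_increasing2)
  qed (use h t in auto)
  have cont: "continuous_on UNIV \<eta>" by (rule solution_on_continuous[OF h(2)])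
  have "norm (\<eta> r) \<le> M"
  proof (rule tendsto_upperbound)
    show "((\<lambda>t. norm (\<eta> t)) \<longlongrightarrow> norm (\<eta> r)) (at_left r)"
      using cont by (intro tendsto_intros) (metis UNIV_I continuous_on_eq_continuous_within continuous_within_subset
          continuous_within subset_UNIV)
    have "eventually (\<lambda>t. t \<in> {0<..<r}) (at_left r)" by (rule eventually_at_leftI[of 0]) (use r(2) in auto)
    then show "\<forall>\<^sub>F t in at_left r. norm (\<eta> t) \<le> M"
      by eventually_elim (use ag bd r fi in auto)
  qed simp
  then have "norm (\<eta> r) < M + 1" by simp
  moreover have "isCont (\<lambda>t. norm (\<eta> t)) r"
    using cont by (auto simp: continuous_on_eq_continuous_at intro!: continuous_intros)
  ultimately have "eventually (\<lambda>t. norm (\<eta> t) < M + 1) (at r)"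
    by (intro order_tendstoD(2)) (auto simp: isCont_def)
  then obtain d where d: "d > 0" "\<And>t. t \<noteq> r \<Longrightarrow> dist t r < d \<Longrightarrow> norm (\<eta> t) < M + 1"
    by (auto simp: eventually_at)
  have small: "norm (\<eta> t) \<le> M + 1" if "t \<in> {0..<r + d}" for t
  proof (cases "t < r")
    case True
    then have "norm (\<gamma> t) \<le> M" using that by (intro bd) (auto simp: r fi)
    then show ?thesis using ag[of t] True that by auto
  next
    case False
    then show ?thesis
      using d(2)[of t] that \<open>norm (\<eta> r) < M + 1\<close> by (cases "t = r") (auto simp: dist_real_def)
  qed
  have "solution_on X {0..<r + d} \<eta>"
    unfolding solution_on_def
  proof
    fix t assume t: "t \<in> {0..<r + d}"
    have "(\<eta> has_vector_derivative ?Y (\<eta> t)) (at t within {0..<r + d})"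
      using solution_on_at[OF h(2)] by (rule has_vector_derivative_at_within)
    then show "(\<eta> has_vector_derivative X (\<eta> t)) (at t within {0..<r + d})"
      using small[OF t] by (simp add: cutoff_eq_1)
  qed
  then have "forward_solution X (ereal (r + d)) \<eta>"
    using r d by (simp add: forward_solution_def fi)
  moreover have "T \<le> ereal (r + d)" using r d by simp
  moreover have "\<forall>t\<in>forward_interval T. \<eta> t = \<gamma> t" using ag r fi by simp
  ultimately have "ereal (r + d) = T" using max unfolding maximal_forward_solution_def by blast
  then show False using r d by simp
qed

section \<open>Zeros of perturbed polynomials\<close>

text \<open>The zeros of \<open>g'\<close> are kept strictly below the largest zero of
  \<open>g\<close>. When that zero is split off, the new Rolle point lies above the maximum of the
  remaining zeros and so differs from all points found before.\<close>

lemma rolle_card: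
  fixes g g' :: "real \<Rightarrow> real"
  assumes der: "\<And>x. x \<in> {a..b} \<Longrightarrow> (g has_real_derivative g' x) (at x)"
  shows "finite S \<Longrightarrow> card S = Suc k \<Longrightarrow> S \<subseteq> {a..b} \<Longrightarrow> (\<forall>x\<in>S. g x = 0) \<Longrightarrow>
    \<exists>S'. finite S' \<and> card S' = k \<and> S' \<subseteq> {a..<Max S} \<and> (\<forall>x\<in>S'. g' x = 0)"
proof (induction k arbitrary: S)
  case 0
  then show ?case by (intro exI[of _ "{}"]) auto
next
  case (Suc k)
  define m where "m = Max S"
  define S0 where "S0 = S - {m}"
  have S: "S \<noteq> {}" using Suc.prems by auto
  have m: "m \<in> S" using Suc.prems S by (auto simp: m_def)
  have S0: "finite S0" "card S0 = Suc k" "S0 \<subseteq> {a..b}" "\<forall>x\<in>S0. g x = 0"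
    using Suc.prems m by (auto simp: S0_def)
  define m0 where "m0 = Max S0"
  have "S0 \<noteq> {}" using S0 by auto
  then have m0: "m0 \<in> S0" using S0 by (auto simp: m0_def)
  then have "m0 \<le> m" "m0 \<noteq> m" using Suc.prems by (auto simp: m_def S0_def)
  then have lt: "m0 < m" by simp
  have ab: "m0 \<in> {a..b}" "m \<in> {a..b}" using m0 m S0 Suc.prems by auto
  have "\<exists>z. m0 < z \<and> z < m \<and> (\<lambda>h. g' z * h) = (\<lambda>v. 0)"
  proof (rule Rolle_deriv[OF lt])
    show "g m0 = g m" using m m0 Suc.prems S0 by auto
    show "continuous_on {m0..m} g"
      using ab by (intro continuous_at_imp_continuous_on ballI DERIV_isCont[OF der]) auto
    show "(g has_derivative (*) (g' x)) (at x)" if "m0 < x" "x < m" for x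
      using der[of x] ab that by (auto simp: has_field_derivative_def)
  qed
  then obtain z where z: "m0 < z" "z < m" "g' z = 0" by (metis mult.right_neutral)
  obtain S' where S': "finite S'" "card S' = k" "S' \<subseteq> {a..<m0}" "\<forall>x\<in>S'. g' x = 0"
    using Suc.IH[OF S0] by (auto simp: m0_def)
  show ?case
    by (rule exI[of _ "insert z S'"]) (use S' z ab lt in \<open>auto simp: m_def[symmetric] card_insert_if\<close>)
qed

lemma rolle_iterated:
  fixes g :: "nat \<Rightarrow> real \<Rightarrow> real"
  assumes der: "\<And>n x. x \<in> {a..b} \<Longrightarrow> (g n has_real_derivative g (Suc n) x) (at x)"
    and S: "finite S" "card S = Suc d" "S \<subseteq> {a..b}" "\<forall>x\<in>S. g 0 x = 0" and "n \<le> d"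
  obtains x where "x \<in> {a..b}" and "g n x = 0"
proof -
  have "\<exists>S'. finite S' \<and> card S' = Suc d - n \<and> S' \<subseteq> {a..b} \<and> (\<forall>x\<in>S'. g n x = 0)" if "n \<le> d" for n
    using that
  proof (induction n)
    case 0
    then show ?case using S by auto
  next
    case (Suc n)
    then obtain S' where S': "finite S'" "card S' = Suc (Suc d - Suc n)" "S' \<subseteq> {a..b}"
      "\<forall>x\<in>S'. g n x = 0" by (auto simp: Suc_diff_le)
    obtain S'' where "finite S''" "card S'' = Suc d - Suc n" "S'' \<subseteq> {a..<Max S'}"
      "\<forall>x\<in>S''. g (Suc n) x = 0"
      using rolle_card[OF der S'] by blast
    moreover have "Max S' \<le> b"
      using S' Max_in[of S'] by (metis atLeastAtMost_iff card.empty nat.simps(3) subsetD)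
    ultimately show ?case by (intro exI[of _ S'']) auto
  qed
  from this[OF \<open>n \<le> d\<close>] obtain S' where S': "card S' = Suc d - n" "S' \<subseteq> {a..b}" "\<forall>x\<in>S'. g n x = 0"
    by blast
  then have "S' \<noteq> {}" using \<open>n \<le> d\<close> by auto
  then show thesis using S' that by blast
qed

text \<open>Rolle's theorem yields a zero of each of the first \<open>d\<close> derivatives, and Cauchy's estimates
  then bound the coefficients of the polynomial one after the other, from the top one downwards.\<close>

lemma perturbed_poly_zeros_coeff_bound:
  fixes d :: nat
  obtains c :: real where "c > 0" and
    "\<And>(p::real poly) R \<epsilon> S j. R holomorphic_on ball 0 2 \<Longrightarrow>
       (\<And>z. z \<in> ball 0 2 \<Longrightarrow> norm (R z) \<le> \<epsilon>) \<Longrightarrow> Polynomial.degree p \<le> d \<Longrightarrow>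
       card S = Suc d \<Longrightarrow> S \<subseteq> {-1..1} \<Longrightarrow> (\<And>x. x \<in> S \<Longrightarrow> poly p x + Re (R (of_real x)) = 0) \<Longrightarrow>
       \<bar>Polynomial.coeff p j\<bar> \<le> c * \<epsilon>"
proof -
  \<comment> \<open>The factor lost at each step of the descent: a coefficient is bounded by
    \<open>E\<close> plus at most \<open>d\<close> higher ones, each weighted by at most
    \<open>fact d\<close>.\<close>
  define Q :: real where "Q = 1 + d * fact d"
  have Q: "Q \<ge> 1" by (simp add: Q_def)
  show thesis
  proof (rule that[of "fact d * 2^d * Q^Suc d"])
    show "fact d * 2^d * Q^Suc d > 0" using Q by (intro mult_pos_pos zero_less_power) auto
    fix p :: "real poly" and R \<epsilon> and S :: "real set" and j :: nat
    assume hol: "R holomorphic_on ball 0 2" and bd: "\<And>z. z \<in> ball 0 2 \<Longrightarrow> norm (R z) \<le> \<epsilon>"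
      and deg: "Polynomial.degree p \<le> d"
      and S: "card S = Suc d" "S \<subseteq> {-1..1}" "\<And>x. x \<in> S \<Longrightarrow> poly p x + Re (R (of_real x)) = 0"
    \<comment> \<open>Cauchy's estimate for all derivatives up to order \<open>d\<close>, on discs
      of radius 1/2 around the points of \<open>{-1..1}\<close>; these discs lie inside the ball of
      radius 2.\<close>
    define E where "E = fact d * 2^d * \<epsilon>"
    have \<epsilon>: "\<epsilon> \<ge> 0" using bd[of 0] norm_ge_zero[of "R 0"] by (simp del: norm_ge_zero)
    then have E: "E \<ge> 0" by (simp add: E_def)
    define g where "g = (\<lambda>n x. poly ((pderiv ^^ n) p) x + Re ((deriv ^^ n) R (of_real x)))"
    have der: "(g n has_real_derivative g (Suc n) x) (at x)" if "x \<in> {-1..1}" for n x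
    proof -
      have "((deriv ^^ n) R has_field_derivative deriv ((deriv ^^ n) R) (of_real x)) (at (of_real x))"
        by (rule holomorphic_derivI[OF holomorphic_higher_deriv[OF hol open_ball] open_ball])
          (use that in auto)
      from bounded_linear.has_vector_derivative[OF bounded_linear_Re has_vector_derivative_real_field[OF this]]
      have "((\<lambda>x. Re ((deriv ^^ n) R (of_real x))) has_real_derivative Re ((deriv ^^ Suc n) R (of_real x))) (at x)"
        by (simp add: has_real_derivative_iff_has_vector_derivative)
      from DERIV_add[OF poly_DERIV this] show ?thesis by (simp add: g_def)
    qed
    have RB: "norm ((deriv ^^ n) R (of_real x)) \<le> E" if x: "x \<in> {-1..1}" and n: "n \<le> d" for n x
    proof -
      have sub: "cball (of_real x) (1/2) \<subseteq> ball (0::complex) 2"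
        using x by (auto simp: cball_subset_ball_iff)
      have "norm ((deriv ^^ n) R (of_real x)) \<le> fact n * \<epsilon> / (1/2)^n"
      proof (rule Cauchy_inequality)
        show "R holomorphic_on ball (of_real x) (1/2)"
          using hol sub by (meson ball_subset_cball holomorphic_on_subset order_trans)
        show "continuous_on (cball (of_real x) (1/2)) R"
          using hol sub by (meson holomorphic_on_imp_continuous_on continuous_on_subset)
        show "norm (R y) \<le> \<epsilon>" if "norm (of_real x - y) = 1/2" for y
          by (rule bd[OF subsetD[OF sub]]) (simp add: dist_norm that)
      qed simp
      also have "\<dots> = fact n * 2^n * \<epsilon>" by (simp add: power_divide)
      also have "\<dots> \<le> E" unfolding E_def
        using n \<epsilon> by (intro mult_right_mono mult_mono fact_mono power_increasing) auto
      finally show ?thesis .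
    qed
    \<comment> \<open>Descent on the index: \<open>k = 0\<close> is the range above the degree, and
      each unit of \<open>k\<close> reaches one index further down.\<close>
    have main: "\<bar>Polynomial.coeff p n\<bar> \<le> E * Q^k" if "n + k > d" for n k
      using that
    proof (induction k arbitrary: n)
      case 0
      then have "Polynomial.coeff p n = 0" using deg by (intro coeff_eq_0) simp
      then show ?case using E by simp
    next
      case (Suc k)
      show ?case
      proof (cases "n + k > d")
        case True
        have "E * Q^k \<le> E * Q^Suc k" using E Q by (intro mult_left_mono power_increasing) auto
        then show ?thesis using Suc.IH[OF True] by linarith
      next
        case False
        then have nd: "n \<le> d" "n + k = d" using Suc.prems by auto
        have fin: "finite S" using S(1) card.infinite by fastforce
        obtain x where x: "x \<in> {-1..1}" "g n x = 0"
        proof (rule rolle_iterated[of "-1" 1 g S d n])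
          show "\<forall>x\<in>S. g 0 x = 0" using S(3) by (simp add: g_def)
        qed (use der fin S nd in auto)
        define q where "q = (pderiv ^^ n) p"
        have cq: "Polynomial.coeff q i = pochhammer (of_nat (Suc i)) n * Polynomial.coeff p (i + n)" for i
          by (simp add: q_def coeff_higher_pderiv)
        have "Polynomial.degree q \<le> d" using deg by (simp add: q_def degree_higher_pderiv)
        then have "q = (\<Sum>i\<le>d. monom (Polynomial.coeff q i) i)"
          by (rule poly_as_sum_of_monoms'[symmetric])
        then have "poly q x = poly (\<Sum>i\<le>d. monom (Polynomial.coeff q i) i) x" by simp
        also have "\<dots> = (\<Sum>i\<le>d. Polynomial.coeff q i * x^i)"
          by (simp add: poly_sum poly_monom)
        also have "\<dots> = Polynomial.coeff q 0 + (\<Sum>i=1..d. Polynomial.coeff q i * x^i)"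
          by (simp add: sum.atMost_shift sum.atLeast1_atMost_eq lessThan_Suc_atMost)
        finally have pq: "poly q x = Polynomial.coeff q 0 + (\<Sum>i=1..d. Polynomial.coeff q i * x^i)" .
        have "\<bar>\<Sum>i=1..d. Polynomial.coeff q i * x^i\<bar> \<le> (\<Sum>i=1..d. fact d * (E * Q^k))"
        proof (intro order_trans[OF sum_abs] sum_mono)
          fix i assume i: "i \<in> {1..d}"
          have xi: "\<bar>x\<bar>^i \<le> 1" using x by (intro power_le_one) auto
          have "\<bar>Polynomial.coeff q i\<bar> \<le> fact d * (E * Q^k)"
          proof (cases "n + i \<le> d")
            case True
            \<comment> \<open>The factor is \<open>fact (i + n) / fact i\<close>, at most
              \<open>fact d\<close> because \<open>n + i \<le> d\<close>.\<close>
            have "fact i * pochhammer (of_nat (Suc i)) n = (fact (i + n) :: real)"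
              using pochhammer_product'[of "1::real" i n] by (simp add: pochhammer_fact[symmetric])
            moreover have "1 * pochhammer (of_nat (Suc i)) n \<le> fact i * (pochhammer (of_nat (Suc i)) n :: real)"
              by (intro mult_right_mono fact_ge_1 pochhammer_nonneg) simp
            moreover have "(fact (i + n) :: real) \<le> fact d" using True by (intro fact_mono) auto
            ultimately have "pochhammer (of_nat (Suc i)) n \<le> (fact d :: real)" by linarith
            moreover have "pochhammer (of_nat (Suc i)) n \<ge> (0::real)" by (intro pochhammer_nonneg) simp
            moreover have "\<bar>Polynomial.coeff p (i + n)\<bar> \<le> E * Q^k"
              using i nd by (intro Suc.IH) auto
            ultimately show ?thesis unfolding cq abs_mult by (intro mult_mono) auto
          next
            case False
            then have "Polynomial.coeff p (i + n) = 0" using deg by (intro coeff_eq_0) simp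
            then show ?thesis using E Q by (simp add: cq)
          qed
          then show "\<bar>Polynomial.coeff q i * x^i\<bar> \<le> fact d * (E * Q^k)"
            using mult_mono[OF _ xi, of "\<bar>Polynomial.coeff q i\<bar>" "fact d * (E * Q^k)"] E Q
            by (simp add: abs_mult power_abs)
        qed
        then have s: "\<bar>\<Sum>i=1..d. Polynomial.coeff q i * x^i\<bar> \<le> d * fact d * (E * Q^k)" by simp
        have "\<bar>Re ((deriv ^^ n) R (of_real x))\<bar> \<le> E"
          using abs_Re_le_cmod RB[OF x(1) nd(1)] order_trans by blast
        then have "\<bar>Polynomial.coeff q 0\<bar> \<le> E + d * fact d * (E * Q^k)"
          using x(2) s pq by (simp add: g_def q_def)
        moreover have "\<bar>Polynomial.coeff p n\<bar> \<le> \<bar>Polynomial.coeff q 0\<bar>"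
        proof -
          have "Polynomial.coeff q 0 = fact n * Polynomial.coeff p n"
            by (simp add: cq pochhammer_fact[symmetric])
          moreover have "1 * \<bar>Polynomial.coeff p n\<bar> \<le> fact n * \<bar>Polynomial.coeff p n\<bar>"
            by (intro mult_right_mono fact_ge_1) simp
          ultimately show ?thesis by (simp add: abs_mult)
        qed
        moreover have "E \<le> E * Q^k" using E Q one_le_power[OF Q, of k] by (simp add: mult_le_cancel_left1)
        ultimately show ?thesis by (simp add: Q_def algebra_simps)
      qed
    qed
    from main[of j "Suc d"] show "\<bar>Polynomial.coeff p j\<bar> \<le> fact d * 2^d * Q^Suc d * \<epsilon>"
      by (simp add: E_def algebra_simps)
  qed
qed

text \<open>The hypotheses say that \<open>D\<close> is a small perturbation of the odd polynomial with the
  coefficients \<open>C j * b j\<close>, the error being controlled by the same coefficients \<open>b j\<close>. Since \<open>D\<close>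
  is odd, \<open>i\<close> positive zeros would yield \<open>2 * i + 1\<close> zeros in all, more than the degree
  \<open>2 * i - 1\<close> of the dominant part.\<close>

lemma odd_expansion_zeros_upper:
  fixes C :: "nat \<Rightarrow> real" and N i :: nat and R A B :: real
  defines "J \<equiv> {j\<in>{1..N}. odd j}"
  assumes C: "\<And>j. j \<in> J \<Longrightarrow> C j > 0" and "R > 0" and "A \<ge> 0" and "B \<ge> 0"
    and i: "1 \<le> i" "2 * i - 1 \<le> N"
  obtains \<rho> where "\<rho> > 0" and "\<And>b D. D holomorphic_on ball 0 R \<Longrightarrow>
     (\<And>z. z \<in> ball 0 R \<Longrightarrow> D (- z) = - D z) \<Longrightarrow>
     (\<And>z. z \<in> ball 0 R \<Longrightarrow>
        norm (D z - (\<Sum>j\<in>J. of_real (C j * b j) * z^j)) \<le> A * norm z * (\<Sum>j\<in>J. \<bar>b j\<bar> * norm z^j)) \<Longrightarrow>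
     (\<And>j. j \<in> J \<Longrightarrow> j > 2 * i - 1 \<Longrightarrow> \<bar>b j\<bar> \<le> B * \<bar>b (2 * i - 1)\<bar>) \<Longrightarrow>
     (\<exists>j\<in>J. j \<le> 2 * i - 1 \<and> b j \<noteq> 0) \<Longrightarrow>
     finite {t. 0 < t \<and> t < \<rho> \<and> D (of_real t) = 0} \<and> card {t. 0 < t \<and> t < \<rho> \<and> D (of_real t) = 0} \<le> i - 1"
proof -
  define d where "d = 2 * i - 1"
  obtain c where c: "c > 0" and few: "\<And>(p::real poly) R \<epsilon> S j. R holomorphic_on ball 0 2 \<Longrightarrow>
       (\<And>z. z \<in> ball 0 2 \<Longrightarrow> norm (R z) \<le> \<epsilon>) \<Longrightarrow> Polynomial.degree p \<le> d \<Longrightarrow>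
       card S = Suc d \<Longrightarrow> S \<subseteq> {-1..1} \<Longrightarrow> (\<And>x. x \<in> S \<Longrightarrow> poly p x + Re (R (of_real x)) = 0) \<Longrightarrow>
       \<bar>Polynomial.coeff p j\<bar> \<le> c * \<epsilon>"
    using perturbed_poly_zeros_coeff_bound[of d] by blast
  have finJ: "finite J" by (simp add: J_def)
  have dJ: "d \<in> J" using i by (auto simp: J_def d_def)
  define Cm where "Cm = Min (C ` J)"
  have Cm: "Cm > 0" "\<And>j. j \<in> J \<Longrightarrow> Cm \<le> C j"
  proof -
    have "Min (C ` J) \<in> C ` J" using finJ dJ by (intro Min_in) auto
    then show "Cm > 0" using C by (auto simp: Cm_def)
    show "\<And>j. j \<in> J \<Longrightarrow> Cm \<le> C j" using finJ by (auto simp: Cm_def)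
  qed
  define CM where "CM = Max (C ` J)"
  have CM: "\<And>j. j \<in> J \<Longrightarrow> C j \<le> CM" using finJ by (auto simp: CM_def)
  have CM0: "CM > 0" using CM[OF dJ] C[OF dJ] by linarith
  \<comment> \<open>Collects the two errors of the rescaled remainder: the one with the constant
    \<open>A\<close>, and the terms above degree \<open>d\<close>. Powers on the ball of radius 2
    account for \<open>2 ^ N\<close>, and the final 1 keeps \<open>G\<close> positive.\<close>
  define G where "G = (2 * A * (1 + N * B) + CM * N * B) * 2^N + 1"
  have G: "G > 0" unfolding G_def using \<open>A \<ge> 0\<close> \<open>B \<ge> 0\<close> CM0
    by (intro add_nonneg_pos mult_nonneg_nonneg add_nonneg_nonneg) auto
  \<comment> \<open>\<open>R / 2\<close> lets the ball of radius 2 be rescaled into the domain of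
    \<open>D\<close>; the last term makes \<open>N * (c * (\<rho> * G))\<close> at most half of
    \<open>Cm\<close>, which contradicts the inequality at the end.\<close>
  define \<rho> where "\<rho> = min (min 1 (R / 2)) (Cm / (2 * N * c * G))"
  have N: "N \<ge> 1" using i by auto
  have \<rho>: "\<rho> > 0" "\<rho> \<le> 1" "2 * \<rho> \<le> R" "\<rho> \<le> Cm / (2 * N * c * G)"
    using Cm c G N \<open>R > 0\<close> by (auto simp: \<rho>_def)
  have \<rho>2: "N * (c * (\<rho> * G)) < Cm"
  proof -
    have "\<rho> * (2 * N * c * G) \<le> Cm" using \<rho>(4) N c G by (simp add: pos_le_divide_eq)
    then show ?thesis using Cm by (simp add: algebra_simps)
  qed
  show thesis
  proof (rule that[OF \<rho>(1)])
    fix b :: "nat \<Rightarrow> real" and D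
    assume hol: "D holomorphic_on ball 0 R" and od: "\<And>z. z \<in> ball 0 R \<Longrightarrow> D (- z) = - D z"
      and est: "\<And>z. z \<in> ball 0 R \<Longrightarrow>
        norm (D z - (\<Sum>j\<in>J. of_real (C j * b j) * z^j)) \<le> A * norm z * (\<Sum>j\<in>J. \<bar>b j\<bar> * norm z^j)"
      and dom: "\<And>j. j \<in> J \<Longrightarrow> j > 2 * i - 1 \<Longrightarrow> \<bar>b j\<bar> \<le> B * \<bar>b (2 * i - 1)\<bar>"
      and nz: "\<exists>j\<in>J. j \<le> 2 * i - 1 \<and> b j \<noteq> 0"
    define J1 where "J1 = {j\<in>J. j \<le> d}"
    define J2 where "J2 = {j\<in>J. j > d}"
    have JJ: "J = J1 \<union> J2" "J1 \<inter> J2 = {}" "finite J1" "finite J2"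
      using finJ by (auto simp: J1_def J2_def)
    have "J1 \<subseteq> {1..N}" "J2 \<subseteq> {1..N}" by (auto simp: J1_def J2_def J_def)
    then have cJ2: "card J2 \<le> N" and cJ1: "card J1 \<le> N"
      by (metis card_atLeastAtMost card_mono diff_Suc_1 finite_atLeastAtMost)+
    have leN: "j \<le> N" if "j \<in> J" for j using that by (auto simp: J_def)
    have dJ1: "d \<in> J1" using dJ by (simp add: J1_def)
    \<comment> \<open>The size of the low part after rescaling. All errors are measured by it, so
      the bound does not degenerate when the low coefficients tend to 0.\<close>
    define m where "m = (\<Sum>j\<in>J1. \<bar>b j\<bar> * \<rho>^j)"
    have m: "m > 0"
    proof -
      obtain j where j: "j \<in> J1" "b j \<noteq> 0" using nz by (auto simp: J1_def d_def)
      have "0 < \<bar>b j\<bar> * \<rho>^j" using j \<rho> by simp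
      also have "\<dots> \<le> m" unfolding m_def using j \<rho> JJ by (intro member_le_sum) auto
      finally show ?thesis .
    qed
    \<comment> \<open>A term above degree \<open>d\<close> has at least one more power of
      \<open>\<rho>\<close> than the term of degree \<open>d\<close> that dominates its
      coefficient.\<close>
    have J2b: "\<bar>b j\<bar> * \<rho>^j \<le> B * \<rho> * m" if "j \<in> J2" for j
    proof -
      have "\<bar>b j\<bar> * \<rho>^j \<le> (B * \<bar>b d\<bar>) * \<rho>^Suc d"
        using that dom \<rho> \<open>B \<ge> 0\<close> by (intro mult_mono power_decreasing) (auto simp: J2_def d_def)
      also have "\<dots> = B * \<rho> * (\<bar>b d\<bar> * \<rho>^d)" by simp
      also have "\<dots> \<le> B * \<rho> * m"
        unfolding m_def using dJ1 JJ \<rho> \<open>B \<ge> 0\<close> by (intro mult_left_mono member_le_sum) auto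
      finally show ?thesis .
    qed
    define p where "p = (\<Sum>j\<in>J1. monom (C j * b j * \<rho>^j) j)"
    have degp: "Polynomial.degree p \<le> d" unfolding p_def
      by (intro degree_sum_le JJ order_trans[OF degree_monom_le]) (auto simp: J1_def)
    have coeffp: "Polynomial.coeff p j = C j * b j * \<rho>^j" if "j \<in> J1" for j
      unfolding p_def using that JJ by (simp add: coeff_sum sum.delta)
    define P where "P = (\<lambda>s::complex. \<Sum>j\<in>J1. of_real (C j * b j * \<rho>^j) * s^j)"
    have Pp: "Re (P (of_real x)) = poly p x" for x
      by (simp add: P_def p_def poly_sum poly_monom of_real_power[symmetric] del: of_real_power)
    define Rm where "Rm = (\<lambda>s. D (of_real \<rho> * s) - P s)"
    have in_ball: "of_real \<rho> * s \<in> ball 0 R" if "s \<in> ball 0 2" for s :: complex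
    proof -
      have "\<rho> * norm s < \<rho> * 2" using that \<rho> by (intro mult_strict_left_mono) auto
      then have "\<rho> * norm s < R" using \<rho>(3) by linarith
      then show ?thesis using \<rho>(1) by (simp add: norm_mult)
    qed
    have holR: "Rm holomorphic_on ball 0 2"
    proof -
      have "(\<lambda>s. D (of_real \<rho> * s)) holomorphic_on ball 0 2"
        by (rule holomorphic_on_compose_gen[OF _ hol, unfolded o_def])
          (use in_ball in \<open>blast intro: holomorphic_intros\<close>)+
      then show ?thesis unfolding Rm_def P_def by (intro holomorphic_intros)
    qed
    have bdR: "norm (Rm s) \<le> \<rho> * G * m" if s: "s \<in> ball 0 2" for s
    proof -
      let ?z = "of_real \<rho> * s"
      have ns: "norm s \<le> 2" using s by simp
      have nz: "norm ?z^j \<le> \<rho>^j * 2^N" if "j \<in> J" for j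
      proof -
        have "norm s^j \<le> 2^j" using ns by (intro power_mono) auto
        also have "\<dots> \<le> 2^N" using leN[OF that] by (intro power_increasing) auto
        finally show ?thesis using \<rho> by (simp add: norm_mult power_mult_distrib)
      qed
      have bz: "\<bar>b j\<bar> * norm ?z^j \<le> (\<bar>b j\<bar> * \<rho>^j) * 2^N" if "j \<in> J" for j
        using mult_left_mono[OF nz[OF that], of "\<bar>b j\<bar>"] by (simp add: mult.assoc)
      have b1: "(\<Sum>j\<in>J1. \<bar>b j\<bar> * norm ?z^j) \<le> m * 2^N"
        unfolding m_def sum_distrib_right by (intro sum_mono bz) (auto simp: J1_def)
      have "(\<Sum>j\<in>J2. \<bar>b j\<bar> * norm ?z^j) \<le> (\<Sum>j\<in>J2. (B * \<rho> * m) * 2^N)"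
        using J2b by (intro sum_mono order_trans[OF bz] mult_right_mono) (auto simp: J2_def)
      also have "\<dots> \<le> N * ((B * \<rho> * m) * 2^N)"
        using cJ2 \<open>B \<ge> 0\<close> \<rho> m by (simp add: mult_right_mono)
      finally have b2: "(\<Sum>j\<in>J2. \<bar>b j\<bar> * norm ?z^j) \<le> N * ((B * \<rho> * m) * 2^N)" .
      have "(\<Sum>j\<in>J. \<bar>b j\<bar> * norm ?z^j) \<le> m * 2^N + N * ((B * \<rho> * m) * 2^N)"
        using b1 b2 JJ by (simp add: sum.union_disjoint)
      also have "\<dots> \<le> m * 2^N + N * ((B * 1 * m) * 2^N)"
        using \<rho> m \<open>B \<ge> 0\<close> by (intro add_mono mult_left_mono mult_right_mono) auto
      finally have bJ: "(\<Sum>j\<in>J. \<bar>b j\<bar> * norm ?z^j) \<le> (1 + N * B) * m * 2^N"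
        by (simp add: algebra_simps)
      have sumJ: "(\<Sum>j\<in>J. of_real (C j * b j) * ?z^j)
          = P s + (\<Sum>j\<in>J2. of_real (C j * b j) * ?z^j)"
        using JJ by (simp add: sum.union_disjoint P_def power_mult_distrib mult.assoc)
      have Rm_le: "norm (Rm s) \<le> norm (D ?z - (\<Sum>j\<in>J. of_real (C j * b j) * ?z^j))
          + norm (\<Sum>j\<in>J2. of_real (C j * b j) * ?z^j)"
        using norm_triangle_ineq[of "D ?z - (\<Sum>j\<in>J. of_real (C j * b j) * ?z^j)"
            "\<Sum>j\<in>J2. of_real (C j * b j) * ?z^j"]
        unfolding sumJ Rm_def by (simp add: algebra_simps)
      have "norm (D ?z - (\<Sum>j\<in>J. of_real (C j * b j) * ?z^j))
          \<le> A * norm ?z * ((1 + N * B) * m * 2^N)"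
        using \<open>A \<ge> 0\<close> by (intro order_trans[OF est[OF in_ball[OF s]]] mult_left_mono bJ) auto
      also have "\<dots> \<le> A * (\<rho> * 2) * ((1 + N * B) * m * 2^N)"
        using \<open>A \<ge> 0\<close> \<open>B \<ge> 0\<close> ns m \<rho> by (intro mult_right_mono mult_left_mono) (auto simp: norm_mult)
      finally have e1: "norm (D ?z - (\<Sum>j\<in>J. of_real (C j * b j) * ?z^j))
          \<le> A * (\<rho> * 2) * ((1 + N * B) * m * 2^N)" .
      have "norm (\<Sum>j\<in>J2. of_real (C j * b j) * ?z^j) \<le> (\<Sum>j\<in>J2. CM * (\<bar>b j\<bar> * norm ?z^j))"
      proof (intro sum_norm_le)
        fix j assume "j \<in> J2"
        then have "j \<in> J" by (simp add: J2_def)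
        then have "\<bar>C j\<bar> \<le> CM" using CM C by (metis abs_of_pos)
        then have "\<bar>C j\<bar> * (\<bar>b j\<bar> * norm ?z^j) \<le> CM * (\<bar>b j\<bar> * norm ?z^j)"
          by (intro mult_right_mono) auto
        then show "norm (of_real (C j * b j) * ?z^j) \<le> CM * (\<bar>b j\<bar> * norm ?z^j)"
          by (simp only: norm_mult norm_power norm_of_real abs_mult mult.assoc)
      qed
      also have "\<dots> \<le> CM * (N * ((B * \<rho> * m) * 2^N))"
        unfolding sum_distrib_left[symmetric] using CM0 b2 by (intro mult_left_mono) auto
      finally have "norm (Rm s) \<le> A * (\<rho> * 2) * ((1 + N * B) * m * 2^N) + CM * (N * ((B * \<rho> * m) * 2^N))"
        using Rm_le e1 by linarith
      also have "\<dots> = \<rho> * ((2 * A * (1 + N * B) + CM * N * B) * 2^N) * m"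
        by (simp add: algebra_simps)
      also have "\<dots> \<le> \<rho> * G * m" using \<rho> m by (intro mult_right_mono mult_left_mono) (auto simp: G_def)
      finally show ?thesis .
    qed
    define Z where "Z = {t. 0 < t \<and> t < \<rho> \<and> D (of_real t) = 0}"
    have no: False if T: "T \<subseteq> Z" "finite T" "card T = i" for T
    proof -
      define S1 where "S1 = (\<lambda>t. t / \<rho>) ` T"
      have finS1: "finite S1" and cS1: "card S1 = i"
        using T \<rho> by (auto simp: S1_def card_image inj_on_def)
      have S1: "S1 \<subseteq> {0<..<1}" "\<And>x. x \<in> S1 \<Longrightarrow> D (of_real (\<rho> * x)) = 0"
        using T \<rho> by (auto simp: S1_def Z_def)
      \<comment> \<open>The \<open>i\<close> positive zeros and their negatives; the origin is left
        out, as these \<open>2 * i = Suc d\<close> points are already too many.\<close>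
      define S where "S = S1 \<union> uminus ` S1"
      have pos: "0 < x" if "x \<in> S1" for x using S1(1) that by auto
      have "S1 \<inter> uminus ` S1 = {}"
      proof (rule equals0I)
        fix x assume "x \<in> S1 \<inter> uminus ` S1"
        then show False using pos[of x] pos[of "- x"] by auto
      qed
      then have "card S = card S1 + card (uminus ` S1)"
        unfolding S_def using finS1 by (intro card_Un_disjoint) auto
      then have cS: "card S = Suc d"
        using i cS1 by (simp add: card_image d_def)
      have zS: "D (of_real (\<rho> * x)) = 0" if x: "x \<in> S" for x
      proof (cases "x \<in> S1")
        case False
        then have "- x \<in> S1" using x by (auto simp: S_def)
        moreover have "of_real (\<rho> * (- x)) \<in> ball (0::complex) R"
        proof -
          have "- x \<in> {0<..<1}" using S1(1) \<open>- x \<in> S1\<close> by blast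
          then have "of_real \<rho> * of_real (- x) \<in> ball (0::complex) R" by (intro in_ball) simp
          then show ?thesis by (simp only: of_real_mult)
        qed
        ultimately show ?thesis using S1(2)[of "- x"] od[of "of_real (\<rho> * (- x))"] by simp
      qed (use S1 in auto)
      have SS: "S \<subseteq> {-1..1}" using S1(1) by (fastforce simp: S_def)
      have few': "\<bar>Polynomial.coeff p j\<bar> \<le> c * (\<rho> * G * m)" for j
      proof (rule few[OF holR bdR degp cS SS])
        show "poly p x + Re (Rm (of_real x)) = 0" if "x \<in> S" for x
          using zS[OF that] by (simp add: Rm_def Pp)
      qed
      have "C j * (\<bar>b j\<bar> * \<rho>^j) \<le> c * (\<rho> * G * m)" if "j \<in> J1" for j
      proof -
        have "C j * (\<bar>b j\<bar> * \<rho>^j) = \<bar>C j * b j * \<rho>^j\<bar>"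
          using C[of j] that \<rho>(1) by (simp add: abs_mult J1_def)
        then show ?thesis using few'[of j] coeffp[OF that] by (simp only:)
      qed
      then have "Cm * (\<bar>b j\<bar> * \<rho>^j) \<le> c * (\<rho> * G * m)" if "j \<in> J1" for j
      proof -
        have "Cm * (\<bar>b j\<bar> * \<rho>^j) \<le> C j * (\<bar>b j\<bar> * \<rho>^j)"
          using Cm(2)[of j] that \<rho> by (intro mult_right_mono) (auto simp: J1_def)
        with that show ?thesis using that \<open>\<And>j. j \<in> J1 \<Longrightarrow> C j * (\<bar>b j\<bar> * \<rho>^j) \<le> c * (\<rho> * G * m)\<close>[of j]
          by linarith
      qed
      \<comment> \<open>Summed over the low coefficients, the bounds compare \<open>Cm * m\<close>
        with a multiple of \<open>m\<close> whose factor is smaller than \<open>Cm\<close>.\<close>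
      then have "Cm * m \<le> (\<Sum>j\<in>J1. c * (\<rho> * G * m))"
        unfolding m_def sum_distrib_left[of Cm] by (intro sum_mono)
      also have "\<dots> = card J1 * (c * (\<rho> * G * m))" by simp
      also have "\<dots> \<le> N * (c * (\<rho> * G * m))"
        using cJ1 c \<rho> G m by (intro mult_right_mono) auto
      also have "\<dots> = N * (c * (\<rho> * G)) * m" by simp
      finally have "Cm \<le> N * (c * (\<rho> * G))" using m by (metis mult_le_cancel_right_pos)
      then show False using \<rho>2 by linarith
    qed
    have "finite Z \<and> card Z \<le> i - 1"
    proof (rule ccontr)
      assume "\<not> (finite Z \<and> card Z \<le> i - 1)"
      then have "infinite Z \<or> card Z \<ge> i" using i by auto
      then obtain T where "T \<subseteq> Z" "finite T" "card T = i"
        by (metis infinite_arbitrarily_large obtain_subset_with_card_n)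
      then show False by (rule no)
    qed
    then show "finite {t. 0 < t \<and> t < \<rho> \<and> D (of_real t) = 0} \<and>
        card {t. 0 < t \<and> t < \<rho> \<and> D (of_real t) = 0} \<le> i - 1"
      by (simp add: Z_def)
  qed
qed

text \<open>The lower coefficients are tuned so that after the rescaling \<open>\<tau> = \<epsilon> s\<close> the dominant part
  becomes a multiple of \<open>s \<Prod>(s\<^sup>2 - k\<^sup>2)\<close>, which changes sign at \<open>1, \<dots>, i - 1\<close>.\<close>

lemma odd_expansion_zeros_lower:
  fixes C :: "nat \<Rightarrow> real" and N i :: nat and R A K :: real and D :: "(nat \<Rightarrow> real) \<Rightarrow> complex \<Rightarrow> complex"
  defines "J \<equiv> {j\<in>{1..N}. odd j}"
  assumes C: "\<And>j. j \<in> J \<Longrightarrow> C j > 0" and "R > 0" and "A \<ge> 0"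
    and i: "1 \<le> i" "2 * i - 1 \<le> N"
    and cont: "\<And>b. (\<forall>j\<in>{1..N}. \<bar>b j\<bar> \<le> K) \<Longrightarrow> continuous_on (ball 0 R) (D b)"
    and real: "\<And>b t. (\<forall>j\<in>{1..N}. \<bar>b j\<bar> \<le> K) \<Longrightarrow> \<bar>t\<bar> < R \<Longrightarrow> D b (of_real t) \<in> \<real>"
    and est: "\<And>b z. (\<forall>j\<in>{1..N}. \<bar>b j\<bar> \<le> K) \<Longrightarrow> z \<in> ball 0 R \<Longrightarrow>
        norm (D b z - (\<Sum>j\<in>J. of_real (C j * b j) * z^j)) \<le> A * norm z * (\<Sum>j\<in>J. \<bar>b j\<bar> * norm z^j)"
    and b: "\<And>j. j \<in> {1..N} \<Longrightarrow> \<bar>b j\<bar> < K" "\<And>j. odd j \<Longrightarrow> j < 2 * i - 1 \<Longrightarrow> b j = 0" "b (2 * i - 1) \<noteq> 0"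
    and "\<delta> > 0" and "\<rho> > 0"
  obtains b' Z where "\<And>j. \<bar>b' j - b j\<bar> < \<delta>" and "\<And>j. j \<in> {1..N} \<Longrightarrow> \<bar>b' j\<bar> \<le> K" and "b' (2 * i - 1) = b (2 * i - 1)"
    and "Z \<subseteq> {t. 0 < t \<and> t < \<rho> \<and> D b' (of_real t) = 0}" and "finite Z" and "card Z = i - 1"
proof -
  define d where "d = 2 * i - 1"
  have dJ: "d \<in> J" using i by (auto simp: J_def d_def)
  have finJ: "finite J" by (simp add: J_def)
  \<comment> \<open>The polynomial \<open>s * poly q (s^2)\<close> is odd, of degree
    \<open>d\<close>, with simple zeros at \<open>1, ..., i - 1\<close> on the positive axis. As
    \<open>q\<close> is monic, the coefficient of index \<open>d\<close> can be left
    unchanged.\<close>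
  define q :: "real poly" where "q = (\<Prod>k\<in>{1..<i}. [:- (real k ^ 2), 1:])"
  have degq: "Polynomial.degree q = i - 1"
    unfolding q_def by (subst degree_prod_eq_sum_degree) auto
  have leadq: "Polynomial.coeff q (i - 1) = 1"
    using lead_coeff_prod[of "\<lambda>k. [:- (real k ^ 2), 1:]" "{1..<i}"] degq by (simp add: q_def)
  have polyq: "poly q x = (\<Prod>k\<in>{1..<i}. x - real k ^ 2)" for x
    by (simp add: q_def poly_prod)
  \<comment> \<open>Makes \<open>C j * \<beta> j\<close> the coefficient of \<open>s ^ j\<close> in
    the target \<open>V\<close>; the odd index \<open>j\<close> belongs to the coefficient
    \<open>(j - 1) div 2\<close> of \<open>q\<close>.\<close>
  define \<beta> where "\<beta> = (\<lambda>j. C d * b d * Polynomial.coeff q ((j - 1) div 2) / C j)"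
  \<comment> \<open>The powers of \<open>\<epsilon>\<close> give all low terms the common size
    \<open>\<epsilon> ^ d\<close> at \<open>\<tau> = \<epsilon> * s\<close>, and they let the
    perturbed coefficients tend to \<open>b\<close>.\<close>
  define B where "B = (\<lambda>\<epsilon> j. if odd j \<and> j < d then \<beta> j * \<epsilon>^(d - j) else b j)"
  define V where "V = (\<lambda>s. C d * b d * s * poly q (s^2))"
  \<comment> \<open>Of the factors \<open>s ^ 2 - l ^ 2\<close> only the one with
    \<open>l = k\<close> changes sign between the half-integers next to \<open>k\<close>.\<close>
  have alt: "V (real k - 1/2) * V (real k + 1/2) < 0" if k: "k \<in> {1..<i}" for k
  proof -
    define f where "f = (\<lambda>l. ((real k - 1/2)^2 - real l ^ 2) * ((real k + 1/2)^2 - real l ^ 2))"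
    have fl: "f l > 0" if "l \<noteq> k" for l
    proof -
      have f_eq: "f l = ((real k - 1/2 - l) * (real k + 1/2 - l)) * ((real k - 1/2 + l) * (real k + 1/2 + l))"
        by (simp only: f_def power2_eq_square square_diff_square_factored mult_ac)
      have 2: "(real k - 1/2 + l) * (real k + 1/2 + l) > 0" using k by (intro mult_pos_pos) auto
      have 1: "(real k - 1/2 - l) * (real k + 1/2 - l) > 0"
      proof (cases "l < k")
        case True
        then have "real l + 1 \<le> real k" by linarith
        then show ?thesis by (intro mult_pos_pos) auto
      next
        case False
        then have "real k + 1 \<le> real l" using that by linarith
        then show ?thesis by (intro mult_neg_neg) auto
      qed
      show ?thesis unfolding f_eq by (rule mult_pos_pos[OF 1 2])
    qed
    have fk: "f k < 0"
    proof -
      have "f k = - ((real k - 1/4) * (real k + 1/4))"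
        by (simp add: f_def power2_eq_square algebra_simps)
      moreover have "(real k - 1/4) * (real k + 1/4) > 0" using k by (intro mult_pos_pos) auto
      ultimately show ?thesis by linarith
    qed
    have "poly q ((real k - 1/2)^2) * poly q ((real k + 1/2)^2) = (\<Prod>l\<in>{1..<i}. f l)"
      by (simp add: polyq f_def prod.distrib)
    also have "\<dots> = f k * (\<Prod>l\<in>{1..<i} - {k}. f l)" using k by (simp add: prod.remove)
    also have "\<dots> < 0" using fk fl by (intro mult_neg_pos prod_pos) auto
    finally have neg: "poly q ((real k - 1/2)^2) * poly q ((real k + 1/2)^2) < 0" .
    have "V (real k - 1/2) * V (real k + 1/2)
      = ((C d * b d)^2 * ((real k - 1/2) * (real k + 1/2))) * (poly q ((real k - 1/2)^2) * poly q ((real k + 1/2)^2))"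
      by (simp add: V_def power2_eq_square)
    also have "\<dots> < 0"
      using k b(3) C[OF dJ] by (intro mult_pos_neg[OF _ neg] mult_pos_pos) (auto simp: d_def zero_less_power2)
    finally show ?thesis .
  qed
  have B_lim: "((\<lambda>\<epsilon>. B \<epsilon> j) \<longlongrightarrow> b j) (at_right 0)" for j
  proof (cases "odd j \<and> j < d")
    case True
    have "((\<lambda>\<epsilon>. \<beta> j * \<epsilon>^(d - j)) \<longlongrightarrow> \<beta> j * 0^(d - j)) (at_right 0)"
      by (intro tendsto_intros)
    moreover have "\<beta> j * 0^(d - j) = b j" using True b(2)[of j] by (auto simp: power_0_left d_def)
    ultimately show ?thesis using True by (simp add: B_def)
  qed (auto simp: B_def)
  have ev_b: "eventually (\<lambda>\<epsilon>. \<forall>j\<in>{..N}. \<bar>B \<epsilon> j - b j\<bar> < \<delta>) (at_right 0)"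
  proof (intro eventually_ball_finite ballI)
    fix j
    show "eventually (\<lambda>\<epsilon>. \<bar>B \<epsilon> j - b j\<bar> < \<delta>) (at_right 0)"
      using tendstoD[OF B_lim[of j] \<open>\<delta> > 0\<close>] by (simp add: dist_real_def)
  qed simp
  have ev_K: "eventually (\<lambda>\<epsilon>. \<forall>j\<in>{1..N}. \<bar>B \<epsilon> j\<bar> < K) (at_right 0)"
  proof (intro eventually_ball_finite ballI)
    fix j assume "j \<in> {1..N}"
    then show "eventually (\<lambda>\<epsilon>. \<bar>B \<epsilon> j\<bar> < K) (at_right 0)"
      by (intro order_tendstoD(2)[OF tendsto_rabs[OF B_lim]] b)
  qed simp
  have ev_pos: "eventually (\<lambda>\<epsilon>::real. \<epsilon> > 0) (at_right 0)" by (simp add: eventually_at_right_less)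
  \<comment> \<open>The coefficients after division by \<open>\<epsilon> ^ d\<close>; those above
    \<open>d\<close> still carry a power of \<open>\<epsilon>\<close> and drop out in the
    limit.\<close>
  define c where "c = (\<lambda>\<epsilon> j. if j \<le> d then \<beta> j else b j * \<epsilon>^(j - d))"
  have \<beta>d: "\<beta> d = b d"
  proof -
    have "(d - 1) div 2 = i - 1" using i by (simp add: d_def)
    then show ?thesis using C[OF dJ] leadq by (simp add: \<beta>_def)
  qed
  have Bc: "B \<epsilon> j * \<epsilon>^j = \<epsilon>^d * c \<epsilon> j" if "odd j" for \<epsilon> j
  proof -
    consider "j < d" | "j = d" | "j > d" by linarith
    then show ?thesis
    proof cases
      case 1
      then have "\<epsilon>^(d - j) * \<epsilon>^j = \<epsilon>^d" by (metis le_add_diff_inverse2 less_imp_le power_add)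
      then show ?thesis using that 1 by (simp add: B_def c_def mult.assoc)
    next
      case 3
      then have "\<epsilon>^(j - d) * \<epsilon>^d = \<epsilon>^j" by (metis le_add_diff_inverse2 less_imp_le power_add)
      then show ?thesis using 3 by (simp add: B_def c_def mult_ac)
    qed (simp add: B_def c_def \<beta>d)
  qed
  have V_eq: "(\<Sum>j\<in>J. if j \<le> d then C j * \<beta> j * s^j else 0) = V s" for s
  proof -
    have "(\<Sum>j\<in>J. if j \<le> d then C j * \<beta> j * s^j else 0) = (\<Sum>j\<in>{j\<in>J. j \<le> d}. C j * \<beta> j * s^j)"
      using finJ by (simp add: sum.inter_filter)
    also have "\<dots> = (\<Sum>m<i. C d * b d * Polynomial.coeff q m * s^(2 * m + 1))"
    proof (rule sum.reindex_bij_witness[of _ "\<lambda>m. 2 * m + 1" "\<lambda>j. (j - 1) div 2"])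
      fix j assume j: "j \<in> {j \<in> J. j \<le> d}"
      then obtain m where m: "j = 2 * m + 1" by (auto simp: J_def elim: oddE)
      show "2 * ((j - 1) div 2) + 1 = j" using m by simp
      show "(j - 1) div 2 \<in> {..<i}" using j m i by (auto simp: d_def)
      show "C d * b d * Polynomial.coeff q ((j - 1) div 2) * s^(2 * ((j - 1) div 2) + 1) = C j * \<beta> j * s^j"
        using C[of j] j m by (simp add: \<beta>_def)
    qed (use i in \<open>auto simp: J_def d_def\<close>)
    also have "\<dots> = C d * b d * s * (\<Sum>m\<le>i - 1. Polynomial.coeff q m * (s^2)^m)"
    proof -
      have "{..<i} = {..i - 1}" using i by auto
      moreover have "s^(2 * m + 1) = s * (s^2)^m" for m unfolding power_add power_mult by simp
      ultimately show ?thesis by (simp only: sum_distrib_left mult_ac)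
    qed
    also have "(\<Sum>m\<le>i - 1. Polynomial.coeff q m * (s^2)^m) = poly q (s^2)"
      by (simp only: poly_altdef degq)
    finally show ?thesis by (simp only: V_def)
  qed
  \<comment> \<open>The error scales like the main part, so after division by
    \<open>\<epsilon> ^ d\<close> its extra factor \<open>\<epsilon> * \<bar>s\<bar>\<close> makes
    it vanish in the limit.\<close>
  have lim: "((\<lambda>\<epsilon>. Re (D (B \<epsilon>) (of_real (\<epsilon> * s))) / \<epsilon>^d) \<longlongrightarrow> V s) (at_right 0)" for s
  proof -
    have c_lim: "((\<lambda>\<epsilon>. c \<epsilon> j) \<longlongrightarrow> (if j \<le> d then \<beta> j else 0)) (at_right 0)" for j
    proof (cases "j \<le> d")
      case False
      have "((\<lambda>\<epsilon>. b j * \<epsilon>^(j - d)) \<longlongrightarrow> b j * 0^(j - d)) (at_right 0)" by (intro tendsto_intros)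
      moreover have "b j * 0^(j - d) = 0" using False by (simp add: power_0_left)
      ultimately show ?thesis using False by (simp add: c_def)
    qed (simp add: c_def)
    have main: "((\<lambda>\<epsilon>. \<Sum>j\<in>J. C j * c \<epsilon> j * s^j) \<longlongrightarrow> V s) (at_right 0)"
    proof -
      have "((\<lambda>\<epsilon>. \<Sum>j\<in>J. C j * c \<epsilon> j * s^j) \<longlongrightarrow> (\<Sum>j\<in>J. C j * (if j \<le> d then \<beta> j else 0) * s^j)) (at_right 0)"
        by (intro tendsto_intros c_lim)
      also have "(\<Sum>j\<in>J. C j * (if j \<le> d then \<beta> j else 0) * s^j) = V s"
        unfolding V_eq[symmetric] by (intro sum.cong) auto
      finally show ?thesis .
    qed
    have err: "((\<lambda>\<epsilon>. A * (\<epsilon> * \<bar>s\<bar>) * (\<Sum>j\<in>J. \<bar>c \<epsilon> j\<bar> * \<bar>s\<bar>^j)) \<longlongrightarrow>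
        A * (0 * \<bar>s\<bar>) * (\<Sum>j\<in>J. \<bar>if j \<le> d then \<beta> j else 0\<bar> * \<bar>s\<bar>^j)) (at_right 0)"
      by (intro tendsto_intros c_lim)
    have "eventually (\<lambda>\<epsilon>. \<epsilon> * \<bar>s\<bar> < R) (at_right 0)"
      by (rule order_tendstoD(2)[of _ "0 * \<bar>s\<bar>"]) (intro tendsto_intros, use \<open>R > 0\<close> in simp)
    then have "eventually (\<lambda>\<epsilon>. norm (Re (D (B \<epsilon>) (of_real (\<epsilon> * s))) / \<epsilon>^d - (\<Sum>j\<in>J. C j * c \<epsilon> j * s^j))
        \<le> A * (\<epsilon> * \<bar>s\<bar>) * (\<Sum>j\<in>J. \<bar>c \<epsilon> j\<bar> * \<bar>s\<bar>^j)) (at_right 0)"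
      using ev_K ev_pos
    proof eventually_elim
      case (elim \<epsilon>)
      let ?z = "of_real (\<epsilon> * s) :: complex"
      have z: "?z \<in> ball 0 R" "norm ?z = \<epsilon> * \<bar>s\<bar>" using elim by (auto simp: norm_mult abs_mult)
      have BK: "\<forall>j\<in>{1..N}. \<bar>B \<epsilon> j\<bar> \<le> K" using elim by (auto intro: less_imp_le)
      have oddJ: "odd j" if "j \<in> J" for j using that by (simp add: J_def)
      have s1: "(\<Sum>j\<in>J. of_real (C j * B \<epsilon> j) * ?z^j) = of_real (\<epsilon>^d * (\<Sum>j\<in>J. C j * c \<epsilon> j * s^j))"
      proof -
        have "C j * B \<epsilon> j * (\<epsilon> * s)^j = \<epsilon>^d * (C j * c \<epsilon> j * s^j)" if "j \<in> J" for j
        proof -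
          have "C j * B \<epsilon> j * (\<epsilon> * s)^j = C j * (B \<epsilon> j * \<epsilon>^j) * s^j" by (simp add: power_mult_distrib)
          also have "\<dots> = \<epsilon>^d * (C j * c \<epsilon> j * s^j)" unfolding Bc[OF oddJ[OF that]] by simp
          finally show ?thesis .
        qed
        then have "(\<Sum>j\<in>J. C j * B \<epsilon> j * (\<epsilon> * s)^j) = \<epsilon>^d * (\<Sum>j\<in>J. C j * c \<epsilon> j * s^j)"
          unfolding sum_distrib_left by (intro sum.cong) auto
        moreover have "(\<Sum>j\<in>J. of_real (C j * B \<epsilon> j) * ?z^j) = of_real (\<Sum>j\<in>J. C j * B \<epsilon> j * (\<epsilon> * s)^j)"
          by (simp only: of_real_sum of_real_mult of_real_power)
        ultimately show ?thesis by (simp only:)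
      qed
      have s2: "(\<Sum>j\<in>J. \<bar>B \<epsilon> j\<bar> * norm ?z^j) = \<epsilon>^d * (\<Sum>j\<in>J. \<bar>c \<epsilon> j\<bar> * \<bar>s\<bar>^j)"
      proof -
        have "\<bar>B \<epsilon> j\<bar> * (\<epsilon> * \<bar>s\<bar>)^j = \<epsilon>^d * (\<bar>c \<epsilon> j\<bar> * \<bar>s\<bar>^j)" if "j \<in> J" for j
        proof -
          have "\<bar>B \<epsilon> j\<bar> * (\<epsilon> * \<bar>s\<bar>)^j = \<bar>B \<epsilon> j * \<epsilon>^j\<bar> * \<bar>s\<bar>^j"
            using elim by (simp add: power_mult_distrib abs_mult)
          also have "\<dots> = \<epsilon>^d * (\<bar>c \<epsilon> j\<bar> * \<bar>s\<bar>^j)"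
            unfolding Bc[OF oddJ[OF that]] using elim by (simp add: abs_mult)
          finally show ?thesis .
        qed
        then show ?thesis unfolding z(2) sum_distrib_left by (intro sum.cong) auto
      qed
      have "norm (D (B \<epsilon>) ?z - of_real (\<epsilon>^d * (\<Sum>j\<in>J. C j * c \<epsilon> j * s^j)))
          \<le> A * (\<epsilon> * \<bar>s\<bar>) * (\<epsilon>^d * (\<Sum>j\<in>J. \<bar>c \<epsilon> j\<bar> * \<bar>s\<bar>^j))"
        using est[OF BK z(1)] unfolding s1 s2 unfolding z(2) .
      then have le: "\<bar>Re (D (B \<epsilon>) ?z) - \<epsilon>^d * (\<Sum>j\<in>J. C j * c \<epsilon> j * s^j)\<bar>
          \<le> A * (\<epsilon> * \<bar>s\<bar>) * (\<Sum>j\<in>J. \<bar>c \<epsilon> j\<bar> * \<bar>s\<bar>^j) * \<epsilon>^d"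
        using abs_Re_le_cmod[of "D (B \<epsilon>) ?z - of_real (\<epsilon>^d * (\<Sum>j\<in>J. C j * c \<epsilon> j * s^j))"]
        by (simp only: minus_complex.sel Re_complex_of_real mult_ac)
      have e: "\<epsilon>^d > 0" using elim by simp
      have "Re (D (B \<epsilon>) ?z) / \<epsilon>^d - (\<Sum>j\<in>J. C j * c \<epsilon> j * s^j)
          = (Re (D (B \<epsilon>) ?z) - \<epsilon>^d * (\<Sum>j\<in>J. C j * c \<epsilon> j * s^j)) / \<epsilon>^d"
      proof -
        have "\<epsilon>^d * (\<Sum>j\<in>J. C j * c \<epsilon> j * s^j) / \<epsilon>^d = (\<Sum>j\<in>J. C j * c \<epsilon> j * s^j)"
          by (rule nonzero_mult_div_cancel_left) (use e in linarith)
        then show ?thesis by (simp only: diff_divide_distrib)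
      qed
      then have "norm (Re (D (B \<epsilon>) ?z) / \<epsilon>^d - (\<Sum>j\<in>J. C j * c \<epsilon> j * s^j))
          = \<bar>Re (D (B \<epsilon>) ?z) - \<epsilon>^d * (\<Sum>j\<in>J. C j * c \<epsilon> j * s^j)\<bar> / \<epsilon>^d"
        using e by (simp only: real_norm_def abs_divide abs_of_pos)
      then show ?case using le pos_divide_le_eq[OF e] by presburger
    qed
    moreover have "((\<lambda>\<epsilon>. A * (\<epsilon> * \<bar>s\<bar>) * (\<Sum>j\<in>J. \<bar>c \<epsilon> j\<bar> * \<bar>s\<bar>^j)) \<longlongrightarrow> 0) (at_right 0)"
      using err by (simp only: mult_zero_left mult_zero_right)
    ultimately have "((\<lambda>\<epsilon>. Re (D (B \<epsilon>) (of_real (\<epsilon> * s))) / \<epsilon>^d - (\<Sum>j\<in>J. C j * c \<epsilon> j * s^j)) \<longlongrightarrow> 0) (at_right 0)"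
      by (rule Lim_null_comparison)
    from tendsto_add[OF this main] show ?thesis
      by (simp only: diff_add_cancel add_0)
  qed
  have ev_sign: "eventually (\<lambda>\<epsilon>. \<forall>k\<in>{1..<i}. Re (D (B \<epsilon>) (of_real (\<epsilon> * (real k - 1/2)))) / \<epsilon>^d *
      (Re (D (B \<epsilon>) (of_real (\<epsilon> * (real k + 1/2)))) / \<epsilon>^d) < 0) (at_right 0)"
    by (intro eventually_ball_finite ballI order_tendstoD(2)[OF tendsto_mult[OF lim lim] alt]) auto
  have ev_r: "eventually (\<lambda>\<epsilon>. \<epsilon> * real i < min \<rho> R) (at_right 0)"
    by (rule order_tendstoD(2)[of _ "0 * real i"]) (intro tendsto_intros, use \<open>R > 0\<close> \<open>\<rho> > 0\<close> in simp)
  obtain \<epsilon> where \<epsilon>: "\<epsilon> > 0" "\<forall>j\<in>{..N}. \<bar>B \<epsilon> j - b j\<bar> < \<delta>" "\<forall>j\<in>{1..N}. \<bar>B \<epsilon> j\<bar> < K"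
    "\<forall>k\<in>{1..<i}. Re (D (B \<epsilon>) (of_real (\<epsilon> * (real k - 1/2)))) / \<epsilon>^d *
      (Re (D (B \<epsilon>) (of_real (\<epsilon> * (real k + 1/2)))) / \<epsilon>^d) < 0" "\<epsilon> * real i < min \<rho> R"
    using eventually_happens'[OF _ eventually_conj[OF ev_pos eventually_conj[OF ev_b eventually_conj[OF ev_K
          eventually_conj[OF ev_sign ev_r]]]]] trivial_limit_at_right_real by blast
  define b' where "b' = B \<epsilon>"
  have b'K: "\<forall>j\<in>{1..N}. \<bar>b' j\<bar> \<le> K" using \<epsilon>(3) by (auto simp: b'_def intro: less_imp_le)
  define h where "h = (\<lambda>t. Re (D b' (of_real t)))"
  have conth: "continuous_on {-R<..<R} h"
    unfolding h_def
    by (intro continuous_intros continuous_on_compose2[OF cont[OF b'K]]) auto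
  have small: "\<epsilon> * (real k + 1/2) < min \<rho> R" if "k \<in> {1..<i}" for k
  proof -
    have "real k + 1 \<le> real i" using that by simp
    then have "\<epsilon> * (real k + 1/2) \<le> \<epsilon> * real i" using \<epsilon>(1) by (intro mult_left_mono) auto
    then show ?thesis using \<epsilon>(5) by linarith
  qed
  have "\<exists>t. \<epsilon> * (real k - 1/2) < t \<and> t < \<epsilon> * (real k + 1/2) \<and> D b' (of_real t) = 0" if k: "k \<in> {1..<i}" for k
  proof -
    let ?u = "\<epsilon> * (real k - 1/2)" and ?v = "\<epsilon> * (real k + 1/2)"
    have uv: "0 < ?u" "?u < ?v" "?v < R" using \<epsilon>(1) k small[OF k] by (auto intro!: mult_strict_left_mono)
    have sgn: "h ?u * h ?v < 0"
    proof -
      have "h ?u / \<epsilon>^d * (h ?v / \<epsilon>^d) < 0" using \<epsilon>(4) k by (auto simp: h_def b'_def)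
      then show ?thesis using \<epsilon>(1) by (simp add: divide_less_0_iff zero_less_mult_iff)
    qed
    have c2: "continuous_on {?u..?v} h" by (rule continuous_on_subset[OF conth]) (use uv in auto)
    obtain t where t: "t \<in> {?u..?v}" "h t = 0"
    proof (cases "h ?u < 0")
      case True
      then have "h ?v > 0" using sgn by (simp add: mult_less_0_iff)
      then show thesis using IVT'[of h ?u 0 ?v] True uv c2 that by auto
    next
      case False
      then have "h ?u > 0" "h ?v < 0" using sgn by (auto simp: mult_less_0_iff)
      then show thesis using IVT2'[of h ?v 0 ?u] uv c2 that by auto
    qed
    have "t \<noteq> ?u" "t \<noteq> ?v" using t sgn by auto
    then have "?u < t" "t < ?v" using t by auto
    moreover have "D b' (of_real t) = 0"
    proof -
      have "D b' (of_real t) \<in> \<real>" using uv t by (intro real b'K) auto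
      then show ?thesis using t(2) by (auto simp: h_def Reals_def)
    qed
    ultimately show ?thesis by blast
  qed
  then obtain T where T: "\<And>k. k \<in> {1..<i} \<Longrightarrow>
      \<epsilon> * (real k - 1/2) < T k \<and> T k < \<epsilon> * (real k + 1/2) \<and> D b' (of_real (T k)) = 0" by metis
  have inj: "inj_on T {1..<i}"
  proof (rule linorder_inj_onI)
    fix k l assume kl: "k < l" "k \<in> {1..<i}" "l \<in> {1..<i}"
    have "real k + 1 \<le> real l" using kl by simp
    then have "\<epsilon> * (real k + 1/2) \<le> \<epsilon> * (real l - 1/2)" using \<epsilon>(1) by (intro mult_left_mono) auto
    then show "T k \<noteq> T l" using T[of k] T[of l] kl by auto
  qed auto
  show thesis
  proof (rule that[of b' "T ` {1..<i}"])
    show "\<bar>b' j - b j\<bar> < \<delta>" for j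
    proof (cases "j \<le> N")
      case False
      then have "b' j = b j" using i by (simp add: b'_def B_def d_def)
      then show ?thesis using \<open>\<delta> > 0\<close> by simp
    qed (use \<epsilon>(2) in \<open>auto simp: b'_def\<close>)
    show "\<bar>b' j\<bar> \<le> K" if "j \<in> {1..N}" for j using b'K that by blast
    show "b' (2 * i - 1) = b (2 * i - 1)" by (simp add: b'_def B_def d_def)
    show "T ` {1..<i} \<subseteq> {t. 0 < t \<and> t < \<rho> \<and> D b' (complex_of_real t) = 0}"
    proof (intro subsetI CollectI)
      fix t assume "t \<in> T ` {1..<i}"
      then obtain k where k: "k \<in> {1..<i}" "t = T k" by blast
      have "\<epsilon> * (real k - 1/2) > 0" using k \<epsilon>(1) by (intro mult_pos_pos) auto
      then show "0 < t \<and> t < \<rho> \<and> D b' (complex_of_real t) = 0"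
        using T[OF k(1)] small[OF k(1)] k(2) by auto
    qed
    show "finite (T ` {1..<i})" by simp
    show "card (T ` {1..<i}) = i - 1" using card_image[OF inj] by simp
  qed
qed

section \<open>The scalar equation along the angle\<close>

lemma unit_interval_scale:
  fixes u t :: real
  assumes "u \<in> {-1..1}" "t \<in> {0..1}" shows "u * t \<in> {-1..1}"
proof -
  have "\<bar>u * t\<bar> \<le> 1 * 1" unfolding abs_mult using assms by (intro mult_mono) auto
  then show ?thesis by auto
qed

text \<open>The integral from 0 to \<open>\<xi>\<close> is written over the fixed interval
  \<open>{0..1}\<close>. This covers both signs of \<open>\<xi>\<close> in one formula and lets the
  theorems on integrals with parameters apply.\<close>

lemma radial_integral_continuous:
  fixes \<Phi> :: "complex \<Rightarrow> real \<Rightarrow> complex"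
  assumes "continuous_on (B \<times> {-1..1}) (\<lambda>(x, u). \<Phi> x u)"
  shows "continuous_on (B \<times> {-1..1}) (\<lambda>(x, \<xi>). of_real \<xi> * integral {0..1} (\<lambda>t. \<Phi> x (\<xi> * t)))"
proof -
  have ab: "\<xi> * t \<in> {-1..1}" if "\<xi> \<in> {-1..1}" "t \<in> {0..1}" for \<xi> t :: real
    by (rule unit_interval_scale[OF that])
  have "continuous_on ((B \<times> {-1..1}) \<times> cbox 0 (1::real)) (\<lambda>(x, t). \<Phi> (fst x) (snd x * t))"
    unfolding split_beta
    by (rule continuous_on_compose2[OF assms, of _ "\<lambda>z. (fst (fst z), snd (fst z) * snd z)",
          unfolded split_beta fst_conv snd_conv])
      (auto intro!: continuous_intros ab)
  from integral_continuous_on_param[OF this]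
  have "continuous_on (B \<times> {-1..1}) (\<lambda>x. integral {0..1} (\<lambda>t. \<Phi> (fst x) (snd x * t)))" by simp
  then show ?thesis unfolding split_beta by (intro continuous_intros)
qed

lemma radial_integral_derivative:
  fixes \<Phi> g :: "complex \<Rightarrow> real \<Rightarrow> complex"
  assumes B: "convex B" "x \<in> B" and \<xi>: "\<xi> \<in> {-1..1}"
    and cont: "continuous_on (B \<times> {-1..1}) (\<lambda>(x, u). \<Phi> x u)"
    and contg: "continuous_on (B \<times> {-1..1}) (\<lambda>(x, u). g x u)"
    and der: "\<And>x u. x \<in> B \<Longrightarrow> u \<in> {-1..1} \<Longrightarrow> ((\<lambda>x. \<Phi> x u) has_field_derivative g x u) (at x within B)"
  shows "((\<lambda>x. of_real \<xi> * integral {0..1} (\<lambda>t. \<Phi> x (\<xi> * t))) has_field_derivative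
      of_real \<xi> * integral {0..1} (\<lambda>t. g x (\<xi> * t))) (at x within B)"
proof -
  have ab: "\<xi> * t \<in> {-1..1}" if "t \<in> {0..1}" for t :: real
    by (rule unit_interval_scale[OF \<xi> that])
  have "((\<lambda>x. integral (cbox 0 1) (\<lambda>t. \<Phi> x (\<xi> * t))) has_field_derivative
      integral (cbox 0 1) (\<lambda>t. g x (\<xi> * t))) (at x within B)"
  proof (rule leibniz_rule_field_derivative[OF _ _ _ B(2,1)])
    show "((\<lambda>x. \<Phi> x (\<xi> * t)) has_field_derivative g x (\<xi> * t)) (at x within B)"
      if "x \<in> B" "t \<in> cbox 0 1" for x t
      using der[OF that(1) ab[of t]] that(2) by simp
    show "(\<lambda>t. \<Phi> x (\<xi> * t)) integrable_on cbox 0 1" if "x \<in> B" for x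
    proof (intro integrable_continuous)
      show "continuous_on (cbox 0 1) (\<lambda>t. \<Phi> x (\<xi> * t))"
        by (rule continuous_on_compose2[OF cont, of _ "\<lambda>t. (x, \<xi> * t)", unfolded split_beta fst_conv snd_conv])
          (use that ab in \<open>auto intro!: continuous_intros\<close>)
    qed
    show "continuous_on (B \<times> cbox 0 1) (\<lambda>(x, t). g x (\<xi> * t))"
      unfolding split_beta
      by (rule continuous_on_compose2[OF contg, of _ "\<lambda>z. (fst z, \<xi> * snd z)", unfolded split_beta fst_conv snd_conv])
        (use ab in \<open>auto intro!: continuous_intros\<close>)
  qed
  then show ?thesis by (auto intro!: derivative_eq_intros)
qed

lemma radial_integral_bound:
  fixes h :: "real \<Rightarrow> complex"
  assumes "continuous_on {-1..1} h" and \<xi>: "\<xi> \<in> {-1..1}" and "\<And>u. u \<in> {-1..1} \<Longrightarrow> norm (h u) \<le> c"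
  shows "norm (of_real \<xi> * integral {0..1} (\<lambda>t. h (\<xi> * t))) \<le> c"
proof -
  have ab: "\<xi> * t \<in> {-1..1}" if "t \<in> {0..1}" for t :: real
    by (rule unit_interval_scale[OF \<xi> that])
  have c0: "c \<ge> 0" using assms(3)[of 0] norm_ge_zero[of "h 0"] by (simp del: norm_ge_zero)
  have "norm (integral {0..1} (\<lambda>t. h (\<xi> * t))) \<le> c * (1 - 0)"
  proof (rule integral_bound)
    show "continuous_on {0..1} (\<lambda>t. h (\<xi> * t))"
      by (rule continuous_on_compose2[OF assms(1)]) (use ab in \<open>auto intro!: continuous_intros\<close>)
  qed (use ab assms in auto)
  then have "\<bar>\<xi>\<bar> * norm (integral {0..1} (\<lambda>t. h (\<xi> * t))) \<le> 1 * c"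
    using \<xi> c0 by (intro mult_mono) auto
  then show ?thesis by (simp add: norm_mult)
qed

text \<open>The radial form equals \<open>G \<xi> - G 0\<close> for an antiderivative
  \<open>G\<close> of \<open>h\<close>.\<close>

lemma radial_integral_ode:
  fixes f h :: "real \<Rightarrow> complex"
  assumes "continuous_on {-1..1} h" and \<xi>: "\<xi> \<in> {-1..1}"
    and "\<And>\<xi>. \<xi> \<in> {-1..1} \<Longrightarrow> f \<xi> = of_real \<xi> * integral {0..1} (\<lambda>t. h (\<xi> * t))"
  shows "(f has_vector_derivative h \<xi>) (at \<xi> within {-1..1})"
proof -
  obtain G where G: "\<And>u. u \<in> {-1..1} \<Longrightarrow> (G has_vector_derivative h u) (at u within {-1..1})"
    using antiderivative_continuous[OF assms(1)] by blast
  have eq: "f x = G x - G 0" if x: "x \<in> {-1..1}" for x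
  proof -
    have ab: "x * t \<in> {-1..1}" if "t \<in> {0..1}" for t :: real
      by (rule unit_interval_scale[OF x that])
    have "((\<lambda>t. x *\<^sub>R h (x * t)) has_integral (G (x * 1) - G (x * 0))) {0..1}"
    proof (rule fundamental_theorem_of_calculus)
      fix t :: real assume t: "t \<in> {0..1}"
      have "((*) x has_vector_derivative x) (at t within {0..1})"
        by (auto intro!: derivative_eq_intros)
      moreover have "(G has_vector_derivative h (x * t)) (at (x * t) within (*) x ` {0..1})"
        by (rule has_vector_derivative_within_subset[OF G]) (use ab t in auto)
      ultimately show "((\<lambda>t. G (x * t)) has_vector_derivative x *\<^sub>R h (x * t)) (at t within {0..1})"
        using vector_diff_chain_within[of "(*) x" x t "{0..1}" G] by (simp add: o_def)
    qed simp
    then have "integral {0..1} (\<lambda>t. x *\<^sub>R h (x * t)) = G (x * 1) - G (x * 0)" by (rule integral_unique)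
    then show ?thesis using assms(3)[OF x] by (simp add: scaleR_conv_of_real)
  qed
  have "((\<lambda>x. G x - G 0) has_vector_derivative h \<xi>) (at \<xi> within {-1..1})"
    using has_vector_derivative_diff[OF G[OF \<xi>] has_vector_derivative_const] by simp
  from has_vector_derivative_transform[OF \<xi> eq this] show ?thesis .
qed

lemma exp_nat_mult_lipschitz:
  fixes v v' :: complex and j N :: nat
  assumes "norm v \<le> 1" "norm v' \<le> 1" "j \<le> N"
  shows "norm (exp (of_nat j * v) - exp (of_nat j * v')) \<le> N * exp N * norm (v - v')"
proof (rule differentiable_bound[of "cball 0 1" _ "\<lambda>x h. h * (exp (of_nat j * x) * of_nat j)"])
  fix x :: complex assume x: "x \<in> cball 0 1"
  show "((\<lambda>v. exp (of_nat j * v)) has_derivative (\<lambda>h. h * (exp (of_nat j * x) * of_nat j))) (at x within cball 0 1)"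
    by (auto intro!: derivative_eq_intros)
  have jx: "norm (of_nat j * x) \<le> real N"
    using x assms(3) mult_mono[of "real j" "real N" "norm x" 1] by (simp add: norm_mult)
  show "onorm (\<lambda>h. h * (exp (of_nat j * x) * of_nat j)) \<le> N * exp N"
  proof (rule onorm_le)
    fix h :: complex
    have "norm (exp (of_nat j * x)) \<le> exp (real N)"
      using norm_exp[of "of_nat j * x"] jx by (meson exp_le_cancel_iff order_trans)
    then have "norm (exp (of_nat j * x) * of_nat j) \<le> exp (real N) * real N"
      unfolding norm_mult using assms(3) by (intro mult_mono) auto
    then show "norm (h * (exp (of_nat j * x) * of_nat j)) \<le> N * exp N * norm h"
      unfolding norm_mult[of h] by (subst mult.commute, intro mult_right_mono) (auto simp: mult.commute)
  qed
qed (use assms in auto)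

text \<open>The unknown is \<open>v = ln (\<tau> / \<tau>\<^sub>0)\<close> as a function of the angular variable \<open>u \<in> [-1, 1]\<close>, with
  \<open>v = 0\<close> at \<open>u = 0\<close>. Letting the initial value \<open>\<tau>\<^sub>0\<close> be complex makes the solution holomorphic in
  \<open>\<tau>\<^sub>0\<close>, which is what the zero counting needs.\<close>

locale angular =
  fixes N :: nat and \<theta> :: real and w :: "nat \<Rightarrow> real \<Rightarrow> real" and K W :: real
  assumes \<theta>: "\<theta> > 0" and K: "K > 0" and W: "W > 0"
    and contw: "\<And>j. continuous_on {-1..1} (w j)"
    and symw: "\<And>j u. j \<in> {1..N} \<Longrightarrow> u \<in> {-1..1} \<Longrightarrow> w j (- u) = (-1) ^ Suc j * w j u"
    and bdw: "\<And>j u. j \<in> {1..N} \<Longrightarrow> u \<in> {-1..1} \<Longrightarrow> \<bar>w j u\<bar> \<le> W"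
begin

text \<open>\<open>R\<close> and the error constant \<open>A\<close> below depend on
  \<open>K\<close> and not on \<open>b\<close>, which makes the estimates uniform over a
  neighbourhood in parameter space.\<close>

definition adm :: "(nat \<Rightarrow> real) \<Rightarrow> bool" where
  "adm b \<longleftrightarrow> (\<forall>j\<in>{1..N}. \<bar>b j\<bar> \<le> K)"

text \<open>With \<open>\<tau> = x * exp v\<close> this is the perturbation
  \<open>\<Sum>j. b j * \<tau> ^ j * w j u\<close>, and \<open>F\<close> is the derivative of
  \<open>ln \<tau>\<close> with respect to the angle: the quotient of the two derivatives in
  \<open>polar_derivatives\<close>, divided by \<open>\<tau>\<close>.\<close>

definition Z :: "(nat \<Rightarrow> real) \<Rightarrow> complex \<Rightarrow> real \<Rightarrow> complex \<Rightarrow> complex" where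
  "Z b x u v = (\<Sum>j=1..N. of_real (b j * w j u) * (x ^ j * exp (of_nat j * v)))"

definition F :: "(nat \<Rightarrow> real) \<Rightarrow> complex \<Rightarrow> real \<Rightarrow> complex \<Rightarrow> complex" where
  "F b x u v = of_real \<theta> * Z b x u v / (1 + of_real u * Z b x u v)"

text \<open>Bounds \<open>Z\<close> and its Lipschitz constant in \<open>v\<close>, per unit of
  \<open>norm x\<close>. The square absorbs the number of summands and the factor \<open>j\<close>
  from differentiating \<open>exp (of_nat j * v)\<close>.\<close>

definition E :: real where "E = (N + 1)^2 * K * W * exp N"

text \<open>Small enough that \<open>E * norm x\<close> and \<open>\<theta> * (E * norm x)\<close>
  are at most 1/16: the first keeps the denominator of \<open>F\<close> at least 1/2 in modulus, the
  second makes the Picard operator a contraction.\<close>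

definition R :: real where "R = 1 / (16 * (1 + \<theta>) * (1 + E))"

lemma E: "E > 0" using K W by (simp add: E_def)

lemma R: "R > 0" "R \<le> 1" "E * R \<le> 1/16" "\<theta> * (E * R) \<le> 1/16"
proof -
  have tE: "\<theta> * E > 0" using \<theta> E by simp
  have ex: "16 * (1 + \<theta>) * (1 + E) = 16 + 16 * \<theta> + 16 * E + 16 * (\<theta> * E)" by (simp add: algebra_simps)
  have p: "16 * (1 + \<theta>) * (1 + E) \<ge> 1" and q: "16 * (1 + \<theta>) * (1 + E) > 0"
    using \<theta> E tE unfolding ex by linarith+
  show "R > 0" using q by (simp add: R_def)
  show "R \<le> 1" using p by (simp add: R_def)
  have "E * 16 \<le> 16 * (1 + \<theta>) * (1 + E)" "\<theta> * E * 16 \<le> 16 * (1 + \<theta>) * (1 + E)"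
    using \<theta> E tE unfolding ex by linarith+
  then show "E * R \<le> 1/16" "\<theta> * (E * R) \<le> 1/16"
    unfolding R_def using q by (simp_all add: divide_le_eq mult_ac)
qed

lemma E_small: "norm x < R \<Longrightarrow> E * norm x \<le> 1/16" and \<theta>_small: "norm x < R \<Longrightarrow> \<theta> * (E * norm x) \<le> 1/16"
proof -
  assume x: "norm x < R"
  then have *: "E * norm x \<le> E * R" using E by (intro mult_left_mono) auto
  then show "E * norm x \<le> 1/16" using R(3) by linarith
  have "\<theta> * (E * norm x) \<le> \<theta> * (E * R)" by (rule mult_left_mono[OF * less_imp_le[OF \<theta>]])
  then show "\<theta> * (E * norm x) \<le> 1/16" using R(4) by linarith
qed

lemma power_le_self: "norm (x::complex) < R \<Longrightarrow> j \<ge> 1 \<Longrightarrow> norm x ^ j \<le> norm x"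
  using power_decreasing[of 1 j "norm x"] R(2) by simp

lemma norm_exp_le: "norm v \<le> 1 \<Longrightarrow> j \<le> N \<Longrightarrow> norm (exp (of_nat j * v :: complex)) \<le> exp N"
proof -
  assume "norm v \<le> 1" "j \<le> N"
  then have "norm (of_nat j * v) \<le> real N"
    using mult_mono[of "real j" "real N" "norm v" 1] by (simp add: norm_mult)
  then show ?thesis using norm_exp[of "of_nat j * v"] by (meson exp_le_cancel_iff order_trans)
qed

lemma NE: "N * (K * W * exp N) \<le> E" "N * (K * W * (N * exp N)) \<le> E"
proof -
  have "real N \<le> (real N + 1)^2" "real N * real N \<le> (real N + 1)^2"
    by (auto simp: power2_eq_square algebra_simps)
  then have "N * (K * W * exp N) \<le> (real N + 1)^2 * (K * W * exp N)"
    "(real N * real N) * (K * W * exp N) \<le> (real N + 1)^2 * (K * W * exp N)"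
    using K W by (auto intro!: mult_right_mono)
  then show "N * (K * W * exp N) \<le> E" "N * (K * W * (N * exp N)) \<le> E"
    by (simp_all add: E_def mult_ac add.commute)
qed

lemma Z_bound:
  assumes "adm b" "norm x < R" "u \<in> {-1..1}" "norm v \<le> 1"
  shows "norm (Z b x u v) \<le> E * norm x"
proof -
  have "norm (Z b x u v) \<le> (\<Sum>j=1..N. K * W * exp N * norm x)"
    unfolding Z_def
  proof (rule sum_norm_le)
    fix j assume j: "j \<in> {1..N}"
    have 1: "\<bar>b j * w j u\<bar> \<le> K * W"
      unfolding abs_mult using assms j K bdw by (intro mult_mono) (auto simp: adm_def)
    have 2: "norm x ^ j * norm (exp (of_nat j * v)) \<le> norm x * exp N"
      using j power_le_self[of x j] norm_exp_le[of v j] assms by (intro mult_mono) auto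
    have "\<bar>b j * w j u\<bar> * (norm x ^ j * norm (exp (of_nat j * v))) \<le> (K * W) * (norm x * exp N)"
      using K W by (intro mult_mono[OF 1 2]) auto
    then show "norm (of_real (b j * w j u) * (x ^ j * exp (of_nat j * v))) \<le> K * W * exp N * norm x"
      by (simp only: norm_mult norm_power norm_of_real mult_ac)
  qed
  also have "\<dots> = N * (K * W * exp N) * norm x" by simp
  also have "\<dots> \<le> E * norm x" by (intro mult_right_mono NE) auto
  finally show ?thesis .
qed

lemma Z_lipschitz:
  assumes "adm b" "norm x < R" "u \<in> {-1..1}" "norm v \<le> 1" "norm v' \<le> 1"
  shows "norm (Z b x u v - Z b x u v') \<le> E * norm x * norm (v - v')"
proof -
  have "norm (Z b x u v - Z b x u v') \<le> (\<Sum>j=1..N. (K * W * (N * exp N)) * (norm x * norm (v - v')))"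
    unfolding Z_def sum_subtractf[symmetric]
  proof (rule sum_norm_le)
    fix j assume j: "j \<in> {1..N}"
    have 1: "\<bar>b j * w j u\<bar> \<le> K * W"
      unfolding abs_mult using assms j K bdw by (intro mult_mono) (auto simp: adm_def)
    have 2: "norm x ^ j * norm (exp (of_nat j * v) - exp (of_nat j * v')) \<le> norm x * (N * exp N * norm (v - v'))"
      using j power_le_self[of x j] exp_nat_mult_lipschitz[of v v' j N] assms by (intro mult_mono) auto
    have "\<bar>b j * w j u\<bar> * (norm x ^ j * norm (exp (of_nat j * v) - exp (of_nat j * v')))
        \<le> (K * W) * (norm x * (N * exp N * norm (v - v')))"
      using K W by (intro mult_mono[OF 1 2]) auto
    moreover have "of_real (b j * w j u) * (x ^ j * exp (of_nat j * v)) - of_real (b j * w j u) * (x ^ j * exp (of_nat j * v'))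
      = of_real (b j * w j u) * (x ^ j * (exp (of_nat j * v) - exp (of_nat j * v')))"
      by (simp only: right_diff_distrib)
    ultimately show "norm (of_real (b j * w j u) * (x ^ j * exp (of_nat j * v)) - of_real (b j * w j u) * (x ^ j * exp (of_nat j * v')))
        \<le> (K * W * (N * exp N)) * (norm x * norm (v - v'))"
      by (simp only: norm_mult norm_power norm_of_real mult_ac)
  qed
  also have "\<dots> = N * (K * W * (N * exp N)) * (norm x * norm (v - v'))" by simp
  also have "\<dots> \<le> E * (norm x * norm (v - v'))" by (intro mult_right_mono NE) auto
  finally show ?thesis by (simp add: mult.assoc)
qed

lemma denom_bound:
  assumes "u \<in> {-1..1}" "norm z \<le> 1/16"
  shows "norm (of_real u * z) \<le> norm z" "norm (1 + of_real u * z) \<ge> 1/2" "1 + of_real u * z \<noteq> (0::complex)"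
proof -
  show a: "norm (of_real u * z) \<le> norm z"
    using assms mult_mono[of "\<bar>u\<bar>" 1 "norm z" "norm z"] by (simp add: norm_mult abs_le_iff)
  have "norm (1::complex) \<le> norm (1 + of_real u * z) + norm (of_real u * z)"
    using norm_triangle_ineq4[of "1 + of_real u * z" "of_real u * z"] by simp
  then show "norm (1 + of_real u * z) \<ge> 1/2" using a assms by simp
  then show "1 + of_real u * z \<noteq> 0" by (metis norm_zero not_le zero_less_divide_1_iff zero_less_numeral)
qed

text \<open>Over a common denominator the numerator collapses to
  \<open>of_real \<theta> * (z - z')\<close>, and each denominator is at least 1/2 in modulus. The
  case \<open>z' = 0\<close> yields the bound on \<open>F\<close>.\<close>

lemma quotient_diff:
  fixes z z' :: complex
  assumes "u \<in> {-1..1}" "norm z \<le> 1/16" "norm z' \<le> 1/16"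
  shows "norm (of_real \<theta> * z / (1 + of_real u * z) - of_real \<theta> * z' / (1 + of_real u * z')) \<le> 4 * \<theta> * norm (z - z')"
proof -
  let ?d = "1 + of_real u * z" and ?d' = "1 + of_real u * z'"
  have nz: "?d \<noteq> 0" "?d' \<noteq> 0" using denom_bound assms by auto
  have eq: "of_real \<theta> * z / ?d - of_real \<theta> * z' / ?d' = of_real \<theta> * (z - z') / (?d * ?d')"
    using nz by (simp add: divide_simps) (simp add: algebra_simps)
  have "norm (?d * ?d') \<ge> 1/2 * (1/2)"
    unfolding norm_mult using denom_bound(2) assms by (intro mult_mono) auto
  then have "norm (of_real \<theta> * (z - z')) / norm (?d * ?d') \<le> norm (of_real \<theta> * (z - z')) / (1/4)"
    by (intro divide_left_mono) (use nz in auto)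
  then show ?thesis using \<theta> unfolding eq norm_divide by (simp add: norm_mult)
qed

lemma Z_small:
  assumes "adm b" "norm x < R" "u \<in> {-1..1}" "norm v \<le> 1"
  shows "norm (Z b x u v) \<le> 1/16"
  using Z_bound[OF assms] E_small[OF assms(2)] by linarith

lemma F_bound:
  assumes "adm b" "norm x < R" "u \<in> {-1..1}" "norm v \<le> 1"
  shows "norm (F b x u v) \<le> 4 * \<theta> * E * norm x"
proof -
  have "norm (F b x u v) \<le> 4 * \<theta> * norm (Z b x u v)"
    using quotient_diff[OF assms(3) Z_small[OF assms], of 0] by (simp add: F_def)
  also have "\<dots> \<le> 4 * \<theta> * (E * norm x)"
    using \<theta> Z_bound[OF assms] by (intro mult_left_mono) auto
  finally show ?thesis by simp
qed

lemma F_small: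
  assumes "adm b" "norm x < R" "u \<in> {-1..1}" "norm v \<le> 1"
  shows "norm (F b x u v) \<le> 1/4"
  using F_bound[OF assms] \<theta>_small[OF assms(2)] by simp

lemma F_lipschitz:
  assumes "adm b" "norm x < R" "u \<in> {-1..1}" "norm v \<le> 1" "norm v' \<le> 1"
  shows "norm (F b x u v - F b x u v') \<le> 1/2 * norm (v - v')"
proof -
  have "norm (F b x u v - F b x u v') \<le> 4 * \<theta> * norm (Z b x u v - Z b x u v')"
    unfolding F_def by (intro quotient_diff Z_small assms)
  also have "\<dots> \<le> 4 * \<theta> * (E * norm x * norm (v - v'))"
    using \<theta> by (intro mult_left_mono Z_lipschitz assms) auto
  also have "\<dots> = 4 * (\<theta> * (E * norm x)) * norm (v - v')" by simp
  also have "\<dots> \<le> 4 * (1/16) * norm (v - v')"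
    by (intro mult_right_mono mult_left_mono \<theta>_small assms) auto
  also have "\<dots> \<le> 1/2 * norm (v - v')" by simp
  finally show ?thesis .
qed

section \<open>Picard iterates for complex initial values\<close>

primrec pic :: "(nat \<Rightarrow> real) \<Rightarrow> nat \<Rightarrow> complex \<Rightarrow> real \<Rightarrow> complex" where
  "pic b 0 = (\<lambda>x \<xi>. 0)"
| "pic b (Suc n) = (\<lambda>x \<xi>. of_real \<xi> * integral {0..1} (\<lambda>t. F b x (\<xi> * t) (pic b n x (\<xi> * t))))"

lemma contw_comp: "continuous_on S f \<Longrightarrow> f ` S \<subseteq> {-1..1} \<Longrightarrow> continuous_on S (\<lambda>x. w j (f x))"
  by (rule continuous_on_compose2[OF contw])

lemma Z_continuous:
  assumes "continuous_on (B \<times> {-1..1}) (\<lambda>(x, u). p x u)"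
  shows "continuous_on (B \<times> {-1..1}) (\<lambda>z. Z b (fst z) (snd z) (p (fst z) (snd z)))"
  unfolding Z_def using assms
  by (auto intro!: continuous_intros contw_comp simp: split_beta)

lemma F_continuous:
  assumes "adm b" "continuous_on (ball 0 R \<times> {-1..1}) (\<lambda>(x, u). p x u)"
    and "\<And>x u. x \<in> ball 0 R \<Longrightarrow> u \<in> {-1..1} \<Longrightarrow> norm (p x u) \<le> 1"
  shows "continuous_on (ball 0 R \<times> {-1..1}) (\<lambda>(x, u). F b x u (p x u))"
  unfolding F_def split_beta
proof (intro continuous_intros Z_continuous assms ballI)
  fix z assume "z \<in> ball (0::complex) R \<times> {-1..1::real}"
  then show "1 + complex_of_real (snd z) * Z b (fst z) (snd z) (p (fst z) (snd z)) \<noteq> 0"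
    using assms by (intro denom_bound Z_small) auto
qed

lemma section_continuous:
  assumes "continuous_on (ball 0 R \<times> {-1..1}) (\<lambda>(x, u). g x u)" "norm x < R"
  shows "continuous_on {-1..1::real} (g x)"
  by (rule continuous_on_compose2[OF assms(1), of _ "\<lambda>u. (x, u)", unfolded split_beta fst_conv snd_conv])
    (use assms in \<open>auto intro!: continuous_intros\<close>)

text \<open>The bound 1 reproduces itself because \<open>F\<close> is at most 1/4 on that range, so
  all iterates stay where \<open>F\<close> is controlled, over the whole of
  \<open>{-1..1}\<close>.\<close>

lemma pic_props:
  assumes b: "adm b"
  shows "continuous_on (ball 0 R \<times> {-1..1}) (\<lambda>(x, u). pic b n x u) \<and>
    (\<forall>x\<in>ball 0 R. \<forall>u\<in>{-1..1}. norm (pic b n x u) \<le> 1)"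
proof (induction n)
  case (Suc n)
  then have c: "continuous_on (ball 0 R \<times> {-1..1}) (\<lambda>(x, u). F b x u (pic b n x u))"
    by (intro F_continuous b) auto
  have "norm (pic b (Suc n) x u) \<le> 1" if "x \<in> ball 0 R" "u \<in> {-1..1}" for x u
    unfolding pic.simps
  proof (rule radial_integral_bound[OF section_continuous[OF c] that(2)])
    fix u :: real assume "u \<in> {-1..1}"
    then have "norm (F b x u (pic b n x u)) \<le> 1/4" using that Suc by (intro F_small b) auto
    then show "norm (F b x u (pic b n x u)) \<le> 1" by simp
  qed (use that in simp)
  then show ?case using radial_integral_continuous[OF c] by simp
qed simp

lemma pic_bound: "adm b \<Longrightarrow> norm x < R \<Longrightarrow> u \<in> {-1..1} \<Longrightarrow> norm (pic b n x u) \<le> 1"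
  using pic_props[of b n] by simp

lemma pic_F_continuous:
  "adm b \<Longrightarrow> continuous_on (ball 0 R \<times> {-1..1}) (\<lambda>(x, u). F b x u (pic b n x u))"
  by (intro F_continuous) (auto simp: pic_props pic_bound)

text \<open>The induction carries along the joint continuity of the derivative, which
  differentiating the next iterate under the integral sign asks for.\<close>

lemma pic_derivative:
  assumes b: "adm b"
  shows "\<exists>g. continuous_on (ball 0 R \<times> {-1..1}) (\<lambda>(x, u). g x u) \<and>
    (\<forall>x\<in>ball 0 R. \<forall>u\<in>{-1..1}. ((\<lambda>x. pic b n x u) has_field_derivative g x u) (at x within ball 0 R))"
proof (induction n)
  case 0
  then show ?case by (intro exI[of _ "\<lambda>x u. 0"]) (auto intro!: derivative_eq_intros)
next
  case (Suc n)
  then obtain g where g: "continuous_on (ball 0 R \<times> {-1..1}) (\<lambda>(x, u). g x u)"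
    "\<And>x u. x \<in> ball 0 R \<Longrightarrow> u \<in> {-1..1} \<Longrightarrow> ((\<lambda>x. pic b n x u) has_field_derivative g x u) (at x within ball 0 R)"
    by blast
  let ?p = "pic b n"
  have cp: "continuous_on (ball 0 R \<times> {-1..1}) (\<lambda>(x, u). ?p x u)" using pic_props[OF b] by blast
  define Z' where "Z' = (\<lambda>x u. \<Sum>j=1..N. of_real (b j * w j u) *
      (of_nat j * x ^ (j - 1) * exp (of_nat j * ?p x u) + x ^ j * (exp (of_nat j * ?p x u) * (of_nat j * g x u))))"
  have dZ: "((\<lambda>x. Z b x u (?p x u)) has_field_derivative Z' x u) (at x within ball 0 R)"
    if "x \<in> ball 0 R" "u \<in> {-1..1}" for x u
    unfolding Z_def Z'_def
    by (rule DERIV_sum, rule DERIV_cmult) (auto intro!: derivative_eq_intros g(2)[OF that] simp: algebra_simps)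
  have cZ': "continuous_on (ball 0 R \<times> {-1..1}) (\<lambda>z. Z' (fst z) (snd z))"
    unfolding Z'_def using cp g(1)
    by (auto intro!: continuous_intros contw_comp simp: split_beta)
  define h where "h = (\<lambda>x u. of_real \<theta> * Z' x u / (1 + of_real u * Z b x u (?p x u))^2)"
  have nz: "1 + of_real u * Z b x u (?p x u) \<noteq> 0" if "x \<in> ball 0 R" "u \<in> {-1..1}" for x u
    using that b by (intro denom_bound Z_small) (auto simp: pic_bound)
  have dF: "((\<lambda>x. F b x u (?p x u)) has_field_derivative h x u) (at x within ball 0 R)"
    if "x \<in> ball 0 R" "u \<in> {-1..1}" for x u
    unfolding F_def h_def
    by (rule derivative_eq_intros dZ[OF that] nz[OF that] refl | simp)+
      (use nz[OF that] in \<open>simp add: divide_simps power2_eq_square\<close>, simp add: algebra_simps)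
  have ch: "continuous_on (ball 0 R \<times> {-1..1}) (\<lambda>(x, u). h x u)"
    unfolding h_def split_beta
    by (intro continuous_intros cZ' Z_continuous cp ballI) (use nz in auto)
  define g' where "g' = (\<lambda>x \<xi>. of_real \<xi> * integral {0..1} (\<lambda>t. h x (\<xi> * t)))"
  have "continuous_on (ball 0 R \<times> {-1..1}) (\<lambda>(x, u). g' x u)"
    unfolding g'_def by (rule radial_integral_continuous[OF ch])
  moreover have "((\<lambda>x. pic b (Suc n) x u) has_field_derivative g' x u) (at x within ball 0 R)"
    if "x \<in> ball 0 R" "u \<in> {-1..1}" for x u
    unfolding pic.simps g'_def
    by (rule radial_integral_derivative[OF convex_ball that pic_F_continuous[OF b] ch dF])
  ultimately show ?case by blast
qed

lemma pic_step:
  assumes b: "adm b" and x: "norm x < R" and "u \<in> {-1..1}"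
  shows "norm (pic b (Suc n) x u - pic b n x u) \<le> (1/2)^n"
  using assms(3)
proof (induction n arbitrary: u)
  case 0
  have "norm (pic b (Suc 0) x u) \<le> 1" by (rule pic_bound[OF b x 0])
  then show ?case by simp
next
  case (Suc n)
  have c: "continuous_on {-1..1} (\<lambda>u. F b x u (pic b n x u))" for n
    by (rule section_continuous[OF pic_F_continuous[OF b] x])
  have int: "(\<lambda>t. F b x (u * t) (pic b n x (u * t))) integrable_on {0..1}" for n
  proof (rule integrable_continuous_interval, rule continuous_on_compose2[OF c])
    show "(*) u ` {0..1} \<subseteq> {-1..1}" using unit_interval_scale[OF Suc.prems] by blast
  qed (intro continuous_intros)
  have "pic b (Suc (Suc n)) x u - pic b (Suc n) x u =
      of_real u * integral {0..1} (\<lambda>t. F b x (u * t) (pic b (Suc n) x (u * t)) - F b x (u * t) (pic b n x (u * t)))"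
    unfolding pic.simps(2)[of b "Suc n"] integral_diff[OF int int] right_diff_distrib by simp
  also have "norm \<dots> \<le> (1/2)^Suc n"
  proof (rule radial_integral_bound[of "\<lambda>u. F b x u (pic b (Suc n) x u) - F b x u (pic b n x u)", OF _ Suc.prems])
    show "continuous_on {- 1..1} (\<lambda>u. F b x u (pic b (Suc n) x u) - F b x u (pic b n x u))"
      by (intro continuous_intros c)
    fix u :: real assume u: "u \<in> {-1..1}"
    have "norm (F b x u (pic b (Suc n) x u) - F b x u (pic b n x u))
        \<le> 1/2 * norm (pic b (Suc n) x u - pic b n x u)"
      by (intro F_lipschitz b x u pic_bound)
    also have "\<dots> \<le> 1/2 * (1/2)^n" by (intro mult_left_mono Suc.IH u) auto
    finally show "norm (F b x u (pic b (Suc n) x u) - F b x u (pic b n x u)) \<le> (1/2)^Suc n" by simp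
  qed
  finally show ?case .
qed

lemma pic_diff:
  assumes "adm b" "norm x < R" "u \<in> {-1..1}"
  shows "norm (pic b (n + k) x u - pic b n x u) \<le> 2 * (1/2)^n"
proof -
  have "norm (pic b (n + k) x u - pic b n x u) \<le> 2 * ((1/2)^n - (1/2)^(n + k))"
  proof (induction k)
    case (Suc k)
    have "norm (pic b (n + Suc k) x u - pic b n x u)
      \<le> norm (pic b (Suc (n + k)) x u - pic b (n + k) x u) + norm (pic b (n + k) x u - pic b n x u)"
      using norm_triangle_ineq[of "pic b (Suc (n + k)) x u - pic b (n + k) x u" "pic b (n + k) x u - pic b n x u"]
      by (simp del: pic.simps)
    also have "\<dots> \<le> (1/2)^(n+k) + 2 * ((1/2)^n - (1/2)^(n + k))"
      by (intro add_mono Suc pic_step assms)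
    also have "\<dots> = 2 * ((1/2)^n - (1/2)^(n + Suc k))" by (simp add: algebra_simps)
    finally show ?case .
  qed simp
  also have "\<dots> \<le> 2 * (1/2)^n" by simp
  finally show ?thesis .
qed

definition sol :: "(nat \<Rightarrow> real) \<Rightarrow> complex \<Rightarrow> real \<Rightarrow> complex" where
  "sol b x u = lim (\<lambda>n. pic b n x u)"

lemma pic_tendsto:
  assumes "adm b" "norm x < R" "u \<in> {-1..1}"
  shows "(\<lambda>n. pic b n x u) \<longlonglongrightarrow> sol b x u"
proof -
  have "Cauchy (\<lambda>n. pic b n x u)"
  proof (rule metric_CauchyI)
    fix e :: real assume "e > 0"
    have "(\<lambda>n. 4 * (1/2::real)^n) \<longlonglongrightarrow> 4 * 0"
      by (intro tendsto_intros LIMSEQ_power_zero) simp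
    then have "eventually (\<lambda>n. 4 * (1/2)^n < e) sequentially"
      using \<open>e > 0\<close> by (intro order_tendstoD) auto
    then obtain M where M: "4 * (1/2)^M < e" using eventually_sequentially by auto
    have "dist (pic b m x u) (pic b n x u) < e" if "m \<ge> M" "n \<ge> M" for m n
    proof -
      have "norm (pic b m x u - pic b M x u) \<le> 2 * (1/2)^M" "norm (pic b n x u - pic b M x u) \<le> 2 * (1/2)^M"
        using pic_diff[OF assms, of M "m - M"] pic_diff[OF assms, of M "n - M"] that by simp_all
      then show ?thesis
        using M dist_triangle2[of "pic b m x u" "pic b n x u" "pic b M x u"] unfolding dist_norm by linarith
    qed
    then show "\<exists>M. \<forall>m\<ge>M. \<forall>n\<ge>M. dist (pic b m x u) (pic b n x u) < e" by blast
  qed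
  then show ?thesis unfolding sol_def by (simp add: Cauchy_convergent_iff convergent_LIMSEQ_iff)
qed

lemma sol_pic_diff:
  assumes "adm b" "norm x < R" "u \<in> {-1..1}"
  shows "norm (sol b x u - pic b n x u) \<le> 2 * (1/2)^n"
proof (rule LIMSEQ_le_const2)
  show "(\<lambda>k. norm (pic b (k + n) x u - pic b n x u)) \<longlonglongrightarrow> norm (sol b x u - pic b n x u)"
    by (intro tendsto_intros LIMSEQ_ignore_initial_segment pic_tendsto assms)
  show "\<exists>M. \<forall>k\<ge>M. norm (pic b (k + n) x u - pic b n x u) \<le> 2 * (1/2)^n"
    using pic_diff[OF assms, of n] by (metis add.commute)
qed

lemma sol_bound:
  assumes "adm b" "norm x < R" "u \<in> {-1..1}" shows "norm (sol b x u) \<le> 1"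
  by (rule LIMSEQ_le_const2[OF tendsto_norm[OF pic_tendsto[OF assms]]]) (use pic_bound assms in auto)

lemma pic_uniform_limit:
  assumes "adm b"
  shows "uniform_limit (ball 0 R \<times> {-1..1}) (\<lambda>n z. pic b n (fst z) (snd z)) (\<lambda>z. sol b (fst z) (snd z)) sequentially"
proof (rule uniform_limitI)
  fix e :: real assume "e > 0"
  have "(\<lambda>n. 2 * (1/2::real)^n) \<longlonglongrightarrow> 2 * 0"
    by (intro tendsto_intros LIMSEQ_power_zero) simp
  then have "eventually (\<lambda>n. 2 * (1/2)^n < e) sequentially"
    using \<open>e > 0\<close> by (intro order_tendstoD) auto
  then show "\<forall>\<^sub>F n in sequentially. \<forall>z\<in>ball 0 R \<times> {-1..1}. dist (pic b n (fst z) (snd z)) (sol b (fst z) (snd z)) < e"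
  proof eventually_elim
    case (elim n)
    show ?case
    proof
      fix z assume "z \<in> ball (0::complex) R \<times> {-1..1::real}"
      then have "norm (sol b (fst z) (snd z) - pic b n (fst z) (snd z)) \<le> 2 * (1/2)^n"
        by (intro sol_pic_diff assms) auto
      then show "dist (pic b n (fst z) (snd z)) (sol b (fst z) (snd z)) < e"
        using elim by (simp add: dist_norm norm_minus_commute)
    qed
  qed
qed

lemma sol_continuous:
  assumes "adm b"
  shows "continuous_on (ball 0 R \<times> {-1..1}) (\<lambda>(x, u). sol b x u)"
  unfolding split_beta
proof (rule uniform_limit_theorem[OF _ pic_uniform_limit[OF assms]])
  show "\<forall>\<^sub>F n in sequentially. continuous_on (ball 0 R \<times> {-1..1}) (\<lambda>z. pic b n (fst z) (snd z))"
    using pic_props[OF assms] by (auto simp: split_beta)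
qed simp

text \<open>The iterates are holomorphic and converge uniformly.\<close>

lemma sol_holomorphic:
  assumes b: "adm b" and u: "u \<in> {-1..1}"
  shows "(\<lambda>x. sol b x u) holomorphic_on ball 0 R"
proof (rule holomorphic_uniform_sequence[OF open_ball])
  show "(\<lambda>x. pic b n x u) holomorphic_on ball 0 R" for n
  proof -
    obtain g where "\<And>x u. x \<in> ball 0 R \<Longrightarrow> u \<in> {-1..1} \<Longrightarrow> ((\<lambda>x. pic b n x u) has_field_derivative g x u) (at x within ball 0 R)"
      using pic_derivative[OF b, of n] by blast
    then show ?thesis using u unfolding holomorphic_on_def field_differentiable_def by blast
  qed
  fix x assume "x \<in> ball (0::complex) R"
  then obtain d where d: "d > 0" "cball x d \<subseteq> ball 0 R" by (metis open_ball open_contains_cball)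
  moreover have "uniform_limit (cball x d) (\<lambda>n x. pic b n x u) (\<lambda>x. sol b x u) sequentially"
    unfolding uniform_limit_iff
  proof (intro allI impI)
    fix e :: real assume "e > 0"
    then have "\<forall>\<^sub>F n in sequentially. \<forall>z\<in>ball 0 R \<times> {-1..1}. dist (pic b n (fst z) (snd z)) (sol b (fst z) (snd z)) < e"
      using pic_uniform_limit[OF b] by (auto simp: uniform_limit_iff)
    then show "\<forall>\<^sub>F n in sequentially. \<forall>x\<in>cball x d. dist (pic b n x u) (sol b x u) < e"
      by eventually_elim (use d(2) u in force)
  qed
  ultimately show "\<exists>d>0. cball x d \<subseteq> ball 0 R \<and> uniform_limit (cball x d) (\<lambda>n x. pic b n x u) (\<lambda>x. sol b x u) sequentially"
    by blast
qed

lemma sol_F_continuous: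
  "adm b \<Longrightarrow> norm x < R \<Longrightarrow> continuous_on {-1..1} (\<lambda>u. F b x u (sol b x u))"
  by (rule section_continuous[OF F_continuous[OF _ sol_continuous]]) (auto simp: sol_bound)

text \<open>The limit passes through the integral because \<open>F\<close> is Lipschitz in
  \<open>v\<close> and the iterates converge geometrically.\<close>

lemma sol_integral_equation:
  assumes b: "adm b" and x: "norm x < R" and u: "u \<in> {-1..1}"
  shows "sol b x u = of_real u * integral {0..1} (\<lambda>t. F b x (u * t) (sol b x (u * t)))"
proof -
  let ?I = "\<lambda>p. of_real u * integral {0..1} (\<lambda>t. F b x (u * t) (p (u * t)))"
  have sub: "(*) u ` {0..1} \<subseteq> {-1..1}" using unit_interval_scale[OF u] by blast
  have int: "(\<lambda>t. F b x (u * t) (p (u * t))) integrable_on {0..1}"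
    if "continuous_on {-1..1} (\<lambda>u. F b x u (p u))" for p
    by (rule integrable_continuous_interval, rule continuous_on_compose2[OF that _ sub]) (intro continuous_intros)
  have cp: "continuous_on {-1..1} (\<lambda>u. F b x u (pic b n x u))" for n
    by (rule section_continuous[OF pic_F_continuous[OF b] x])
  note cs = sol_F_continuous[OF b x]
  have le: "norm (pic b (Suc n) x u - ?I (sol b x)) \<le> (1/2)^n" for n
  proof -
    have "pic b (Suc n) x u - ?I (sol b x)
      = of_real u * integral {0..1} (\<lambda>t. F b x (u * t) (pic b n x (u * t)) - F b x (u * t) (sol b x (u * t)))"
      unfolding pic.simps(2) integral_diff[OF int[OF cp] int[OF cs]] right_diff_distrib by simp
    also have "norm \<dots> \<le> (1/2)^n"
    proof (rule radial_integral_bound[of "\<lambda>u. F b x u (pic b n x u) - F b x u (sol b x u)", OF _ u])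
      show "continuous_on {- 1..1} (\<lambda>u. F b x u (pic b n x u) - F b x u (sol b x u))"
        by (intro continuous_intros cp cs)
      fix u :: real assume u: "u \<in> {-1..1}"
      have "norm (F b x u (pic b n x u) - F b x u (sol b x u)) \<le> 1/2 * norm (pic b n x u - sol b x u)"
        by (intro F_lipschitz b x u pic_bound sol_bound)
      also have "\<dots> \<le> 1/2 * (2 * (1/2)^n)"
        using sol_pic_diff[OF b x u, of n] by (simp add: norm_minus_commute)
      finally show "norm (F b x u (pic b n x u) - F b x u (sol b x u)) \<le> (1/2)^n" by simp
    qed
    finally show ?thesis .
  qed
  have "(\<lambda>n. pic b (Suc n) x u - ?I (sol b x)) \<longlonglongrightarrow> 0"
    by (rule Lim_null_comparison[where g="\<lambda>n. (1/2)^n"])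
      (use le in \<open>auto intro!: LIMSEQ_power_zero simp del: pic.simps\<close>)
  moreover have "(\<lambda>n. pic b (Suc n) x u - ?I (sol b x)) \<longlonglongrightarrow> sol b x u - ?I (sol b x)"
    by (intro tendsto_intros LIMSEQ_Suc pic_tendsto b x u)
  ultimately show ?thesis using LIMSEQ_unique by fastforce
qed

lemma sol_ode:
  assumes b: "adm b" and x: "norm x < R" and u: "u \<in> {-1..1}"
  shows "(sol b x has_vector_derivative F b x u (sol b x u)) (at u within {-1..1})"
  by (rule radial_integral_ode[OF sol_F_continuous[OF b x] u sol_integral_equation[OF b x]])

lemma sol_0: "adm b \<Longrightarrow> norm x < R \<Longrightarrow> sol b x 0 = 0"
  using sol_integral_equation[of b x 0] by simp

text \<open>Turns the symmetries of \<open>F\<close> into symmetries of \<open>sol\<close>.\<close>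

lemma ode_unique:
  assumes b: "adm b" and x: "norm x < R"
    and f: "\<And>u. u \<in> {-1..1} \<Longrightarrow> (f has_vector_derivative F b x u (f u)) (at u within {-1..1})"
      "\<And>u. u \<in> {-1..1} \<Longrightarrow> norm (f u) \<le> 1" "f 0 = 0"
    and u: "u \<in> {-1..1}"
  shows "f u = sol b x u"
proof -
  have "f u - sol b x u = 0"
  proof (rule gronwall_zero[of "-1" 1 _ "\<lambda>u. F b x u (f u) - F b x u (sol b x u)" "1/2" 0])
    show "((\<lambda>u. f u - sol b x u) has_vector_derivative F b x t (f t) - F b x t (sol b x t)) (at t within {- 1..1})"
      if "t \<in> {-1..1}" for t
      by (intro has_vector_derivative_diff f sol_ode b x that)
    show "norm (F b x t (f t) - F b x t (sol b x t)) \<le> 1/2 * norm (f t - sol b x t)" if "t \<in> {-1..1}" for t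
      by (intro F_lipschitz b x that f sol_bound)
  qed (use f u sol_0[OF b x] in auto)
  then show ?thesis by simp
qed

end

section \<open>Symmetries and first-order expansion of the displacement\<close>

context angular
begin

text \<open>The parity of \<open>w j\<close> in \<open>u\<close> is opposite to that of
  \<open>j\<close>, so a change of sign in \<open>x\<close> amounts to reflecting \<open>u\<close>
  and changing the sign of the sum.\<close>

lemma Z_minus:
  assumes "u \<in> {-1..1}" shows "Z b (- x) u v = - Z b x (- u) v"
  unfolding Z_def sum_negf[symmetric]
proof (rule sum.cong)
  fix j assume "j \<in> {1..N}"
  then show "of_real (b j * w j u) * ((- x) ^ j * exp (of_nat j * v)) =
      - (of_real (b j * w j (- u)) * (x ^ j * exp (of_nat j * v)))"
    using symw[of j u] assms by (cases "even j") auto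
qed simp

lemma F_minus:
  assumes "u \<in> {-1..1}" shows "F b (- x) u v = - F b x (- u) v"
  unfolding F_def Z_minus[OF assms] by simp

text \<open>The reflected solution satisfies the equation with \<open>- x\<close>. Since this
  exchanges the two ends of the interval, the displacement becomes an odd function of
  \<open>x\<close>.\<close>

lemma sol_minus:
  assumes b: "adm b" and x: "norm x < R" and u: "u \<in> {-1..1}"
  shows "sol b (- x) u = sol b x (- u)"
proof -
  have "(\<lambda>u. sol b x (- u)) u = sol b (- x) u"
  proof (rule ode_unique[OF b _ _ _ _ u])
    fix t :: real assume t: "t \<in> {-1..1}"
    then have mt: "- t \<in> {-1..1}" by auto
    have "(sol b x has_vector_derivative F b x (- t) (sol b x (- t))) (at (- t) within uminus ` {-1..1})"
      using sol_ode[OF b x mt] by simp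
    moreover have "(uminus has_vector_derivative - 1) (at t within {-1..1})"
      by (auto intro!: derivative_eq_intros)
    ultimately have "((\<lambda>u. sol b x (- u)) has_vector_derivative - F b x (- t) (sol b x (- t))) (at t within {-1..1})"
      using vector_diff_chain_within[of uminus "- 1" t "{-1..1}" "sol b x"] by (simp add: o_def)
    then show "((\<lambda>u. sol b x (- u)) has_vector_derivative F b (- x) t (sol b x (- t))) (at t within {-1..1})"
      by (simp add: F_minus[OF t])
    show "norm (sol b x (- t)) \<le> 1" by (rule sol_bound[OF b x mt])
  qed (use x sol_0[OF b x] in auto)
  then show ?thesis by simp
qed

lemma Z_cnj: "Z b (of_real t) u (cnj v) = cnj (Z b (of_real t) u v)"
  by (simp add: Z_def exp_cnj)

text \<open>For a real initial value, complex conjugation preserves the equation.\<close>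

lemma sol_real:
  assumes b: "adm b" and t: "\<bar>t\<bar> < R" and u: "u \<in> {-1..1}"
  shows "sol b (of_real t) u \<in> \<real>"
proof -
  have x: "norm (of_real t :: complex) < R" using t by simp
  have "(\<lambda>u. cnj (sol b (of_real t) u)) u = sol b (of_real t) u"
  proof (rule ode_unique[OF b x _ _ _ u])
    fix s :: real assume s: "s \<in> {-1..1}"
    have "F b (of_real t) s (cnj (sol b (of_real t) s)) = cnj (F b (of_real t) s (sol b (of_real t) s))"
      by (simp add: F_def Z_cnj)
    then show "((\<lambda>u. cnj (sol b (of_real t) u)) has_vector_derivative
        F b (of_real t) s (cnj (sol b (of_real t) s))) (at s within {-1..1})"
      using bounded_linear.has_vector_derivative[OF bounded_linear_cnj sol_ode[OF b x s]] by simp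
    show "norm (cnj (sol b (of_real t) s)) \<le> 1" using sol_bound[OF b x s] by simp
  qed (use sol_0[OF b x] in auto)
  then show ?thesis by (simp add: Reals_cnj_iff)
qed

text \<open>The logarithm of the ratio of the values of \<open>\<tau>\<close> at the two ends of a
  half turn, so that closing up corresponds to a zero of a holomorphic function.\<close>

definition disp :: "(nat \<Rightarrow> real) \<Rightarrow> complex \<Rightarrow> complex" where
  "disp b x = sol b x 1 - sol b x (- 1)"

lemma disp_holomorphic: "adm b \<Longrightarrow> disp b holomorphic_on ball 0 R"
  unfolding disp_def by (intro holomorphic_intros sol_holomorphic) auto

lemma disp_minus: "adm b \<Longrightarrow> norm x < R \<Longrightarrow> disp b (- x) = - disp b x"
  by (simp add: disp_def sol_minus)

lemma disp_real: "adm b \<Longrightarrow> \<bar>t\<bar> < R \<Longrightarrow> disp b (of_real t) \<in> \<real>"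
  unfolding disp_def by (intro Reals_diff sol_real) auto

definition evenpart :: "(nat \<Rightarrow> real) \<Rightarrow> nat \<Rightarrow> real" where
  "evenpart b j = (if even j then b j else 0)"

lemma adm_evenpart: "adm b \<Longrightarrow> adm (evenpart b)"
  using K by (auto simp: adm_def evenpart_def)

text \<open>Without odd coefficients \<open>F\<close> is even in \<open>x\<close>, so the
  displacement is even; being odd as well, it vanishes.\<close>

lemma disp_eq_0:
  assumes b: "adm b" and odd: "\<And>j. j \<in> {1..N} \<Longrightarrow> odd j \<Longrightarrow> b j = 0" and x: "norm x < R"
  shows "disp b x = 0"
proof -
  have "Z b (- x) u v = Z b x u v" for u v
    unfolding Z_def
  proof (rule sum.cong)
    fix j assume "j \<in> {1..N}"
    then show "of_real (b j * w j u) * ((- x) ^ j * exp (of_nat j * v)) =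
        of_real (b j * w j u) * (x ^ j * exp (of_nat j * v))"
      using odd[of j] by (cases "even j") auto
  qed simp
  then have F: "F b (- x) u v = F b x u v" for u v by (simp add: F_def)
  have "sol b x u = sol b (- x) u" if u: "u \<in> {-1..1}" for u
    by (rule ode_unique[OF b _ _ _ _ u]) (use x sol_ode[OF b x] sol_bound[OF b x] sol_0[OF b x] F in auto)
  then have "disp b (- x) = disp b x" by (simp add: disp_def)
  then show ?thesis using disp_minus[OF b x] by simp
qed

abbreviation J :: "nat set" where "J \<equiv> {j\<in>{1..N}. odd j}"

text \<open>The first-order effect of the term of index \<open>j\<close> over a half turn, with
  \<open>\<tau>\<close> frozen at its value for \<open>u = 0\<close>.\<close>

definition C :: "nat \<Rightarrow> real" where "C j = \<theta> * integral {-1..1} (w j)"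

text \<open>The outer 2 is the length of \<open>{-1..1}\<close>, and \<open>\<theta>\<close> is the
  factor in \<open>F\<close>. The three summands bound the effect on \<open>Z\<close> of passing
  from the full solution to the even one, the replacement of \<open>exp (of_nat j * v)\<close> by 1,
  and the deviation of the denominators from 1.\<close>

definition A :: real where
  "A = 2 * \<theta> * (E * (8 * \<theta> * W * exp N) + W * (N * exp N) * (4 * \<theta> * E) + 12 * E * (E * (8 * \<theta> * W * exp N) + W * exp N))"

lemma A_nonneg: "A \<ge> 0"
  unfolding A_def using \<theta> E W by (intro mult_nonneg_nonneg add_nonneg_nonneg) auto

text \<open>The solution is compared with the one for the even part of the coefficients, whose
  displacement vanishes by symmetry; this is why the error term only involves odd coefficients.\<close>

lemma disp_estimate:
  assumes b: "adm b" and x: "norm x < R"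
  shows "norm (disp b x - (\<Sum>j\<in>J. of_real (C j * b j) * x^j)) \<le> A * norm x * (\<Sum>j\<in>J. \<bar>b j\<bar> * norm x^j)"
proof -
  define e where "e = evenpart b"
  have e: "adm e" unfolding e_def by (rule adm_evenpart[OF b])
  define m where "m = (\<Sum>j\<in>J. \<bar>b j\<bar> * norm x^j)"
  have m: "m \<ge> 0" unfolding m_def by (intro sum_nonneg) auto
  define f g where "f = sol b x" and "g = sol e x"
  have f1: "norm (f u) \<le> 1" and g1: "norm (g u) \<le> 1" if "u \<in> {-1..1}" for u
    unfolding f_def g_def using that by (auto intro!: sol_bound b e x)
  \<comment> \<open>\<open>Q\<close> is the part of \<open>Z\<close> with odd indices, and
    \<open>P\<close> is its value at \<open>v = 0\<close>, whose integral gives the main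
    term.\<close>
  define P where "P = (\<lambda>u. \<Sum>j\<in>J. of_real (b j * w j u) * x^j)"
  define Q where "Q = (\<lambda>u v. \<Sum>j\<in>J. of_real (b j * w j u) * (x^j * exp (of_nat j * v)))"
  have ZQ: "Z b x u v = Z e x u v + Q u v" for u v
  proof -
    have "Q u v = (\<Sum>j=1..N. if odd j then of_real (b j * w j u) * (x^j * exp (of_nat j * v)) else 0)"
      unfolding Q_def by (rule sum.inter_filter) simp
    moreover have "Z e x u v = (\<Sum>j=1..N. if odd j then 0 else of_real (b j * w j u) * (x^j * exp (of_nat j * v)))"
      unfolding Z_def by (rule sum.cong) (auto simp: e_def evenpart_def)
    ultimately have "Z e x u v + Q u v =
        (\<Sum>j=1..N. (if odd j then 0 else of_real (b j * w j u) * (x^j * exp (of_nat j * v))) +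
          (if odd j then of_real (b j * w j u) * (x^j * exp (of_nat j * v)) else 0))"
      by (simp only: sum.distrib)
    also have "\<dots> = (\<Sum>j=1..N. of_real (b j * w j u) * (x^j * exp (of_nat j * v)))"
      by (rule sum.cong) auto
    finally have "Z e x u v + Q u v = (\<Sum>j=1..N. of_real (b j * w j u) * (x^j * exp (of_nat j * v)))" .
    then show ?thesis by (simp add: Z_def)
  qed
  have bw: "\<bar>b j * w j u\<bar> \<le> W * \<bar>b j\<bar>" if "j \<in> J" "u \<in> {-1..1}" for j u
    using bdw[of j u] that mult_right_mono[of "\<bar>w j u\<bar>" W "\<bar>b j\<bar>"] by (simp add: abs_mult mult.commute)
  have Qb: "norm (Q u v) \<le> W * exp N * m" if u: "u \<in> {-1..1}" and v: "norm v \<le> 1" for u v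
    unfolding Q_def m_def sum_distrib_left
  proof (rule sum_norm_le)
    fix j assume j: "j \<in> J"
    have "norm (exp (of_nat j * v)) \<le> exp N" using j v by (intro norm_exp_le) auto
    then have "\<bar>b j * w j u\<bar> * (norm x^j * norm (exp (of_nat j * v))) \<le> (W * \<bar>b j\<bar>) * (norm x^j * exp N)"
      using W by (intro mult_mono[OF bw[OF j u]] mult_left_mono) auto
    then show "norm (of_real (b j * w j u) * (x^j * exp (of_nat j * v))) \<le> W * exp N * (\<bar>b j\<bar> * norm x^j)"
      by (simp only: norm_mult norm_power norm_of_real mult_ac)
  qed
  have QP: "norm (Q u v - P u) \<le> W * (N * exp N) * norm v * m" if u: "u \<in> {-1..1}" and v: "norm v \<le> 1" for u v
    unfolding Q_def P_def m_def sum_distrib_left sum_subtractf[symmetric]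
  proof (rule sum_norm_le)
    fix j assume j: "j \<in> J"
    have "norm (exp (of_nat j * v) - exp (of_nat j * 0)) \<le> N * exp N * norm (v - 0)"
      using j v by (intro exp_nat_mult_lipschitz) auto
    then have "\<bar>b j * w j u\<bar> * (norm x^j * norm (exp (of_nat j * v) - 1)) \<le> (W * \<bar>b j\<bar>) * (norm x^j * (N * exp N * norm v))"
      using W by (intro mult_mono[OF bw[OF j u]] mult_left_mono) auto
    moreover have "of_real (b j * w j u) * (x^j * exp (of_nat j * v)) - of_real (b j * w j u) * x^j
      = of_real (b j * w j u) * (x^j * (exp (of_nat j * v) - 1))" by (simp only: right_diff_distrib mult_1_right)
    ultimately show "norm (of_real (b j * w j u) * (x^j * exp (of_nat j * v)) - of_real (b j * w j u) * x^j)
        \<le> W * (N * exp N) * norm v * (\<bar>b j\<bar> * norm x^j)"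
      by (simp only: norm_mult norm_power norm_of_real mult_ac)
  qed
  have f_int: "f u = of_real u * integral {0..1} (\<lambda>t. F b x (u * t) (f (u * t)))"
    and g_int: "g u = of_real u * integral {0..1} (\<lambda>t. F e x (u * t) (g (u * t)))"
    if "u \<in> {-1..1}" for u
    unfolding f_def g_def using sol_integral_equation[OF b x that] sol_integral_equation[OF e x that] by auto
  have cF: "continuous_on {-1..1} (\<lambda>u. F b x u (f u))" "continuous_on {-1..1} (\<lambda>u. F e x u (g u))"
    unfolding f_def g_def by (intro sol_F_continuous b e x)+
  have cfg: "continuous_on {-1..1} f" "continuous_on {-1..1} g"
    unfolding f_def g_def by (intro section_continuous sol_continuous b e x)+
  let ?\<delta> = "\<lambda>u. norm (f u - g u)"
  have ZZ: "norm (Z b x u (f u) - Z e x u (g u)) \<le> E * norm x * ?\<delta> u + W * exp N * m" if u: "u \<in> {-1..1}" for u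
  proof -
    have eq: "Z b x u (f u) - Z e x u (g u) = (Z b x u (f u) - Z b x u (g u)) + Q u (g u)"
      by (simp add: ZQ[of u "g u"])
    show ?thesis unfolding eq
      using norm_triangle_ineq[of "Z b x u (f u) - Z b x u (g u)" "Q u (g u)"]
        Z_lipschitz[OF b x u f1[OF u] g1[OF u]] Qb[OF u g1[OF u]] by linarith
  qed
  have Zs: "norm (Z b x u (f u)) \<le> 1/16" "norm (Z e x u (g u)) \<le> 1/16" if "u \<in> {-1..1}" for u
    using Z_small[OF b x that f1[OF that]] Z_small[OF e x that g1[OF that]] by auto
  have FF: "norm (F b x u (f u) - F e x u (g u)) \<le> 1/4 * ?\<delta> u + 4 * \<theta> * (W * exp N * m)" if u: "u \<in> {-1..1}" for u
  proof -
    have "norm (F b x u (f u) - F e x u (g u)) \<le> 4 * \<theta> * norm (Z b x u (f u) - Z e x u (g u))"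
      unfolding F_def by (intro quotient_diff u Zs)
    also have "\<dots> \<le> 4 * \<theta> * (E * norm x * ?\<delta> u + W * exp N * m)"
      using \<theta> by (intro mult_left_mono ZZ u) auto
    also have "\<dots> = 4 * (\<theta> * (E * norm x)) * ?\<delta> u + 4 * \<theta> * (W * exp N * m)" by (simp add: algebra_simps)
    also have "\<dots> \<le> 4 * (1/16) * ?\<delta> u + 4 * \<theta> * (W * exp N * m)"
      by (intro add_right_mono mult_right_mono mult_left_mono \<theta>_small x) auto
    finally show ?thesis by simp
  qed
  \<comment> \<open>At a point of maximal difference the term \<open>1/4 * S\<close> of the integral
    estimate can be absorbed into the left-hand side.\<close>
  obtain u0 where u0: "u0 \<in> {-1..1}" "\<And>u. u \<in> {-1..1} \<Longrightarrow> ?\<delta> u \<le> ?\<delta> u0"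
  proof -
    have "continuous_on {-1..1} ?\<delta>" by (intro continuous_intros cfg)
    then have "\<exists>x\<in>{-1..1}. \<forall>y\<in>{-1..1}. ?\<delta> y \<le> ?\<delta> x"
      by (intro continuous_attains_sup) auto
    then show thesis using that by blast
  qed
  define S where "S = ?\<delta> u0"
  have S: "?\<delta> u \<le> S" if "u \<in> {-1..1}" for u using u0(2)[OF that] by (simp add: S_def)
  have S0: "S \<ge> 0" by (simp add: S_def)
  have "S \<le> 1/4 * S + 4 * \<theta> * (W * exp N * m)"
  proof -
    have sub: "(*) u0 ` {0..1} \<subseteq> {-1..1}" using unit_interval_scale[OF u0(1)] by blast
    have i: "(\<lambda>t. F b x (u0 * t) (f (u0 * t))) integrable_on {0..1}" "(\<lambda>t. F e x (u0 * t) (g (u0 * t))) integrable_on {0..1}"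
      by (rule integrable_continuous_interval, rule continuous_on_compose2[OF cF(1) _ sub], intro continuous_intros)
        (rule integrable_continuous_interval, rule continuous_on_compose2[OF cF(2) _ sub], intro continuous_intros)
    have "f u0 - g u0 = of_real u0 * integral {0..1} (\<lambda>t. F b x (u0 * t) (f (u0 * t)) - F e x (u0 * t) (g (u0 * t)))"
      unfolding integral_diff[OF i] right_diff_distrib f_int[OF u0(1), symmetric] g_int[OF u0(1), symmetric] ..
    also have "norm \<dots> \<le> 1/4 * S + 4 * \<theta> * (W * exp N * m)"
    proof (rule radial_integral_bound[of "\<lambda>u. F b x u (f u) - F e x u (g u)", OF _ u0(1)])
      show "continuous_on {- 1..1} (\<lambda>u. F b x u (f u) - F e x u (g u))" by (intro continuous_intros cF)
      show "norm (F b x u (f u) - F e x u (g u)) \<le> 1/4 * S + 4 * \<theta> * (W * exp N * m)" if "u \<in> {-1..1}" for u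
        using FF[OF that] S[OF that] by linarith
    qed
    finally show ?thesis by (simp add: S_def)
  qed
  then have Sm: "S \<le> 8 * \<theta> * W * exp N * m"
  proof -
    assume a: "S \<le> 1/4 * S + 4 * \<theta> * (W * exp N * m)"
    have "\<theta> * (W * exp N * m) \<ge> 0" using \<theta> W m by (intro mult_nonneg_nonneg) auto
    moreover have "8 * \<theta> * W * exp N * m = 8 * (\<theta> * (W * exp N * m))" by simp
    ultimately show ?thesis using a by linarith
  qed
  have gb: "norm (g u) \<le> 4 * \<theta> * E * norm x" if u: "u \<in> {-1..1}" for u
    unfolding g_int[OF u]
    by (rule radial_integral_bound[of "\<lambda>u. F e x u (g u)", OF cF(2) u]) (intro F_bound e x g1)
  have main: "norm (F b x u (f u) - F e x u (g u) - of_real \<theta> * P u) \<le> A / 2 * norm x * m" if u: "u \<in> {-1..1}" for u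
  proof -
    let ?Z = "Z b x u (f u)" and ?Y = "Z e x u (g u)" and ?u = "of_real u :: complex"
    let ?q = "(1 + ?u * ?Z) * (1 + ?u * ?Y)"
    have nz: "1 + ?u * ?Z \<noteq> 0" "1 + ?u * ?Y \<noteq> 0" using denom_bound[OF u] Zs[OF u] by auto
    have q: "norm ?q \<ge> 1/4"
      unfolding norm_mult using mult_mono[of "1/2" "norm (1 + ?u * ?Z)" "1/2" "norm (1 + ?u * ?Y)"]
        denom_bound(2)[OF u] Zs[OF u] by simp
    have zy: "norm (?u * ?Z) \<le> E * norm x" "norm (?u * ?Y) \<le> E * norm x"
      using denom_bound(1)[OF u] Zs[OF u] Z_bound[OF b x u f1[OF u]] Z_bound[OF e x u g1[OF u]] order_trans by blast+
    have q1: "norm (1 - ?q) \<le> 3 * (E * norm x)"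
    proof -
      have "1 - ?q = - (?u * ?Z + ?u * ?Y + ?u * ?Z * (?u * ?Y))" by (simp add: algebra_simps)
      then have "norm (1 - ?q) \<le> norm (?u * ?Z) + norm (?u * ?Y) + norm (?u * ?Z) * norm (?u * ?Y)"
        using norm_triangle_ineq[of "?u * ?Z + ?u * ?Y" "?u * ?Z * (?u * ?Y)"] norm_triangle_ineq[of "?u * ?Z" "?u * ?Y"]
        by (simp only: norm_minus_cancel norm_mult)
      moreover have "norm (?u * ?Z) * norm (?u * ?Y) \<le> (E * norm x) * 1"
        using zy E_small[OF x] E by (intro mult_mono) auto
      ultimately show ?thesis using zy by linarith
    qed
    have D: "norm (?Z - ?Y) \<le> (E * (8 * \<theta> * W * exp N) + W * exp N) * m"
    proof -
      have "E * norm x * ?\<delta> u \<le> E * 1 * (8 * \<theta> * W * exp N * m)"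
        using E x R(2) S[OF u] Sm by (intro mult_mono) auto
      then show ?thesis using ZZ[OF u] by (simp add: algebra_simps)
    qed
    have ZP: "norm (?Z - ?Y - P u) \<le> (E * (8 * \<theta> * W * exp N) + W * (N * exp N) * (4 * \<theta> * E)) * norm x * m"
    proof -
      have "?Z - ?Y - P u = (?Z - Z b x u (g u)) + (Q u (g u) - P u)" by (simp add: ZQ[of u "g u"])
      then have "norm (?Z - ?Y - P u) \<le> norm (?Z - Z b x u (g u)) + norm (Q u (g u) - P u)"
        by (simp only: norm_triangle_ineq)
      moreover have "norm (?Z - Z b x u (g u)) \<le> E * norm x * (8 * \<theta> * W * exp N * m)"
        using E S[OF u] Sm by (intro order_trans[OF Z_lipschitz[OF b x u f1[OF u] g1[OF u]]] mult_left_mono) auto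
      moreover have "norm (Q u (g u) - P u) \<le> W * (N * exp N) * (4 * \<theta> * E * norm x) * m"
        using W m by (intro order_trans[OF QP[OF u g1[OF u]]] mult_right_mono mult_left_mono gb u) auto
      ultimately show ?thesis by (simp add: algebra_simps)
    qed
    \<comment> \<open>Both quotients are put over the common denominator \<open>?q\<close>; then
      \<open>1 / ?q\<close> is replaced by 1 at the cost of \<open>(1 - ?q) / ?q\<close>.\<close>
    have "F b x u (f u) - F e x u (g u) = of_real \<theta> * (?Z - ?Y) / ?q"
      unfolding F_def using nz by (simp add: divide_simps) (simp add: algebra_simps)
    moreover have "a * d / q - a * p = a * ((d - p) + d * (1 - q) / q)" if "q \<noteq> 0" for a d p q :: complex
      using that by (simp add: field_simps)
    moreover have "?q \<noteq> 0" using nz by simp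
    ultimately have eq: "F b x u (f u) - F e x u (g u) - of_real \<theta> * P u
        = of_real \<theta> * ((?Z - ?Y - P u) + (?Z - ?Y) * (1 - ?q) / ?q)" by (simp only:) blast
    have t2: "norm ((?Z - ?Y) * (1 - ?q) / ?q) \<le> 12 * E * (E * (8 * \<theta> * W * exp N) + W * exp N) * norm x * m"
    proof -
      have "norm ((?Z - ?Y) * (1 - ?q) / ?q) \<le> norm ((?Z - ?Y) * (1 - ?q)) / (1/4)"
        unfolding norm_divide using q nz by (intro divide_left_mono) auto
      also have "\<dots> = 4 * (norm (?Z - ?Y) * norm (1 - ?q))" by (simp add: norm_mult)
      also have "\<dots> \<le> 4 * (((E * (8 * \<theta> * W * exp N) + W * exp N) * m) * (3 * (E * norm x)))"
        using D q1 E \<theta> W m by (intro mult_left_mono mult_mono) auto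
      finally show ?thesis by (simp add: algebra_simps)
    qed
    have "norm (F b x u (f u) - F e x u (g u) - of_real \<theta> * P u)
        \<le> \<theta> * (norm (?Z - ?Y - P u) + norm ((?Z - ?Y) * (1 - ?q) / ?q))"
      unfolding eq norm_mult[of "of_real \<theta>"] norm_of_real using \<theta>
      by (simp only: abs_of_pos) (intro mult_left_mono norm_triangle_ineq, simp)
    also have "\<dots> \<le> \<theta> * ((E * (8 * \<theta> * W * exp N) + W * (N * exp N) * (4 * \<theta> * E)) * norm x * m
        + 12 * E * (E * (8 * \<theta> * W * exp N) + W * exp N) * norm x * m)"
      using \<theta> ZP t2 by (intro mult_left_mono add_mono) auto
    also have "\<dots> = A / 2 * norm x * m" by (simp add: A_def algebra_simps)
    finally show ?thesis .
  qed
  obtain I where I: "\<And>j u. u \<in> {-1..1} \<Longrightarrow> (I j has_vector_derivative w j u) (at u within {-1..1})"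
  proof -
    have "\<forall>j. \<exists>I. \<forall>u\<in>{-1..1}. (I has_vector_derivative w j u) (at u within {-1..1})"
      using antiderivative_continuous[OF contw] by metis
    then show thesis using that by metis
  qed
  have intw: "integral {-1..1} (w j) = I j 1 - I j (-1)" for j
    by (rule integral_unique, rule fundamental_theorem_of_calculus) (use I in auto)
  \<comment> \<open>What is left of \<open>f - g\<close> after subtracting the first-order term; its
    derivative is bounded by \<open>main\<close>, so the mean value inequality applies between the
    ends.\<close>
  define h where "h = (\<lambda>u. f u - g u - of_real \<theta> * (\<Sum>j\<in>J. of_real (b j) * x^j * of_real (I j u)))"
  have dh: "(h has_vector_derivative (F b x u (f u) - F e x u (g u) - of_real \<theta> * P u)) (at u within {-1..1})"
    if u: "u \<in> {-1..1}" for u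
  proof -
    have "((\<lambda>u. of_real (b j) * x^j * of_real (I j u)) has_vector_derivative of_real (b j * w j u) * x^j) (at u within {-1..1})" for j
    proof -
      have "((\<lambda>u. complex_of_real (I j u)) has_vector_derivative of_real (w j u)) (at u within {-1..1})"
        by (rule bounded_linear.has_vector_derivative[OF bounded_linear_of_real I[OF u]])
      from has_vector_derivative_mult_right[OF this, of "of_real (b j) * x^j"]
      show ?thesis by (simp add: mult_ac)
    qed
    then have "((\<lambda>u. \<Sum>j\<in>J. of_real (b j) * x^j * of_real (I j u)) has_vector_derivative P u) (at u within {-1..1})"
      unfolding P_def by (intro has_vector_derivative_sum)
    then show ?thesis unfolding h_def f_def g_def
      by (intro has_vector_derivative_diff sol_ode has_vector_derivative_mult_right b e x u)
  qed
  have "norm (h 1 - h (-1)) \<le> A / 2 * norm x * m * norm (1 - (-1::real))"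
  proof (rule differentiable_bound[of "{-1..1}" _ "\<lambda>u s. s *\<^sub>R (F b x u (f u) - F e x u (g u) - of_real \<theta> * P u)"])
    show "onorm (\<lambda>s. s *\<^sub>R (F b x u (f u) - F e x u (g u) - of_real \<theta> * P u)) \<le> A / 2 * norm x * m"
      if "u \<in> {-1..1}" for u
    proof (rule onorm_le)
      fix s :: real
      show "norm (s *\<^sub>R (F b x u (f u) - F e x u (g u) - of_real \<theta> * P u)) \<le> A / 2 * norm x * m * norm s"
        using mult_left_mono[OF main[OF that], of "\<bar>s\<bar>"] by (simp only: norm_scaleR real_norm_def mult.commute abs_ge_zero)
    qed
  qed (use dh in \<open>auto simp: has_vector_derivative_def\<close>)
  moreover have "h 1 - h (-1) = disp b x - (\<Sum>j\<in>J. of_real (C j * b j) * x^j)"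
  proof -
    \<comment> \<open>The solution for the even coefficients has no displacement, so only
      \<open>disp b x\<close> and the main term survive in the difference of
      \<open>h\<close>.\<close>
    have "g 1 - g (-1) = 0"
      using disp_eq_0[OF e _ x] by (auto simp: g_def disp_def e_def evenpart_def)
    moreover have "of_real \<theta> * (\<Sum>j\<in>J. of_real (b j) * x^j * of_real (I j 1)) -
        of_real \<theta> * (\<Sum>j\<in>J. of_real (b j) * x^j * of_real (I j (-1))) = (\<Sum>j\<in>J. of_real (C j * b j) * x^j)"
      unfolding sum_distrib_left sum_subtractf[symmetric] C_def intw
      by (rule sum.cong) (simp_all add: algebra_simps)
    ultimately show ?thesis by (simp add: h_def f_def disp_def algebra_simps)
  qed
  ultimately show ?thesis by (simp add: m_def)
qed

end

section \<open>Real trajectories and the order of their labels\<close>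

context angular
begin

definition S :: "(nat \<Rightarrow> real) \<Rightarrow> real \<Rightarrow> real \<Rightarrow> real" where
  "S b s u = (\<Sum>j=1..N. b j * s ^ j * w j u)"

text \<open>The value of \<open>\<tau>\<close> at the angle \<open>u\<close> on the trajectory that
  has \<open>\<tau> = t\<close> at \<open>u = 0\<close>.\<close>

definition sig :: "(nat \<Rightarrow> real) \<Rightarrow> real \<Rightarrow> real \<Rightarrow> real" where
  "sig b t u = t * exp (Re (sol b (of_real t) u))"

lemma Z_sig:
  assumes "adm b" "0 < t" "t < R" "u \<in> {-1..1}"
  shows "Z b (of_real t) u (sol b (of_real t) u) = of_real (S b (sig b t u) u)"
proof -
  have "sol b (of_real t) u \<in> \<real>" using assms by (intro sol_real) auto
  then obtain v where v: "sol b (of_real t) u = of_real v" by (auto simp: Reals_def)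
  have "of_real (b j * w j u) * (of_real t ^ j * exp (of_nat j * of_real v))
      = (of_real (b j * (t * exp v) ^ j * w j u) :: complex)" for j
  proof -
    have "exp (of_nat j * of_real v) = (of_real (exp v ^ j) :: complex)"
      by (metis exp_of_nat_mult exp_of_real of_real_power)
    then show ?thesis by (simp add: power_mult_distrib)
  qed
  then show ?thesis unfolding Z_def S_def sig_def v of_real_sum Re_complex_of_real by (simp only:)
qed

lemma S_small:
  assumes "adm b" "0 < t" "t < R" "u \<in> {-1..1}"
  shows "\<bar>S b (sig b t u) u\<bar> \<le> 1/16"
proof -
  have "norm (Z b (of_real t) u (sol b (of_real t) u)) \<le> 1/16"
    using assms by (intro Z_small sol_bound) auto
  then show ?thesis by (simp add: Z_sig[OF assms])
qed

lemma sig_derivative: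
  assumes "adm b" "0 < t" "t < R" "u \<in> {-1..1}"
  shows "(sig b t has_real_derivative
      sig b t u * (\<theta> * S b (sig b t u) u / (1 + u * S b (sig b t u) u))) (at u within {-1..1})"
proof -
  let ?S = "S b (sig b t u) u"
  have t: "norm (of_real t :: complex) < R" using assms by simp
  have "F b (of_real t) u (sol b (of_real t) u) = of_real (\<theta> * ?S / (1 + u * ?S))"
    unfolding F_def Z_sig[OF assms] by simp
  then have "((\<lambda>u. Re (sol b (of_real t) u)) has_real_derivative \<theta> * ?S / (1 + u * ?S)) (at u within {-1..1})"
    using bounded_linear.has_vector_derivative[OF bounded_linear_Re sol_ode[OF assms(1) t assms(4)]]
    by (simp add: has_real_derivative_iff_has_vector_derivative)
  then have "((\<lambda>u. t * exp (Re (sol b (of_real t) u))) has_real_derivative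
      t * (exp (Re (sol b (of_real t) u)) * (\<theta> * ?S / (1 + u * ?S)))) (at u within {-1..1})"
    by (intro DERIV_cmult DERIV_chain2[OF DERIV_exp])
  then show ?thesis unfolding sig_def[abs_def] mult.assoc .
qed

lemma sig_bounds:
  assumes "adm b" "0 < t" "t < R" "u \<in> {-1..1}"
  shows "t * exp (-1) \<le> sig b t u" "sig b t u \<le> t * exp 1" "0 < sig b t u"
proof -
  have "\<bar>Re (sol b (of_real t) u)\<bar> \<le> 1"
    using assms by (intro order_trans[OF abs_Re_le_cmod] sol_bound) auto
  then show "t * exp (-1) \<le> sig b t u" "sig b t u \<le> t * exp 1" "0 < sig b t u"
    using assms by (auto simp: sig_def)
qed

lemma sig_0: "adm b \<Longrightarrow> 0 < t \<Longrightarrow> t < R \<Longrightarrow> sig b t 0 = t"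
  by (simp add: sig_def sol_0)

lemma sig_continuous_label:
  assumes "adm b" "u \<in> {-1..1}"
  shows "continuous_on {0<..<R} (\<lambda>t. sig b t u)"
  unfolding sig_def
  by (intro continuous_intros continuous_on_compose2[OF holomorphic_on_imp_continuous_on[OF sol_holomorphic[OF assms]]])
    auto

lemma sig_continuous:
  assumes "adm b" "0 < t" "t < R"
  shows "continuous_on {-1..1} (sig b t)"
  by (rule DERIV_continuous_on[OF sig_derivative[OF assms]])

text \<open>The logarithm of \<open>sig\<close> is \<open>ln t\<close> plus the real part of the
  solution. Cauchy's estimate bounds the derivative of the solution by \<open>2 / R\<close>, and the
  slope of the logarithm exceeds this for arguments below \<open>R / 2\<close>.\<close>

lemma sig_mono:
  assumes b: "adm b" and t: "0 < t" "t < t'" "t' < R / 2" and u: "u \<in> {-1..1}"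
  shows "sig b t u < sig b t' u"
proof -
  let ?f = "\<lambda>x. sol b x u"
  have hol: "?f holomorphic_on ball 0 R" by (rule sol_holomorphic[OF b u])
  have "norm (?f (of_real t') - ?f (of_real t)) \<le> 2 / R * norm (of_real t' - of_real t :: complex)"
  proof (rule differentiable_bound[of "ball 0 (R / 2)" _ "\<lambda>x h. deriv ?f x * h"])
    fix x :: complex assume x: "x \<in> ball 0 (R / 2)"
    have sub: "cball x (R / 2) \<subseteq> ball 0 R"
      using x by (auto simp: cball_subset_ball_iff)
    have "(?f has_field_derivative deriv ?f x) (at x within ball 0 (R / 2))"
      using x R by (intro holomorphic_derivI[OF hol open_ball]) auto
    then show "(?f has_derivative (\<lambda>h. deriv ?f x * h)) (at x within ball 0 (R / 2))"
      by (simp add: has_field_derivative_def)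
    have "norm ((deriv ^^ 1) ?f x) \<le> fact 1 * 1 / (R / 2) ^ 1"
    proof (rule Cauchy_inequality)
      show "?f holomorphic_on ball x (R / 2)"
        using hol sub by (meson ball_subset_cball holomorphic_on_subset order_trans)
      show "continuous_on (cball x (R / 2)) ?f"
        using hol sub by (meson holomorphic_on_imp_continuous_on continuous_on_subset)
      show "norm (?f y) \<le> 1" if "norm (x - y) = R / 2" for y
      proof -
        have "y \<in> cball x (R / 2)" using that by (simp add: dist_norm)
        then have "y \<in> ball 0 R" using sub by blast
        then show ?thesis using u by (intro sol_bound b) auto
      qed
    qed (use R in auto)
    then have "norm (deriv ?f x) \<le> 2 / R" by simp
    then show "onorm (\<lambda>h. deriv ?f x * h) \<le> 2 / R"
      by (intro onorm_le) (simp only: norm_mult mult_right_mono norm_ge_zero)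
  qed (use t in auto)
  then have "\<bar>Re (?f (of_real t')) - Re (?f (of_real t))\<bar> \<le> 2 / R * (t' - t)"
    using t abs_Re_le_cmod[of "?f (of_real t') - ?f (of_real t)"]
    by (simp flip: of_real_diff)
  moreover have "2 / R * (t' - t) < ln t' - ln t"
  proof -
    have "0 < t / t'" "t / t' \<noteq> 1" using t by auto
    then have "ln (t / t') < t / t' - 1"
      using ln_le_minus_one[of "t / t'"] ln_eq_minus_one[of "t / t'"] by linarith
    then have "1 - t / t' < ln t' - ln t" using t by (simp add: ln_div)
    moreover have "1 - t / t' = (t' - t) / t'" using t by (simp add: diff_divide_distrib)
    moreover have "2 / R * (t' - t) \<le> (t' - t) / t'"
    proof -
      have "2 / R \<le> 1 / t'" using t R(1) by (simp add: field_simps)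
      then show ?thesis using mult_right_mono[of "2 / R" "1 / t'" "t' - t"] t by simp
    qed
    ultimately show ?thesis by linarith
  qed
  ultimately have "ln t + Re (?f (of_real t)) < ln t' + Re (?f (of_real t'))" by linarith
  then have "exp (ln t + Re (?f (of_real t))) < exp (ln t' + Re (?f (of_real t')))" by simp
  then show ?thesis using t by (simp add: sig_def exp_add)
qed

text \<open>Since \<open>sol\<close> is bounded by 1, a label differs from the value of
  \<open>\<tau>\<close> by a factor of at most \<open>exp 1\<close>, and the intermediate value
  theorem finds it in that range.\<close>

lemma sig_surj:
  assumes b: "adm b" and s: "0 < s" "s * exp 1 < R" and u: "u \<in> {-1..1}"
  obtains t where "s * exp (-1) \<le> t" "t \<le> s * exp 1" "0 < t" "sig b t u = s"
proof -
  have pos: "0 < s * exp (-1)" using s by simp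
  have le: "s * exp (-1) \<le> s * exp 1" using s by simp
  have lt: "s * exp (-1) < R" using le s by linarith
  have "sig b (s * exp (-1)) u \<le> s * exp (-1) * exp 1" by (intro sig_bounds b u pos lt)
  then have 1: "sig b (s * exp (-1)) u \<le> s" by (simp add: mult.assoc flip: exp_add)
  have "s * exp 1 * exp (-1) \<le> sig b (s * exp 1) u" using s by (intro sig_bounds b u) auto
  then have 2: "s \<le> sig b (s * exp 1) u" by (simp add: mult.assoc flip: exp_add)
  have "continuous_on {s * exp (-1)..s * exp 1} (\<lambda>t. sig b t u)"
    by (rule continuous_on_subset[OF sig_continuous_label[OF b u]])
      (intro subsetI, simp only: atLeastAtMost_iff greaterThanLessThan_iff, use pos s(2) in linarith)
  from IVT'[OF 1 2 le this] obtain t where "s * exp (-1) \<le> t" "t \<le> s * exp 1" "sig b t u = s" by blast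
  then show thesis using pos by (intro that[of t]) linarith+
qed

lemma disp_sig:
  assumes "adm b" "0 < t" "t < R"
  shows "disp b (of_real t) = 0 \<longleftrightarrow> sig b t 1 = sig b t (-1)"
    and "Re (disp b (of_real t)) > 0 \<longleftrightarrow> sig b t 1 > sig b t (-1)"
proof -
  have "disp b (of_real t) \<in> \<real>" using assms by (intro disp_real) auto
  then have "disp b (of_real t) = 0 \<longleftrightarrow> Re (disp b (of_real t)) = 0" by (auto simp: Reals_def)
  then show "disp b (of_real t) = 0 \<longleftrightarrow> sig b t 1 = sig b t (-1)"
    using assms by (simp add: disp_def sig_def)
  show "Re (disp b (of_real t)) > 0 \<longleftrightarrow> sig b t 1 > sig b t (-1)"
    using assms by (simp add: disp_def sig_def)
qed

text \<open>For small \<open>t\<close> the term of index \<open>d\<close> outweighs the higher terms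
  and the error, all of which are of order \<open>t ^ Suc d\<close>.\<close>

lemma disp_pos_near_0:
  assumes b: "adm b" and d: "d \<in> J" "b d > 0" "C d > 0" "\<And>j. odd j \<Longrightarrow> j < d \<Longrightarrow> b j = 0"
  obtains \<rho> where "\<rho> > 0" "\<rho> \<le> R" "\<And>t. 0 < t \<Longrightarrow> t < \<rho> \<Longrightarrow> Re (disp b (of_real t)) > 0"
proof -
  define M where "M = (\<Sum>j\<in>J. \<bar>b j\<bar>)"
  define M' where "M' = (\<Sum>j\<in>J. \<bar>C j * b j\<bar>)"
  have M: "M \<ge> 0" "M' \<ge> 0" by (auto simp: M_def M'_def intro: sum_nonneg)
  define \<rho> where "\<rho> = min R (C d * b d / (M' + A * M + 1))"
  have den: "M' + A * M + 1 > 0" using M A_nonneg by (intro add_nonneg_pos add_nonneg_nonneg mult_nonneg_nonneg) auto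
  show thesis
  proof (rule that[of \<rho>])
    show "\<rho> > 0" using R(1) d den by (simp add: \<rho>_def)
    show "\<rho> \<le> R" by (simp add: \<rho>_def)
    fix t :: real assume t: "0 < t" "t < \<rho>"
    then have tR: "t < R" "t < C d * b d / (M' + A * M + 1)" by (auto simp: \<rho>_def)
    then have t1: "t \<le> 1" using R(2) by linarith
    have td: "t * (M' + A * M + 1) < C d * b d" using tR(2) den by (simp add: pos_less_divide_eq)
    let ?x = "of_real t :: complex"
    have s1: "(\<Sum>j\<in>J. \<bar>b j\<bar> * norm ?x^j) \<le> M * t^d"
      unfolding M_def sum_distrib_right
    proof (rule sum_mono)
      fix j assume "j \<in> J"
      then show "\<bar>b j\<bar> * norm ?x^j \<le> \<bar>b j\<bar> * t^d"
        using t t1 d(4)[of j] by (cases "j < d") (auto intro!: mult_left_mono power_decreasing)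
    qed
    have s2: "\<bar>(\<Sum>j\<in>J. C j * b j * t^j) - C d * b d * t^d\<bar> \<le> M' * t^Suc d"
    proof -
      have "(\<Sum>j\<in>J. C j * b j * t^j) - C d * b d * t^d = (\<Sum>j\<in>J - {d}. C j * b j * t^j)"
        using d(1) by (simp add: sum.remove)
      also have "\<bar>\<dots>\<bar> \<le> (\<Sum>j\<in>J - {d}. \<bar>C j * b j\<bar> * t^Suc d)"
      proof (rule order_trans[OF sum_abs sum_mono])
        fix j assume j: "j \<in> J - {d}"
        show "\<bar>C j * b j * t^j\<bar> \<le> \<bar>C j * b j\<bar> * t^Suc d"
        proof (cases "j < d")
          case True
          then have "b j = 0" using j d(4) by auto
          then show ?thesis by simp
        next
          case False
          then have "Suc d \<le> j" using j by auto
          then have "t^j \<le> t^Suc d" using t t1 by (intro power_decreasing) auto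
          moreover have "\<bar>C j * b j * t^j\<bar> = \<bar>C j * b j\<bar> * t^j" using t by (simp add: abs_mult)
          ultimately show ?thesis using mult_left_mono[of "t^j" "t^Suc d" "\<bar>C j * b j\<bar>"] by simp
        qed
      qed
      also have "\<dots> = (\<Sum>j\<in>J - {d}. \<bar>C j * b j\<bar>) * t^Suc d" by (simp only: sum_distrib_right)
      also have "\<dots> \<le> M' * t^Suc d"
        unfolding M'_def using t by (intro mult_right_mono sum_mono2) auto
      finally show ?thesis .
    qed
    have "norm ?x < R" using t tR by simp
    from disp_estimate[OF b this]
    have "norm (disp b ?x - of_real (\<Sum>j\<in>J. C j * b j * t^j)) \<le> A * t * (M * t^d)"
      using mult_left_mono[OF s1, of "A * t"] A_nonneg t by simp
    then have "\<bar>Re (disp b ?x) - (\<Sum>j\<in>J. C j * b j * t^j)\<bar> \<le> A * t * (M * t^d)"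
      using abs_Re_le_cmod[of "disp b ?x - of_real (\<Sum>j\<in>J. C j * b j * t^j)"]
      by (simp only: minus_complex.sel Re_complex_of_real)
    then have "Re (disp b ?x) \<ge> C d * b d * t^d - M' * t^Suc d - A * t * (M * t^d)"
      using s2 by linarith
    moreover have "C d * b d * t^d - M' * t^Suc d - A * t * (M * t^d) = t^d * (C d * b d - t * (M' + A * M))"
      by (simp add: algebra_simps)
    moreover have "t^d * (C d * b d - t * (M' + A * M)) > 0"
      using td t by (intro mult_pos_pos) (auto simp: algebra_simps)
    ultimately show "Re (disp b ?x) > 0" by linarith
  qed
qed

end

section \<open>Weighted polar coordinates\<close>

lemma powr_inverse_power: "a \<ge> 0 \<Longrightarrow> n > 0 \<Longrightarrow> (a powr (1 / real n)) ^ n = a"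
  by (cases "a = 0") (simp_all add: powr_realpow[symmetric] powr_powr)

text \<open>Here \<open>r1 = 2 * l1 - 1\<close> and \<open>r2 = 2 * l2 - 1\<close>. The paper's generalized trigonometric functions
  are avoided by using \<open>u = x / rad ^ l1 \<in> [-1, 1]\<close> itself as the angular variable of each half-plane,
  and \<open>tau = rad ^ (- s)\<close> as the distance to infinity; in these variables every term of the
  system has the form \<open>b j * tau ^ j * w j u\<close>.\<close>

locale polar =
  fixes p q r1 r2 l1 l2 :: nat
  assumes r1: "Suc r1 = 2 * l1" and r2: "Suc r2 = 2 * l2"
    and odd_p: "odd p" and odd_q: "odd q" and weights: "l2 * p < l1 * q"
begin

definition N :: nat where "N = r2 div q"
definition s :: nat where "s = l1 * q - l2 * p"
text \<open>Makes \<open>H\<close> a first integral of the leading part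
  \<open>x' = - y ^ r1\<close>, \<open>y' = x ^ r2\<close>.\<close>

definition \<kappa> :: real where "\<kappa> = real l2 / real l1"
text \<open>The exponent in \<open>tau = 1 / rad ^ s\<close>, divided by the \<open>l1\<close> that
  appears in the logarithmic derivative \<open>k * S / l1\<close> of \<open>rad\<close>.\<close>

definition \<theta> :: real where "\<theta> = real s / real l1"
definition H :: "real \<times> real \<Rightarrow> real" where "H z = fst z ^ (2 * l2) + \<kappa> * snd z ^ (2 * l1)"
definition rad :: "real \<times> real \<Rightarrow> real" where "rad z = H z powr (1 / real (2 * l1 * l2))"
definition tau :: "real \<times> real \<Rightarrow> real" where "tau z = 1 / rad z ^ s"
definition xi :: "real \<times> real \<Rightarrow> real" where "xi z = fst z / rad z ^ l1"
text \<open>The ordinate of the point with abscissa \<open>u\<close> on the upper half of the oval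
  \<open>H = 1\<close>. Its slope is infinite at both ends, so the angular equation is merely
  continuous in \<open>u\<close> there.\<close>

definition eta :: "real \<Rightarrow> real" where "eta u = ((1 - u ^ (2 * l2)) / \<kappa>) powr (1 / real (2 * l1))"
definition w :: "nat \<Rightarrow> real \<Rightarrow> real" where "w j u = u ^ (r2 - j * q) * eta u ^ (j * p)"
text \<open>The inverse of \<open>(tau, xi)\<close> on the closed upper half-plane without the
  origin, by \<open>pt_tau_xi\<close> and \<open>pt_props\<close>.\<close>

definition pt :: "real \<Rightarrow> real \<Rightarrow> real \<times> real" where
  "pt t u = ((t powr (- 1 / real s)) ^ l1 * u, (t powr (- 1 / real s)) ^ l2 * eta u)"

lemma l: "l1 \<ge> 1" "l2 \<ge> 1" using r1 r2 by (cases l1; cases l2; simp)+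

lemma s: "s > 0" using weights by (simp add: s_def)

lemma pq: "p \<ge> 1" "q \<ge> 1" using odd_p odd_q by (cases p; cases q; simp)+

lemma \<kappa>: "\<kappa> > 0" using l by (simp add: \<kappa>_def)
lemma \<theta>: "\<theta> > 0" using l s by (simp add: \<theta>_def)

lemma N_le: "j \<le> N \<Longrightarrow> j * q \<le> r2"
  unfolding N_def by (metis div_times_less_eq_dividend le_trans mult_le_mono1)

lemma even_2l: "even (2 * l1)" "even (2 * l2)" by simp_all

lemma H_nonneg: "H z \<ge> 0"
  unfolding H_def using \<kappa> by (intro add_nonneg_nonneg mult_nonneg_nonneg zero_le_even_power) auto

lemma H_pos: "z \<noteq> 0 \<Longrightarrow> H z > 0"
proof -
  assume "z \<noteq> 0"
  then have "fst z \<noteq> 0 \<or> snd z \<noteq> 0" by (cases z) (auto simp: zero_prod_def)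
  then have "H z \<noteq> 0"
    unfolding H_def using \<kappa> l zero_le_even_power[OF even_2l(1), of "snd z"] zero_le_even_power[OF even_2l(2), of "fst z"]
    by (auto simp: add_nonneg_eq_0_iff)
  then show ?thesis using H_nonneg[of z] by simp
qed

lemma rad_pos: "z \<noteq> 0 \<Longrightarrow> rad z > 0"
  using H_pos[of z] by (simp add: rad_def)

lemma rad_power: "z \<noteq> 0 \<Longrightarrow> rad z ^ (2 * l1 * l2) = H z"
  unfolding rad_def using H_pos[of z] l by (intro powr_inverse_power) auto

lemma tau_pos: "z \<noteq> 0 \<Longrightarrow> tau z > 0"
  using rad_pos[of z] by (simp add: tau_def)

lemma H_minus: "H (- z) = H z" by (simp add: H_def)
lemma rad_minus: "rad (- z) = rad z" by (simp add: rad_def H_minus)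
lemma tau_minus: "tau (- z) = tau z" by (simp add: tau_def rad_minus)
lemma xi_minus: "xi (- z) = - xi z" by (simp add: xi_def rad_minus)

lemma xi_power: "z \<noteq> 0 \<Longrightarrow> xi z ^ (2 * l2) = fst z ^ (2 * l2) / H z"
  using rad_power[of z] by (simp add: xi_def power_divide mult_ac flip: power_mult)

lemma xi_range: "z \<noteq> 0 \<Longrightarrow> xi z \<in> {-1..1}"
proof -
  assume z: "z \<noteq> 0"
  have "xi z ^ (2 * l2) \<le> 1"
    unfolding xi_power[OF z] using H_pos[OF z] \<kappa> zero_le_even_power[OF even_2l(1), of "snd z"]
    by (simp add: H_def)
  then have "\<bar>xi z\<bar> ^ (2 * l2) \<le> 1" by (simp add: power_even_abs)
  then have "\<bar>xi z\<bar> \<le> 1" using l power_le_one_iff[of "\<bar>xi z\<bar>" "2 * l2"] by simp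
  then show ?thesis by auto
qed

lemma eta_nonneg: "eta u \<ge> 0" by (simp add: eta_def)

lemma eta_minus: "eta (- u) = eta u" by (simp add: eta_def)

lemma one_minus_power: "u \<in> {-1..1} \<Longrightarrow> (0::real) \<le> 1 - u ^ (2 * l2)"
  using power_le_one[of "\<bar>u\<bar>" "2 * l2"] by (simp add: power_even_abs abs_le_iff)

lemma eta_power: "u \<in> {-1..1} \<Longrightarrow> eta u ^ (2 * l1) = (1 - u ^ (2 * l2)) / \<kappa>"
proof -
  assume u: "u \<in> {-1..1}"
  then have "(1 - u ^ (2 * l2)) / \<kappa> \<ge> 0" using one_minus_power[OF u] \<kappa> by simp
  then show ?thesis unfolding eta_def using l by (intro powr_inverse_power) auto
qed

lemma eta_pos: "\<bar>u\<bar> < 1 \<Longrightarrow> eta u > 0"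
proof -
  assume u: "\<bar>u\<bar> < 1"
  then have "\<bar>u\<bar> ^ (2 * l2) < 1" using l by (intro power_Suc_less_one power_less_one_iff[THEN iffD2]) auto
  then have "u ^ (2 * l2) < 1" by (simp add: power_even_abs)
  then show ?thesis using \<kappa> by (simp add: eta_def)
qed

lemma eta_continuous: "continuous_on {-1..1} eta"
  unfolding eta_def
  by (rule continuous_on_powr') (use \<kappa> l one_minus_power in \<open>auto intro!: continuous_intros\<close>)

lemma w_continuous: "continuous_on {-1..1} (w j)"
  unfolding w_def by (intro continuous_intros eta_continuous)

text \<open>As \<open>r2\<close> and \<open>q\<close> are odd, \<open>r2 - j * q\<close> and
  \<open>j\<close> have opposite parities, and \<open>eta\<close> is even.\<close>

lemma w_minus: "j \<in> {1..N} \<Longrightarrow> w j (- u) = (-1) ^ Suc j * w j u"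
proof -
  assume j: "j \<in> {1..N}"
  have "even (r2 - j * q) \<longleftrightarrow> odd j"
    using N_le[of j] j odd_q r2 by (auto simp: even_diff_nat) presburger+
  then have "(- u) ^ (r2 - j * q) = (-1) ^ Suc j * u ^ (r2 - j * q)"
    by (cases "even j") auto
  then show ?thesis by (simp add: w_def eta_minus)
qed

text \<open>For odd \<open>j\<close> the exponent of \<open>u\<close> is even, so \<open>w j\<close>
  is nonnegative, and it is positive at 1/2. This is the source of the sign of
  \<open>C j\<close>.\<close>

lemma w_integral_pos:
  assumes j: "j \<in> {1..N}" "odd j"
  shows "integral {-1..1} (w j) > 0"
proof -
  have ev: "even (r2 - j * q)"
    using N_le[of j] j odd_q r2 by (auto simp: even_diff_nat) presburger+
  have nonneg: "w j u \<ge> 0" for u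
    unfolding w_def using ev eta_nonneg by (intro mult_nonneg_nonneg zero_le_even_power zero_le_power)
  have pos: "w j (1/2) > 0" unfolding w_def using eta_pos[of "1/2"] by (intro mult_pos_pos zero_less_power) auto
  have int: "w j integrable_on {-1..1}" by (intro integrable_continuous_interval w_continuous)
  have "integral {-1..1} (w j) \<noteq> 0"
  proof
    assume "integral {-1..1} (w j) = 0"
    then have "(w j has_integral 0) (cbox (-1) 1)" using int by (metis box_real(2) integrable_integral)
    from has_integral_0_cbox_imp_0[OF _ _ this] have "w j (1/2) = 0"
      using w_continuous nonneg by simp
    then show False using pos by simp
  qed
  moreover have "integral {-1..1} (w j) \<ge> 0" using int nonneg by (intro integral_nonneg)
  ultimately show ?thesis by simp
qed

lemma snd_eta: "z \<noteq> 0 \<Longrightarrow> \<bar>snd z\<bar> = rad z ^ l2 * eta (xi z)"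
proof -
  assume z: "z \<noteq> 0"
  have "(rad z ^ l2 * eta (xi z)) ^ (2 * l1) = rad z ^ (2 * l1 * l2) * eta (xi z) ^ (2 * l1)"
    by (simp add: power_mult_distrib mult_ac flip: power_mult)
  also have "\<dots> = H z * ((1 - fst z ^ (2 * l2) / H z) / \<kappa>)"
    unfolding rad_power[OF z] eta_power[OF xi_range[OF z]] xi_power[OF z] ..
  also have "\<dots> = (H z - fst z ^ (2 * l2)) / \<kappa>" using H_pos[OF z] \<kappa> by (simp add: field_simps)
  also have "\<dots> = snd z ^ (2 * l1)" using \<kappa> by (simp add: H_def)
  also have "\<dots> = \<bar>snd z\<bar> ^ (2 * l1)" by (simp add: power_even_abs)
  finally have "\<bar>snd z\<bar> ^ (2 * l1) = (rad z ^ l2 * eta (xi z)) ^ (2 * l1)" by simp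
  moreover have "0 \<le> rad z ^ l2 * eta (xi z)" using rad_pos[OF z] eta_nonneg by simp
  ultimately show ?thesis using l power_eq_imp_eq_base[of "\<bar>snd z\<bar>" "2 * l1" "rad z ^ l2 * eta (xi z)"] by simp
qed

lemma fst_xi: "z \<noteq> 0 \<Longrightarrow> fst z = rad z ^ l1 * xi z"
  using rad_pos[of z] by (simp add: xi_def)

lemma rad_tau: "z \<noteq> 0 \<Longrightarrow> rad z = tau z powr (- 1 / real s)"
proof -
  assume z: "z \<noteq> 0"
  have "tau z = rad z powr (- real s)"
    using rad_pos[OF z] by (simp add: tau_def powr_minus powr_realpow divide_inverse)
  then show ?thesis using rad_pos[OF z] s by (simp add: powr_powr)
qed

lemma pt_tau_xi:
  assumes "z \<noteq> 0" "snd z \<ge> 0" shows "z = pt (tau z) (xi z)"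
  unfolding pt_def rad_tau[OF assms(1), symmetric] fst_xi[OF assms(1), symmetric] snd_eta[OF assms(1), symmetric]
  using assms(2) by simp

lemma xi_axis: "z \<noteq> 0 \<Longrightarrow> snd z = 0 \<Longrightarrow> fst z > 0 \<Longrightarrow> xi z = 1"
proof -
  assume z: "z \<noteq> 0" "snd z = 0" "fst z > 0"
  have "xi z ^ (2 * l2) = 1"
    unfolding xi_power[OF z(1)] using z H_pos[OF z(1)] l by (simp add: H_def power_0_left)
  moreover have "xi z > 0" using z rad_pos[OF z(1)] by (simp add: xi_def)
  ultimately show ?thesis using l power_eq_imp_eq_base[of "xi z" "2 * l2" 1] by simp
qed

lemma pt_props:
  assumes t: "t > 0" and u: "u \<in> {-1..1}"
  shows "pt t u \<noteq> 0" "tau (pt t u) = t" "xi (pt t u) = u" "snd (pt t u) \<ge> 0"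
proof -
  define r where "r = t powr (- 1 / real s)"
  have r: "r > 0" using t by (simp add: r_def)
  have pt: "pt t u = (r ^ l1 * u, r ^ l2 * eta u)" by (simp add: pt_def r_def)
  have "H (pt t u) = r ^ (2 * l1 * l2) * (u ^ (2 * l2) + \<kappa> * eta u ^ (2 * l1))"
    by (simp add: H_def pt power_mult_distrib algebra_simps flip: power_mult)
  also have "u ^ (2 * l2) + \<kappa> * eta u ^ (2 * l1) = 1" using eta_power[OF u] \<kappa> by simp
  finally have H: "H (pt t u) = r ^ (2 * l1 * l2)" by simp
  show nz: "pt t u \<noteq> 0"
  proof
    assume "pt t u = 0"
    then have "H (pt t u) = 0" using l by (simp add: H_def power_0_left)
    then show False using H r by simp
  qed
  have "rad (pt t u) = r"
    using rad_power[OF nz] H l r rad_pos[OF nz] power_eq_imp_eq_base[of "rad (pt t u)" "2 * l1 * l2" r] by simp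
  moreover have "1 / r ^ s = t"
  proof -
    have "r ^ s = t powr (- 1)" unfolding r_def using t s by (simp add: powr_power)
    then show ?thesis using t by (simp add: powr_minus divide_inverse)
  qed
  ultimately show "tau (pt t u) = t" "xi (pt t u) = u"
    using r by (simp_all add: tau_def xi_def pt)
  show "snd (pt t u) \<ge> 0" using r eta_nonneg by (simp add: pt)
qed

lemma pt_continuous:
  assumes "continuous_on S f" "continuous_on S g" "\<And>x. x \<in> S \<Longrightarrow> f x > 0" "g ` S \<subseteq> {-1..1}"
  shows "continuous_on S (\<lambda>x. pt (f x) (g x))"
  unfolding pt_def
  by (intro continuous_intros assms continuous_on_compose2[OF eta_continuous]) (use assms in force)+

lemma H_continuous: "continuous_on S H"
  unfolding H_def by (intro continuous_intros)

lemma rad_continuous: "continuous_on (- {0}) rad"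
  unfolding rad_def by (intro continuous_intros H_continuous) (use H_pos in force)

lemma tau_continuous: "continuous_on (- {0}) tau"
  unfolding tau_def by (intro continuous_intros rad_continuous) (use rad_pos in force)

lemma xi_continuous: "continuous_on (- {0}) xi"
  unfolding xi_def by (intro continuous_intros rad_continuous) (use rad_pos in force)

text \<open>Together with \<open>norm_large_imp_tau_small\<close>: smallness of \<open>tau\<close>
  and largeness of the norm describe the same neighbourhoods of infinity.\<close>

lemma tau_small_imp_norm_large:
  obtains \<epsilon> where "\<epsilon> > 0" and "\<And>z. z \<noteq> 0 \<Longrightarrow> tau z < \<epsilon> \<Longrightarrow> norm z > M"
proof -
  have "compact (cball (0::real \<times> real) M)" by simp
  then have "bounded (H ` cball 0 M)" by (intro compact_imp_bounded compact_continuous_image H_continuous)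
  then obtain B where B: "\<forall>h\<in>H ` cball 0 M. norm h \<le> B" unfolding bounded_iff ..
  define B' where "B' = max B 1"
  define \<epsilon> where "\<epsilon> = 1 / (B' powr (1 / real (2 * l1 * l2))) ^ s"
  show thesis
  proof (rule that[of \<epsilon>])
    show "\<epsilon> > 0" by (simp add: \<epsilon>_def B'_def)
    fix z :: "real \<times> real" assume z: "z \<noteq> 0" "tau z < \<epsilon>"
    show "norm z > M"
    proof (rule ccontr)
      assume "\<not> norm z > M"
      then have "z \<in> cball 0 M" by simp
      then have "norm (H z) \<le> B" using B by blast
      then have "H z \<le> B'" by (simp add: B'_def)
      then have "rad z \<le> B' powr (1 / real (2 * l1 * l2))"
        unfolding rad_def using H_nonneg by (intro powr_mono2) auto
      then have "rad z ^ s \<le> (B' powr (1 / real (2 * l1 * l2))) ^ s"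
        using rad_pos[OF z(1)] by (intro power_mono) auto
      then have "\<epsilon> \<le> tau z"
        unfolding \<epsilon>_def tau_def using rad_pos[OF z(1)] by (intro divide_left_mono) (auto simp: B'_def)
      then show False using z by simp
    qed
  qed
qed

lemma norm_large_imp_tau_small:
  assumes "\<epsilon> > 0"
  obtains M where "\<And>z. norm z > M \<Longrightarrow> z \<noteq> 0 \<and> tau z < \<epsilon>"
proof -
  \<comment> \<open>The value of \<open>H\<close> at which \<open>tau\<close> equals
    \<open>\<epsilon> / 2\<close>.\<close>
  define h where "h = ((2 / \<epsilon>) powr (1 / real s)) ^ (2 * l1 * l2)"
  have h: "h > 0" using assms by (simp add: h_def)
  \<comment> \<open>A larger norm forces one coordinate beyond \<open>1 + h + h / \<kappa>\<close>,
    and then the corresponding summand of \<open>H\<close> alone exceeds \<open>h\<close>.\<close>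
  define M where "M = 2 * (1 + h + h / \<kappa>)"
  have hk: "h / \<kappa> > 0" using h \<kappa> by simp
  show thesis
  proof (rule that[of M])
    fix z :: "real \<times> real" assume z: "norm z > M"
    have M0: "M > 0" using h hk by (simp add: M_def)
    then have nz: "z \<noteq> 0" using z by auto
    have "norm z \<le> \<bar>fst z\<bar> + \<bar>snd z\<bar>" 
      unfolding norm_prod_def using sqrt_sum_squares_le_sum_abs[of "fst z" "snd z"] by simp
    then have "\<bar>fst z\<bar> > 1 + h + h / \<kappa> \<or> \<bar>snd z\<bar> > 1 + h + h / \<kappa>" using z by (auto simp: M_def)
    then have "H z > h"
    proof
      assume a: "\<bar>fst z\<bar> > 1 + h + h / \<kappa>"
      have "\<bar>fst z\<bar> ^ 1 \<le> \<bar>fst z\<bar> ^ (2 * l2)" using a h hk l by (intro power_increasing) auto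
      then have "h < fst z ^ (2 * l2)" using a hk by (simp add: power_even_abs)
      moreover have "0 \<le> \<kappa> * snd z ^ (2 * l1)"
        using \<kappa> zero_le_even_power[OF even_2l(1), of "snd z"] by (intro mult_nonneg_nonneg) auto
      ultimately show ?thesis unfolding H_def by linarith
    next
      assume a: "\<bar>snd z\<bar> > 1 + h + h / \<kappa>"
      have "\<bar>snd z\<bar> ^ 1 \<le> \<bar>snd z\<bar> ^ (2 * l1)" using a h hk l by (intro power_increasing) auto
      then have "h / \<kappa> < snd z ^ (2 * l1)" using a h by (simp add: power_even_abs)
      then have "h < \<kappa> * snd z ^ (2 * l1)" using \<kappa> by (simp add: pos_divide_less_eq mult.commute)
      moreover have "0 \<le> fst z ^ (2 * l2)" by (intro zero_le_even_power) simp
      ultimately show ?thesis unfolding H_def by linarith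
    qed
    then have "((2 / \<epsilon>) powr (1 / real s)) ^ (2 * l1 * l2) < rad z ^ (2 * l1 * l2)"
      unfolding rad_power[OF nz] h_def .
    then have "(2 / \<epsilon>) powr (1 / real s) < rad z"
      by (rule power_less_imp_less_base) (use rad_pos[OF nz] in simp)
    then have "((2 / \<epsilon>) powr (1 / real s)) ^ s < rad z ^ s" using s by (intro power_strict_mono) auto
    moreover have "((2 / \<epsilon>) powr (1 / real s)) ^ s = 2 / \<epsilon>"
      using assms s by (intro powr_inverse_power) auto
    ultimately have "2 / \<epsilon> < rad z ^ s" by simp
    then have "tau z < \<epsilon> / 2"
      unfolding tau_def using assms rad_pos[OF nz] by (simp add: field_simps)
    then show "z \<noteq> 0 \<and> tau z < \<epsilon>" using nz assms by simp
  qed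
qed

section \<open>The vector field in weighted polar coordinates\<close>

abbreviation A :: "(nat \<Rightarrow> real) \<Rightarrow> vfield" where "A \<equiv> family_A p q r1 r2"

definition T :: "(nat \<Rightarrow> real) \<Rightarrow> real \<times> real \<Rightarrow> real" where
  "T b z = fst z ^ r2 + (\<Sum>j=1..N. b j * fst z ^ (r2 - j * q) * snd z ^ (j * p))"

lemma A_eq: "A b z = (- (snd z ^ r1), T b z)"
  by (cases z) (simp add: family_A_def T_def N_def)

lemma A_lip_bounded: "lip_bounded (A b)"
  unfolding A_eq T_def
  by (intro lip_bounded_Pair lip_bounded_minus lip_bounded_power lip_bounded_add lip_bounded_sum
      lip_bounded_mult lip_bounded_const lip_bounded_fst lip_bounded_snd)

lemma r_odd: "odd r1" "odd r2" using r1 r2 by presburger+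

lemma r_pos: "r1 > 0" "r2 > 0" using r_odd by (auto intro: odd_pos)

lemma T_axis: "snd z = 0 \<Longrightarrow> T b z = fst z ^ r2"
proof -
  assume "snd z = 0"
  then have "b j * fst z ^ (r2 - j * q) * snd z ^ (j * p) = 0" if "j \<in> {1..N}" for j
    using that pq by (simp add: power_0_left)
  then show ?thesis unfolding T_def by (simp add: sum.neutral)
qed

lemma A_eq_0: "A b z = 0 \<longleftrightarrow> z = 0"
proof
  assume "A b z = 0"
  then have "snd z = 0" "T b z = 0" by (auto simp: A_eq zero_prod_def)
  then show "z = 0" using T_axis[of z b] by (simp add: prod_eq_iff)
next
  assume "z = 0"
  then show "A b z = 0" using T_axis[of z b] r_pos by (simp add: A_eq zero_prod_def power_0_left)
qed

text \<open>Each monomial has odd total degree, because \<open>r2\<close>, \<open>p\<close>,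
  \<open>q\<close> and \<open>r1\<close> are odd. Hence the reflection in the origin maps
  trajectories to trajectories.\<close>

lemma A_minus: "A b (- z) = - A b z"
proof -
  have "b j * (- fst z) ^ (r2 - j * q) * (- snd z) ^ (j * p) = - (b j * fst z ^ (r2 - j * q) * snd z ^ (j * p))"
    if "j \<in> {1..N}" for j
  proof -
    have "even (r2 - j * q) \<longleftrightarrow> odd j"
      using N_le[of j] that odd_q r_odd by (auto simp: even_diff_nat)
    then show ?thesis using odd_p by (cases "even j") auto
  qed
  then have "(\<Sum>j=1..N. b j * (- fst z) ^ (r2 - j * q) * (- snd z) ^ (j * p)) =
      - (\<Sum>j=1..N. b j * fst z ^ (r2 - j * q) * snd z ^ (j * p))"
    unfolding sum_negf[symmetric] by (intro sum.cong) auto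
  then have "T b (- z) = - T b z"
    unfolding T_def using r_odd by simp
  then show ?thesis using r_odd by (simp add: A_eq)
qed

text \<open>The monomial of index \<open>j\<close> has weighted degree
  \<open>2 * l1 * l2 - l1 - s * j\<close>: each unit of \<open>j\<close> costs a factor
  \<open>rad ^ s\<close>, that is, contributes one factor \<open>tau\<close>. The left-hand side has
  the shape of \<open>T b z\<close> minus its leading term.\<close>

lemma S_identity:
  assumes z: "z \<noteq> 0" "snd z \<ge> 0"
  shows "fst z ^ r2 + (\<Sum>j=1..N. b j * fst z ^ (r2 - j * q) * snd z ^ (j * p))
      - fst z ^ r2 = (\<Sum>j=1..N. b j * tau z ^ j * w j (xi z)) * H z / rad z ^ l1"
proof -
  define r where "r = rad z"
  have r: "r > 0" unfolding r_def by (rule rad_pos[OF z(1)])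
  have "b j * fst z ^ (r2 - j * q) * snd z ^ (j * p) = b j * tau z ^ j * w j (xi z) * H z / r ^ l1"
    if j: "j \<in> {1..N}" for j
  proof -
    have y: "snd z = r ^ l2 * eta (xi z)" using snd_eta[OF z(1)] z(2) by (simp add: r_def)
    have x: "fst z = r ^ l1 * xi z" using fst_xi[OF z(1)] by (simp add: r_def)
    have "l1 * (r2 - j * q) + l2 * (j * p) + (s * j + l1) = 2 * l1 * l2"
    proof -
      have "l1 * (r2 - j * q) + l1 * (j * q) = l1 * r2"
        using N_le[of j] j by (simp flip: distrib_left)
      moreover have "s * j + l2 * (j * p) = l1 * (j * q)"
        using weights by (simp add: s_def diff_mult_distrib algebra_simps)
      moreover have "l1 * r2 + l1 = 2 * l1 * l2" using r2 by (metis mult.assoc mult.commute mult_Suc_right add.commute)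
      ultimately show ?thesis by linarith
    qed
    then have "r ^ (l1 * (r2 - j * q)) * r ^ (l2 * (j * p)) * (r ^ (s * j) * r ^ l1) = H z"
      using rad_power[OF z(1)] by (simp add: r_def flip: power_add)
    then have e1: "H z / (r ^ (s * j) * r ^ l1) = r ^ (l1 * (r2 - j * q)) * r ^ (l2 * (j * p))"
      using r by (simp add: divide_eq_eq)
    have e2: "fst z ^ (r2 - j * q) * snd z ^ (j * p) = r ^ (l1 * (r2 - j * q)) * r ^ (l2 * (j * p)) * w j (xi z)"
      unfolding w_def y x by (simp add: power_mult_distrib power_mult)
    have e3: "tau z ^ j = 1 / r ^ (s * j)" by (simp add: tau_def r_def power_one_over power_mult)
    have "b j * fst z ^ (r2 - j * q) * snd z ^ (j * p) = b j * (H z / (r ^ (s * j) * r ^ l1) * w j (xi z))"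
      unfolding e1 e2[symmetric] by simp
    also have "\<dots> = b j * tau z ^ j * w j (xi z) * H z / r ^ l1" unfolding e3 by simp
    finally show ?thesis .
  qed
  then have "(\<Sum>j=1..N. b j * fst z ^ (r2 - j * q) * snd z ^ (j * p)) = (\<Sum>j=1..N. b j * tau z ^ j * w j (xi z) * H z / r ^ l1)"
    by (intro sum.cong) auto
  then show ?thesis by (simp add: sum_divide_distrib sum_distrib_right r_def)
qed

text \<open>Both derivatives share the factor \<open>k\<close>, which contains the speed
  \<open>c\<close> and vanishes on the x-axis; it cancels in their quotient, leaving the angular
  equation.\<close>

lemma polar_derivatives:
  fixes \<gamma> :: "real \<Rightarrow> real \<times> real"
  assumes d: "(\<gamma> has_vector_derivative c *\<^sub>R A b (\<gamma> t)) (at t within D)"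
    and z: "\<gamma> t \<noteq> 0" "snd (\<gamma> t) \<ge> 0"
  defines "k \<equiv> c * snd (\<gamma> t) ^ r1 / rad (\<gamma> t) ^ l1"
    and "S \<equiv> \<Sum>j=1..N. b j * tau (\<gamma> t) ^ j * w j (xi (\<gamma> t))"
  shows "((\<lambda>t. tau (\<gamma> t)) has_real_derivative - (\<theta> * k * tau (\<gamma> t) * S)) (at t within D)"
    and "((\<lambda>t. xi (\<gamma> t)) has_real_derivative - (k * (1 + xi (\<gamma> t) * S))) (at t within D)"
proof -
  define x y where "x = (\<lambda>t. fst (\<gamma> t))" and "y = (\<lambda>t. snd (\<gamma> t))"
  define h r where "h = H (\<gamma> t)" and "r = rad (\<gamma> t)"
  have h: "h > 0" and r: "r > 0" using H_pos[OF z(1)] rad_pos[OF z(1)] by (simp_all add: h_def r_def)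
  define V where "V = S * h / r ^ l1"
  have TV: "T b (\<gamma> t) = x t ^ r2 + V"
    using S_identity[OF z, of b] by (simp add: T_def x_def V_def S_def h_def r_def)
  have dx: "(x has_real_derivative - (c * y t ^ r1)) (at t within D)"
    using bounded_linear.has_vector_derivative[OF bounded_linear_fst d]
    by (simp add: has_real_derivative_iff_has_vector_derivative x_def y_def A_eq)
  have dy: "(y has_real_derivative c * (x t ^ r2 + V)) (at t within D)"
    using bounded_linear.has_vector_derivative[OF bounded_linear_snd d]
    by (simp add: has_real_derivative_iff_has_vector_derivative y_def A_eq TV[symmetric] del: TV)
  have l': "2 * l2 - 1 = r2" "2 * l1 - 1 = r1" using r1 r2 by auto
  \<comment> \<open>The leading terms cancel because \<open>\<kappa> * real l1 = real l2\<close>, so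
    only the perturbation \<open>V\<close> changes \<open>H\<close>.\<close>
  have dH: "((\<lambda>t. H (\<gamma> t)) has_real_derivative 2 * l2 * c * y t ^ r1 * V) (at t within D)"
  proof -
    have "((\<lambda>t. x t ^ (2 * l2) + \<kappa> * y t ^ (2 * l1)) has_real_derivative
        real (2 * l2) * (- (c * y t ^ r1) * x t ^ r2) + \<kappa> * (real (2 * l1) * (c * (x t ^ r2 + V) * y t ^ r1))) (at t within D)"
      by (intro DERIV_add DERIV_cmult DERIV_cong[OF DERIV_power[OF dx]] DERIV_cong[OF DERIV_power[OF dy]])
        (simp_all add: l'[unfolded One_nat_def])
    moreover have "real (2 * l2) * (- (c * y t ^ r1) * x t ^ r2) + \<kappa> * (real (2 * l1) * (c * (x t ^ r2 + V) * y t ^ r1))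
        = 2 * l2 * c * y t ^ r1 * V"
    proof -
      have "\<kappa> * real l1 = real l2" using l by (simp add: \<kappa>_def)
      then have "\<kappa> * (real (2 * l1) * (c * (x t ^ r2 + V) * y t ^ r1)) = 2 * real l2 * (c * (x t ^ r2 + V) * y t ^ r1)"
        by simp
      then show ?thesis by (simp add: algebra_simps)
    qed
    ultimately show ?thesis by (simp add: H_def x_def y_def)
  qed
  define rd where "rd = r * (c * y t ^ r1 * V / (l1 * h))"
  have dr: "((\<lambda>t. rad (\<gamma> t)) has_real_derivative rd) (at t within D)"
  proof -
    let ?a = "1 / real (2 * l1 * l2)"
    have "((\<lambda>t. H (\<gamma> t) powr ?a) has_real_derivative ?a * h powr (?a - 1) * (2 * l2 * c * y t ^ r1 * V)) (at t within D)"
      using DERIV_chain2[OF has_real_derivative_powr[of "H (\<gamma> t)" ?a] dH] h by (simp add: h_def)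
    moreover have "?a * h powr (?a - 1) * (2 * l2 * c * y t ^ r1 * V) = rd"
    proof -
      have "h powr (?a - 1) = r / h" using h by (simp add: powr_diff r_def rad_def h_def)
      then show ?thesis using l h by (simp add: rd_def field_simps)
    qed
    ultimately show ?thesis by (simp add: rad_def)
  qed
  have kS: "c * y t ^ r1 * V / h = k * S" using h by (simp add: V_def k_def y_def r_def)
  have "rd = r * (c * y t ^ r1 * V / h) / l1" by (simp add: rd_def divide_divide_eq_left mult.commute)
  then have rdr: "rd = r * (k * S) / l1" unfolding kS .
  have "((\<lambda>t. 1 / rad (\<gamma> t) ^ s) has_real_derivative - (s * r ^ (s - 1) * rd) / (r ^ s) ^ 2) (at t within D)"
    using r by (auto intro!: derivative_eq_intros dr simp: r_def[symmetric] power2_eq_square)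
  moreover have "- (s * r ^ (s - 1) * rd) / (r ^ s) ^ 2 = - (\<theta> * k * tau (\<gamma> t) * S)"
  proof -
    have "r ^ s = r * r ^ (s - 1)" using s by (simp add: power_eq_if)
    then have "r ^ (s - 1) * r = r ^ s" by simp
    then have "s * r ^ (s - 1) * rd = s * r ^ s * (k * S) / l1"
      unfolding rdr by (metis (no_types, lifting) mult.assoc times_divide_eq_right)
    then show ?thesis using r by (simp add: \<theta>_def tau_def r_def[symmetric] power2_eq_square field_simps)
  qed
  ultimately show "((\<lambda>t. tau (\<gamma> t)) has_real_derivative - (\<theta> * k * tau (\<gamma> t) * S)) (at t within D)"
    by (simp add: tau_def)
  have "((\<lambda>t. x t / rad (\<gamma> t) ^ l1) has_real_derivative
      (- (c * y t ^ r1) * r ^ l1 - x t * (l1 * (rd * r ^ (l1 - 1)))) / (r ^ l1 * r ^ l1)) (at t within D)"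
    using DERIV_divide[OF dx DERIV_power[OF dr, of l1]] r by (simp add: r_def)
  moreover have "(- (c * y t ^ r1) * r ^ l1 - x t * (l1 * (rd * r ^ (l1 - 1)))) / (r ^ l1 * r ^ l1)
      = - (k * (1 + xi (\<gamma> t) * S))"
  proof -
    have "r * r ^ (l1 - 1) = r ^ l1" using l by (simp add: power_eq_if)
    then have "rd * r ^ (l1 - 1) = r ^ l1 * (k * S) / l1"
      unfolding rdr by (metis (no_types, lifting) mult.assoc mult.commute times_divide_eq_right)
    then have 1: "l1 * (rd * r ^ (l1 - 1)) = r ^ l1 * (k * S)" using l by simp
    have 2: "x t = r ^ l1 * xi (\<gamma> t)" using fst_xi[OF z(1)] by (simp add: x_def r_def)
    have 3: "c * y t ^ r1 = k * r ^ l1" using r by (simp add: k_def y_def r_def)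
    show ?thesis unfolding 1 2 3 using r by (simp add: field_simps)
  qed
  ultimately show "((\<lambda>t. xi (\<gamma> t)) has_real_derivative - (k * (1 + xi (\<gamma> t) * S))) (at t within D)"
    by (simp add: xi_def x_def)
qed

end

section \<open>The flow near infinity\<close>

lemma power_diff_bound:
  fixes x y B :: real
  assumes "\<bar>x\<bar> \<le> B" "\<bar>y\<bar> \<le> B" "1 \<le> B"
  shows "\<bar>x ^ n - y ^ n\<bar> \<le> n * B ^ n * \<bar>x - y\<bar>"
proof (induction n)
  case (Suc n)
  have "x ^ Suc n - y ^ Suc n = x * (x ^ n - y ^ n) + (x - y) * y ^ n" by (simp add: algebra_simps)
  then have "\<bar>x ^ Suc n - y ^ Suc n\<bar> \<le> \<bar>x\<bar> * \<bar>x ^ n - y ^ n\<bar> + \<bar>x - y\<bar> * \<bar>y\<bar> ^ n"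
    by (metis abs_mult abs_triangle_ineq power_abs)
  also have "\<dots> \<le> B * (n * B ^ n * \<bar>x - y\<bar>) + \<bar>x - y\<bar> * B ^ Suc n"
  proof (intro add_mono mult_mono Suc assms order_refl)
    have "\<bar>y\<bar> ^ n \<le> B ^ n" using assms by (intro power_mono) auto
    also have "\<dots> \<le> B ^ Suc n" using assms by (intro power_increasing) auto
    finally show "\<bar>y\<bar> ^ n \<le> B ^ Suc n" .
  qed (use assms in auto)
  also have "\<dots> = Suc n * B ^ Suc n * \<bar>x - y\<bar>" by (simp add: algebra_simps)
  finally show ?case .
qed simp

lemma decreasing_bounded_tendsto:
  fixes f :: "real \<Rightarrow> real"
  assumes mono: "\<And>s t. a \<le> s \<Longrightarrow> s \<le> t \<Longrightarrow> f t \<le> f s" and bd: "\<And>t. a \<le> t \<Longrightarrow> m \<le> f t"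
  obtains L where "(f \<longlongrightarrow> L) at_top" and "L \<ge> m" and "\<And>t. a \<le> t \<Longrightarrow> L \<le> f t"
proof -
  define L where "L = Inf (f ` {a..})"
  have bb: "bdd_below (f ` {a..})" by (rule bdd_belowI2[of _ m]) (use bd in simp)
  have low: "L \<le> f t" if "a \<le> t" for t
    unfolding L_def using that by (intro cInf_lower bb) auto
  have Lm: "L \<ge> m" unfolding L_def using bd by (intro cInf_greatest) auto
  have "(f \<longlongrightarrow> L) at_top"
  proof (rule tendstoI)
    fix e :: real assume "e > 0"
    then have "Inf (f ` {a..}) < L + e" by (simp add: L_def)
    then obtain y where "y \<in> f ` {a..}" "y < L + e" using cInf_lessD[of "f ` {a..}" "L + e"] by auto
    then obtain t0 where t0: "a \<le> t0" "f t0 < L + e" by auto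
    have "dist (f t) L < e" if "t \<ge> t0" for t
      using mono[OF t0(1) that] low[of t] t0 that by (simp add: dist_real_def)
    then show "\<forall>\<^sub>F t in at_top. dist (f t) L < e"
      unfolding eventually_at_top_linorder by blast
  qed
  then show thesis using that Lm low by blast
qed

text \<open>Fixes the bounds that the angular equation asks for: \<open>K\<close> for the
  coefficients under consideration and \<open>W\<close> for the finitely many weights
  \<open>w j\<close>.\<close>

locale polar_flow = polar +
  fixes K W :: real
  assumes K: "K > 0" and W: "W > 0"
    and bdw: "\<And>j u. j \<in> {1..N} \<Longrightarrow> u \<in> {-1..1} \<Longrightarrow> \<bar>w j u\<bar> \<le> W"
begin

sublocale ang: angular N \<theta> w K W
  by unfold_locales (use \<theta> K W bdw w_continuous w_minus in auto)

text \<open>Speed factors: the constant 1 gives (A) itself, a cutoff gives global solutions.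
  Evenness keeps the reflection in the origin a symmetry of the flow.\<close>

definition damp :: "(real \<times> real \<Rightarrow> real) \<Rightarrow> bool" where
  "damp c \<longleftrightarrow> (\<forall>z. 0 \<le> c z) \<and> (\<forall>z. c (- z) = c z) \<and> lip_bounded c"

definition flow :: "(real \<times> real \<Rightarrow> real) \<Rightarrow> (nat \<Rightarrow> real) \<Rightarrow> vfield" where
  "flow c b z = c z *\<^sub>R A b z"

text \<open>The label of a point of the closed upper half-plane is the value of \<open>tau\<close> where its
  trajectory crosses the positive \<open>y\<close>-axis.\<close>

definition Lab :: "(nat \<Rightarrow> real) \<Rightarrow> real \<Rightarrow> real \<times> real \<Rightarrow> bool" where
  "Lab b t z \<longleftrightarrow> z \<noteq> 0 \<and> 0 \<le> snd z \<and> tau z = ang.sig b t (xi z)"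

text \<open>Half-open, so that \<open>upper z\<close> and \<open>upper (- z)\<close> split the plane
  without the origin; the positive x-axis, where half turns begin, belongs to the upper
  part.\<close>

definition upper :: "real \<times> real \<Rightarrow> bool" where
  "upper z \<longleftrightarrow> 0 < snd z \<or> (snd z = 0 \<and> 0 < fst z)"

lemma damp_1: "damp (\<lambda>z. 1)" by (simp add: damp_def lip_bounded_const)

lemma flow_1: "flow (\<lambda>z. 1) b = A b" by (simp add: flow_def fun_eq_iff)

lemma damp_cutoff: "damp (cutoff M)"
proof -
  have "lip_bounded (cutoff M)"
    unfolding lip_bounded_def
    by (intro allI exI[of _ 1] lipschitz_onI) (use cutoff_lipschitz in \<open>auto simp: dist_norm\<close>)
  moreover have "cutoff M (- z) = cutoff M z" for z by (simp add: cutoff_def)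
  ultimately show ?thesis unfolding damp_def using cutoff_nonneg by blast
qed

lemma flow_lip: "damp c \<Longrightarrow> lip_bounded (flow c b)"
  unfolding flow_def[abs_def] damp_def by (intro lip_bounded_scaleR A_lip_bounded) auto

lemma solution_minus:
  assumes "damp c" "solution_on (flow c b) I \<gamma>"
  shows "solution_on (flow c b) I (\<lambda>t. - \<gamma> t)"
  unfolding solution_on_def
proof
  fix t assume "t \<in> I"
  then have "((\<lambda>t. - \<gamma> t) has_vector_derivative - flow c b (\<gamma> t)) (at t within I)"
    using assms(2) by (auto simp: solution_on_def intro!: derivative_eq_intros)
  moreover have "c (- \<gamma> t) = c (\<gamma> t)" using assms(1) unfolding damp_def by blast
  ultimately show "((\<lambda>t. - \<gamma> t) has_vector_derivative flow c b (- \<gamma> t)) (at t within I)"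
    by (simp add: flow_def A_minus)
qed

lemma flow_nonzero:
  assumes "damp c" "solution_on (flow c b) {a..d} \<gamma>" "t0 \<in> {a..d}" "t \<in> {a..d}" "\<gamma> t0 \<noteq> 0"
  shows "\<gamma> t \<noteq> 0"
proof
  assume z: "\<gamma> t = 0"
  have "solution_on (flow c b) {a..d} (\<lambda>t. 0)"
    using A_eq_0[of b 0] by (simp add: solution_on_def flow_def has_vector_derivative_const)
  from solution_unique[OF flow_lip[OF assms(1)] assms(2) this z assms(4,3)] show False using assms(5) by simp
qed

lemma snd_derivative:
  assumes "solution_on (flow c b) I \<gamma>" "t \<in> I"
  shows "((\<lambda>t. snd (\<gamma> t)) has_real_derivative c (\<gamma> t) * T b (\<gamma> t)) (at t within I)"
proof -
  have "(\<gamma> has_vector_derivative flow c b (\<gamma> t)) (at t within I)" using assms by (simp add: solution_on_def)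
  from bounded_linear.has_vector_derivative[OF bounded_linear_snd this]
  show ?thesis by (simp add: has_real_derivative_iff_has_vector_derivative flow_def A_eq)
qed

lemma fst_derivative:
  assumes "solution_on (flow c b) I \<gamma>" "t \<in> I"
  shows "((\<lambda>t. fst (\<gamma> t)) has_real_derivative - (c (\<gamma> t) * snd (\<gamma> t) ^ r1)) (at t within I)"
proof -
  have "(\<gamma> has_vector_derivative flow c b (\<gamma> t)) (at t within I)" using assms by (simp add: solution_on_def)
  from bounded_linear.has_vector_derivative[OF bounded_linear_fst this]
  show ?thesis by (simp add: has_real_derivative_iff_has_vector_derivative flow_def A_eq)
qed

text \<open>On the positive x-axis \<open>snd\<close> has the positive derivative
  \<open>c * x ^ r2\<close>, so trajectories pass from below to above.\<close>

lemma axis_crossing: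
  assumes "solution_on (flow c b) I \<gamma>" "t \<in> I" "snd (\<gamma> t) = 0" "c (\<gamma> t) > 0" "fst (\<gamma> t) > 0"
  obtains e where "e > 0" "\<And>h. 0 < h \<Longrightarrow> h < e \<Longrightarrow> t + h \<in> I \<Longrightarrow> snd (\<gamma> (t + h)) > 0"
    "\<And>h. 0 < h \<Longrightarrow> h < e \<Longrightarrow> t - h \<in> I \<Longrightarrow> snd (\<gamma> (t - h)) < 0"
proof -
  have pos: "c (\<gamma> t) * T b (\<gamma> t) > 0" using assms T_axis[of "\<gamma> t" b] by simp
  note d = snd_derivative[OF assms(1,2)]
  obtain e1 where e1: "e1 > 0" "\<And>h. h > 0 \<Longrightarrow> t + h \<in> I \<Longrightarrow> h < e1 \<Longrightarrow> snd (\<gamma> t) < snd (\<gamma> (t + h))"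
    using has_real_derivative_pos_inc_right[OF d pos] by blast
  obtain e2 where e2: "e2 > 0" "\<And>h. h > 0 \<Longrightarrow> t - h \<in> I \<Longrightarrow> h < e2 \<Longrightarrow> snd (\<gamma> (t - h)) < snd (\<gamma> t)"
    using has_real_derivative_pos_inc_left[OF d pos] by blast
  show thesis by (rule that[of "min e1 e2"]) (use e1 e2 assms(3) in auto)
qed

text \<open>The angle is not a regular parameter of the trajectory where it meets the x-axis.
  Instead \<open>tau - sig (xi)\<close> is followed in time: its derivative is bounded by a multiple
  of itself, so Gronwall's inequality keeps it zero.\<close>

lemma label_constant:
  assumes b: "ang.adm b" and c: "damp c" and \<zeta>: "0 < \<zeta>" "\<zeta> < ang.R"
    and sol: "solution_on (flow c b) {a..d} \<gamma>"
    and up: "\<And>t. t \<in> {a..d} \<Longrightarrow> \<gamma> t \<noteq> 0 \<and> 0 \<le> snd (\<gamma> t)"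
    and lab: "Lab b \<zeta> (\<gamma> t0)" and t0: "t0 \<in> {a..d}" and t: "t \<in> {a..d}"
  shows "Lab b \<zeta> (\<gamma> t)"
proof -
  define y x k where "y = (\<lambda>t. tau (\<gamma> t))" and "x = (\<lambda>t. xi (\<gamma> t))"
    and "k = (\<lambda>t. c (\<gamma> t) * snd (\<gamma> t) ^ r1 / rad (\<gamma> t) ^ l1)"
  have cg: "continuous_on {a..d} \<gamma>" by (rule solution_on_continuous[OF sol])
  have img: "\<gamma> ` {a..d} \<subseteq> - {0}" using up by auto
  have cy: "continuous_on {a..d} y"
    unfolding y_def by (rule continuous_on_compose2[OF tau_continuous cg img])
  have ck: "continuous_on {a..d} k"
    unfolding k_def
  proof (intro continuous_intros cg continuous_on_compose2[OF rad_continuous cg img] ballI)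
    show "continuous_on {a..d} (\<lambda>t. c (\<gamma> t))"
      using c by (intro continuous_on_compose2[OF lip_bounded_continuous cg]) (auto simp: damp_def)
    show "rad (\<gamma> t) ^ l1 \<noteq> 0" if "t \<in> {a..d}" for t using rad_pos[of "\<gamma> t"] up[OF that] by simp
  qed
  have xr: "x t \<in> {-1..1}" if "t \<in> {a..d}" for t using up[OF that] xi_range by (simp add: x_def)
  have "bounded (y ` {a..d})" by (intro compact_imp_bounded compact_continuous_image cy compact_Icc)
  then obtain B1 where B1: "\<forall>v\<in>y ` {a..d}. norm v \<le> B1" unfolding bounded_iff ..
  have "bounded (k ` {a..d})" by (intro compact_imp_bounded compact_continuous_image ck compact_Icc)
  then obtain k0 where k0: "\<forall>v\<in>k ` {a..d}. norm v \<le> k0" unfolding bounded_iff ..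
  define B where "B = max (max B1 1) (\<zeta> * exp 1)"
  have B: "1 \<le> B" by (simp add: B_def)
  have yB: "\<bar>y t\<bar> \<le> B" if "t \<in> {a..d}" for t
  proof -
    have "\<bar>y t\<bar> \<le> B1" using B1 that by simp
    then show ?thesis by (simp add: B_def)
  qed
  let ?\<sigma> = "\<lambda>t. ang.sig b \<zeta> (x t)"
  have \<sigma>B: "\<bar>?\<sigma> t\<bar> \<le> B" if "t \<in> {a..d}" for t
  proof -
    have "\<bar>?\<sigma> t\<bar> \<le> \<zeta> * exp 1" using ang.sig_bounds[OF b \<zeta> xr[OF that]] by simp
    then show ?thesis by (simp add: B_def)
  qed
  let ?S1 = "\<lambda>t. ang.S b (y t) (x t)" and ?S0 = "\<lambda>t. ang.S b (?\<sigma> t) (x t)"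
  define D where "D = (\<lambda>t. - (\<theta> * k t * y t * ?S1 t)
      - ?\<sigma> t * (\<theta> * ?S0 t / (1 + x t * ?S0 t)) * - (k t * (1 + x t * ?S1 t)))"
  have der: "((\<lambda>t. y t - ?\<sigma> t) has_vector_derivative D t) (at t within {a..d})" if t: "t \<in> {a..d}" for t
  proof -
    have dg: "(\<gamma> has_vector_derivative c (\<gamma> t) *\<^sub>R A b (\<gamma> t)) (at t within {a..d})"
      using sol t by (simp add: solution_on_def flow_def)
    note p = polar_derivatives[OF dg conjunct1[OF up[OF t]] conjunct2[OF up[OF t]]]
    have dy: "(y has_real_derivative - (\<theta> * k t * y t * ?S1 t)) (at t within {a..d})"
      using p(1) by (simp add: y_def k_def x_def ang.S_def)
    have dx: "(x has_real_derivative - (k t * (1 + x t * ?S1 t))) (at t within {a..d})"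
      using p(2) by (simp add: y_def k_def x_def ang.S_def)
    have "(ang.sig b \<zeta> has_real_derivative ?\<sigma> t * (\<theta> * ?S0 t / (1 + x t * ?S0 t))) (at (x t) within x ` {a..d})"
      by (rule DERIV_subset[OF ang.sig_derivative[OF b \<zeta> xr[OF t]]]) (use xr in auto)
    from DERIV_image_chain[OF this dx] have "(?\<sigma> has_real_derivative
        ?\<sigma> t * (\<theta> * ?S0 t / (1 + x t * ?S0 t)) * - (k t * (1 + x t * ?S1 t))) (at t within {a..d})"
      by (simp add: o_def)
    from DERIV_diff[OF dy this] show ?thesis
      by (simp add: D_def has_real_derivative_iff_has_vector_derivative)
  qed
  \<comment> \<open>On the range up to \<open>B\<close>, which contains both \<open>y\<close> and
    \<open>?\<sigma>\<close>, \<open>M1\<close> is a Lipschitz constant of \<open>\<tau> * S\<close>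
    in \<open>\<tau>\<close> and \<open>M2\<close> is a bound on \<open>S\<close>.\<close>
  define M1 M2 where "M1 = N * (K * W * (Suc N * B ^ Suc N))" and "M2 = N * (K * W * B ^ N)"
  have bw: "\<bar>b j * w j (x t)\<bar> \<le> K * W" if "j \<in> {1..N}" "t \<in> {a..d}" for j t
    unfolding abs_mult using b that bdw xr K by (intro mult_mono) (auto simp: ang.adm_def)
  have S1: "\<bar>?S1 t\<bar> \<le> M2" if t: "t \<in> {a..d}" for t
  proof -
    have "\<bar>?S1 t\<bar> \<le> (\<Sum>j=1..N. K * W * B ^ N)"
      unfolding ang.S_def
    proof (rule order_trans[OF sum_abs sum_mono])
      fix j assume j: "j \<in> {1..N}"
      have "\<bar>y t\<bar> ^ j \<le> B ^ j" using yB[OF t] by (intro power_mono) auto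
      also have "\<dots> \<le> B ^ N" using B j by (intro power_increasing) auto
      finally have "\<bar>b j * w j (x t)\<bar> * \<bar>y t\<bar> ^ j \<le> K * W * B ^ N"
        using bw[OF j t] K W by (intro mult_mono) auto
      then show "\<bar>b j * y t ^ j * w j (x t)\<bar> \<le> K * W * B ^ N" by (simp add: abs_mult power_abs mult_ac)
    qed
    then show ?thesis by (simp add: M2_def)
  qed
  have S01: "\<bar>y t * ?S1 t - ?\<sigma> t * ?S0 t\<bar> \<le> M1 * \<bar>y t - ?\<sigma> t\<bar>" if t: "t \<in> {a..d}" for t
  proof -
    have eq: "y t * ?S1 t - ?\<sigma> t * ?S0 t = (\<Sum>j=1..N. b j * w j (x t) * (y t ^ Suc j - ?\<sigma> t ^ Suc j))"
      unfolding ang.S_def sum_distrib_left sum_subtractf[symmetric] by (rule sum.cong) (simp_all add: algebra_simps)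
    have "\<bar>y t * ?S1 t - ?\<sigma> t * ?S0 t\<bar> \<le> (\<Sum>j=1..N. K * W * (Suc N * B ^ Suc N * \<bar>y t - ?\<sigma> t\<bar>))"
      unfolding eq
    proof (rule order_trans[OF sum_abs sum_mono])
      fix j assume j: "j \<in> {1..N}"
      have "\<bar>y t ^ Suc j - ?\<sigma> t ^ Suc j\<bar> \<le> Suc j * B ^ Suc j * \<bar>y t - ?\<sigma> t\<bar>"
        by (rule power_diff_bound[OF yB[OF t] \<sigma>B[OF t] B])
      also have "\<dots> \<le> Suc N * B ^ Suc N * \<bar>y t - ?\<sigma> t\<bar>"
        using j B by (intro mult_right_mono mult_mono power_increasing) auto
      finally show "\<bar>b j * w j (x t) * (y t ^ Suc j - ?\<sigma> t ^ Suc j)\<bar> \<le> K * W * (Suc N * B ^ Suc N * \<bar>y t - ?\<sigma> t\<bar>)"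
        unfolding abs_mult[of "b j * w j (x t)"] using bw[OF j t] K W by (intro mult_mono) auto
    qed
    moreover have "(\<Sum>j=1..N. K * W * (r * v)) = N * (K * W * r) * v" for r v :: real by simp
    ultimately show ?thesis unfolding M1_def by (simp only:)
  qed
  have M: "M1 \<ge> 0" "M2 \<ge> 0" using K W B by (auto simp: M1_def M2_def)
  have k00: "k0 \<ge> 0" using k0 t by (metis abs_ge_zero imageI order_trans real_norm_def)
  have bd: "norm (D t) \<le> (\<theta> * k0 * 2 * (M1 + M2)) * norm (y t - ?\<sigma> t)" if t: "t \<in> {a..d}" for t
  proof -
    let ?u = "x t" and ?Q = "?S0 t"
    have s0: "\<bar>?Q\<bar> \<le> 1/16" by (rule ang.S_small[OF b \<zeta> xr[OF t]])
    have u: "\<bar>?u\<bar> \<le> 1" using xr[OF t] by auto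
    have uq: "\<bar>?u * ?Q\<bar> \<le> 1 * (1/16)" unfolding abs_mult by (intro mult_mono u s0) auto
    then have den: "1 + ?u * ?Q \<ge> 1/2" by linarith
    then have nz: "1 + ?u * ?Q \<noteq> 0" by linarith
    \<comment> \<open>Over a common denominator every term of the numerator contains a difference
      that vanishes when the two values of \<open>\<tau>\<close> agree.\<close>
    have gen: "- (\<theta> * k * y * S) - s * (\<theta> * Q / (1 + u * Q)) * - (k * (1 + u * S))
        = - (\<theta> * k) * ((y * S - s * Q) + u * Q * S * (y - s)) / (1 + u * Q)"
      if "1 + u * Q \<noteq> 0" for k y S s Q u :: real
      using that by (simp add: field_simps)
    have D_eq: "D t = - (\<theta> * k t) * ((y t * ?S1 t - ?\<sigma> t * ?Q) + ?u * ?Q * ?S1 t * (y t - ?\<sigma> t)) / (1 + ?u * ?Q)"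
      unfolding D_def by (rule gen[OF nz])
    let ?P = "(y t * ?S1 t - ?\<sigma> t * ?Q) + ?u * ?Q * ?S1 t * (y t - ?\<sigma> t)"
    have "\<bar>?u * ?Q * ?S1 t * (y t - ?\<sigma> t)\<bar> \<le> 1 * M2 * \<bar>y t - ?\<sigma> t\<bar>"
      unfolding abs_mult[of "?u * ?Q * ?S1 t"] abs_mult[of "?u * ?Q"]
      using uq S1[OF t] M by (intro mult_right_mono mult_mono) auto
    then have P: "\<bar>?P\<bar> \<le> (M1 + M2) * \<bar>y t - ?\<sigma> t\<bar>"
      using S01[OF t] abs_triangle_ineq[of "y t * ?S1 t - ?\<sigma> t * ?Q" "?u * ?Q * ?S1 t * (y t - ?\<sigma> t)"]
      by (simp add: distrib_right)
    have kt: "\<bar>k t\<bar> \<le> k0" using k0 t by simp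
    have "\<bar>D t\<bar> = \<bar>\<theta> * k t\<bar> * \<bar>?P\<bar> / (1 + ?u * ?Q)"
      unfolding D_eq abs_divide abs_mult[of "- (\<theta> * k t)"] using den by simp
    also have "\<dots> \<le> \<bar>\<theta> * k t\<bar> * \<bar>?P\<bar> / (1/2)"
      using den by (intro divide_left_mono) auto
    also have "\<dots> = \<bar>\<theta> * k t\<bar> * \<bar>?P\<bar> * 2" by simp
    also have "\<dots> \<le> (\<theta> * k0) * ((M1 + M2) * \<bar>y t - ?\<sigma> t\<bar>) * 2"
      using \<theta> kt k00 M P by (intro mult_right_mono mult_mono) (auto simp: abs_mult)
    finally show ?thesis by (simp add: mult_ac)
  qed
  have "y t - ?\<sigma> t = 0"
  proof (rule gronwall_zero[OF der bd])
    show "y t0 - ?\<sigma> t0 = 0" using lab by (simp add: Lab_def y_def x_def)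
  qed (use t0 t in auto)
  then show ?thesis using up[OF t] by (simp add: Lab_def y_def x_def)
qed

lemma Lab_tau:
  assumes "ang.adm b" "0 < \<zeta>" "\<zeta> < ang.R" "Lab b \<zeta> z"
  shows "\<zeta> * exp (-1) \<le> tau z" "tau z \<le> \<zeta> * exp 1"
  using ang.sig_bounds[OF assms(1-3), of "xi z"] xi_range[of z] assms(4) by (auto simp: Lab_def)

text \<open>While the trajectory stays above the x-axis its label is fixed and \<open>xi\<close>
  does not increase. It cannot stay there forever: it would converge to a point of the arc with that
  label, hence to an equilibrium, and the origin is the only one.\<close>

lemma half_turn:
  assumes b: "ang.adm b" and c: "damp c" and \<zeta>: "0 < \<zeta>" "\<zeta> < ang.R"
    and cpos: "\<And>z. z \<noteq> 0 \<Longrightarrow> \<zeta> * exp (-1) \<le> tau z \<Longrightarrow> c z > 0"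
    and sol: "solution_on (flow c b) {t0..} \<gamma>" and lab: "Lab b \<zeta> (\<gamma> t0)" and up: "upper (\<gamma> t0)"
  obtains t1 where "t0 < t1" "snd (\<gamma> t1) = 0" "fst (\<gamma> t1) < 0"
    "\<And>t. t \<in> {t0<..<t1} \<Longrightarrow> snd (\<gamma> t) > 0" "\<And>t. t \<in> {t0..t1} \<Longrightarrow> Lab b \<zeta> (\<gamma> t)"
proof -
  have nz: "\<gamma> t \<noteq> 0" if "t \<ge> t0" for t
    using flow_nonzero[OF c solution_on_subset[OF sol], of t0 t t0 t] lab that by (auto simp: Lab_def)
  have cont: "continuous_on {t0..} \<gamma>" by (rule solution_on_continuous[OF sol])
  have conty: "continuous_on {t0..} (\<lambda>t. snd (\<gamma> t))" by (intro continuous_intros cont)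
  have clab: "c z > 0" if "Lab b \<zeta> z" for z
    using Lab_tau[OF b \<zeta> that] that by (intro cpos) (auto simp: Lab_def)
  have conf: "Lab b \<zeta> (\<gamma> t)" if "\<And>s. s \<in> {t0..d} \<Longrightarrow> 0 \<le> snd (\<gamma> s)" "t \<in> {t0..d}" for t d
  proof (rule label_constant[OF b c \<zeta>, of t0 d \<gamma> t0])
    show "solution_on (flow c b) {t0..d} \<gamma>" by (rule solution_on_subset[OF sol]) auto
  qed (use that nz lab in auto)
  have y0: "0 \<le> snd (\<gamma> t0)" using up by (auto simp: upper_def)
  obtain e where e: "e > 0" "\<And>t. t0 < t \<Longrightarrow> t < t0 + e \<Longrightarrow> snd (\<gamma> t) > 0"
  proof (cases "snd (\<gamma> t0) = 0")
    case True
    then have "fst (\<gamma> t0) > 0" using up by (simp add: upper_def)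
    from axis_crossing[OF sol _ True clab[OF lab] this]
    obtain e where "e > 0" "\<And>h. 0 < h \<Longrightarrow> h < e \<Longrightarrow> t0 + h \<in> {t0..} \<Longrightarrow> snd (\<gamma> (t0 + h)) > 0" by auto
    then show thesis using that[of e] by (metis add.commute add_diff_cancel_left' atLeast_iff diff_add_cancel
          diff_gt_0_iff_gt less_diff_eq less_imp_le)
  next
    case False
    then have "snd (\<gamma> t0) > 0" using y0 by simp
    moreover have "((\<lambda>t. snd (\<gamma> t)) \<longlongrightarrow> snd (\<gamma> t0)) (at t0 within {t0..})"
      using conty by (auto simp: continuous_on_def)
    ultimately have "eventually (\<lambda>t. snd (\<gamma> t) > 0) (at t0 within {t0..})"
      by (intro order_tendstoD)
    then obtain e where "e > 0" "\<forall>t\<in>{t0..}. t \<noteq> t0 \<and> dist t t0 < e \<longrightarrow> snd (\<gamma> t) > 0"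
      unfolding eventually_at by blast
    then show thesis using that[of e] by (auto simp: dist_real_def)
  qed
  have "\<exists>t>t0. snd (\<gamma> t) \<le> 0"
  proof (rule ccontr)
    assume "\<not> (\<exists>t>t0. snd (\<gamma> t) \<le> 0)"
    then have ypos: "snd (\<gamma> t) > 0" if "t > t0" for t using that by force
    have lab': "Lab b \<zeta> (\<gamma> t)" if "t \<ge> t0" for t
    proof (rule conf[of t t])
      show "0 \<le> snd (\<gamma> s)" if "s \<in> {t0..t}" for s
        using ypos[of s] y0 that by (cases "s = t0") auto
    qed (use that in simp)
    have dec: "xi (\<gamma> t) \<le> xi (\<gamma> s)" if "t0 \<le> s" "s \<le> t" for s t
    proof -
      define D where "D = (\<lambda>x. - (c (\<gamma> x) * snd (\<gamma> x) ^ r1 / rad (\<gamma> x) ^ l1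
            * (1 + xi (\<gamma> x) * (\<Sum>j=1..N. b j * tau (\<gamma> x) ^ j * w j (xi (\<gamma> x))))))"
      have d: "((\<lambda>t. xi (\<gamma> t)) has_derivative (\<lambda>h. D x * h)) (at x within {s..t})" if "s \<le> x" "x \<le> t" for x
      proof -
        have L: "Lab b \<zeta> (\<gamma> x)" using that \<open>t0 \<le> s\<close> by (intro lab') auto
        have "(\<gamma> has_vector_derivative c (\<gamma> x) *\<^sub>R A b (\<gamma> x)) (at x within {s..t})"
          using solution_on_subset[OF sol, of "{s..t}"] that \<open>t0 \<le> s\<close> by (auto simp: solution_on_def flow_def)
        from polar_derivatives(2)[OF this] L show ?thesis
          unfolding D_def has_field_derivative_def Lab_def by blast
      qed
      obtain x where x: "x \<in> {s..t}" "xi (\<gamma> t) - xi (\<gamma> s) = D x * (t - s)"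
        using mvt_very_simple[OF \<open>s \<le> t\<close> d] by blast
      have L: "Lab b \<zeta> (\<gamma> x)" using x \<open>t0 \<le> s\<close> by (intro lab') auto
      then have xr: "xi (\<gamma> x) \<in> {-1..1}" using xi_range by (simp add: Lab_def)
      have "\<bar>\<Sum>j=1..N. b j * tau (\<gamma> x) ^ j * w j (xi (\<gamma> x))\<bar> \<le> 1/16"
        using ang.S_small[OF b \<zeta> xr] L by (simp add: ang.S_def Lab_def)
      then have "\<bar>xi (\<gamma> x) * (\<Sum>j=1..N. b j * tau (\<gamma> x) ^ j * w j (xi (\<gamma> x)))\<bar> \<le> 1 * (1/16)"
        unfolding abs_mult using xr by (intro mult_mono) auto
      then have "1 + xi (\<gamma> x) * (\<Sum>j=1..N. b j * tau (\<gamma> x) ^ j * w j (xi (\<gamma> x))) \<ge> 0" by linarith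
      then have "D x \<le> 0"
        unfolding D_def neg_le_0_iff_le using L c rad_pos[of "\<gamma> x"]
        by (intro mult_nonneg_nonneg divide_nonneg_nonneg zero_le_power) (auto simp: Lab_def damp_def simp del: split_paired_All)
      then have "D x * (t - s) \<le> 0" using \<open>s \<le> t\<close> by (intro mult_nonpos_nonneg) auto
      then show ?thesis using x(2) by linarith
    qed
    obtain u where u: "((\<lambda>t. xi (\<gamma> t)) \<longlongrightarrow> u) at_top" "-1 \<le> u" "\<And>t. t0 \<le> t \<Longrightarrow> u \<le> xi (\<gamma> t)"
    proof (rule decreasing_bounded_tendsto[of t0 "\<lambda>t. xi (\<gamma> t)" "-1"])
      show "- 1 \<le> xi (\<gamma> t)" if "t0 \<le> t" for t using xi_range[OF nz[OF that]] by simp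
    qed (use dec in auto)
    have ur: "u \<in> {-1..1}" using u(2) u(3)[of t0] xi_range[OF nz[of t0]] by auto
    \<comment> \<open>The arc with label \<open>\<zeta>\<close>, parametrized by the angle including
      both ends, so that convergence of \<open>xi\<close> implies convergence of the
      trajectory.\<close>
    let ?g = "\<lambda>u. pt (ang.sig b \<zeta> u) u"
    have contg: "continuous_on {-1..1} ?g"
      by (rule pt_continuous) (use ang.sig_continuous[OF b \<zeta>] ang.sig_bounds(3)[OF b \<zeta>] in \<open>auto intro: continuous_on_id\<close>)
    have "\<forall>t\<ge>t0. xi (\<gamma> t) \<in> {-1..1}" using xi_range nz by blast
    then have ev: "\<forall>\<^sub>F t in at_top. xi (\<gamma> t) \<in> {-1..1}" unfolding eventually_at_top_linorder ..
    have "((\<lambda>t. ?g (xi (\<gamma> t))) \<longlongrightarrow> ?g u) at_top"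
      by (rule continuous_on_tendsto_compose[OF contg u(1) ur ev])
    moreover have "\<gamma> t = ?g (xi (\<gamma> t))" if "t \<ge> t0" for t
      using lab'[OF that] pt_tau_xi[of "\<gamma> t"] by (simp add: Lab_def)
    then have "eventually (\<lambda>t. ?g (xi (\<gamma> t)) = \<gamma> t) at_top"
      unfolding eventually_at_top_linorder by metis
    ultimately have lim: "(\<gamma> \<longlongrightarrow> ?g u) at_top" by (rule Lim_transform_eventually)
    have sp: "ang.sig b \<zeta> u > 0" by (rule ang.sig_bounds(3)[OF b \<zeta> ur])
    note pp = pt_props[OF sp ur]
    have "flow c b (?g u) = 0"
      by (rule limit_is_equilibrium[OF sol lip_bounded_continuous[OF flow_lip[OF c]] lim])
    moreover have "c (?g u) > 0"
      using pp ang.sig_bounds(1)[OF b \<zeta> ur] by (intro cpos) auto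
    ultimately have "A b (?g u) = 0" by (simp add: flow_def)
    then show False using pp(1) A_eq_0 by blast
  qed
  then obtain t2 where t2: "t0 < t2" "snd (\<gamma> t2) \<le> 0" by blast
  \<comment> \<open>A time shortly after \<open>t0\<close>, as the trajectory may begin on the
    x-axis itself.\<close>
  define m where "m = min (t0 + e / 2) t2"
  have m: "t0 < m" "m \<le> t2" "m < t0 + e" using t2 e by (auto simp: m_def)
  then have ym: "snd (\<gamma> m) > 0" using e by auto
  have "continuous_on {m..t2} (\<lambda>t. snd (\<gamma> t))"
    by (rule continuous_on_subset[OF conty]) (use m in auto)
  from first_nonpos[OF this m(2) ym t2(2)] obtain t1 where
    t1: "t1 \<in> {m<..t2}" "snd (\<gamma> t1) = 0" "\<And>s. s \<in> {m..<t1} \<Longrightarrow> snd (\<gamma> s) > 0" by blast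
  have ypos: "snd (\<gamma> t) > 0" if "t \<in> {t0<..<t1}" for t
    using that e(2)[of t] t1(3)[of t] m by (cases "t < m") auto
  have ynn: "0 \<le> snd (\<gamma> t)" if "t \<in> {t0..t1}" for t
    using that ypos[of t] y0 t1(2) by (cases "t = t0"; cases "t = t1") auto
  have lab1: "Lab b \<zeta> (\<gamma> t)" if "t \<in> {t0..t1}" for t by (rule conf[OF ynn that])
  have L1: "Lab b \<zeta> (\<gamma> t1)" using t1 m by (intro lab1) auto
  \<comment> \<open>At a point of the positive x-axis the trajectory would have come from
    below.\<close>
  have "fst (\<gamma> t1) < 0"
  proof (rule ccontr)
    assume "\<not> fst (\<gamma> t1) < 0"
    moreover have "fst (\<gamma> t1) \<noteq> 0" using L1 t1(2) by (auto simp: Lab_def prod_eq_iff)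
    ultimately have fp: "fst (\<gamma> t1) > 0" by simp
    have t1in: "t1 \<in> {t0..}" using t1(1) m by simp
    obtain e' where e': "e' > 0" "\<And>h. 0 < h \<Longrightarrow> h < e' \<Longrightarrow> t1 + h \<in> {t0..} \<Longrightarrow> snd (\<gamma> (t1 + h)) > 0"
      "\<And>h. 0 < h \<Longrightarrow> h < e' \<Longrightarrow> t1 - h \<in> {t0..} \<Longrightarrow> snd (\<gamma> (t1 - h)) < 0"
      by (rule axis_crossing[OF sol t1in t1(2) clab[OF L1] fp], rule that)
    define h where "h = min (e' / 2) ((t1 - t0) / 2)"
    have t01: "t0 < t1" using t1(1) m by simp
    moreover have "h \<le> e' / 2" unfolding h_def by (rule min.cobounded1)
    moreover have "h \<le> (t1 - t0) / 2" unfolding h_def by (rule min.cobounded2)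
    moreover have "0 < h" using t01 e'(1) by (simp add: h_def)
    ultimately have "0 < h" "h < e'" "h < t1 - t0" using e'(1) t01 by simp_all
    then show False using e'(3)[of h] ypos[of "t1 - h"] by auto
  qed
  moreover have "t0 < t1" using t1(1) m by simp
  ultimately show thesis using that t1(2) ypos lab1 by blast
qed

end

section \<open>Closed orbits near infinity\<close>

context polar_flow
begin

text \<open>The arc with label \<open>t\<close> in the closed upper half-plane and its image under
  reflection in the origin. The two join to a closed curve exactly when \<open>sig\<close> takes the
  same value at \<open>u = 1\<close> and \<open>u = -1\<close>.\<close>

definition Gam :: "(nat \<Rightarrow> real) \<Rightarrow> real \<Rightarrow> (real \<times> real) set" where
  "Gam b t = {z. Lab b t z \<or> Lab b t (- z)}"

lemma Lab_pt:
  assumes "ang.adm b" "0 < t" "t < ang.R" "u \<in> {-1..1}"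
  shows "Lab b t (pt (ang.sig b t u) u)"
  using pt_props[OF ang.sig_bounds(3)[OF assms] assms(4)] by (simp add: Lab_def)

lemma Lab_eq_pt: "Lab b t z \<Longrightarrow> z = pt (ang.sig b t (xi z)) (xi z)"
  using pt_tau_xi[of z] by (simp add: Lab_def)

lemma Gam_norm:
  assumes b: "ang.adm b" and t: "0 < t" "t < ang.R" and M: "\<And>z. z \<noteq> 0 \<Longrightarrow> tau z \<le> t * exp 1 \<Longrightarrow> norm z > M"
  shows "Gam b t \<subseteq> {z. norm z > M}"
proof
  fix z assume "z \<in> Gam b t"
  then consider "Lab b t z" | "Lab b t (- z)" by (auto simp: Gam_def)
  then have "z \<noteq> 0 \<and> tau z \<le> t * exp 1"
    using Lab_tau(2)[OF b t, of z] Lab_tau(2)[OF b t, of "- z"] by cases (auto simp: Lab_def tau_minus)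
  then show "z \<in> {z. norm z > M}" using M by simp
qed

lemma xi_neg_axis: "z \<noteq> 0 \<Longrightarrow> snd z = 0 \<Longrightarrow> fst z < 0 \<Longrightarrow> xi z = -1"
  using xi_axis[of "- z"] by (simp add: xi_minus)

lemma outer_cutoff:
  assumes "\<epsilon> > 0"
  obtains M where "M \<ge> 0" and "\<And>z. z \<noteq> 0 \<Longrightarrow> \<epsilon> \<le> tau z \<Longrightarrow> norm z \<le> M"
proof -
  obtain M where M: "\<And>z. norm z > M \<Longrightarrow> z \<noteq> 0 \<and> tau z < \<epsilon>"
    using norm_large_imp_tau_small[OF assms] by blast
  show thesis
  proof (rule that[of "max M 0"])
    fix z :: "real \<times> real" assume "z \<noteq> 0" "\<epsilon> \<le> tau z"
    then have "\<not> norm z > M" using M[of z] by auto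
    then show "norm z \<le> max M 0" by simp
  qed simp
qed

text \<open>A trajectory starting on the positive y-axis meets the negative y-axis in the opposite
  point, since the ends of the two arcs match. Oddness of the field then gives
  \<open>\<gamma> (t3 + s) = - \<gamma> s\<close> and the period \<open>2 * t3\<close>.\<close>

lemma Gam_periodic:
  assumes b: "ang.adm b" and t: "0 < t" "t < ang.R" and eq: "ang.sig b t 1 = ang.sig b t (-1)"
  shows "periodic_orbit (A b) (Gam b t)"
proof -
  have "t * exp (-1) > 0" using t by simp
  then obtain M where M: "\<And>z. z \<noteq> 0 \<Longrightarrow> t * exp (-1) \<le> tau z \<Longrightarrow> norm z \<le> M"
    using outer_cutoff by blast
  \<comment> \<open>The cutoff equals 1 on the curve, so the global solution obtained below solves
    (A) once it is known to stay on the curve.\<close>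
  define c where "c = cutoff M"
  have c: "damp c" unfolding c_def by (rule damp_cutoff)
  have cpos: "c z > 0" if "z \<noteq> 0" "t * exp (-1) \<le> tau z" for z
    using cutoff_eq_1[OF M[OF that]] by (simp add: c_def)
  have c1: "c z = 1" if "z \<in> Gam b t" for z
  proof -
    have "z \<noteq> 0 \<and> t * exp (-1) \<le> tau z"
      using that Lab_tau(1)[OF b t, of z] Lab_tau(1)[OF b t, of "- z"] by (auto simp: Gam_def Lab_def tau_minus)
    then show ?thesis unfolding c_def by (intro cutoff_eq_1 M) auto
  qed
  define z0 where "z0 = pt (ang.sig b t 0) 0"
  have L0: "Lab b t z0" unfolding z0_def by (rule Lab_pt[OF b t]) simp
  have z0: "fst z0 = 0" by (simp add: z0_def pt_def)
  then have y0: "snd z0 > 0" using L0 by (auto simp: Lab_def prod_eq_iff less_le)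
  obtain \<gamma> where g: "\<gamma> 0 = z0" "solution_on (flow c b) UNIV \<gamma>"
    using cutoff_global_solution[OF A_lip_bounded, of z0 M b] unfolding flow_def[abs_def] c_def by metis
  have contg: "continuous_on UNIV \<gamma>" by (rule solution_on_continuous[OF g(2)])
  have sol0: "solution_on (flow c b) {0..} \<gamma>" by (rule solution_on_subset[OF g(2)]) simp
  have LU0: "Lab b t (\<gamma> 0)" "upper (\<gamma> 0)" using L0 y0 g by (auto simp: upper_def)
  obtain t1 where t1: "0 < t1" "snd (\<gamma> t1) = 0" "fst (\<gamma> t1) < 0" "\<And>s. s \<in> {0..t1} \<Longrightarrow> Lab b t (\<gamma> s)"
    by (rule half_turn[OF b c t _ sol0 LU0], erule (1) cpos, rule that)
  let ?h = "\<lambda>s. - \<gamma> s"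
  have nz1: "\<gamma> t1 \<noteq> 0" using t1(3) by auto
  \<comment> \<open>Here \<open>eq\<close> enters: the mirror image of the end point carries the
    same label \<open>t\<close>.\<close>
  have L1: "Lab b t (?h t1)"
  proof -
    have "tau (\<gamma> t1) = ang.sig b t (xi (\<gamma> t1))" using t1(4)[of t1] t1(1) by (simp add: Lab_def)
    then have "tau (\<gamma> t1) = ang.sig b t 1" using xi_neg_axis[OF nz1 t1(2,3)] eq by simp
    then show ?thesis using nz1 t1(2) xi_neg_axis[OF nz1 t1(2,3)] by (simp add: Lab_def tau_minus xi_minus)
  qed
  have sol1: "solution_on (flow c b) {t1..} ?h" by (rule solution_on_subset[OF solution_minus[OF c g(2)]]) simp
  have U1: "upper (?h t1)" using t1 by (auto simp: upper_def)
  obtain t2 where t2: "t1 < t2" "snd (?h t2) = 0" "fst (?h t2) < 0" "\<And>s. s \<in> {t1..t2} \<Longrightarrow> Lab b t (?h s)"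
    by (rule half_turn[OF b c t _ sol1 L1 U1], erule (1) cpos, rule that)
  obtain t3 where t3: "t1 \<le> t3" "t3 \<le> t2" "fst (\<gamma> t3) = 0"
  proof -
    have "continuous_on {t1..t2} (\<lambda>s. fst (\<gamma> s))"
      by (intro continuous_intros continuous_on_subset[OF contg]) simp
    then show thesis using IVT'[of "\<lambda>s. fst (\<gamma> s)" t1 0 t2] t1 t2 that by auto
  qed
  have T: "t3 > 0" using t1 t3 by simp
  have h3: "?h t3 = z0"
  proof -
    have L: "Lab b t (?h t3)" using t2(4) t3 by auto
    have "xi (?h t3) = 0" using t3(3) by (simp add: xi_def)
    then show ?thesis using Lab_eq_pt[OF L] by (simp add: z0_def)
  qed
  have anti: "\<gamma> (t3 + s) = - \<gamma> s" for s
  proof -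
    have "(\<lambda>s. \<gamma> (t3 + s)) = ?h"
    proof (rule solution_unique_UNIV[OF flow_lip[OF c], where c=0])
      show "solution_on (flow c b) UNIV (\<lambda>s. \<gamma> (t3 + s))"
        by (rule solution_on_shift, rule solution_on_subset[OF g(2)]) simp
      show "solution_on (flow c b) UNIV ?h" by (rule solution_minus[OF c g(2)])
      show "\<gamma> (t3 + 0) = - \<gamma> 0" using h3 g(1) by (simp add: minus_equation_iff)
    qed
    then show ?thesis by meson
  qed
  have per: "\<gamma> (s + 2 * t3) = \<gamma> s" for s
    using anti[of "t3 + s"] anti[of s] by (simp add: algebra_simps)
  have inG_shift: "\<gamma> (s + of_int n * t3) \<in> Gam b t \<longleftrightarrow> \<gamma> s \<in> Gam b t" for s n
  proof -
    have sh: "\<gamma> (t3 + s) \<in> Gam b t \<longleftrightarrow> \<gamma> s \<in> Gam b t" for s unfolding anti by (auto simp: Gam_def)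
    show ?thesis
    proof (induction n rule: int_induct[where k=0])
      case (step1 i)
      then show ?case using sh[of "s + of_int i * t3"] by (simp add: algebra_simps)
    next
      case (step2 i)
      then show ?case using sh[of "s + of_int (i - 1) * t3"] by (simp add: algebra_simps)
    qed simp
  qed
  have inG0: "\<gamma> s \<in> Gam b t" if "s \<in> {0..t3}" for s
    using that t1(4)[of s] t2(4)[of s] t3 by (cases "s \<le> t1") (auto simp: Gam_def)
  have inG: "\<gamma> s \<in> Gam b t" for s
  proof -
    let ?n = "\<lfloor>s / t3\<rfloor>"
    have n: "of_int ?n \<le> s / t3" "s / t3 \<le> of_int ?n + 1" by linarith+
    have "s / t3 * t3 = s" using T by simp
    then have "of_int ?n * t3 \<le> s" "s \<le> of_int ?n * t3 + t3"
      using mult_right_mono[OF n(1), of t3] mult_right_mono[OF n(2), of t3] T by (simp_all add: distrib_right)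
    then have "\<gamma> (s + of_int (- ?n) * t3) \<in> Gam b t" by (intro inG0) auto
    then show ?thesis using inG_shift[of s "- ?n"] by simp
  qed
  have nz: "\<gamma> s \<noteq> 0" for s using inG[of s] by (auto simp: Gam_def Lab_def)
  have cx: "continuous_on S (\<lambda>s. xi (\<gamma> s))" for S
    by (rule continuous_on_compose2[OF xi_continuous continuous_on_subset[OF contg]])
      (use nz in auto)
  \<comment> \<open>The two quarter turns sweep the angles in \<open>{-1..0}\<close> and in
    \<open>{0..1}\<close>, and label and angle together determine the point.\<close>
  have cover: "z \<in> range \<gamma>" if z: "Lab b t z" for z
  proof (cases "xi z \<le> 0")
    case True
    have "xi (\<gamma> t1) \<le> xi z" using xi_neg_axis[OF nz1 t1(2,3)] xi_range[of z] z by (auto simp: Lab_def)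
    moreover have "xi z \<le> xi (\<gamma> 0)" using True z0 g(1) by (simp add: xi_def)
    ultimately obtain s where s: "0 \<le> s" "s \<le> t1" "xi (\<gamma> s) = xi z"
      using IVT2'[of "\<lambda>s. xi (\<gamma> s)" t1 "xi z" 0] t1(1) cx by auto
    have "\<gamma> s = z" using Lab_eq_pt[OF t1(4)[of s]] Lab_eq_pt[OF z] s by simp
    then show ?thesis by blast
  next
    case False
    have "xi (?h t1) = 1" using xi_neg_axis[OF nz1 t1(2,3)] by (simp add: xi_minus)
    moreover have "xi (?h t3) = 0" using t3(3) by (simp add: xi_def)
    moreover have "continuous_on {t1..t3} (\<lambda>s. xi (?h s))" unfolding xi_minus by (intro continuous_intros cx)
    ultimately obtain s where s: "t1 \<le> s" "s \<le> t3" "xi (?h s) = xi z"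
      using IVT2'[of "\<lambda>s. xi (?h s)" t3 "xi z" t1] t3(1) False xi_range[of z] z by (auto simp: Lab_def)
    have "?h s = z" using Lab_eq_pt[OF t2(4)[of s]] Lab_eq_pt[OF z] s t3(2) by simp
    then show ?thesis using anti[of s] by (metis rangeI)
  qed
  have "Gam b t = range \<gamma>"
  proof
    show "Gam b t \<subseteq> range \<gamma>"
    proof
      fix z assume "z \<in> Gam b t"
      then consider "Lab b t z" | "Lab b t (- z)" by (auto simp: Gam_def)
      then show "z \<in> range \<gamma>"
      proof cases
        case 2
        then obtain s where "- z = \<gamma> s" using cover by blast
        then have "z = \<gamma> (t3 + s)" unfolding anti[of s] by (metis add.inverse_inverse)
        then show ?thesis by blast
      qed (rule cover)
    qed
  qed (use inG in auto)
  moreover have "solution_on (A b) UNIV \<gamma>"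
    using g(2) c1 inG by (simp add: solution_on_def flow_def)
  moreover have "\<gamma> 0 \<noteq> \<gamma> t1" using y0 t1(2) g(1) by auto
  ultimately show ?thesis
    unfolding periodic_orbit_def using T per by (intro exI[of _ \<gamma>] exI[of _ "2 * t3"]) auto
qed

text \<open>A closed orbit might wind around several times before it closes. Among its crossings of
  the x-axis the one with the smallest \<open>tau\<close> is chosen; the crossings just after and
  just before have a \<open>tau\<close> at least as large. As the passage from one crossing to the
  next is increasing, these two inequalities force equality after a single half turn.\<close>

lemma periodic_orbit_Gam:
  assumes b: "ang.adm b" and G: "periodic_orbit (A b) \<Gamma>"
    and small: "\<And>z. z \<in> \<Gamma> \<Longrightarrow> z \<noteq> 0 \<and> tau z * exp 1 < \<rho>" and \<rho>: "\<rho> \<le> ang.R / 2"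
  obtains t where "0 < t" "t < \<rho>" "ang.sig b t 1 = ang.sig b t (-1)" "\<Gamma> = Gam b t"
proof -
  have R: "ang.R > 0" "\<rho> < ang.R" using ang.R(1) \<rho> by auto
  obtain \<gamma> T where g: "0 < T" "solution_on (A b) UNIV \<gamma>" "\<And>t. \<gamma> (t + T) = \<gamma> t" "\<Gamma> = range \<gamma>"
    using G by (auto simp: periodic_orbit_def)
  have sm: "\<gamma> s \<noteq> 0" "tau (\<gamma> s) * exp 1 < \<rho>" for s using small[of "\<gamma> s"] g(4) by auto
  have sol1: "solution_on (flow (\<lambda>z. 1) b) UNIV \<gamma>" using g(2) by (simp add: flow_1)
  have contg: "continuous_on UNIV \<gamma>" by (rule solution_on_continuous[OF g(2)])
  have per: "\<gamma> (t + of_int n * T) = \<gamma> t" for t n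
  proof (induction n rule: int_induct[where k=0])
    case (step1 i)
    then show ?case using g(3)[of "t + of_int i * T"] by (simp add: algebra_simps)
  next
    case (step2 i)
    then show ?case using g(3)[of "t + of_int (i - 1) * T"] by (simp add: algebra_simps)
  qed simp
  have conty: "continuous_on S (\<lambda>t. snd (\<gamma> t))" for S
    by (intro continuous_intros continuous_on_subset[OF contg]) simp
  \<comment> \<open>Over one period \<open>fst\<close> returns to its value, so its derivative
    \<open>- y ^ r1\<close> vanishes somewhere.\<close>
  have "\<exists>s\<in>{0..T}. snd (\<gamma> s) = 0"
  proof (rule ccontr)
    assume no: "\<not> (\<exists>s\<in>{0..T}. snd (\<gamma> s) = 0)"
    have d: "((\<lambda>t. fst (\<gamma> t)) has_derivative (\<lambda>h. - (snd (\<gamma> x) ^ r1) * h)) (at x within {0..T})" for x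
      using has_field_derivative_at_within[OF fst_derivative[OF sol1 UNIV_I], of x "{0..T}"]
      by (simp only: has_field_derivative_def mult_1_left)
    obtain x where x: "x \<in> {0..T}" "fst (\<gamma> T) - fst (\<gamma> 0) = - (snd (\<gamma> x) ^ r1) * (T - 0)"
      using mvt_very_simple[OF less_imp_le[OF g(1)] d] by blast
    then have "snd (\<gamma> x) = 0" using g(1) g(3)[of 0] by simp
    then show False using no x(1) by blast
  qed
  then have ne: "{s\<in>{0..T}. snd (\<gamma> s) = 0} \<noteq> {}" by blast
  have "closed {s\<in>{0..T}. snd (\<gamma> s) = 0}"
    by (rule continuous_closed_preimage_constant[OF conty closed_atLeastAtMost])
  moreover have "{s\<in>{0..T}. snd (\<gamma> s) = 0} \<subseteq> {0..T}" by blast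
  then have "bounded {s\<in>{0..T}. snd (\<gamma> s) = 0}" by (rule bounded_subset[OF bounded_closed_interval])
  ultimately have comp: "compact {s\<in>{0..T}. snd (\<gamma> s) = 0}"
    by (simp only: compact_eq_bounded_closed)
  have ct: "continuous_on S (\<lambda>s. tau (\<gamma> s))" for S
    by (rule continuous_on_compose2[OF tau_continuous continuous_on_subset[OF contg]]) (use sm in auto)
  obtain t0 where t0: "t0 \<in> {s\<in>{0..T}. snd (\<gamma> s) = 0}"
    "\<And>s. s \<in> {s\<in>{0..T}. snd (\<gamma> s) = 0} \<Longrightarrow> tau (\<gamma> t0) \<le> tau (\<gamma> s)"
    using continuous_attains_inf[OF comp ne ct] by blast
  have min: "tau (\<gamma> t0) \<le> tau (\<gamma> s)" if "snd (\<gamma> s) = 0" for s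
  proof -
    let ?n = "\<lfloor>s / T\<rfloor>"
    have n: "of_int ?n \<le> s / T" "s / T \<le> of_int ?n + 1" by linarith+
    have "s / T * T = s" using g(1) by simp
    then have "of_int ?n * T \<le> s" "s \<le> of_int ?n * T + T"
      using mult_right_mono[OF n(1), of T] mult_right_mono[OF n(2), of T] g(1) by (simp_all add: distrib_right)
    then have "s + of_int (- ?n) * T \<in> {0..T}" by auto
    then show ?thesis using t0(2)[of "s + of_int (- ?n) * T"] per[of s "- ?n"] that by auto
  qed
  have y0: "snd (\<gamma> t0) = 0" using t0 by simp
  \<comment> \<open>A sign that moves the chosen crossing to the positive x-axis.\<close>
  define \<sigma> :: real where "\<sigma> = (if fst (\<gamma> t0) > 0 then 1 else -1)"
  define h where "h = (\<lambda>s. \<sigma> *\<^sub>R \<gamma> s)"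
  have hg: "h = \<gamma> \<or> h = (\<lambda>s. - \<gamma> s)" by (auto simp: h_def \<sigma>_def)
  have solh: "solution_on (flow (\<lambda>z. 1) b) UNIV h"
    using hg sol1 solution_minus[OF damp_1 sol1] by auto
  have h0: "snd (h t0) = 0" "fst (h t0) > 0"
    using y0 sm(1)[of t0] by (auto simp: h_def \<sigma>_def prod_eq_iff)
  have tauh: "tau (h s) = tau (\<gamma> s)" for s using hg tau_minus by metis
  have smh: "h s \<noteq> 0" "tau (h s) * exp 1 < \<rho>" for s
    using hg sm(1)[of s] sm(2)[of s] by (auto simp only: tauh neg_equal_0_iff_equal)
  have zh: "snd (h s) = 0 \<longleftrightarrow> snd (\<gamma> s) = 0" for s by (auto simp: h_def \<sigma>_def)
  have minh: "tau (h t0) \<le> tau (h s)" if "snd (h s) = 0" for s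
    unfolding tauh using min that zh by blast
  have lab: "\<exists>t. 0 < t \<and> t < \<rho> \<and> ang.sig b t u = tau (h s)" if u: "u \<in> {-1..1}" for u s
  proof -
    have p: "0 < tau (h s)" "tau (h s) * exp 1 < ang.R" 
      using tau_pos[OF smh(1)[of s]] smh(2)[of s] R by linarith+
    obtain t where "0 < t" "t \<le> tau (h s) * exp 1" "ang.sig b t u = tau (h s)"
      by (rule ang.sig_surj[OF b p u], rule that)
    then show ?thesis using smh(2)[of s] by (intro exI[of _ t]) auto
  qed
  have x0: "xi (h t0) = 1" by (rule xi_axis[OF smh(1) h0])
  obtain t where t: "0 < t" "t < \<rho>" "ang.sig b t 1 = tau (h t0)" using lab[of 1 t0] by auto
  have tR: "t < ang.R" using t R by simp
  have L0: "Lab b t (h t0)" using smh(1) h0 x0 t by (simp add: Lab_def)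
  have solh0: "solution_on (flow (\<lambda>z. 1) b) {t0..} h" by (rule solution_on_subset[OF solh]) simp
  have U0: "upper (h t0)" using h0 by (simp add: upper_def)
  obtain t1 where t1: "t0 < t1" "snd (h t1) = 0" "fst (h t1) < 0" "\<And>s. s \<in> {t0..t1} \<Longrightarrow> Lab b t (h s)"
    by (rule half_turn[OF b damp_1 t(1) tR _ solh0 L0 U0], simp, rule that)
  have s1: "tau (h t1) = ang.sig b t (-1)"
    using t1(4)[of t1] t1(1) xi_neg_axis[OF smh(1) t1(2,3)] by (simp add: Lab_def)
  have le1: "ang.sig b t 1 \<le> ang.sig b t (-1)" using minh[OF t1(2)] s1 t(3) by simp
  obtain e where e: "e > 0" "\<And>h'. 0 < h' \<Longrightarrow> h' < e \<Longrightarrow> t0 + h' \<in> UNIV \<Longrightarrow> snd (h (t0 + h')) > 0"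
    "\<And>h'. 0 < h' \<Longrightarrow> h' < e \<Longrightarrow> t0 - h' \<in> UNIV \<Longrightarrow> snd (h (t0 - h')) < 0"
    by (rule axis_crossing[OF solh UNIV_I h0(1) _ h0(2)], simp, rule that)
  define m where "m = min (e / 2) (T / 2)"
  have m: "0 < m" "m < e" "m < T" using e(1) g(1) by (auto simp: m_def)
  \<comment> \<open>Time runs backwards from \<open>t0\<close>, where the curve lies below the
    x-axis; the first zero of \<open>f\<close> after \<open>m\<close> is the preceding
    crossing.\<close>
  define f where "f = (\<lambda>s. - snd (h (t0 - s)))"
  have cf: "continuous_on {m..T} f"
  proof -
    have "continuous_on UNIV h" by (rule solution_on_continuous[OF solh])
    then have "continuous_on {m..T} (\<lambda>s. h (t0 - s))"
      by (rule continuous_on_compose2) (auto intro!: continuous_intros)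
    then show ?thesis unfolding f_def by (intro continuous_on_minus continuous_on_snd)
  qed
  have "snd (h (t0 - T)) = 0" using zh y0 g(3)[of "t0 - T"] by simp
  then have fT: "f T \<le> 0" by (simp add: f_def)
  have fm: "f m > 0" using e(3)[of m] m by (simp add: f_def)
  obtain d where d: "d \<in> {m<..T}" "f d = 0" "\<And>s. s \<in> {m..<d} \<Longrightarrow> f s > 0"
    by (rule first_nonpos[OF cf less_imp_le[OF m(3)] fm fT], rule that)
  let ?k = "\<lambda>s. - h s"
  have solk: "solution_on (flow (\<lambda>z. 1) b) UNIV ?k" by (rule solution_minus[OF damp_1 solh])
  define t' where "t' = t0 - d"
  have t': "t' < t0" using d(1) m(1) by (simp add: t'_def)
  have kpos: "snd (?k s) > 0" if "s \<in> {t'<..<t0}" for s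
  proof (cases "t0 - s < m")
    case True
    then show ?thesis using e(3)[of "t0 - s"] that m by auto
  next
    case False
    then show ?thesis using d(3)[of "t0 - s"] that by (auto simp: f_def t'_def)
  qed
  have k0: "snd (?k t') = 0" using d(2) by (simp add: f_def t'_def)
  have kf: "fst (?k t') > 0"
  proof (rule ccontr)
    assume "\<not> fst (?k t') > 0"
    then have hp: "fst (h t') > 0" using smh(1)[of t'] k0 by (auto simp: prod_eq_iff)
    obtain e where e: "e > 0" "\<And>h'. 0 < h' \<Longrightarrow> h' < e \<Longrightarrow> t' + h' \<in> UNIV \<Longrightarrow> snd (h (t' + h')) > 0"
      "\<And>h'. 0 < h' \<Longrightarrow> h' < e \<Longrightarrow> t' - h' \<in> UNIV \<Longrightarrow> snd (h (t' - h')) < 0"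
      by (rule axis_crossing[OF solh UNIV_I _ _ hp], use k0 in simp, simp, rule that)
    define r where "r = min (e / 2) ((t0 - t') / 2)"
    have "r \<le> e / 2" unfolding r_def by (rule min.cobounded1)
    moreover have "r \<le> (t0 - t') / 2" unfolding r_def by (rule min.cobounded2)
    moreover have "0 < r" using t' e(1) by (simp add: r_def)
    ultimately have "0 < r" "r < e" "r < t0 - t'" using t' e(1) by simp_all
    then show False using e(2)[of r] kpos[of "t' + r"] by auto
  qed
  have xk: "xi (?k t') = 1" by (rule xi_axis[OF _ k0 kf]) (use smh(1) in simp)
  obtain t'' where t'': "0 < t''" "t'' < \<rho>" "ang.sig b t'' 1 = tau (h t')" using lab[of 1 t'] by auto
  have t''R: "t'' < ang.R" using t'' R by simp
  have "Lab b t'' (?k t0)"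
  proof (rule label_constant[OF b damp_1 t''(1) t''R, of t' t0 ?k t'])
    show "solution_on (flow (\<lambda>z. 1) b) {t'..t0} ?k" by (rule solution_on_subset[OF solk]) simp
    show "?k s \<noteq> 0 \<and> 0 \<le> snd (?k s)" if s: "s \<in> {t'..t0}" for s
    proof
      show "?k s \<noteq> 0" using smh(1)[of s] by simp
      show "0 \<le> snd (?k s)"
        using kpos[of s] k0 h0(1) s by (cases "s = t'"; cases "s = t0") auto
    qed
    show "Lab b t'' (?k t')" using smh(1)[of t'] k0 xk t''(3) by (simp add: Lab_def tau_minus)
  qed (use t' in auto)
  then have s2: "tau (h t0) = ang.sig b t'' (-1)" using x0 by (simp add: Lab_def tau_minus xi_minus)
  have "tau (h t0) \<le> tau (h t')" using minh[of t'] k0 by simp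
  \<comment> \<open>The preceding half turn starts at a \<open>tau\<close> at least as large, so its
    label \<open>t''\<close> is at least \<open>t\<close>, and its end, which is the crossing at
    \<open>t0\<close>, bounds \<open>sig t (-1)\<close> from above.\<close>
  then have "ang.sig b t 1 \<le> ang.sig b t'' 1" using t t'' by simp
  then have "t \<le> t''"
    using ang.sig_mono[OF b t''(1), of t 1] t \<rho> by (cases "t'' < t") auto
  then have "ang.sig b t (-1) \<le> ang.sig b t'' (-1)"
    using ang.sig_mono[OF b t(1), of t'' "-1"] t'' \<rho> by (cases "t = t''") auto
  then have eq: "ang.sig b t 1 = ang.sig b t (-1)" using s2 t(3) le1 by simp
  have "\<gamma> t0 \<in> Gam b t" using L0 hg by (auto simp: Gam_def)
  moreover have "\<gamma> t0 \<in> \<Gamma>" using g(4) by simp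
  ultimately have "\<Gamma> = Gam b t"
    using periodic_orbits_disjoint[OF A_lip_bounded G Gam_periodic[OF b t(1) tR eq]] by blast
  then show thesis using that t eq by blast
qed

text \<open>On the y-axis the value of \<open>tau\<close> is the label.\<close>

lemma Gam_inj:
  assumes b: "ang.adm b" and "0 < t" "t < ang.R" "0 < t'" "t' < ang.R" "Gam b t = Gam b t'"
  shows "t = t'"
proof -
  let ?z = "pt (ang.sig b t 0) 0"
  have L: "Lab b t ?z" using assms by (intro Lab_pt) auto
  have x: "xi ?z = 0" by (simp add: pt_def xi_def)
  have "?z \<in> Gam b t'" using L assms(6) by (auto simp: Gam_def)
  then have "tau ?z = ang.sig b t' 0" using x by (auto simp: Gam_def Lab_def tau_minus xi_minus)
  moreover have "tau ?z = ang.sig b t 0" using L x by (simp add: Lab_def)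
  ultimately show ?thesis using assms by (simp add: ang.sig_0)
qed

end

section \<open>Labels along trajectories and stability\<close>

context polar_flow
begin

text \<open>Extends labels to both half-planes by symmetry. Along a trajectory such a label is
  constant between crossings of the x-axis and may change at each of them.\<close>

definition labelled :: "(nat \<Rightarrow> real) \<Rightarrow> real \<Rightarrow> real \<times> real \<Rightarrow> bool" where
  "labelled b t z \<longleftrightarrow> (Lab b t z \<and> upper z) \<or> (Lab b t (- z) \<and> upper (- z))"

lemma labelled_minus: "labelled b t (- z) \<longleftrightarrow> labelled b t z"
  by (auto simp: labelled_def)

lemma labelled_tau:
  assumes "ang.adm b" "0 < t" "t < ang.R" "labelled b t z"
  shows "z \<noteq> 0" "t * exp (-1) \<le> tau z" "tau z \<le> t * exp 1"
proof -
  consider "Lab b t z" | "Lab b t (- z)" using assms(4) by (auto simp: labelled_def)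
  then have "z \<noteq> 0 \<and> t * exp (-1) \<le> tau z \<and> tau z \<le> t * exp 1"
  proof cases
    case 1
    then show ?thesis using Lab_tau[OF assms(1-3) 1] by (simp add: Lab_def)
  next
    case 2
    then show ?thesis using Lab_tau[OF assms(1-3) 2] unfolding tau_minus by (simp add: Lab_def)
  qed
  then show "z \<noteq> 0" "t * exp (-1) \<le> tau z" "tau z \<le> t * exp 1" by auto
qed

lemma labelled_exists:
  assumes b: "ang.adm b" and z: "z \<noteq> 0" "tau z * exp 1 < ang.R"
  obtains t where "0 < t" "t \<le> tau z * exp 1" "labelled b t z"
proof -
  have main: "\<exists>t. 0 < t \<and> t \<le> tau y * exp 1 \<and> Lab b t y \<and> upper y"
    if y: "y \<noteq> 0" "tau y * exp 1 < ang.R" "upper y" for y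
  proof -
    obtain t where "0 < t" "t \<le> tau y * exp 1" "ang.sig b t (xi y) = tau y"
      using ang.sig_surj[OF b tau_pos[OF y(1)] y(2) xi_range[OF y(1)]] by metis
    then show ?thesis using y by (intro exI[of _ t]) (auto simp: Lab_def upper_def)
  qed
  consider "upper z" | "upper (- z)"
    unfolding upper_def using z(1) by (cases z) (force simp: zero_prod_def)
  then show thesis
  proof cases
    case 1
    then show thesis using main[OF z 1] that by (auto simp: labelled_def)
  next
    case 2
    then have "\<exists>t. 0 < t \<and> t \<le> tau (- z) * exp 1 \<and> Lab b t (- z) \<and> upper (- z)"
      using z by (intro main) (simp_all add: tau_minus)
    then show thesis using that unfolding tau_minus labelled_def by blast
  qed
qed

lemma xi_neg_axis': "z \<noteq> 0 \<Longrightarrow> snd z = 0 \<Longrightarrow> fst z < 0 \<Longrightarrow> xi z = -1"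
  using xi_axis[of "- z"] by (simp add: xi_minus)

text \<open>At the end of a half turn the next label \<open>t'\<close> is given by
  \<open>sig t' 1 = sig t (-1)\<close>, and monotonicity of \<open>sig\<close> compares it with
  \<open>t0\<close>. The factor \<open>exp 2\<close> keeps \<open>t'\<close> below
  \<open>R / 2\<close>: one \<open>exp 1\<close> for the passage from label to \<open>tau\<close>
  and one for the way back.\<close>

lemma label_drop:
  assumes b: "ang.adm b" and t: "0 < t" "t * exp 2 < ang.R / 2"
    and lt: "ang.sig b t (-1) < ang.sig b t0 1" "0 < t0" "t0 < ang.R / 2"
    and z: "Lab b t z" "snd z = 0" "fst z < 0"
  obtains t' where "0 < t'" "t' < t0" "labelled b t' z"
proof -
  have nz: "z \<noteq> 0" using z(3) by auto
  have tR: "t < ang.R"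
  proof -
    have "t * 1 \<le> t * exp 2" using t by (intro mult_left_mono) auto
    then show ?thesis using t ang.R(1) by linarith
  qed
  have tz: "tau z = ang.sig b t (-1)" using z(1) xi_neg_axis'[OF nz z(2,3)] by (simp add: Lab_def)
  have "tau z * exp 1 \<le> t * exp 1 * exp 1"
    unfolding tz using ang.sig_bounds(2)[OF b t(1) tR, of "-1"] by (intro mult_right_mono) auto
  also have "\<dots> = t * exp 2" by (simp add: mult.assoc flip: exp_add)
  finally have small: "tau z * exp 1 < ang.R / 2" using t by simp
  have "tau z * exp 1 < ang.R" using small ang.R(1) by linarith
  note sz = this
  obtain t' where t': "0 < t'" "t' \<le> tau z * exp 1" "ang.sig b t' 1 = tau z"
    by (rule ang.sig_surj[OF b tau_pos[OF nz] sz, where u=1], simp, rule that)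
  have mx: "- z \<noteq> 0" "snd (- z) = 0" "fst (- z) > 0" using z(2,3) by auto
  have "Lab b t' (- z)" using t'(3) xi_axis[OF mx] mx unfolding Lab_def tau_minus by simp
  then have "labelled b t' z" using mx by (simp add: labelled_def upper_def)
  moreover have "t' < t0"
  proof (rule ccontr)
    assume "\<not> t' < t0"
    then have "ang.sig b t0 1 \<le> ang.sig b t' 1"
      using ang.sig_mono[OF b lt(2), of t' 1] t' small by (cases "t' = t0") auto
    then show False using t'(3) tz lt by simp
  qed
  ultimately show thesis using t' that by blast
qed

text \<open>Labels are constant between crossings and drop at each crossing. Induction along the
  time interval avoids counting the crossings or ruling out beforehand that they accumulate.\<close>

lemma trapping:
  assumes b: "ang.adm b" and \<rho>: "0 < \<rho>" "\<rho> * exp 2 < ang.R / 2"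
    and pos: "\<And>t. 0 < t \<Longrightarrow> t < \<rho> \<Longrightarrow> ang.sig b t (-1) < ang.sig b t 1"
    and sol: "solution_on (A b) {0..d} \<gamma>" and d: "0 \<le> d"
    and t0: "0 < t0" "t0 < \<rho>" "labelled b t0 (\<gamma> 0)"
  obtains t where "0 < t" "t \<le> t0" "labelled b t (\<gamma> d)"
proof -
  have e2: "1 \<le> exp (2::real)" by simp
  have small: "t < ang.R / 2" "t * exp 2 < ang.R / 2" if "0 < t" "t \<le> t0" for t
  proof -
    have "t * exp 2 \<le> \<rho> * exp 2" using that t0 by (intro mult_right_mono) auto
    then show s: "t * exp 2 < ang.R / 2" using \<rho> by linarith
    have "t * 1 \<le> t * exp 2" using that by (intro mult_left_mono e2) auto
    then show "t < ang.R / 2" using s by linarith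
  qed
  have smallR: "t < ang.R" if "0 < t" "t \<le> t0" for t using small(1)[OF that] ang.R(1) by linarith
  have solf: "solution_on (flow (\<lambda>z. 1) b) {0..d} \<gamma>" using sol by (simp add: flow_1)
  define Q where "Q = (\<lambda>s. \<exists>t. 0 < t \<and> t \<le> t0 \<and> labelled b t (\<gamma> s))"
  have nz0: "\<gamma> 0 \<noteq> 0" using labelled_tau(1)[OF b t0(1) smallR t0(3)] t0 by simp
  have nz: "\<gamma> s \<noteq> 0" if "s \<in> {0..d}" for s
    by (rule flow_nonzero[OF damp_1 solf _ that nz0]) (use d in auto)
  \<comment> \<open>Of the curves \<open>\<gamma>\<close> and \<open>- \<gamma>\<close> the one in
    the required position is called \<open>h\<close> from here on, so that each case is argued
    once.\<close>
  have signed: "\<exists>h. (h = \<gamma> \<or> h = (\<lambda>s. - \<gamma> s)) \<and> P h" if "P \<gamma> \<or> P (\<lambda>s. - \<gamma> s)" for P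
    using that by blast
  have solh: "solution_on (flow (\<lambda>z. 1) b) {0..d} h" if "h = \<gamma> \<or> h = (\<lambda>s. - \<gamma> s)" for h
    using that solf solution_minus[OF damp_1 solf] by auto
  have conth: "continuous_on {0..d} (\<lambda>s. snd (h s))" if "h = \<gamma> \<or> h = (\<lambda>s. - \<gamma> s)" for h
    by (intro continuous_intros solution_on_continuous[OF solh[OF that]])
  have nzh: "h s \<noteq> 0" if "h = \<gamma> \<or> h = (\<lambda>s. - \<gamma> s)" "s \<in> {0..d}" for h s
    using that nz by auto
  have labh: "labelled b t (h s) \<longleftrightarrow> labelled b t (\<gamma> s)" if "h = \<gamma> \<or> h = (\<lambda>s. - \<gamma> s)" for h t s
    using that by (elim disjE) (simp_all only: labelled_minus)
  have keep: "Lab b t (h s')" if h: "h = \<gamma> \<or> h = (\<lambda>s. - \<gamma> s)" and t: "0 < t" "t \<le> t0" and "Lab b t (h s)"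
    and s: "s \<in> {0..d}" "s' \<in> {s..d}" and up: "\<And>x. x \<in> {s..s'} \<Longrightarrow> 0 \<le> snd (h x)" for h t s s'
  proof (rule label_constant[OF b damp_1 t(1) smallR[OF t], of s s' h s])
    show "solution_on (flow (\<lambda>z. 1) b) {s..s'} h"
      by (rule solution_on_subset[OF solh[OF h]]) (use s in auto)
    show "h x \<noteq> 0 \<and> 0 \<le> snd (h x)" if "x \<in> {s..s'}" for x
      using nzh[OF h, of x] up[OF that] that s by auto
  qed (use that in auto)
  have "Q d"
  proof (rule interval_induction[OF d])
    show "Q 0" using t0 by (auto simp: Q_def)
  next
    fix s assume s: "s \<in> {0..<d}" "Q s"
    then obtain t where t: "0 < t" "t \<le> t0" "labelled b t (\<gamma> s)" by (auto simp: Q_def)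
    then obtain h where h: "h = \<gamma> \<or> h = (\<lambda>s. - \<gamma> s)" and L: "Lab b t (h s)" "upper (h s)"
      using signed[of "\<lambda>h. Lab b t (h s) \<and> upper (h s)"] by (auto simp: labelled_def)
    have "\<exists>e>0. \<forall>x. s < x \<and> x < s + e \<and> x \<le> d \<longrightarrow> 0 < snd (h x)"
    proof (cases "snd (h s) = 0")
      case True
      then have f: "fst (h s) > 0" using L(2) by (simp add: upper_def)
      have sd: "s \<in> {0..d}" using s by simp
      obtain e where e: "e > 0" "\<And>k. 0 < k \<Longrightarrow> k < e \<Longrightarrow> s + k \<in> {0..d} \<Longrightarrow> snd (h (s + k)) > 0"
        "\<And>k. 0 < k \<Longrightarrow> k < e \<Longrightarrow> s - k \<in> {0..d} \<Longrightarrow> snd (h (s - k)) < 0"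
        by (rule axis_crossing[OF solh[OF h] sd True _ f], simp, rule that)
      show ?thesis
      proof (intro exI[of _ e] conjI allI impI e(1))
        fix x assume "s < x \<and> x < s + e \<and> x \<le> d"
        then show "0 < snd (h x)" using e(2)[of "x - s"] s by auto
      qed
    next
      case False
      then have "snd (h s) > 0" using L(2) by (simp add: upper_def)
      moreover have "((\<lambda>x. snd (h x)) \<longlongrightarrow> snd (h s)) (at s within {0..d})"
        using conth[OF h] s by (auto simp: continuous_on_def)
      ultimately have "eventually (\<lambda>x. snd (h x) > 0) (at s within {0..d})" by (intro order_tendstoD)
      then obtain e where e: "e > 0" "\<forall>x\<in>{0..d}. x \<noteq> s \<and> dist x s < e \<longrightarrow> snd (h x) > 0"
        unfolding eventually_at by blast
      show ?thesis
      proof (intro exI[of _ e] conjI allI impI e(1))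
        fix x assume "s < x \<and> x < s + e \<and> x \<le> d"
        then show "0 < snd (h x)" using e(2) s by (auto simp: dist_real_def)
      qed
    qed
    then obtain e where e: "e > 0" "\<And>x. s < x \<Longrightarrow> x < s + e \<Longrightarrow> x \<le> d \<Longrightarrow> 0 < snd (h x)" by blast
    show "\<exists>e>0. \<forall>x\<in>{s..s + e}. x \<le> d \<longrightarrow> Q x"
    proof (intro exI[of _ "e / 2"] conjI ballI impI)
      show "e / 2 > 0" using e by simp
      fix x assume x: "x \<in> {s..s + e / 2}" "x \<le> d"
      show "Q x"
      proof (cases "x = s")
        case False
        have up: "0 < snd (h y)" if "s < y" "y \<le> x" for y using e that x by auto
        have "Lab b t (h x)"
        proof (rule keep[OF h t(1,2) L(1)])
          show "0 \<le> snd (h y)" if "y \<in> {s..x}" for y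
            using up[of y] that L(1) by (cases "y = s") (auto simp: Lab_def)
        qed (use s x in auto)
        moreover have "upper (h x)" using up[of x] x False by (simp add: upper_def)
        ultimately have "labelled b t (h x)" by (simp add: labelled_def)
        then show ?thesis using t labh[OF h] by (auto simp: Q_def)
      qed (use s in simp)
    qed
  next
    fix s assume s: "s \<in> {0<..d}" and IH: "\<And>x. x \<in> {0..<s} \<Longrightarrow> Q x"
    have sd: "s \<in> {0..d}" using s by simp
    show "Q s"
    proof (cases "snd (\<gamma> s) = 0")
      case False
      then obtain h where h: "h = \<gamma> \<or> h = (\<lambda>s. - \<gamma> s)" and hp: "0 < snd (h s)"
        using signed[of "\<lambda>h. 0 < snd (h s)"] by (cases "0 < snd (\<gamma> s)") auto
      have "((\<lambda>x. snd (h x)) \<longlongrightarrow> snd (h s)) (at s within {0..d})"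
        using conth[OF h] sd by (auto simp: continuous_on_def)
      then have "eventually (\<lambda>x. snd (h x) > 0) (at s within {0..d})" using hp by (intro order_tendstoD)
      then obtain e where e: "e > 0" "\<forall>x\<in>{0..d}. x \<noteq> s \<and> dist x s < e \<longrightarrow> snd (h x) > 0"
        unfolding eventually_at by blast
      define x where "x = max 0 (s - e / 2)"
      have x: "x \<in> {0..<s}" "s - x < e" using e(1) s by (auto simp: x_def)
      have up: "0 < snd (h y)" if "y \<in> {x..s}" for y
        using e(2) that x s hp by (cases "y = s") (auto simp: dist_real_def)
      obtain t where t: "0 < t" "t \<le> t0" "labelled b t (h x)" using IH[OF x(1)] labh[OF h] by (auto simp: Q_def)
      have "\<not> upper (- h x)" using up[of x] x by (auto simp: upper_def)
      then have "Lab b t (h x)" using t(3) by (auto simp: labelled_def)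
      then have "Lab b t (h s)"
        by (rule keep[OF h t(1,2)]) (use x s up in \<open>auto intro: less_imp_le\<close>)
      then have "labelled b t (h s)" using hp by (simp add: labelled_def upper_def)
      then show ?thesis using t labh[OF h] by (auto simp: Q_def)
    next
      case True
      then have "fst (\<gamma> s) \<noteq> 0" using nz[OF sd] by (auto simp: prod_eq_iff)
      then obtain h where h: "h = \<gamma> \<or> h = (\<lambda>s. - \<gamma> s)" and hp: "0 < fst (h s)"
        using signed[of "\<lambda>h. 0 < fst (h s)"] by (cases "0 < fst (\<gamma> s)") auto
      have h0: "snd (h s) = 0" using h True by auto
      obtain e where e: "e > 0" "\<And>k. 0 < k \<Longrightarrow> k < e \<Longrightarrow> s + k \<in> {0..d} \<Longrightarrow> snd (h (s + k)) > 0"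
        "\<And>k. 0 < k \<Longrightarrow> k < e \<Longrightarrow> s - k \<in> {0..d} \<Longrightarrow> snd (h (s - k)) < 0"
        by (rule axis_crossing[OF solh[OF h] sd h0 _ hp], simp, rule that)
      \<comment> \<open>Just before the crossing it is the mirror image of \<open>h\<close> that
        lies above the x-axis.\<close>
      let ?k = "\<lambda>s. - h s"
      have k: "?k = \<gamma> \<or> ?k = (\<lambda>s. - \<gamma> s)" using h by auto
      define x where "x = max 0 (s - e / 2)"
      have x: "x \<in> {0..<s}" "s - x < e" using e(1) s by (auto simp: x_def)
      have up: "0 < snd (?k y)" if "y \<in> {x..<s}" for y
        using e(3)[of "s - y"] that x s by auto
      obtain t where t: "0 < t" "t \<le> t0" "labelled b t (?k x)"
        using IH[OF x(1)] labh[OF k] unfolding Q_def by blast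
      have "\<not> upper (- ?k x)" using up[of x] x by (auto simp: upper_def)
      then have L: "Lab b t (?k x)" using t(3) by (auto simp: labelled_def)
      have Ls: "Lab b t (?k s)"
      proof (rule keep[OF k t(1,2) L])
        show "0 \<le> snd (?k y)" if "y \<in> {x..s}" for y
          using up[of y] that h0 by (cases "y = s") auto
      qed (use x s in auto)
      have "ang.sig b t (-1) < ang.sig b t 1" using pos[of t] t t0 by simp
      note drop = label_drop[OF b t(1) small(2)[OF t(1,2)] this t(1) small(1)[OF t(1,2)] Ls]
      obtain t' where t': "0 < t'" "t' < t" "labelled b t' (?k s)"
        by (rule drop, use h0 in simp, use hp in simp, rule that)
      then have "labelled b t' (\<gamma> s)" using labh[OF k] by blast
      then show ?thesis using t t' unfolding Q_def by (intro exI[of _ t']) auto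
    qed
  qed (use d in auto)
  then show thesis using that unfolding Q_def by blast
qed

text \<open>Lyapunov stability is the monotonicity of labels. For convergence, suppose that the
  labels stay above some \<open>\<epsilon>\<close>; then the solution is bounded and exists for all
  times. Let \<open>i\<close> be the infimum of its labels. By continuity
  \<open>sig t (-1) < sig i 1\<close> for labels \<open>t\<close> close to \<open>i\<close>, so one
  more half turn produces a label below \<open>i\<close>.\<close>

lemma attracting_of_disp:
  assumes b: "ang.adm b" and \<rho>: "0 < \<rho>" "\<rho> * exp 2 < ang.R / 2"
    and pos: "\<And>t. 0 < t \<Longrightarrow> t < \<rho> \<Longrightarrow> ang.sig b t (-1) < ang.sig b t 1"
  shows "infinity_attracting (A b)"
proof -
  have e2: "1 \<le> exp (2::real)" "exp (1::real) * exp 1 = exp 2" by (simp_all flip: exp_add)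
  have smallR: "t < ang.R / 2" "t * exp 2 < ang.R / 2" if "0 < t" "t \<le> \<rho>" for t
  proof -
    have "t * exp 2 \<le> \<rho> * exp 2" using that by (intro mult_right_mono) auto
    then show s: "t * exp 2 < ang.R / 2" using \<rho> by linarith
    have "t * 1 \<le> t * exp 2" using that by (intro mult_left_mono e2) auto
    then show "t < ang.R / 2" using s by linarith
  qed
  have R2: "ang.R / 2 < ang.R" using ang.R(1) by simp
  have start: "\<exists>t. 0 < t \<and> t < \<epsilon> \<and> labelled b t z"
    if z: "0 < \<epsilon>" "\<epsilon> \<le> \<rho>" "z \<noteq> 0" "tau z < \<epsilon> * exp (-1)" for z \<epsilon>
  proof -
    have "tau z * exp 1 < \<epsilon> * exp (-1) * exp 1" using z(4) by (intro mult_strict_right_mono) auto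
    then have l: "tau z * exp 1 < \<epsilon>" by (simp add: mult.assoc flip: exp_add)
    also have "\<epsilon> < ang.R" using smallR(1)[OF z(1,2)] R2 by linarith
    finally have lR: "tau z * exp 1 < ang.R" .
    obtain t where "0 < t" "t \<le> tau z * exp 1" "labelled b t z"
      by (rule labelled_exists[OF b z(3) lR])
    then show ?thesis using l by (intro exI[of _ t]) auto
  qed
  have sub: "solution_on (A b) {0..t} \<gamma>" if "forward_solution (A b) T \<gamma>" "t \<in> forward_interval T" for T \<gamma> t
  proof (rule solution_on_subset)
    show "solution_on (A b) (forward_interval T) \<gamma>" using that(1) by (simp add: forward_solution_def)
    show "{0..t} \<subseteq> forward_interval T"
    proof
      fix x assume x: "x \<in> {0..t}"
      then have "ereal x \<le> ereal t" by simp
      also have "\<dots> < T" using that(2) by (simp add: forward_interval_def)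
      finally show "x \<in> forward_interval T" using x by (simp add: forward_interval_def)
    qed
  qed
  have trap: "\<exists>t'. 0 < t' \<and> t' < \<epsilon> \<and> labelled b t' (\<gamma> s)"
    if a: "forward_solution (A b) T \<gamma>" "s \<in> forward_interval T" "0 < t" "t < \<epsilon>" "\<epsilon> \<le> \<rho>" "labelled b t (\<gamma> 0)" for T \<gamma> s t \<epsilon>
  proof -
    have s0: "0 \<le> s" using a(2) by (simp add: forward_interval_def)
    have t\<rho>: "t < \<rho>" using a(4,5) by simp
    obtain t' where "0 < t'" "t' \<le> t" "labelled b t' (\<gamma> s)"
      by (rule trapping[OF b \<rho> pos sub[OF a(1,2)] s0 a(3) t\<rho> a(6)])
    then show ?thesis using a(4) by (intro exI[of _ t']) auto
  qed
  have far: "\<exists>\<epsilon>>0. \<epsilon> \<le> \<rho> \<and> (\<forall>t z. 0 < t \<and> t < \<epsilon> \<and> labelled b t z \<longrightarrow> norm z > M)" for M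
  proof -
    obtain \<epsilon> where \<epsilon>: "\<epsilon> > 0" "\<And>z. z \<noteq> 0 \<Longrightarrow> tau z < \<epsilon> \<Longrightarrow> norm z > M" using tau_small_imp_norm_large by blast
    show ?thesis
    \<comment> \<open>The factor \<open>exp (-1)\<close> compensates the passage from label to
      \<open>tau\<close>.\<close>
    proof (intro exI[of _ "min \<rho> (\<epsilon> * exp (-1))"] conjI allI impI)
      fix t z assume a: "0 < t \<and> t < min \<rho> (\<epsilon> * exp (-1)) \<and> labelled b t z"
      then have t: "0 < t" "t < \<rho>" "t < \<epsilon> * exp (-1)" by auto
      have "t < ang.R" using smallR(1)[of t] t R2 by linarith
      from labelled_tau[OF b t(1) this] a have tz: "z \<noteq> 0" "tau z \<le> t * exp 1" by blast+
      have "t * exp 1 < \<epsilon> * exp (-1) * exp 1" using t by (intro mult_strict_right_mono) auto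
      then have "t * exp 1 < \<epsilon>" by (simp add: mult.assoc flip: exp_add)
      then show "norm z > M" using \<epsilon>(2) tz by simp
    qed (use \<epsilon> \<rho> in auto)
  qed
  have near: "\<exists>M'. \<forall>z. norm z > M' \<longrightarrow> (\<exists>t. 0 < t \<and> t < \<epsilon> \<and> labelled b t z)" if \<epsilon>: "0 < \<epsilon>" "\<epsilon> \<le> \<rho>" for \<epsilon>
  proof -
    have "\<epsilon> * exp (-1) > 0" using \<epsilon> by simp
    then obtain M' where "\<And>z. norm z > M' \<Longrightarrow> z \<noteq> 0 \<and> tau z < \<epsilon> * exp (-1)"
      using norm_large_imp_tau_small by blast
    then show ?thesis using start[OF \<epsilon>] by blast
  qed
  have part1: "\<exists>M'. \<forall>T \<gamma>. forward_solution (A b) T \<gamma> \<and> norm (\<gamma> 0) > M'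
        \<longrightarrow> (\<forall>t\<in>forward_interval T. norm (\<gamma> t) > M)" for M
  proof -
    obtain \<epsilon> where \<epsilon>: "\<epsilon> > 0" "\<epsilon> \<le> \<rho>" "\<And>t z. 0 < t \<Longrightarrow> t < \<epsilon> \<Longrightarrow> labelled b t z \<Longrightarrow> norm z > M" using far[of M] by blast
    obtain M' where "\<And>z. norm z > M' \<Longrightarrow> \<exists>t. 0 < t \<and> t < \<epsilon> \<and> labelled b t z" using near[OF \<epsilon>(1,2)] by blast
    then show ?thesis using trap[of _ _ _ _ \<epsilon>] \<epsilon> by (intro exI[of _ M']) meson
  qed
  obtain M0 where M0: "\<And>z. norm z > M0 \<Longrightarrow> \<exists>t. 0 < t \<and> t < \<rho> \<and> labelled b t z" using near[OF \<rho>(1)] by blast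
  have part2: "\<exists>s\<in>forward_interval T. \<forall>t\<in>forward_interval T. s \<le> t \<longrightarrow> norm (\<gamma> t) > M"
    if max: "maximal_forward_solution (A b) T \<gamma>" and far0: "norm (\<gamma> 0) > M0" for T \<gamma> M
  proof -
    have fs: "forward_solution (A b) T \<gamma>" using max by (simp add: maximal_forward_solution_def)
    then have T0: "0 < T" by (simp add: forward_solution_def)
    obtain t0 where t0: "0 < t0" "t0 < \<rho>" "labelled b t0 (\<gamma> 0)" using M0[OF far0] by blast
    obtain \<epsilon> where \<epsilon>: "\<epsilon> > 0" "\<epsilon> \<le> \<rho>" "\<And>t z. 0 < t \<Longrightarrow> t < \<epsilon> \<Longrightarrow> labelled b t z \<Longrightarrow> norm z > M" using far[of M] by blast
    have "\<exists>s\<in>forward_interval T. \<exists>t. 0 < t \<and> t < \<epsilon> \<and> labelled b t (\<gamma> s)"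
    proof (rule ccontr)
      assume no: "\<not> (\<exists>s\<in>forward_interval T. \<exists>t. 0 < t \<and> t < \<epsilon> \<and> labelled b t (\<gamma> s))"
      have lab: "\<exists>t. \<epsilon> \<le> t \<and> t < \<rho> \<and> labelled b t (\<gamma> s)" if s: "s \<in> forward_interval T" for s
        using trap[OF fs s t0(1,2) order_refl t0(3)] no s by (meson not_le)
      have "0 < \<epsilon> * exp (-1)" using \<epsilon> by simp
      then obtain B where B: "\<And>z. norm z > B \<Longrightarrow> z \<noteq> 0 \<and> tau z < \<epsilon> * exp (-1)"
        using norm_large_imp_tau_small by blast
      have "norm (\<gamma> s) \<le> B" if s: "s \<in> forward_interval T" for s
      proof (rule ccontr)
        assume "\<not> norm (\<gamma> s) \<le> B"
        then have c: "tau (\<gamma> s) < \<epsilon> * exp (-1)" using B by simp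
        obtain t where t: "\<epsilon> \<le> t" "t < \<rho>" "labelled b t (\<gamma> s)" using lab[OF s] by blast
        have "0 < t" "t < ang.R" using t \<epsilon>(1) smallR(1)[of t] R2 by linarith+
        from labelled_tau(2)[OF b this t(3)] have "t * exp (-1) \<le> tau (\<gamma> s)" .
        moreover have "\<epsilon> * exp (-1) \<le> t * exp (-1)" using t(1) by (intro mult_right_mono) auto
        ultimately show False using c by linarith
      qed
      from maximal_bounded_global[OF A_lip_bounded max this] have Tinf: "T = \<infinity>" .
      have fi: "forward_interval T = {0..}" by (auto simp: forward_interval_def Tinf)
      have solg: "solution_on (flow (\<lambda>z. 1) b) {0..} \<gamma>" using fs by (simp add: forward_solution_def fi flow_1)
      define LS where "LS = {t. \<epsilon> \<le> t \<and> t < \<rho> \<and> (\<exists>s\<ge>0. labelled b t (\<gamma> s))}"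
      have LS0: "LS \<noteq> {}" using lab[of 0] by (auto simp: LS_def fi)
      have bb: "bdd_below LS" by (rule bdd_belowI[of _ \<epsilon>]) (simp add: LS_def)
      define i where "i = Inf LS"
      have low: "i \<le> t" if "t \<in> LS" for t unfolding i_def by (rule cInf_lower[OF that bb])
      have i\<epsilon>: "\<epsilon> \<le> i" unfolding i_def by (rule cInf_greatest[OF LS0]) (simp add: LS_def)
      obtain t1 where "t1 \<in> LS" using LS0 by blast
      then have i\<rho>: "i < \<rho>" using low[of t1] by (auto simp: LS_def)
      have i0: "0 < i" using i\<epsilon> \<epsilon> by linarith
      have gap: "ang.sig b i (-1) < ang.sig b i 1" by (rule pos[OF i0 i\<rho>])
      have iR: "i < ang.R" using smallR(1)[of i] i0 i\<rho> R2 by linarith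
      have "((\<lambda>t. ang.sig b t (-1)) \<longlongrightarrow> ang.sig b i (-1)) (at i)"
        using ang.sig_continuous_label[OF b, of "-1"] i0 iR
        by (simp add: continuous_on_eq_continuous_at isCont_def)
      then have "eventually (\<lambda>t. ang.sig b t (-1) < ang.sig b i 1) (at i)"
        using gap by (intro order_tendstoD)
      then obtain e where e: "e > 0" "\<And>t. t \<noteq> i \<Longrightarrow> dist t i < e \<Longrightarrow> ang.sig b t (-1) < ang.sig b i 1"
        unfolding eventually_at by auto
      have "Inf LS < i + e" using e(1) by (simp add: i_def)
      then obtain t where t: "t \<in> LS" "t < i + e" using cInf_lessD[OF LS0] by blast
      have sg: "ang.sig b t (-1) < ang.sig b i 1"
        using e(2)[of t] low[OF t(1)] t(2) gap by (cases "t = i") (auto simp: dist_real_def)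
      obtain s where s: "0 \<le> s" "labelled b t (\<gamma> s)" using t(1) by (auto simp: LS_def)
      have tp: "0 < t" "t < \<rho>" using t(1) \<epsilon>(1) by (auto simp: LS_def)
      then have tR: "t < ang.R" using smallR(1)[of t] R2 by linarith
      obtain h where h: "h = \<gamma> \<or> h = (\<lambda>s. - \<gamma> s)" and L: "Lab b t (h s)" "upper (h s)"
        using s(2) unfolding labelled_def by (metis (no_types, lifting))
      have solh: "solution_on (flow (\<lambda>z. 1) b) {s..} h"
        using h solution_on_subset[OF solg] solution_on_subset[OF solution_minus[OF damp_1 solg]] s(1) by auto
      obtain s1 where s1: "s < s1" "snd (h s1) = 0" "fst (h s1) < 0" "\<And>x. x \<in> {s..s1} \<Longrightarrow> Lab b t (h x)"
        by (rule half_turn[OF b damp_1 tp(1) tR _ solh L], simp, rule that)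
      have L1: "Lab b t (h s1)" using s1 by auto
      have iR2: "i < ang.R / 2" and tR2: "t * exp 2 < ang.R / 2"
        using smallR(1)[of i] smallR(2)[of t] i0 i\<rho> tp by auto
      obtain t' where t': "0 < t'" "t' < i" "labelled b t' (h s1)"
        by (rule label_drop[OF b tp(1) tR2 sg i0 iR2 L1 s1(2,3)])
      have l': "labelled b t' (\<gamma> s1)" using h t'(3) by (elim disjE) (simp_all only: labelled_minus)
      have "s1 \<in> forward_interval T" using s s1 by (simp add: fi)
      then have "\<epsilon> \<le> t'" using no l' t'(1) by (meson not_le)
      then have "t' \<in> LS" unfolding LS_def using l' t'(2) i\<rho> s s1(1) by (auto intro!: exI[of _ s1])
      then show False using low t'(2) by force
    qed
    then obtain s t where s: "s \<in> forward_interval T" "0 < t" "t < \<epsilon>" "labelled b t (\<gamma> s)" by blast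
    have "norm (\<gamma> x) > M" if x: "x \<in> forward_interval T" "s \<le> x" for x
    proof -
      have s0: "0 \<le> s" using s(1) by (simp add: forward_interval_def)
      have "solution_on (A b) {0..x - s} (\<lambda>t. \<gamma> (s + t))"
        by (rule solution_on_shift, rule solution_on_subset[OF sub[OF fs x(1)]]) (use s0 in auto)
      note sx = this
      have d0: "0 \<le> x - s" "t < \<rho>" "labelled b t (\<gamma> (s + 0))" using x(2) s(3,4) \<epsilon>(2) by auto
      obtain t' where t': "0 < t'" "t' \<le> t" "labelled b t' (\<gamma> (s + (x - s)))"
        by (rule trapping[OF b \<rho> pos sx d0(1) s(2) d0(2,3)])
      then have "labelled b t' (\<gamma> x)" by simp
      then show ?thesis using \<epsilon>(3)[of t' "\<gamma> x"] t'(1,2) s(3) by simp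
    qed
    then show ?thesis using s(1) by blast
  qed
  show ?thesis
    unfolding infinity_attracting_def using part1 part2 by blast
qed

end

section \<open>Bifurcation numbers\<close>

text \<open>An involutive linear isometry maps solutions of one field to solutions of the other,
  preserves maximality and leaves norms unchanged. It serves to deduce the repelling case from the
  attracting one.\<close>

lemma infinity_attracting_conjugate:
  assumes L: "bounded_linear L" and inv: "\<And>z. L (L z) = z" and nrm: "\<And>z. norm (L z) = norm z"
    and att: "infinity_attracting (\<lambda>z. L (X (L z)))"
  shows "infinity_attracting X"
proof -
  let ?Y = "\<lambda>z. L (X (L z))"
  have sol: "solution_on ?Y I (\<lambda>t. L (\<gamma> t))" if "solution_on X I \<gamma>" for I \<gamma>
    unfolding solution_on_def
  proof
    fix t assume "t \<in> I"
    then have "(\<gamma> has_vector_derivative X (\<gamma> t)) (at t within I)" using that by (simp add: solution_on_def)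
    from bounded_linear.has_vector_derivative[OF L this]
    show "((\<lambda>t. L (\<gamma> t)) has_vector_derivative L (X (L (L (\<gamma> t))))) (at t within I)" by (simp only: inv)
  qed
  have sol': "solution_on X I (\<lambda>t. L (\<gamma> t))" if "solution_on ?Y I \<gamma>" for I \<gamma>
    unfolding solution_on_def
  proof
    fix t assume "t \<in> I"
    then have "(\<gamma> has_vector_derivative L (X (L (\<gamma> t)))) (at t within I)" using that by (simp add: solution_on_def)
    from bounded_linear.has_vector_derivative[OF L this]
    show "((\<lambda>t. L (\<gamma> t)) has_vector_derivative X (L (\<gamma> t))) (at t within I)" by (simp only: inv)
  qed
  have fs: "forward_solution ?Y T (\<lambda>t. L (\<gamma> t))" if "forward_solution X T \<gamma>" for T \<gamma>
    using that unfolding forward_solution_def by (elim conjE) (intro conjI sol)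
  have fs': "forward_solution X T (\<lambda>t. L (\<gamma> t))" if "forward_solution ?Y T \<gamma>" for T \<gamma>
    using that unfolding forward_solution_def by (elim conjE) (intro conjI sol')
  have ms: "maximal_forward_solution ?Y T (\<lambda>t. L (\<gamma> t))" if max: "maximal_forward_solution X T \<gamma>" for T \<gamma>
    unfolding maximal_forward_solution_def
  proof (intro conjI allI impI)
    show "forward_solution ?Y T (\<lambda>t. L (\<gamma> t))"
      by (rule fs) (use max in \<open>simp add: maximal_forward_solution_def\<close>)
    fix T' \<gamma>' assume a: "forward_solution ?Y T' \<gamma>' \<and> T \<le> T' \<and> (\<forall>t\<in>forward_interval T. \<gamma>' t = L (\<gamma> t))"
    then have "forward_solution X T' (\<lambda>t. L (\<gamma>' t))" "T \<le> T'" "\<forall>t\<in>forward_interval T. L (\<gamma>' t) = \<gamma> t"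
      using fs'[of T' \<gamma>'] inv by simp_all
    then show "T' = T" using max[unfolded maximal_forward_solution_def, THEN conjunct2, rule_format, of T' "\<lambda>t. L (\<gamma>' t)"]
      by simp
  qed
  have 1: "\<exists>M'. \<forall>T \<gamma>. forward_solution X T \<gamma> \<and> norm (\<gamma> 0) > M' \<longrightarrow> (\<forall>t\<in>forward_interval T. norm (\<gamma> t) > M)" for M
  proof -
    obtain M' where M': "\<forall>T \<gamma>. forward_solution ?Y T \<gamma> \<and> norm (\<gamma> 0) > M' \<longrightarrow> (\<forall>t\<in>forward_interval T. norm (\<gamma> t) > M)"
      using att unfolding infinity_attracting_def by blast
    have "\<forall>t\<in>forward_interval T. norm (\<gamma> t) > M" if "forward_solution X T \<gamma> \<and> norm (\<gamma> 0) > M'" for T \<gamma>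
      using M'[rule_format, of T "\<lambda>t. L (\<gamma> t)"] fs[of T \<gamma>] that unfolding nrm by simp
    then show ?thesis by (intro exI[of _ M'] allI impI)
  qed
  obtain M' where M': "\<forall>T \<gamma>. maximal_forward_solution ?Y T \<gamma> \<and> norm (\<gamma> 0) > M'
        \<longrightarrow> (\<forall>M. \<exists>s\<in>forward_interval T. \<forall>t\<in>forward_interval T. s \<le> t \<longrightarrow> norm (\<gamma> t) > M)"
    using att unfolding infinity_attracting_def by blast
  have "\<forall>M. \<exists>s\<in>forward_interval T. \<forall>t\<in>forward_interval T. s \<le> t \<longrightarrow> norm (\<gamma> t) > M"
    if "maximal_forward_solution X T \<gamma> \<and> norm (\<gamma> 0) > M'" for T \<gamma>
    using M'[rule_format, of T "\<lambda>t. L (\<gamma> t)"] ms[of T \<gamma>] that unfolding nrm by simp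
  then show ?thesis
    unfolding infinity_attracting_def by (intro conjI[OF allI[OF 1]] exI[of _ M'] allI impI[rotated]) simp_all
qed

text \<open>A periodic solution is maximal and returns to its starting point at arbitrarily late
  times, so it does not tend to infinity.\<close>

lemma attracting_not_center:
  assumes att: "infinity_attracting X" and cen: "infinity_center X"
  shows False
proof -
  obtain M' where M': "\<forall>T \<gamma>. maximal_forward_solution X T \<gamma> \<and> norm (\<gamma> 0) > M'
        \<longrightarrow> (\<forall>M. \<exists>s\<in>forward_interval T. \<forall>t\<in>forward_interval T. s \<le> t \<longrightarrow> norm (\<gamma> t) > M)"
    using att unfolding infinity_attracting_def by blast
  obtain K where K: "compact K" "\<And>z. z \<notin> K \<Longrightarrow> \<exists>\<Gamma>. periodic_orbit X \<Gamma> \<and> z \<in> \<Gamma>"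
    using cen unfolding infinity_center_def by blast
  then obtain B where B: "\<forall>z\<in>K. norm z \<le> B" using compact_imp_bounded bounded_iff by metis
  define z where "z = (\<bar>B\<bar> + \<bar>M'\<bar> + 1, 0::real)"
  have nz: "norm z > B" "norm z > M'" by (auto simp: z_def norm_Pair)
  then obtain \<Gamma> where "periodic_orbit X \<Gamma>" "z \<in> \<Gamma>" using K(2)[of z] B by force
  then obtain \<gamma> T s where g: "0 < T" "solution_on X UNIV \<gamma>" "\<And>t. \<gamma> (t + T) = \<gamma> t" "\<gamma> s = z"
    unfolding periodic_orbit_def by blast
  define \<eta> where "\<eta> = (\<lambda>t. \<gamma> (s + t))"
  have fi: "forward_interval \<infinity> = {0..}" by (auto simp: forward_interval_def)
  have "solution_on X {0..} \<eta>"
    unfolding \<eta>_def by (rule solution_on_shift, rule solution_on_subset[OF g(2)]) simp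
  then have "maximal_forward_solution X \<infinity> \<eta>"
    by (auto simp: maximal_forward_solution_def forward_solution_def fi)
  moreover have "norm (\<eta> 0) > M'" using nz(2) g(4) by (simp add: \<eta>_def)
  ultimately have "\<exists>s\<in>{0..}. \<forall>t\<in>{0..}. s \<le> t \<longrightarrow> norm (\<eta> t) > norm z"
    using M'[rule_format, of \<infinity> \<eta> "norm z"] unfolding fi by simp
  then obtain s' where s': "s' \<ge> 0" "\<And>t. t \<ge> s' \<Longrightarrow> norm (\<eta> t) > norm z" by auto
  have per: "\<gamma> (s + real n * T) = z" for n
  proof (induction n)
    case (Suc n)
    then show ?case using g(3)[of "s + real n * T"] by (simp add: algebra_simps)
  qed (simp add: g)
  obtain n :: nat where "s' / T < n" using reals_Archimedean2 by blast
  then have "s' \<le> real n * T" using g(1) by (simp add: divide_less_eq less_imp_le)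
  then show False using s'(2)[of "real n * T"] per[of n] by (simp add: \<eta>_def)
qed

lemma periodic_orbit_reverse: "periodic_orbit X \<Gamma> \<Longrightarrow> periodic_orbit (\<lambda>z. - X z) \<Gamma>"
proof -
  assume "periodic_orbit X \<Gamma>"
  then obtain \<gamma> T s t where g: "0 < T" "solution_on X UNIV \<gamma>" "\<And>t. \<gamma> (t + T) = \<gamma> t" "\<gamma> s \<noteq> \<gamma> t" "\<Gamma> = range \<gamma>"
    unfolding periodic_orbit_def by blast
  have "solution_on (\<lambda>z. - X z) UNIV (\<lambda>t. \<gamma> (- t))"
    by (rule solution_on_reverse, rule solution_on_subset[OF g(2)]) simp
  moreover have "\<gamma> (- (t + T)) = \<gamma> (- t)" for t using g(3)[of "- (t + T)"] by simp
  moreover have "\<gamma> (- (- s)) \<noteq> \<gamma> (- (- t))" using g(4) by simp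
  moreover have "range \<gamma> \<subseteq> range (\<lambda>t. \<gamma> (- t))"
  proof
    fix z assume "z \<in> range \<gamma>"
    then obtain t where "z = \<gamma> t" by blast
    then show "z \<in> range (\<lambda>t. \<gamma> (- t))" by (intro range_eqI[of _ _ "- t"]) simp
  qed
  then have "\<Gamma> = range (\<lambda>t. \<gamma> (- t))" using g(5) by auto
  ultimately show ?thesis
    unfolding periodic_orbit_def using g(1)
    by (intro exI[of _ "\<lambda>t. \<gamma> (- t)"] exI[of _ T] conjI allI exI[of _ "- s"] exI[of _ "- t"]) assumption+
qed

lemma repelling_not_center:
  assumes "infinity_repelling X" "infinity_center X" shows False
proof (rule attracting_not_center)
  show "infinity_attracting (\<lambda>z. - X z)" using assms(1) by (simp add: infinity_repelling_def)
  show "infinity_center (\<lambda>z. - X z)"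
  proof -
    obtain K where K: "compact K" "\<And>z. z \<notin> K \<Longrightarrow> \<exists>\<Gamma>. periodic_orbit X \<Gamma> \<and> z \<in> \<Gamma>"
      using assms(2) unfolding infinity_center_def by blast
    have "\<exists>\<Gamma>. periodic_orbit (\<lambda>z. - X z) \<Gamma> \<and> z \<in> \<Gamma>" if z: "z \<notin> K" for z
    proof -
      obtain \<Gamma> where G: "periodic_orbit X \<Gamma>" "z \<in> \<Gamma>" using K(2)[OF z] by blast
      show ?thesis by (rule exI[of _ \<Gamma>], rule conjI[OF periodic_orbit_reverse[OF G(1)] G(2)])
    qed
    then have "\<forall>z. z \<notin> K \<longrightarrow> (\<exists>\<Gamma>. periodic_orbit (\<lambda>z. - X z) \<Gamma> \<and> z \<in> \<Gamma>)" by (intro allI impI)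
    with K(1) show ?thesis unfolding infinity_center_def by (intro exI[of _ K] conjI)
  qed
qed

text \<open>The orbits are compact and pairwise disjoint, so removing the finitely many others
  leaves an open neighbourhood of the given one.\<close>

lemma finite_orbits_limit_cycle:
  assumes X: "lip_bounded X" and fin: "finite {\<Gamma>. periodic_orbit X \<Gamma> \<and> \<Gamma> \<subseteq> {z. norm z > M}}"
    and G: "periodic_orbit X \<Gamma>" "\<Gamma> \<subseteq> {z. norm z > M}"
  shows "limit_cycle X \<Gamma>"
proof -
  let ?P = "{\<Gamma>. periodic_orbit X \<Gamma> \<and> \<Gamma> \<subseteq> {z. norm z > M}}"
  define U where "U = {z. norm z > M} - \<Union>(?P - {\<Gamma>})"
  have "closed (\<Union>(?P - {\<Gamma>}))"
    using fin by (intro closed_Union) (auto intro: compact_imp_closed periodic_orbit_compact)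
  moreover have "open {z::real \<times> real. norm z > M}"
    by (intro open_Collect_less continuous_intros)
  ultimately have "open U" unfolding U_def by (rule open_Diff[rotated])
  moreover have "\<Gamma> \<subseteq> U"
  proof
    fix z assume z: "z \<in> \<Gamma>"
    have "z \<notin> \<Gamma>'" if "\<Gamma>' \<in> ?P - {\<Gamma>}" for \<Gamma>'
      using periodic_orbits_disjoint[OF X G(1), of \<Gamma>' z] that z by blast
    then show "z \<in> U" using z G(2) by (auto simp: U_def)
  qed
  moreover have "\<Gamma>' = \<Gamma>" if "periodic_orbit X \<Gamma>'" "\<Gamma>' \<subseteq> U" for \<Gamma>'
  proof (rule ccontr)
    assume "\<Gamma>' \<noteq> \<Gamma>"
    then have "\<Gamma>' \<in> ?P - {\<Gamma>}" using that by (auto simp: U_def)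
    moreover have "\<Gamma>' \<noteq> {}" using that(1) by (auto simp: periodic_orbit_def)
    ultimately show False using that(2) by (auto simp: U_def)
  qed
  ultimately show ?thesis unfolding limit_cycle_def using G(1) by blast
qed

lemma ecount_le: "finite A \<Longrightarrow> card A \<le> k \<Longrightarrow> ecount A \<le> enat k"
  by (simp add: ecount_def)

lemma ecount_ge: "F \<subseteq> A \<Longrightarrow> finite F \<Longrightarrow> card F = k \<Longrightarrow> enat k \<le> ecount A"
  using card_mono[of A F] by (auto simp: ecount_def)

lemma ecount_mono: "A \<subseteq> B \<Longrightarrow> ecount A \<le> ecount B"
  using card_mono[of B A] finite_subset[of A B] by (auto simp: ecount_def)

lemma bifurcation_number_le:
  assumes "0 < (\<delta>::real)"
    and "\<And>b'. (\<And>j. j \<in> J \<Longrightarrow> \<bar>b' j - b j\<bar> < \<delta>) \<Longrightarrow> ecount {\<Gamma>. orb (X b') \<Gamma> \<and> \<Gamma> \<subseteq> {z. norm z > M}} \<le> e"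
  shows "bifurcation_number orb J X b \<le> e"
  unfolding bifurcation_number_def
proof (rule INF_lower2[of \<delta>], use assms(1) in simp, rule INF_lower2[of M], simp, rule SUP_least)
  fix b' assume "b' \<in> {b'. \<forall>j\<in>J. \<bar>b' j - b j\<bar> < \<delta>}"
  then show "ecount {\<Gamma>. orb (X b') \<Gamma> \<and> \<Gamma> \<subseteq> {z. norm z > M}} \<le> e" by (intro assms(2)) auto
qed

lemma bifurcation_number_ge:
  assumes "\<And>\<delta> M. 0 < (\<delta>::real) \<Longrightarrow> \<exists>b'. (\<forall>j\<in>J. \<bar>b' j - b j\<bar> < \<delta>) \<and>
      e \<le> ecount {\<Gamma>. orb (X b') \<Gamma> \<and> \<Gamma> \<subseteq> {z. norm z > M}}"
  shows "e \<le> bifurcation_number orb J X b"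
  unfolding bifurcation_number_def
proof (rule INF_greatest, rule INF_greatest)
  fix \<delta> M :: real assume "\<delta> \<in> {0<..}"
  then obtain b' where "\<forall>j\<in>J. \<bar>b' j - b j\<bar> < \<delta>" "e \<le> ecount {\<Gamma>. orb (X b') \<Gamma> \<and> \<Gamma> \<subseteq> {z. norm z > M}}"
    using assms[of \<delta> M] by auto
  then show "e \<le> (SUP b'\<in>{b'. \<forall>j\<in>J. \<bar>b' j - b j\<bar> < \<delta>}. ecount {\<Gamma>. orb (X b') \<Gamma> \<and> \<Gamma> \<subseteq> {z. norm z > M}})"
    by (intro SUP_upper2[of b']) auto
qed

section \<open>Counting orbits in a neighbourhood of infinity\<close>

context polar_flow
begin

lemma C_pos: "j \<in> {1..N} \<Longrightarrow> odd j \<Longrightarrow> ang.C j > 0"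
  unfolding ang.C_def using \<theta> w_integral_pos by simp

lemma attracting:
  assumes b: "ang.adm b" and d: "d \<in> {1..N}" "odd d" "b d > 0" "\<And>j. odd j \<Longrightarrow> j < d \<Longrightarrow> b j = 0"
  shows "infinity_attracting (A b)"
proof -
  have dJ: "d \<in> ang.J" using d by simp
  obtain \<rho>0 where \<rho>0: "\<rho>0 > 0" "\<rho>0 \<le> ang.R" "\<And>t. 0 < t \<Longrightarrow> t < \<rho>0 \<Longrightarrow> Re (ang.disp b (of_real t)) > 0"
    by (rule ang.disp_pos_near_0[OF b dJ d(3) C_pos[OF d(1,2)]], rule d(4), assumption, assumption, rule that)
  \<comment> \<open>The second term secures \<open>\<rho> * exp 2 < R / 2\<close>, the range in
    which labels are trapped.\<close>
  define \<rho> where "\<rho> = min \<rho>0 (ang.R / (4 * exp 2))"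
  have "\<rho> \<le> ang.R / (4 * exp 2)" by (simp add: \<rho>_def)
  then have "\<rho> * exp 2 \<le> ang.R / (4 * exp 2) * exp 2" by (intro mult_right_mono) auto
  also have "\<dots> = ang.R / 4" by simp
  also have "\<dots> < ang.R / 2" using ang.R(1) by simp
  finally have 2: "\<rho> * exp 2 < ang.R / 2" .
  have 1: "0 < \<rho>" using \<rho>0(1) ang.R(1) by (simp add: \<rho>_def)
  show ?thesis
  proof (rule attracting_of_disp[OF b 1 2])
    fix t assume t: "0 < t" "t < \<rho>"
    then have "t < \<rho>0" "t < ang.R" using \<rho>0(2) by (auto simp: \<rho>_def)
    then show "ang.sig b t (- 1) < ang.sig b t 1" using \<rho>0(3) ang.disp_sig(2)[OF b t(1)] t(1) by simp
  qed
qed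

lemma sig_eq_of_even:
  assumes "ang.adm b" "\<And>j. j \<in> {1..N} \<Longrightarrow> odd j \<Longrightarrow> b j = 0" "0 < t" "t < ang.R"
  shows "ang.sig b t 1 = ang.sig b t (-1)"
  using ang.disp_eq_0[OF assms(1,2), of "of_real t"] ang.disp_sig(1)[OF assms(1,3,4)] assms(3,4) by simp

lemma center:
  assumes b: "ang.adm b" and ev: "\<And>j. j \<in> {1..N} \<Longrightarrow> odd j \<Longrightarrow> b j = 0"
  shows "infinity_center (A b)"
proof -
  have "ang.R * exp (-1) > 0" using ang.R(1) by simp
  then obtain M where M: "\<And>z. norm z > M \<Longrightarrow> z \<noteq> 0 \<and> tau z < ang.R * exp (-1)"
    using norm_large_imp_tau_small by blast
  have "\<exists>\<Gamma>. periodic_orbit (A b) \<Gamma> \<and> z \<in> \<Gamma>" if "z \<notin> cball 0 M" for z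
  proof -
    have z: "z \<noteq> 0" "tau z < ang.R * exp (-1)" using M[of z] that by auto
    have "tau z * exp 1 < ang.R * exp (-1) * exp 1" using z(2) by (intro mult_strict_right_mono) auto
    then have l: "tau z * exp 1 < ang.R" by (simp add: mult.assoc flip: exp_add)
    obtain t where t: "0 < t" "t \<le> tau z * exp 1" "labelled b t z"
      by (rule labelled_exists[OF b z(1) l])
    have tR: "t < ang.R" using t l by simp
    have "z \<in> Gam b t" using t(3) by (auto simp: labelled_def Gam_def)
    then show ?thesis using Gam_periodic[OF b t(1) tR sig_eq_of_even[OF b ev t(1) tR]] by blast
  qed
  then show ?thesis unfolding infinity_center_def using compact_cball by blast
qed

text \<open>One radius \<open>M\<close> serves all admissible coefficients, as the count in a common
  neighbourhood of infinity requires.\<close>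

lemma orbits_far:
  assumes "0 < \<rho>" "\<rho> \<le> ang.R / 2"
  obtains M where "\<And>b \<Gamma>. ang.adm b \<Longrightarrow> periodic_orbit (A b) \<Gamma> \<Longrightarrow> \<Gamma> \<subseteq> {z. norm z > M} \<Longrightarrow>
      \<exists>t. 0 < t \<and> t < \<rho> \<and> ang.disp b (of_real t) = 0 \<and> \<Gamma> = Gam b t"
proof -
  have "\<rho> * exp (-1) > 0" using assms(1) by simp
  then obtain M where M: "\<And>z. norm z > M \<Longrightarrow> z \<noteq> 0 \<and> tau z < \<rho> * exp (-1)"
    using norm_large_imp_tau_small by blast
  show thesis
  proof (rule that[of M])
    fix b \<Gamma> assume b: "ang.adm b" and G: "periodic_orbit (A b) \<Gamma>" "\<Gamma> \<subseteq> {z. norm z > M}"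
    have small: "z \<noteq> 0 \<and> tau z * exp 1 < \<rho>" if "z \<in> \<Gamma>" for z
    proof -
      have z: "z \<noteq> 0" "tau z < \<rho> * exp (-1)" using M[of z] G(2) that by auto
      have "tau z * exp 1 < \<rho> * exp (-1) * exp 1" using z(2) by (intro mult_strict_right_mono) auto
      then show ?thesis using z(1) by (simp add: mult.assoc flip: exp_add)
    qed
    obtain t where t: "0 < t" "t < \<rho>" "ang.sig b t 1 = ang.sig b t (-1)" "\<Gamma> = Gam b t"
      by (rule periodic_orbit_Gam[OF b G(1) small assms(2)])
    have "t < ang.R" using t assms ang.R(1) by linarith
    then show "\<exists>t. 0 < t \<and> t < \<rho> \<and> ang.disp b (of_real t) = 0 \<and> \<Gamma> = Gam b t"
      using ang.disp_sig(1)[OF b t(1)] t by blast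
  qed
qed

text \<open>Far orbits are images under \<open>Gam b\<close> of zeros of the displacement, and the
  expansion bounds the number of these.\<close>

lemma orbits_upper:
  assumes i: "1 \<le> i" "2 * i - 1 \<le> N" and B: "0 \<le> B"
  obtains M where "\<And>b. ang.adm b \<Longrightarrow> (\<And>j. j \<in> {1..N} \<Longrightarrow> odd j \<Longrightarrow> j > 2 * i - 1 \<Longrightarrow> \<bar>b j\<bar> \<le> B * \<bar>b (2 * i - 1)\<bar>) \<Longrightarrow>
     (\<exists>j\<in>{1..N}. odd j \<and> j \<le> 2 * i - 1 \<and> b j \<noteq> 0) \<Longrightarrow>
     finite {\<Gamma>. periodic_orbit (A b) \<Gamma> \<and> \<Gamma> \<subseteq> {z. norm z > M}} \<and>
     card {\<Gamma>. periodic_orbit (A b) \<Gamma> \<and> \<Gamma> \<subseteq> {z. norm z > M}} \<le> i - 1"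
proof -
  have CJ: "ang.C j > 0" if "j \<in> {j\<in>{1..N}. odd j}" for j using that C_pos by simp
  show thesis
  proof (rule odd_expansion_zeros_upper[OF CJ ang.R(1) ang.A_nonneg B i])
    fix \<rho>1
    assume \<rho>1: "\<rho>1 > 0" "\<And>b D. D holomorphic_on ball 0 ang.R \<Longrightarrow>
     (\<And>z. z \<in> ball 0 ang.R \<Longrightarrow> D (- z) = - D z) \<Longrightarrow>
     (\<And>z. z \<in> ball 0 ang.R \<Longrightarrow>
        norm (D z - (\<Sum>j\<in>{j\<in>{1..N}. odd j}. of_real (ang.C j * b j) * z^j))
          \<le> ang.A * norm z * (\<Sum>j\<in>{j\<in>{1..N}. odd j}. \<bar>b j\<bar> * norm z^j)) \<Longrightarrow>
     (\<And>j. j \<in> {j\<in>{1..N}. odd j} \<Longrightarrow> j > 2 * i - 1 \<Longrightarrow> \<bar>b j\<bar> \<le> B * \<bar>b (2 * i - 1)\<bar>) \<Longrightarrow>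
     (\<exists>j\<in>{j\<in>{1..N}. odd j}. j \<le> 2 * i - 1 \<and> b j \<noteq> 0) \<Longrightarrow>
     finite {t. 0 < t \<and> t < \<rho>1 \<and> D (of_real t) = 0} \<and> card {t. 0 < t \<and> t < \<rho>1 \<and> D (of_real t) = 0} \<le> i - 1"
    define \<rho> where "\<rho> = min \<rho>1 (ang.R / 2)"
    have \<rho>: "0 < \<rho>" "\<rho> \<le> ang.R / 2" using \<rho>1(1) ang.R(1) by (auto simp: \<rho>_def)
    obtain M where M: "\<And>b \<Gamma>. ang.adm b \<Longrightarrow> periodic_orbit (A b) \<Gamma> \<Longrightarrow> \<Gamma> \<subseteq> {z. norm z > M} \<Longrightarrow>
        \<exists>t. 0 < t \<and> t < \<rho> \<and> ang.disp b (of_real t) = 0 \<and> \<Gamma> = Gam b t"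
      by (rule orbits_far[OF \<rho>]) (rule that)
    show thesis
    proof (rule that[of M])
      fix b assume b: "ang.adm b" and dom: "\<And>j. j \<in> {1..N} \<Longrightarrow> odd j \<Longrightarrow> j > 2 * i - 1 \<Longrightarrow> \<bar>b j\<bar> \<le> B * \<bar>b (2 * i - 1)\<bar>"
        and nz: "\<exists>j\<in>{1..N}. odd j \<and> j \<le> 2 * i - 1 \<and> b j \<noteq> 0"
      let ?Z = "{t. 0 < t \<and> t < \<rho>1 \<and> ang.disp b (of_real t) = 0}"
      let ?P = "{\<Gamma>. periodic_orbit (A b) \<Gamma> \<and> \<Gamma> \<subseteq> {z. norm z > M}}"
      have Z: "finite ?Z \<and> card ?Z \<le> i - 1"
      proof (rule \<rho>1(2))
        show "ang.disp b holomorphic_on ball 0 ang.R" by (rule ang.disp_holomorphic[OF b])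
        show "ang.disp b (- z) = - ang.disp b z" if "z \<in> ball 0 ang.R" for z
          using ang.disp_minus[OF b] that by simp
        show "norm (ang.disp b z - (\<Sum>j\<in>{j\<in>{1..N}. odd j}. of_real (ang.C j * b j) * z^j))
            \<le> ang.A * norm z * (\<Sum>j\<in>{j\<in>{1..N}. odd j}. \<bar>b j\<bar> * norm z^j)" if "z \<in> ball 0 ang.R" for z
          by (rule ang.disp_estimate[OF b]) (use that in simp)
      qed (use dom nz in auto)
      have sub: "?P \<subseteq> Gam b ` ?Z"
      proof
        fix \<Gamma> assume "\<Gamma> \<in> ?P"
        then obtain t where "0 < t" "t < \<rho>" "ang.disp b (of_real t) = 0" "\<Gamma> = Gam b t" using M[OF b, of \<Gamma>] by blast
        then show "\<Gamma> \<in> Gam b ` ?Z" by (intro image_eqI[of _ _ t]) (auto simp: \<rho>_def)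
      qed
      have "card ?P \<le> card (Gam b ` ?Z)" using Z sub by (intro card_mono) auto
      also have "\<dots> \<le> card ?Z" using Z by (intro card_image_le) auto
      finally show "finite ?P \<and> card ?P \<le> i - 1" using Z finite_subset[OF sub] by auto
    qed
  qed
qed

text \<open>When all odd coefficients vanish, every small label gives a closed orbit. Orbits with
  nearby labels enter any neighbourhood of a given one, so none is isolated.\<close>

lemma no_limit_cycles:
  obtains M where "\<And>b \<Gamma>. ang.adm b \<Longrightarrow> (\<And>j. j \<in> {1..N} \<Longrightarrow> odd j \<Longrightarrow> b j = 0) \<Longrightarrow>
     limit_cycle (A b) \<Gamma> \<Longrightarrow> \<Gamma> \<subseteq> {z. norm z > M} \<Longrightarrow> False"
proof -
  have R2: "0 < ang.R / 2" "ang.R / 2 < ang.R" using ang.R(1) by auto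
  obtain M where M: "\<And>b \<Gamma>. ang.adm b \<Longrightarrow> periodic_orbit (A b) \<Gamma> \<Longrightarrow> \<Gamma> \<subseteq> {z. norm z > M} \<Longrightarrow>
      \<exists>t. 0 < t \<and> t < ang.R / 2 \<and> ang.disp b (of_real t) = 0 \<and> \<Gamma> = Gam b t"
    by (rule orbits_far[OF R2(1) order_refl]) (rule that)
  show thesis
  proof (rule that[of M])
    fix b \<Gamma> assume b: "ang.adm b" and ev: "\<And>j. j \<in> {1..N} \<Longrightarrow> odd j \<Longrightarrow> b j = 0"
      and G: "limit_cycle (A b) \<Gamma>" "\<Gamma> \<subseteq> {z. norm z > M}"
    have P: "periodic_orbit (A b) \<Gamma>" using G(1) by (simp add: limit_cycle_def)
    obtain U where U: "open U" "\<Gamma> \<subseteq> U" "\<And>\<Gamma>'. periodic_orbit (A b) \<Gamma>' \<Longrightarrow> \<Gamma>' \<subseteq> U \<Longrightarrow> \<Gamma>' = \<Gamma>"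
      using G(1) unfolding limit_cycle_def by blast
    obtain t where t: "0 < t" "t < ang.R / 2" "\<Gamma> = Gam b t" using M[OF b P G(2)] by blast
    have tR: "t < ang.R" using t(2) R2 by linarith
    obtain e where e: "e > 0" "(\<Union>x\<in>\<Gamma>. ball x e) \<subseteq> U"
      using compact_subset_open_imp_ball_epsilon_subset[OF periodic_orbit_compact[OF P] U(1,2)] by metis
    define t2 where "t2 = (t + ang.R / 2) / 2"
    have t2: "t < t2" "t2 < ang.R / 2" using t by (auto simp: t2_def)
    let ?\<Phi> = "\<lambda>z. pt (ang.sig b (fst z) (snd z)) (snd z)"
    let ?B = "{t..t2} \<times> {-1..1::real}"
    have cs: "continuous_on ?B (\<lambda>z. ang.sig b (fst z) (snd z))"
    proof -
      have "continuous_on ?B (\<lambda>z. ang.sol b (of_real (fst z)) (snd z))"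
        by (rule continuous_on_compose2[OF ang.sol_continuous[OF b], of _ "\<lambda>z. (of_real (fst z), snd z)", unfolded split_beta fst_conv snd_conv])
          (use t t2 R2 in \<open>auto intro!: continuous_intros\<close>)
      then show ?thesis unfolding ang.sig_def by (intro continuous_intros)
    qed
    have c\<Phi>: "continuous_on ?B ?\<Phi>"
    proof (rule pt_continuous[OF cs])
      fix z assume "z \<in> ?B"
      then have "0 < fst z" "fst z < ang.R" "snd z \<in> {-1..1}" using t t2 R2 by auto
      then show "0 < ang.sig b (fst z) (snd z)" by (rule ang.sig_bounds(3)[OF b])
    qed (auto intro!: continuous_intros)
    \<comment> \<open>Uniformity in the angle brings the whole neighbouring curve within distance
      \<open>e\<close>, not just single points of it.\<close>
    have "uniformly_continuous_on ?B ?\<Phi>"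
      by (intro compact_uniformly_continuous[OF c\<Phi>] compact_Times compact_Icc)
    then obtain d where d: "d > 0" "\<And>x x'. x \<in> ?B \<Longrightarrow> x' \<in> ?B \<Longrightarrow> dist x' x < d \<Longrightarrow> dist (?\<Phi> x') (?\<Phi> x) < e"
      unfolding uniformly_continuous_on_def using e(1) by metis
    define t' where "t' = min (t + d / 2) t2"
    have t': "t < t'" "t' \<le> t2" "t' - t < d" using d(1) t2 by (auto simp: t'_def)
    have t'R: "0 < t'" "t' < ang.R" using t' t t2 R2 by linarith+
    have near: "dist (pt (ang.sig b t' u) u) (pt (ang.sig b t u) u) < e" if "u \<in> {-1..1}" for u
      using d(2)[of "(t, u)" "(t', u)"] that t' t2 by (auto simp: dist_Pair_Pair dist_real_def)
    have close: "z \<in> (\<Union>x\<in>\<Gamma>. ball x e)" if z: "z \<in> Gam b t'" for z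
    proof -
      have ex: "\<exists>y. Lab b t y \<and> dist y x < e" if x: "Lab b t' x" for x
      proof -
        have xr: "xi x \<in> {-1..1}" using x xi_range by (simp add: Lab_def)
        have "Lab b t (pt (ang.sig b t (xi x)) (xi x))" by (rule Lab_pt[OF b t(1) tR xr])
        moreover have "x = pt (ang.sig b t' (xi x)) (xi x)" by (rule Lab_eq_pt[OF x])
        ultimately show ?thesis using near[OF xr] by (metis dist_commute)
      qed
      have dm: "dist (- y) z = dist y (- z)" for y :: "real \<times> real"
      proof -
        have "- y - z = - (y - (- z))" by simp
        then show ?thesis by (simp only: dist_norm norm_minus_cancel)
      qed
      consider "Lab b t' z" | "Lab b t' (- z)" using z by (auto simp: Gam_def)
      then show ?thesis
      proof cases
        case 1
        then obtain y where "Lab b t y" "dist y z < e" using ex by blast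
        then have "y \<in> \<Gamma>" "z \<in> ball y e" using t(3) by (simp_all add: Gam_def)
        then show ?thesis by (rule UN_I)
      next
        case 2
        then obtain y where y: "Lab b t y" "dist y (- z) < e" using ex by blast
        then have "- y \<in> \<Gamma>" "z \<in> ball (- y) e" using t(3) dm[of y] by (simp_all add: Gam_def)
        then show ?thesis by (rule UN_I)
      qed
    qed
    then have "Gam b t' \<subseteq> U" using e(2) by blast
    from U(3)[OF Gam_periodic[OF b t'R sig_eq_of_even[OF b ev t'R]] this]
    have "Gam b t' = Gam b t" using t(3) by simp
    from Gam_inj[OF b t'R t(1) tR this] show False using t'(1) by simp
  qed
qed

text \<open>Zeros of the displacement give closed orbits, and by \<open>Gam_inj\<close> different
  zeros give different orbits.\<close>

lemma orbits_lower:
  assumes i: "1 \<le> i" "2 * i - 1 \<le> N"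
    and b: "\<And>j. j \<in> {1..N} \<Longrightarrow> \<bar>b j\<bar> < K" "\<And>j. odd j \<Longrightarrow> j < 2 * i - 1 \<Longrightarrow> b j = 0" "b (2 * i - 1) \<noteq> 0"
    and \<delta>: "\<delta> > 0"
  obtains b' F where "\<And>j. \<bar>b' j - b j\<bar> < \<delta>" "ang.adm b'" "b' (2 * i - 1) = b (2 * i - 1)"
    "F \<subseteq> {\<Gamma>. periodic_orbit (A b') \<Gamma> \<and> \<Gamma> \<subseteq> {z. norm z > M}}" "finite F" "card F = i - 1"
proof -
  obtain \<epsilon> where \<epsilon>: "\<epsilon> > 0" "\<And>z. z \<noteq> 0 \<Longrightarrow> tau z < \<epsilon> \<Longrightarrow> norm z > M" using tau_small_imp_norm_large by blast
  \<comment> \<open>The factor \<open>exp (-1)\<close> accounts for the passage from labels to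
    \<open>tau\<close>.\<close>
  define \<rho> where "\<rho> = min (ang.R / 2) (\<epsilon> * exp (-1))"
  have \<rho>: "\<rho> > 0" "\<rho> < ang.R" "\<rho> \<le> \<epsilon> * exp (-1)" using \<epsilon>(1) ang.R(1) by (auto simp: \<rho>_def)
  have CJ: "ang.C j > 0" if "j \<in> {j\<in>{1..N}. odd j}" for j using that C_pos by simp
  have adm: "ang.adm b'" if "\<forall>j\<in>{1..N}. \<bar>b' j\<bar> \<le> K" for b' using that by (simp add: ang.adm_def)
  show thesis
  proof (rule odd_expansion_zeros_lower[where K=K and D=ang.disp and b=b and \<delta>=\<delta> and \<rho>=\<rho>, OF CJ ang.R(1) ang.A_nonneg i])
    show "continuous_on (ball 0 ang.R) (ang.disp b')" if "\<forall>j\<in>{1..N}. \<bar>b' j\<bar> \<le> K" for b'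
      by (rule holomorphic_on_imp_continuous_on[OF ang.disp_holomorphic[OF adm[OF that]]])
    show "ang.disp b' (of_real t) \<in> \<real>" if "\<forall>j\<in>{1..N}. \<bar>b' j\<bar> \<le> K" "\<bar>t\<bar> < ang.R" for b' t
      by (rule ang.disp_real[OF adm[OF that(1)] that(2)])
    show "norm (ang.disp b' z - (\<Sum>j\<in>{j\<in>{1..N}. odd j}. of_real (ang.C j * b' j) * z^j))
        \<le> ang.A * norm z * (\<Sum>j\<in>{j\<in>{1..N}. odd j}. \<bar>b' j\<bar> * norm z^j)"
      if "\<forall>j\<in>{1..N}. \<bar>b' j\<bar> \<le> K" "z \<in> ball 0 ang.R" for b' z
      by (rule ang.disp_estimate[OF adm[OF that(1)]]) (use that(2) in simp)
    fix b' Z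
    assume b': "\<And>j. \<bar>b' j - b j\<bar> < \<delta>" "\<And>j. j \<in> {1..N} \<Longrightarrow> \<bar>b' j\<bar> \<le> K" "b' (2 * i - 1) = b (2 * i - 1)"
    "Z \<subseteq> {t. 0 < t \<and> t < \<rho> \<and> ang.disp b' (of_real t) = 0}" "finite Z" "card Z = i - 1"
    have adm': "ang.adm b'" using b'(2) by (intro adm) auto
    have Zp: "0 < t \<and> t < ang.R \<and> t < \<rho> \<and> ang.sig b' t 1 = ang.sig b' t (-1)" if "t \<in> Z" for t
    proof -
      have t: "0 < t" "t < \<rho>" "ang.disp b' (of_real t) = 0" using that b'(4) by auto
      then have "t < ang.R" using \<rho> by linarith
      then show ?thesis using ang.disp_sig(1)[OF adm' t(1)] t by blast
    qed
    have inj: "inj_on (Gam b') Z"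
    proof (rule inj_onI)
      fix t t' assume a: "t \<in> Z" "t' \<in> Z" "Gam b' t = Gam b' t'"
      note Z = Zp[OF a(1)] Zp[OF a(2)]
      show "t = t'" by (rule Gam_inj[OF adm' _ _ _ _ a(3)]) (use Z in auto)
    qed
    show thesis
    proof (rule that[of b' "Gam b' ` Z"])
      show "Gam b' ` Z \<subseteq> {\<Gamma>. periodic_orbit (A b') \<Gamma> \<and> \<Gamma> \<subseteq> {z. norm z > M}}"
      proof
        fix \<Gamma> assume "\<Gamma> \<in> Gam b' ` Z"
        then obtain t where t: "t \<in> Z" "\<Gamma> = Gam b' t" by blast
        have "periodic_orbit (A b') (Gam b' t)" using Gam_periodic[OF adm'] Zp[OF t(1)] by blast
        moreover have "Gam b' t \<subseteq> {z. norm z > M}"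
        proof (rule Gam_norm[OF adm'])
          fix z :: "real \<times> real" assume z: "z \<noteq> 0" "tau z \<le> t * exp 1"
          have "t * exp 1 < \<epsilon> * exp (-1) * exp 1"
            using Zp[OF t(1)] \<rho>(3) by (intro mult_strict_right_mono) auto
          then have "t * exp 1 < \<epsilon>" by (simp add: mult.assoc flip: exp_add)
          then show "norm z > M" using z by (intro \<epsilon>(2)) auto
        qed (use Zp[OF t(1)] in auto)
        ultimately show "\<Gamma> \<in> {\<Gamma>. periodic_orbit (A b') \<Gamma> \<and> \<Gamma> \<subseteq> {z. norm z > M}}" using t(2) by simp
      qed
      show "card (Gam b' ` Z) = i - 1" using card_image[OF inj] b'(6) by simp
    qed (assumption | rule b'(1) adm' b'(3) finite_imageI[OF b'(5)])+
  qed (assumption | rule b \<delta> \<rho>(1))+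
qed

end

section \<open>Center, stability and cyclicity\<close>

context polar
begin

definition far_orbits :: "(nat \<Rightarrow> real) \<Rightarrow> real \<Rightarrow> (real \<times> real) set set" where
  "far_orbits b M = {\<Gamma>. periodic_orbit (A b) \<Gamma> \<and> \<Gamma> \<subseteq> {z. norm z > M}}"

lemma far_orbits_antimono: "M \<le> M' \<Longrightarrow> far_orbits b M' \<subseteq> far_orbits b M"
  by (force simp: far_orbits_def)

lemma ex_flow:
  assumes "K > 0"
  obtains W where "polar_flow p q r1 r2 l1 l2 K W"
proof -
  have "\<exists>B. \<forall>u\<in>{-1..1}. \<bar>w j u\<bar> \<le> B" for j
  proof -
    have "bounded (w j ` {-1..1})"
      by (intro compact_imp_bounded compact_continuous_image w_continuous compact_Icc)
    then show ?thesis by (simp add: bounded_iff)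
  qed
  then obtain B where B: "\<And>j u. u \<in> {-1..1} \<Longrightarrow> \<bar>w j u\<bar> \<le> B j" by metis
  have "polar_flow p q r1 r2 l1 l2 K (1 + (\<Sum>j\<in>{1..N}. \<bar>B j\<bar>))"
  proof unfold_locales
    show "0 < 1 + (\<Sum>j\<in>{1..N}. \<bar>B j\<bar>)" by (intro add_pos_nonneg sum_nonneg) auto
    fix j u assume ju: "j \<in> {1..N}" "u \<in> {-1..1::real}"
    have "\<bar>w j u\<bar> \<le> \<bar>B j\<bar>" using B[OF ju(2), of j] by linarith
    also have "\<dots> \<le> (\<Sum>j\<in>{1..N}. \<bar>B j\<bar>)" using ju(1) by (intro member_le_sum) auto
    finally show "\<bar>w j u\<bar> \<le> 1 + (\<Sum>j\<in>{1..N}. \<bar>B j\<bar>)" by simp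
  qed (rule assms)
  then show thesis by (rule that)
qed

text \<open>Leaves room to spare, so that it also bounds all coefficients within distance 1 of
  \<open>b\<close>.\<close>

definition bound :: "(nat \<Rightarrow> real) \<Rightarrow> real" where "bound b = 2 + (\<Sum>j\<in>{1..N}. \<bar>b j\<bar>)"

lemma bound_pos: "bound b > 0"
  unfolding bound_def by (intro add_pos_nonneg sum_nonneg) auto

lemma bound_gt: "j \<in> {1..N} \<Longrightarrow> \<bar>b j\<bar> + 1 < bound b"
  using member_le_sum[of j "{1..N}" "\<lambda>j. \<bar>b j\<bar>"] by (simp add: bound_def)

lemma bound_le: "j \<in> {1..N} \<Longrightarrow> \<bar>b j\<bar> \<le> bound b"
  using bound_gt[of j b] by simp

lemma infinity_attracting_pos:
  assumes d: "d \<in> {1..N}" "odd d" "b d > 0" "\<And>j. odd j \<Longrightarrow> j < d \<Longrightarrow> b j = 0"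
  shows "infinity_attracting (A b)"
proof -
  obtain W where W: "polar_flow p q r1 r2 l1 l2 (bound b) W" by (rule ex_flow[OF bound_pos])
  interpret F: polar_flow p q r1 r2 l1 l2 "bound b" W by (rule W)
  have "F.ang.adm b" unfolding F.ang.adm_def using bound_le by blast
  from F.attracting[OF this d] show ?thesis .
qed

text \<open>Reversing time and reflecting in the x-axis turns the field into the one with
  coefficients \<open>(-1) ^ j * b j\<close>. The odd ones change sign, which is the attracting
  case.\<close>

lemma infinity_repelling_neg:
  assumes d: "d \<in> {1..N}" "odd d" "b d < 0" "\<And>j. odd j \<Longrightarrow> j < d \<Longrightarrow> b j = 0"
  shows "infinity_repelling (A b)"
proof -
  define L :: "real \<times> real \<Rightarrow> real \<times> real" where "L = (\<lambda>z. (fst z, - snd z))"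
  define b' where "b' = (\<lambda>j. (-1) ^ j * b j)"
  have eq: "L (- A b (L z)) = A b' z" for z
  proof -
    have pw: "(- snd z) ^ (j * p) = (-1) ^ j * snd z ^ (j * p)" for j
    proof -
      have "(- snd z) ^ (j * p) = ((- snd z) ^ p) ^ j" by (simp only: mult.commute[of j p] power_mult)
      also have "(- snd z) ^ p = - (snd z ^ p)" using odd_p by simp
      also have "(- (snd z ^ p)) ^ j = (-1) ^ j * (snd z ^ p) ^ j" by (rule power_minus)
      also have "(snd z ^ p) ^ j = snd z ^ (j * p)" by (simp only: mult.commute[of j p] power_mult)
      finally show ?thesis .
    qed
    have "T b (L z) = T b' z"
      unfolding T_def L_def b'_def fst_conv snd_conv pw by (simp only: mult.assoc mult.left_commute)
    moreover have "(- snd z) ^ r1 = - (snd z ^ r1)" using r_odd(1) by simp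
    ultimately show ?thesis unfolding A_eq by (simp add: L_def)
  qed
  have "infinity_attracting (A b')"
    by (rule infinity_attracting_pos[of d b', OF d(1,2)]) (use d in \<open>simp_all add: b'_def\<close>)
  then have "infinity_attracting (\<lambda>z. L (- A b (L z)))" unfolding eq .
  moreover have "bounded_linear L"
    unfolding L_def by (intro bounded_linear_Pair bounded_linear_fst bounded_linear_minus bounded_linear_snd)
  moreover have "L (L z) = z" "norm (L z) = norm z" for z
    by (simp_all add: L_def norm_prod_def)
  ultimately show ?thesis
    unfolding infinity_repelling_def by (intro infinity_attracting_conjugate[where L=L and X="\<lambda>z. - A b z"])
qed

text \<open>If some odd coefficient is nonzero, the first such coefficient makes infinity attracting
  or repelling, and neither is compatible with a center.\<close>

lemma center_iff: "infinity_center (A b) \<longleftrightarrow> (\<forall>j. odd j \<and> j \<le> N \<longrightarrow> b j = 0)"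
proof
  assume ev: "\<forall>j. odd j \<and> j \<le> N \<longrightarrow> b j = 0"
  obtain W where W: "polar_flow p q r1 r2 l1 l2 (bound b) W" by (rule ex_flow[OF bound_pos])
  interpret F: polar_flow p q r1 r2 l1 l2 "bound b" W by (rule W)
  have "F.ang.adm b" unfolding F.ang.adm_def using bound_le by blast
  then show "infinity_center (A b)" by (rule F.center) (use ev in simp)
next
  assume cen: "infinity_center (A b)"
  show "\<forall>j. odd j \<and> j \<le> N \<longrightarrow> b j = 0"
  proof (rule ccontr)
    assume "\<not> (\<forall>j. odd j \<and> j \<le> N \<longrightarrow> b j = 0)"
    then have ex: "\<exists>d. odd d \<and> d \<le> N \<and> b d \<noteq> 0" by blast
    then obtain d where d: "odd d \<and> d \<le> N \<and> b d \<noteq> 0"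
      and least: "\<And>j. j < d \<Longrightarrow> \<not> (odd j \<and> j \<le> N \<and> b j \<noteq> 0)"
      using exists_least_iff[of "\<lambda>d. odd d \<and> d \<le> N \<and> b d \<noteq> 0"] by blast
    have d1: "d \<in> {1..N}" "odd d" using d by (auto simp: Suc_le_eq odd_pos)
    have low: "b j = 0" if "odd j" "j < d" for j using least[OF that(2)] that d by auto
    consider "b d > 0" | "b d < 0" using d by linarith
    then show False
    proof cases
      case 1
      from attracting_not_center[OF infinity_attracting_pos[of d b, OF d1 1 low] cen] show False .
    next
      case 2
      from repelling_not_center[OF infinity_repelling_neg[of d b, OF d1 2 low] cen] show False .
    qed
  qed
qed

lemma far_orbits_upper:
  assumes K: "K > 0" and i: "1 \<le> i" "2 * i - 1 \<le> N" and B: "0 \<le> B"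
  obtains M where "\<And>b. \<forall>j\<in>{1..N}. \<bar>b j\<bar> \<le> K \<Longrightarrow>
     \<forall>j\<in>{1..N}. odd j \<and> j > 2 * i - 1 \<longrightarrow> \<bar>b j\<bar> \<le> B * \<bar>b (2 * i - 1)\<bar> \<Longrightarrow>
     \<exists>j\<in>{1..N}. odd j \<and> j \<le> 2 * i - 1 \<and> b j \<noteq> 0 \<Longrightarrow>
     finite (far_orbits b M) \<and> card (far_orbits b M) \<le> i - 1"
proof -
  obtain W where W: "polar_flow p q r1 r2 l1 l2 K W" by (rule ex_flow[OF K])
  interpret F: polar_flow p q r1 r2 l1 l2 K W by (rule W)
  show thesis
  proof (rule F.orbits_upper[OF i B])
    fix M
    assume M: "\<And>b. F.ang.adm b \<Longrightarrow> (\<And>j. j \<in> {1..N} \<Longrightarrow> odd j \<Longrightarrow> j > 2 * i - 1 \<Longrightarrow> \<bar>b j\<bar> \<le> B * \<bar>b (2 * i - 1)\<bar>) \<Longrightarrow>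
     (\<exists>j\<in>{1..N}. odd j \<and> j \<le> 2 * i - 1 \<and> b j \<noteq> 0) \<Longrightarrow>
     finite {\<Gamma>. periodic_orbit (A b) \<Gamma> \<and> \<Gamma> \<subseteq> {z. norm z > M}} \<and>
     card {\<Gamma>. periodic_orbit (A b) \<Gamma> \<and> \<Gamma> \<subseteq> {z. norm z > M}} \<le> i - 1"
    show thesis
    proof (rule that[of M])
      fix b
      assume b: "\<forall>j\<in>{1..N}. \<bar>b j\<bar> \<le> K"
        "\<forall>j\<in>{1..N}. odd j \<and> j > 2 * i - 1 \<longrightarrow> \<bar>b j\<bar> \<le> B * \<bar>b (2 * i - 1)\<bar>"
        "\<exists>j\<in>{1..N}. odd j \<and> j \<le> 2 * i - 1 \<and> b j \<noteq> 0"
      show "finite (far_orbits b M) \<and> card (far_orbits b M) \<le> i - 1"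
        unfolding far_orbits_def
      proof (rule M)
        show "F.ang.adm b" unfolding F.ang.adm_def by (rule b(1))
        show "\<bar>b j\<bar> \<le> B * \<bar>b (2 * i - 1)\<bar>" if "j \<in> {1..N}" "odd j" "2 * i - 1 < j" for j
          using b(2) that by blast
      qed (rule b(3))
    qed
  qed
qed

lemma far_orbits_lower:
  assumes i: "1 \<le> i" "2 * i - 1 \<le> N"
    and b: "\<And>j. j \<in> {1..N} \<Longrightarrow> \<bar>b j\<bar> < K" "\<And>j. odd j \<Longrightarrow> j < 2 * i - 1 \<Longrightarrow> b j = 0" "b (2 * i - 1) \<noteq> 0"
    and \<delta>: "\<delta> > 0"
  obtains b' F where "\<And>j. \<bar>b' j - b j\<bar> < \<delta>" "\<forall>j\<in>{1..N}. \<bar>b' j\<bar> \<le> K" "b' (2 * i - 1) = b (2 * i - 1)"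
    "F \<subseteq> far_orbits b' M" "finite F" "card F = i - 1"
proof -
  have "\<bar>b (2 * i - 1)\<bar> < K" using i by (intro b(1)) auto
  then have K: "K > 0" by linarith
  obtain W where W: "polar_flow p q r1 r2 l1 l2 K W" by (rule ex_flow[OF K])
  interpret F: polar_flow p q r1 r2 l1 l2 K W by (rule W)
  show thesis
  proof (rule F.orbits_lower[OF i, of b \<delta> M])
    fix b' G
    assume *: "\<And>j. \<bar>b' j - b j\<bar> < \<delta>" "F.ang.adm b'" "b' (2 * i - 1) = b (2 * i - 1)"
      "G \<subseteq> {\<Gamma>. periodic_orbit (A b') \<Gamma> \<and> \<Gamma> \<subseteq> {z. norm z > M}}" "finite G" "card G = i - 1"
    show thesis
      by (rule that[OF *(1) *(2)[unfolded F.ang.adm_def] *(3) *(4)[folded far_orbits_def] *(5,6)])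
  qed (assumption | rule b \<delta>)+
qed

lemma no_far_limit_cycles:
  assumes K: "K > 0"
  obtains M where "\<And>b. \<forall>j\<in>{1..N}. \<bar>b j\<bar> \<le> K \<Longrightarrow> \<forall>j\<in>{1..N}. odd j \<longrightarrow> b j = 0 \<Longrightarrow>
     {\<Gamma>. limit_cycle (A b) \<Gamma> \<and> \<Gamma> \<subseteq> {z. norm z > M}} = {}"
proof -
  obtain W where W: "polar_flow p q r1 r2 l1 l2 K W" by (rule ex_flow[OF K])
  interpret F: polar_flow p q r1 r2 l1 l2 K W by (rule W)
  show thesis
  proof (rule F.no_limit_cycles)
    fix M assume M: "\<And>b \<Gamma>. F.ang.adm b \<Longrightarrow> (\<And>j. j \<in> {1..N} \<Longrightarrow> odd j \<Longrightarrow> b j = 0) \<Longrightarrow>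
     limit_cycle (A b) \<Gamma> \<Longrightarrow> \<Gamma> \<subseteq> {z. norm z > M} \<Longrightarrow> False"
    show thesis
    proof (rule that[of M])
      fix b assume b: "\<forall>j\<in>{1..N}. \<bar>b j\<bar> \<le> K" "\<forall>j\<in>{1..N}. odd j \<longrightarrow> b j = 0"
      have "F.ang.adm b" unfolding F.ang.adm_def by (rule b(1))
      note M' = M[OF this, OF b(2)[rule_format]]
      show "{\<Gamma>. limit_cycle (A b) \<Gamma> \<and> \<Gamma> \<subseteq> {z. norm z > M}} = {}"
        using M' by (intro Collect_empty_eq[THEN iffD2] allI notI) (elim conjE)
    qed
  qed
qed

lemma bifurcation_number_periodic_orbit:
  assumes i: "1 \<le> i" "2 * i - 1 \<le> N"
    and b: "\<And>j. odd j \<Longrightarrow> j < 2 * i - 1 \<Longrightarrow> b j = 0" "b (2 * i - 1) \<noteq> 0"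
  shows "bifurcation_number periodic_orbit {1..N} (family_A p q r1 r2) b = enat (i - 1)"
proof (rule antisym)
  let ?d = "2 * i - 1"
  have d: "?d \<in> {1..N}" "odd ?d" using i by auto
  define \<beta> where "\<beta> = \<bar>b ?d\<bar>"
  have \<beta>: "\<beta> > 0" using b(2) by (simp add: \<beta>_def)
  \<comment> \<open>Within distance \<open>\<beta> / 2\<close> of \<open>b\<close> the coefficient
    of index \<open>?d\<close> is at least \<open>\<beta> / 2\<close> in modulus, so this constant
    times it dominates \<open>bound b\<close>, hence all coefficients.\<close>
  have B: "0 \<le> 2 * bound b / \<beta>" using \<beta> bound_pos[of b] by simp
  obtain M where M: "\<And>b'. \<forall>j\<in>{1..N}. \<bar>b' j\<bar> \<le> bound b \<Longrightarrow>
     \<forall>j\<in>{1..N}. odd j \<and> j > 2 * i - 1 \<longrightarrow> \<bar>b' j\<bar> \<le> 2 * bound b / \<beta> * \<bar>b' (2 * i - 1)\<bar> \<Longrightarrow>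
     \<exists>j\<in>{1..N}. odd j \<and> j \<le> 2 * i - 1 \<and> b' j \<noteq> 0 \<Longrightarrow>
     finite (far_orbits b' M) \<and> card (far_orbits b' M) \<le> i - 1"
    by (rule far_orbits_upper[OF bound_pos i B], rule that)
  show "bifurcation_number periodic_orbit {1..N} (family_A p q r1 r2) b \<le> enat (i - 1)"
  proof (rule bifurcation_number_le[where \<delta>="min 1 (\<beta> / 2)" and M=M])
    show "0 < min 1 (\<beta> / 2)" using \<beta> by simp
    fix b' assume near: "\<And>j. j \<in> {1..N} \<Longrightarrow> \<bar>b' j - b j\<bar> < min 1 (\<beta> / 2)"
    have le: "\<bar>b' j\<bar> \<le> bound b" if "j \<in> {1..N}" for j
      using near[OF that] bound_gt[OF that, of b] by linarith
    have half: "\<beta> / 2 \<le> \<bar>b' ?d\<bar>" using near[OF d(1)] unfolding \<beta>_def by linarith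
    have "2 * bound b / \<beta> * (\<beta> / 2) \<le> 2 * bound b / \<beta> * \<bar>b' ?d\<bar>" by (rule mult_left_mono[OF half B])
    then have dom: "bound b \<le> 2 * bound b / \<beta> * \<bar>b' ?d\<bar>" using \<beta> by simp
    have "b' ?d \<noteq> 0" using half \<beta> by auto
    then have "\<exists>j\<in>{1..N}. odd j \<and> j \<le> ?d \<and> b' j \<noteq> 0" by (intro bexI[OF _ d(1)] conjI d(2) order_refl)
    moreover have "\<forall>j\<in>{1..N}. odd j \<and> j > ?d \<longrightarrow> \<bar>b' j\<bar> \<le> 2 * bound b / \<beta> * \<bar>b' ?d\<bar>"
    proof (intro ballI impI)
      fix j assume "j \<in> {1..N}"
      from order_trans[OF le[OF this] dom] show "\<bar>b' j\<bar> \<le> 2 * bound b / \<beta> * \<bar>b' ?d\<bar>" .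
    qed
    ultimately have "finite (far_orbits b' M) \<and> card (far_orbits b' M) \<le> i - 1"
      using le by (intro M) (intro ballI)
    then show "ecount {\<Gamma>. periodic_orbit (A b') \<Gamma> \<and> \<Gamma> \<subseteq> {z. norm z > M}} \<le> enat (i - 1)"
      unfolding far_orbits_def[symmetric] by (intro ecount_le) auto
  qed
  show "enat (i - 1) \<le> bifurcation_number periodic_orbit {1..N} (family_A p q r1 r2) b"
  proof (rule bifurcation_number_ge)
    fix \<delta> M :: real assume \<delta>: "0 < \<delta>"
    have lt: "\<bar>b j\<bar> < bound b" if "j \<in> {1..N}" for j using bound_gt[OF that, of b] by simp
    obtain b' G where b': "\<And>j. \<bar>b' j - b j\<bar> < \<delta>" "G \<subseteq> far_orbits b' M" "finite G" "card G = i - 1"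
      by (rule far_orbits_lower[where i=i and b=b, OF i lt b \<delta>], assumption+, rule that)
    show "\<exists>b'. (\<forall>j\<in>{1..N}. \<bar>b' j - b j\<bar> < \<delta>) \<and>
        enat (i - 1) \<le> ecount {\<Gamma>. periodic_orbit (A b') \<Gamma> \<and> \<Gamma> \<subseteq> {z. norm z > M}}"
      unfolding far_orbits_def[symmetric]
      by (intro exI[of _ b'] conjI ballI b'(1) ecount_ge[OF b'(2-4)])
  qed
qed

text \<open>Two kinds of nearby systems are separated. If all odd coefficients vanish, there are no
  limit cycles near infinity at all. Otherwise the zero count applies with the largest odd index,
  above which there are no odd coefficients to dominate.\<close>

lemma cyclicity_le: "infinity_cyclicity {1..N} (family_A p q r1 r2) b \<le> enat ((N - 1) div 2)"
proof -
  obtain M1 where M1: "\<And>b'. \<forall>j\<in>{1..N}. \<bar>b' j\<bar> \<le> bound b \<Longrightarrow> \<forall>j\<in>{1..N}. odd j \<longrightarrow> b' j = 0 \<Longrightarrow>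
     {\<Gamma>. limit_cycle (A b') \<Gamma> \<and> \<Gamma> \<subseteq> {z. norm z > M1}} = {}"
    by (rule no_far_limit_cycles[OF bound_pos], rule that)
  define i where "i = (N + 1) div 2"
  have "\<exists>M2. \<forall>b'. (\<forall>j\<in>{1..N}. \<bar>b' j\<bar> \<le> bound b) \<and> (\<exists>j\<in>{1..N}. odd j \<and> b' j \<noteq> 0) \<longrightarrow>
      finite (far_orbits b' M2) \<and> card (far_orbits b' M2) \<le> (N - 1) div 2"
  proof (cases "N = 0")
    case False
    have i: "1 \<le> i" "2 * i - 1 \<le> N" and i1: "i - 1 = (N - 1) div 2" and last: "\<And>j. odd j \<Longrightarrow> j \<le> N \<Longrightarrow> j \<le> 2 * i - 1"
      unfolding i_def using False by presburger+
    \<comment> \<open>The domination constant can be 0, as no odd index up to \<open>N\<close>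
      exceeds \<open>2 * i - 1\<close>.\<close>
    obtain M2 where M2: "\<And>b'. \<forall>j\<in>{1..N}. \<bar>b' j\<bar> \<le> bound b \<Longrightarrow>
       \<forall>j\<in>{1..N}. odd j \<and> j > 2 * i - 1 \<longrightarrow> \<bar>b' j\<bar> \<le> 0 * \<bar>b' (2 * i - 1)\<bar> \<Longrightarrow>
       \<exists>j\<in>{1..N}. odd j \<and> j \<le> 2 * i - 1 \<and> b' j \<noteq> 0 \<Longrightarrow>
       finite (far_orbits b' M2) \<and> card (far_orbits b' M2) \<le> i - 1"
      by (rule far_orbits_upper[OF bound_pos i order_refl], rule that)
    show ?thesis
    proof (intro exI[of _ M2] allI impI, elim conjE)
      fix b' assume b': "\<forall>j\<in>{1..N}. \<bar>b' j\<bar> \<le> bound b" "\<exists>j\<in>{1..N}. odd j \<and> b' j \<noteq> 0"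
      have "\<exists>j\<in>{1..N}. odd j \<and> j \<le> 2 * i - 1 \<and> b' j \<noteq> 0" using b'(2) last by auto
      moreover have "\<forall>j\<in>{1..N}. odd j \<and> j > 2 * i - 1 \<longrightarrow> \<bar>b' j\<bar> \<le> 0 * \<bar>b' (2 * i - 1)\<bar>"
        using last by force
      ultimately show "finite (far_orbits b' M2) \<and> card (far_orbits b' M2) \<le> (N - 1) div 2"
        using M2[OF b'(1)] i1 by simp
    qed
  qed auto
  then obtain M2 where M2: "\<And>b'. \<forall>j\<in>{1..N}. \<bar>b' j\<bar> \<le> bound b \<Longrightarrow> \<exists>j\<in>{1..N}. odd j \<and> b' j \<noteq> 0 \<Longrightarrow>
      finite (far_orbits b' M2) \<and> card (far_orbits b' M2) \<le> (N - 1) div 2" by blast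
  define M where "M = max M1 M2"
  show ?thesis
    unfolding infinity_cyclicity_def
  proof (rule bifurcation_number_le[where \<delta>=1 and M=M])
    fix b' assume near: "\<And>j. j \<in> {1..N} \<Longrightarrow> \<bar>b' j - b j\<bar> < 1"
    have le: "\<forall>j\<in>{1..N}. \<bar>b' j\<bar> \<le> bound b"
    proof
      fix j assume j: "j \<in> {1..N}"
      show "\<bar>b' j\<bar> \<le> bound b" using near[OF j] bound_gt[OF j, of b] by linarith
    qed
    let ?L = "{\<Gamma>. limit_cycle (A b') \<Gamma> \<and> \<Gamma> \<subseteq> {z. norm z > M}}"
    show "ecount ?L \<le> enat ((N - 1) div 2)"
    proof (cases "\<forall>j\<in>{1..N}. odd j \<longrightarrow> b' j = 0")
      case True
      have "?L \<subseteq> {\<Gamma>. limit_cycle (A b') \<Gamma> \<and> \<Gamma> \<subseteq> {z. norm z > M1}}"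
        by (force simp: M_def)
      then have e: "?L = {}" unfolding M1[OF le True] by simp
      have "ecount ?L = 0" unfolding e by (simp add: ecount_def zero_enat_def)
      then show ?thesis by simp
    next
      case False
      then have fin: "finite (far_orbits b' M2)" "card (far_orbits b' M2) \<le> (N - 1) div 2"
        using M2[OF le] by blast+
      have "?L \<subseteq> far_orbits b' M" by (auto simp: far_orbits_def limit_cycle_def)
      also have "\<dots> \<subseteq> far_orbits b' M2" by (rule far_orbits_antimono) (simp add: M_def)
      finally have "ecount ?L \<le> ecount (far_orbits b' M2)" by (rule ecount_mono)
      also have "\<dots> \<le> enat ((N - 1) div 2)" by (rule ecount_le[OF fin])
      finally show ?thesis .
    qed
  qed simp
qed

text \<open>At a center the last odd coefficient is switched on first, so that the perturbations of
  the second step produce the maximal number of isolated orbits.\<close>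

lemma cyclicity_center:
  assumes ev: "\<And>j. odd j \<Longrightarrow> j \<le> N \<Longrightarrow> b j = 0"
  shows "infinity_cyclicity {1..N} (family_A p q r1 r2) b = enat ((N - 1) div 2)"
proof (rule antisym[OF cyclicity_le])
  show "enat ((N - 1) div 2) \<le> infinity_cyclicity {1..N} (family_A p q r1 r2) b"
  proof (cases "N = 0")
    case False
    define i where "i = (N + 1) div 2"
    have i: "1 \<le> i" "2 * i - 1 \<le> N" and i1: "i - 1 = (N - 1) div 2" and last: "\<And>j. odd j \<Longrightarrow> j \<le> N \<Longrightarrow> j \<le> 2 * i - 1"
      unfolding i_def using False by presburger+
    let ?d = "2 * i - 1"
    have d: "?d \<in> {1..N}" "odd ?d" using i by auto
    show ?thesis
      unfolding infinity_cyclicity_def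
    proof (rule bifurcation_number_ge)
      fix \<delta> M :: real assume \<delta>: "0 < \<delta>"
      \<comment> \<open>Half of \<open>\<delta>\<close> is spent on the last odd coefficient, the
        other half on the tuning of the lower ones.\<close>
      define b0 where "b0 = b(?d := \<delta> / 2)"
      define K where "K = bound b + \<delta>"
      have K: "K > 0" using bound_pos[of b] \<delta> by (simp add: K_def)
      have lt: "\<bar>b0 j\<bar> < K" if "j \<in> {1..N}" for j
        using bound_gt[OF that, of b] \<delta> bound_pos[of b] by (auto simp: b0_def K_def)
      have low: "b0 j = 0" if "odd j" "j < ?d" for j using ev[OF that(1)] that i by (simp add: b0_def)
      have nz: "b0 ?d \<noteq> 0" using \<delta> by (simp add: b0_def)
      have \<delta>2: "\<delta> / 2 > 0" using \<delta> by simp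
      \<comment> \<open>This bound serves for finiteness: with finitely many far periodic orbits,
        each of them is a limit cycle.\<close>
      obtain M2 where M2: "\<And>b'. \<forall>j\<in>{1..N}. \<bar>b' j\<bar> \<le> K \<Longrightarrow>
         \<forall>j\<in>{1..N}. odd j \<and> j > 2 * i - 1 \<longrightarrow> \<bar>b' j\<bar> \<le> 0 * \<bar>b' (2 * i - 1)\<bar> \<Longrightarrow>
         \<exists>j\<in>{1..N}. odd j \<and> j \<le> 2 * i - 1 \<and> b' j \<noteq> 0 \<Longrightarrow>
         finite (far_orbits b' M2) \<and> card (far_orbits b' M2) \<le> i - 1"
        by (rule far_orbits_upper[OF K i order_refl], rule that)
      define M' where "M' = max M M2"
      obtain b' G where b': "\<And>j. \<bar>b' j - b0 j\<bar> < \<delta> / 2" "\<forall>j\<in>{1..N}. \<bar>b' j\<bar> \<le> K" "b' ?d = b0 ?d"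
        and G: "G \<subseteq> far_orbits b' M'" "finite G" "card G = i - 1"
        by (rule far_orbits_lower[where i=i and b=b0, OF i lt low nz \<delta>2], assumption+, rule that)
      have "\<exists>j\<in>{1..N}. odd j \<and> j \<le> ?d \<and> b' j \<noteq> 0" using nz
        by (intro bexI[OF _ d(1)] conjI d(2) order_refl) (simp only: b'(3) not_False_eq_True)
      moreover have "\<forall>j\<in>{1..N}. odd j \<and> j > ?d \<longrightarrow> \<bar>b' j\<bar> \<le> 0 * \<bar>b' ?d\<bar>"
        using last by force
      ultimately have "finite (far_orbits b' M2)" using M2[OF b'(2)] by blast
      then have fin: "finite (far_orbits b' M')"
        by (rule finite_subset[OF far_orbits_antimono, rotated]) (simp add: M'_def)
      have "limit_cycle (A b') \<Gamma> \<and> \<Gamma> \<subseteq> {z. norm z > M}" if "\<Gamma> \<in> G" for \<Gamma>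
      proof -
        have \<Gamma>: "periodic_orbit (A b') \<Gamma>" "\<Gamma> \<subseteq> {z. norm z > M'}" using that G(1) by (auto simp: far_orbits_def)
        have "limit_cycle (A b') \<Gamma>"
          by (rule finite_orbits_limit_cycle[OF A_lip_bounded fin[unfolded far_orbits_def] \<Gamma>])
        then show ?thesis using \<Gamma>(2) by (auto simp: M'_def)
      qed
      then have sub: "G \<subseteq> {\<Gamma>. limit_cycle (A b') \<Gamma> \<and> \<Gamma> \<subseteq> {z. norm z > M}}" by blast
      have "\<bar>b' j - b j\<bar> < \<delta>" for j
      proof -
        have "\<bar>b0 j - b j\<bar> \<le> \<delta> / 2" using ev[OF d(2) i(2)] \<delta> by (simp add: b0_def)
        then show ?thesis using b'(1)[of j] by linarith
      qed
      then show "\<exists>b'. (\<forall>j\<in>{1..N}. \<bar>b' j - b j\<bar> < \<delta>) \<and>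
          enat ((N - 1) div 2) \<le> ecount {\<Gamma>. limit_cycle (A b') \<Gamma> \<and> \<Gamma> \<subseteq> {z. norm z > M}}"
        using ecount_ge[OF sub G(2,3)] unfolding i1 by (intro exI[of _ b'] conjI ballI)
    qed
  qed (simp add: zero_enat_def[symmetric])
qed

lemma cyclicity_SUP: "(SUP b. infinity_cyclicity {1..N} (family_A p q r1 r2) b) = enat ((N - 1) div 2)"
proof (rule antisym)
  show "(SUP b. infinity_cyclicity {1..N} (family_A p q r1 r2) b) \<le> enat ((N - 1) div 2)"
    by (rule SUP_least) (rule cyclicity_le)
  show "enat ((N - 1) div 2) \<le> (SUP b. infinity_cyclicity {1..N} (family_A p q r1 r2) b)"
    by (rule SUP_upper2[of "\<lambda>_. 0"], simp) (subst cyclicity_center, simp_all)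
qed

end

lemma last_odd:
  fixes N \<mu> :: nat
  assumes "\<mu> = (if odd N then N else N - 1)"
  shows "(\<mu> - 1) div 2 = (N - 1) div 2" "\<mu> \<le> N" "(odd j \<and> j \<le> \<mu>) \<longleftrightarrow> (odd j \<and> j \<le> N)"
proof (atomize(full), cases "odd N")
  case False
  then obtain k where k: "N = 2 * k" by blast
  then have "\<mu> = 2 * k - 1" using assms by simp
  then show "(\<mu> - 1) div 2 = (N - 1) div 2 \<and> \<mu> \<le> N \<and> ((odd j \<and> j \<le> \<mu>) \<longleftrightarrow> (odd j \<and> j \<le> N))"
    unfolding k by (cases k) (auto elim!: oddE)
qed (use assms in simp)

text \<open>Twice the two sides are \<open>p + q + n - 1\<close> and
  \<open>p + q + m - 1\<close>.\<close>

lemma weight_inequality: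
  fixes p q m n r1 r2 l1 l2 :: nat
  assumes "odd m" "odd p" "odd n" "odd q" "r1 * q = p + m - 1" "r2 * p = q + n - 1" "n < m"
    "Suc r1 = 2 * l1" "Suc r2 = 2 * l2"
  shows "l2 * p < l1 * q"
proof -
  have pos: "p \<ge> 1" "q \<ge> 1" "m \<ge> 1" "n \<ge> 1" using assms(1-4) by (auto simp: Suc_le_eq odd_pos)
  have "2 * (l2 * p) = Suc r2 * p" using assms(9) by simp
  also have "\<dots> = r2 * p + p" by simp
  also have "\<dots> < r1 * q + q" using assms(5-7) pos by linarith
  also have "\<dots> = Suc r1 * q" by simp
  also have "\<dots> = 2 * (l1 * q)" using assms(8) by simp
  finally show ?thesis by simp
qed

theorem theorem5:
  fixes p q m n r1 r2 N \<mu> :: nat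
    and A :: "(nat \<Rightarrow> real) \<Rightarrow> real \<times> real \<Rightarrow> real \<times> real"
  assumes "odd p" and "odd q" and "odd m" and "odd n"
    and "gcd p q = 1"
    and "q dvd p + m - 1" and "p dvd q + n - 1"
    and "r1 = (p + m - 1) div q" and "r2 = (q + n - 1) div p"
    and "odd r1" and "odd r2"
    and "r1 > r2" and "m > n"
    and "A = family_A p q r1 r2"
    and "N = r2 div q"
    and "\<mu> = (if odd N then N else N - 1)"
  shows
    "(\<forall>b. infinity_center (A b) \<longleftrightarrow> (\<forall>j. odd j \<and> j \<le> \<mu> \<longrightarrow> b j = 0)) \<and>
     (\<forall>b i. 1 \<le> i \<and> 2 * i - 1 \<le> \<mu> \<and> (\<forall>k\<in>{1..<i}. b (2 * k - 1) = 0) \<and> b (2 * i - 1) \<noteq> 0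
        \<longrightarrow> (b (2 * i - 1) > 0 \<longrightarrow> infinity_attracting (A b)) \<and>
            (b (2 * i - 1) < 0 \<longrightarrow> infinity_repelling (A b)) \<and>
            bifurcation_number periodic_orbit {1..N} A b = enat (i - 1)) \<and>
     (SUP b. infinity_cyclicity {1..N} A b) = enat ((\<mu> - 1) div 2) \<and>
     (\<forall>b. infinity_center (A b) \<longrightarrow> infinity_cyclicity {1..N} A b = enat ((\<mu> - 1) div 2)) \<and>
     (\<mu> - 1) div 2 = (N - 1) div 2"
proof -
  have r: "r1 * q = p + m - 1" "r2 * p = q + n - 1" using assms(6-9) by simp_all
  define l1 l2 where "l1 = (r1 + 1) div 2" and "l2 = (r2 + 1) div 2"
  have l: "Suc r1 = 2 * l1" "Suc r2 = 2 * l2"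
    unfolding l1_def l2_def using assms(10,11) by presburger+
  interpret polar p q r1 r2 l1 l2
    by (rule polar.intro[OF l assms(1,2) weight_inequality[OF assms(3,1,4,2) r assms(13) l]])
  have N: "polar.N q r2 = N" unfolding N_def assms(15) ..
  note A = assms(14)
  note div = last_odd(1)[OF assms(16)] and \<mu>N = last_odd(2)[OF assms(16)] and odd_le = last_odd(3)[OF assms(16)]
  have center: "infinity_center (A b) \<longleftrightarrow> (\<forall>j. odd j \<and> j \<le> \<mu> \<longrightarrow> b j = 0)" for b
  proof -
    have "infinity_center (A b) \<longleftrightarrow> (\<forall>j. odd j \<and> j \<le> N \<longrightarrow> b j = 0)"
      unfolding A N[symmetric] by (rule center_iff)
    then show ?thesis by (simp only: odd_le)
  qed
  have stab: "(b (2 * i - 1) > 0 \<longrightarrow> infinity_attracting (A b)) \<and>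
            (b (2 * i - 1) < 0 \<longrightarrow> infinity_repelling (A b)) \<and>
            bifurcation_number periodic_orbit {1..N} A b = enat (i - 1)"
    if h: "1 \<le> i \<and> 2 * i - 1 \<le> \<mu> \<and> (\<forall>k\<in>{1..<i}. b (2 * k - 1) = 0) \<and> b (2 * i - 1) \<noteq> 0" for b i
  proof -
    have i: "1 \<le> i" "2 * i - 1 \<le> polar.N q r2" "2 * i - 1 \<in> {1..polar.N q r2}" "odd (2 * i - 1)"
      using h \<mu>N unfolding N by auto
    have low: "b j = 0" if j: "odd j" "j < 2 * i - 1" for j
    proof -
      obtain k where k: "j = 2 * k + 1" using j(1) by (rule oddE)
      then have "Suc k \<in> {1..<i}" using j(2) by auto
      then have "b (2 * Suc k - 1) = 0" using h by blast
      then show ?thesis using k by simp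
    qed
    show ?thesis
      unfolding A
    proof (intro conjI impI)
      show "infinity_attracting (family_A p q r1 r2 b)" if "b (2 * i - 1) > 0"
        by (rule infinity_attracting_pos[of "2 * i - 1" b, OF i(3,4) that low])
      show "infinity_repelling (family_A p q r1 r2 b)" if "b (2 * i - 1) < 0"
        by (rule infinity_repelling_neg[of "2 * i - 1" b, OF i(3,4) that low])
      have "b (2 * i - 1) \<noteq> 0" using h by blast
      from bifurcation_number_periodic_orbit[of i b, OF i(1,2) low this]
      show "bifurcation_number periodic_orbit {1..N} (family_A p q r1 r2) b = enat (i - 1)" unfolding N .
    qed
  qed
  have sup: "(SUP b. infinity_cyclicity {1..N} A b) = enat ((\<mu> - 1) div 2)"
    unfolding A div N[symmetric] by (rule cyclicity_SUP)
  have cyc: "infinity_cyclicity {1..N} A b = enat ((\<mu> - 1) div 2)" if "infinity_center (A b)" for b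
  proof -
    have "b j = 0" if "odd j" "j \<le> polar.N q r2" for j
      using \<open>infinity_center (A b)\<close> center[of b] odd_le[of j] that unfolding N by blast
    then show ?thesis unfolding A div N[symmetric] by (rule cyclicity_center)
  qed
  show ?thesis
    by (intro conjI allI impI center sup cyc div) (use stab in blast)+
qed

end
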